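(* Let $\Lambda=KQ/I$ be a finite dimensional string algebra over a field $K$ whose quiver $Q$ has a tree as underlying graph, and let $i\in Q_0$. Then $P(i)\in\operatorname{Det}(\Lambda)$ if and only if $i$ is of one of the following kinds: (1.1) of type (v1.1); (1.2) of type (v1.2) with $J_i=0$; (2.1) of type (v2.2) with $J_i=0$; (2.2) of type (v2.3); (3.1) of type (v3.1); (3.2) of type (v3.2) with $J_i=0$; (4) of type (v4) with $J_i=0$.
   Context: Setting. $K$ is a field and $Q$ a finite quiver with vertex set $Q_0=\{1,\dots,n\}$ and arrow set $Q_1$; for $\alpha\in Q_1$, $s(\alpha)$ and $e(\alpha)$ are its starting and end points; paths are written right to left. $\Lambda=KQ/I$ with $I$ either $0$ or an admissible ideal of $KQ$, and $\Lambda$ is a string algebra, i.e.: (i) at each vertex at most two arrows start and at most two arrows end; (ii) if $\alpha\neq\beta,\gamma$ are arrows with $e(\alpha)=e(\beta)=s(\gamma)$ then $\gamma\alpha\in I$ or $\gamma\beta\in I$; (iii) if $\alpha\neq\beta,\gamma$ are arrows with $s(\alpha)=s(\beta)=e(\gamma)$ then $\alpha\gamma\in I$ or $\beta\gamma\in I$; (iv) $I$ is generated by paths. $\operatorname{mod}\Lambda$ is the category of finitely generated left $\Lambda$-modules, $\tau$ the Auslander–Reiten translation, $P(i)$ the indecomposable projective module at vertex $i$. Minimal right determiners. For $f:B\to C$ write $B=B_1\oplus B_2$ with $B_1\subseteq\operatorname{Ker}f$ and $f|_{B_2}$ right minimal; $\operatorname{Ker}(f|_{B_2})$ is the intrinsic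 kernel of $f$. An indecomposable projective $P$ almost factors through $f:M\to N$ if there are $h:P\to N$ and $g:\operatorname{rad}P\to M$ with $h|_{\operatorname{rad}P}=fg$ and $\operatorname{Im}h\not\subseteq\operatorname{Im}f$. The minimal right determiner $C(f)$ is the direct sum of the modules $\tau^{-1}L$, $L$ running over the indecomposable direct summands of the intrinsic kernel of $f$, and of the indecomposable projective modules almost factoring through $f$, one from each isomorphism class (a morphism $f$ is right determined by $C$ iff $C(f)\in\operatorname{add}C$). $\operatorname{Det}(\Lambda)$ is the set of isomorphism classes of the modules $C(f)$ with $f$ ranging over all irreducible morphisms between indecomposable modules in $\operatorname{mod}\Lambda$. Vertex types. Vertices joined by an arrow are neighbours. A vertex $i$ is of type (v1.1) if it has exactly one neighbour and the arrow starts at $i$; (v1.2) one neighbour, arrow ends at $i$; (v2.1) two neighbours, both arrows start at $i$; (v2.2) two neighbours, both arrows end at $i$; (v2.3) two neighbours, one arrow ending and one starting at $i$; (v3.1) three neighbours, with arrows $j_1\to i$, $j_2\to i$ and one arrow starting at $i$; (v3.2) three neighbours, with one arrow ending at $i$ and arrows $i\to j_1$, $i\to j_2$; (v4) four neighbours, with arrows $j_1\to i$, $j_2\to i$, $i\to j_3$, $i\to j_4$. For vertices $a,b$, $\langle a,b\rangle$ is the full subquiver on the vertices of the unique walk from $a$ to $b$ in the tree; it is called linear if it is a directed path from $a$ to $b$. For a subquiver $Q'$, $I|_{Q'}=I\cap KQ'$. For $i$ of type (v3.x) or (v4), $X_i$ is the full subquiver on $i$ and its neighbours. Vertex ideals $J_i$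 (defined for types (v1.2), (v2.2), (v3.1), (v3.2), (v4)). If $i$ is of type (v1.2) or (v2.2): $J_i=0$ if there is $j\in Q_0$ at which exactly two arrows start with $\langle j,i\rangle$ linear and $I|_{\langle j,i\rangle}=0$; $J_i=\Lambda$ if $\Lambda=KQ$ is a path algebra and $i$ is the unique sink of $Q$; $J_i=I$ otherwise. If $i$ is of type (v3.1): $J_i=0$. If $i$ is of type (v3.2): $J_i=0$ if there is $j\in Q_0$ at which exactly two arrows start with $\langle j,i\rangle$ linear, $I|_{\langle j,i\rangle}=0$, $I|_{\langle j,j_1\rangle}\neq0$ and $I|_{\langle j,j_2\rangle}\neq0$; otherwise $J_i=I|_{X_i}$. If $i$ is of type (v4): $J_i=0$ if there is $j\in Q_0$ at which exactly two arrows start with $\langle j,i\rangle$ linear, $I|_{\langle j,i\rangle}=0$, $I|_{\langle j,j_3\rangle}\neq0$ and $I|_{\langle j,j_4\rangle}\neq0$; otherwise $J_i=I|_{X_i}$. *)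

theory Defs
  imports "Jordan_Normal_Form.Matrix"
begin

section \<open>Bound quivers with monomial relations\<close>

text \<open>A quiver Q with vertex set Q0, arrow set Q1, start point src, end point tgt,
  and a set rels of paths generating the ideal I (condition (iv): I is generated by paths).
  A path is a nonempty list of arrows in the order in which they are traversed,
  so the list [a1, a2, ..., ak] is the path written ak ... a2 a1 (right to left).\<close>

record ('v, 'a) quiver =
  Q0 :: "'v set"
  Q1 :: "'a set"
  src :: "'a \<Rightarrow> 'v"
  tgt :: "'a \<Rightarrow> 'v"
  rels :: "'a list set"

definition is_path :: "('v,'a) quiver \<Rightarrow> 'a list \<Rightarrow> bool" where
  "is_path Q p \<longleftrightarrow> p \<noteq> [] \<and> set p \<subseteq> Q1 Q \<and>
     (\<forall>k. Suc k < length p \<longrightarrow> tgt Q (p ! k) = src Q (p ! Suc k))"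

text \<open>A path lies in the ideal generated by the path set rels iff it contains a generator.\<close>
definition in_I :: "('v,'a) quiver \<Rightarrow> 'a list \<Rightarrow> bool" where
  "in_I Q p \<longleftrightarrow> (\<exists>r\<in>rels Q. \<exists>u w. p = u @ r @ w)"

definition outA :: "('v,'a) quiver \<Rightarrow> 'v \<Rightarrow> 'a set" where
  "outA Q v = {\<alpha> \<in> Q1 Q. src Q \<alpha> = v}"

definition inA :: "('v,'a) quiver \<Rightarrow> 'v \<Rightarrow> 'a set" where
  "inA Q v = {\<alpha> \<in> Q1 Q. tgt Q \<alpha> = v}"

definition adj :: "('v,'a) quiver \<Rightarrow> ('v \<times> 'v) set" where
  "adj Q = {(src Q \<alpha>, tgt Q \<alpha>) | \<alpha>. \<alpha> \<in> Q1 Q} \<union> {(tgt Q \<alpha>, src Q \<alpha>) | \<alpha>. \<alpha> \<in> Q1 Q}"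

text \<open>Underlying graph is a (finite) tree: connected with one edge fewer than vertices.\<close>
definition tree_quiver :: "('v,'a) quiver \<Rightarrow> bool" where
  "tree_quiver Q \<longleftrightarrow> finite (Q0 Q) \<and> finite (Q1 Q) \<and>
     (\<forall>\<alpha>\<in>Q1 Q. src Q \<alpha> \<in> Q0 Q \<and> tgt Q \<alpha> \<in> Q0 Q) \<and>
     (\<forall>u\<in>Q0 Q. \<forall>w\<in>Q0 Q. (u, w) \<in> (adj Q)\<^sup>*) \<and>
     card (Q1 Q) + 1 = card (Q0 Q)"

text \<open>I is 0 (rels empty) or admissible: generated by paths of length at least 2
  (for an acyclic quiver R_Q^m = 0 for large m, so admissibility is I contained in R_Q^2).\<close>
definition admissible_paths :: "('v,'a) quiver \<Rightarrow> bool" where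
  "admissible_paths Q \<longleftrightarrow> (\<forall>r\<in>rels Q. is_path Q r \<and> 2 \<le> length r)"

definition string_algebra :: "('v,'a) quiver \<Rightarrow> bool" where
  "string_algebra Q \<longleftrightarrow>
     (\<forall>v\<in>Q0 Q. card (outA Q v) \<le> 2 \<and> card (inA Q v) \<le> 2) \<and>
     (\<forall>\<alpha>\<in>Q1 Q. \<forall>\<beta>\<in>Q1 Q. \<forall>\<gamma>\<in>Q1 Q.
        \<alpha> \<noteq> \<beta> \<and> tgt Q \<alpha> = tgt Q \<beta> \<and> tgt Q \<beta> = src Q \<gamma> \<longrightarrow>
        in_I Q [\<alpha>, \<gamma>] \<or> in_I Q [\<beta>, \<gamma>]) \<and>
     (\<forall>\<alpha>\<in>Q1 Q. \<forall>\<beta>\<in>Q1 Q. \<forall>\<gamma>\<in>Q1 Q.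
        \<alpha> \<noteq> \<beta> \<and> src Q \<alpha> = src Q \<beta> \<and> src Q \<beta> = tgt Q \<gamma> \<longrightarrow>
        in_I Q [\<gamma>, \<alpha>] \<or> in_I Q [\<gamma>, \<beta>])"

definition string_tree_algebra :: "('v,'a) quiver \<Rightarrow> bool" where
  "string_tree_algebra Q \<longleftrightarrow> tree_quiver Q \<and> admissible_paths Q \<and> string_algebra Q"

section \<open>Vertex types and vertex ideals\<close>

definition nbrs :: "('v,'a) quiver \<Rightarrow> 'v \<Rightarrow> 'v set" where
  "nbrs Q v = tgt Q ` outA Q v \<union> src Q ` inA Q v"

definition type_v11 where "type_v11 Q i \<longleftrightarrow> card (nbrs Q i) = 1 \<and> inA Q i = {}"
definition type_v12 where "type_v12 Q i \<longleftrightarrow> card (nbrs Q i) = 1 \<and> outA Q i = {}"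
definition type_v21 where "type_v21 Q i \<longleftrightarrow> card (nbrs Q i) = 2 \<and> inA Q i = {}"
definition type_v22 where "type_v22 Q i \<longleftrightarrow> card (nbrs Q i) = 2 \<and> outA Q i = {}"
definition type_v23 where
  "type_v23 Q i \<longleftrightarrow> card (nbrs Q i) = 2 \<and> card (inA Q i) = 1 \<and> card (outA Q i) = 1"
definition type_v31 where
  "type_v31 Q i \<longleftrightarrow> card (nbrs Q i) = 3 \<and> card (inA Q i) = 2 \<and> card (outA Q i) = 1"
definition type_v32 where
  "type_v32 Q i \<longleftrightarrow> card (nbrs Q i) = 3 \<and> card (inA Q i) = 1 \<and> card (outA Q i) = 2"
definition type_v4 where
  "type_v4 Q i \<longleftrightarrow> card (nbrs Q i) = 4 \<and> card (inA Q i) = 2 \<and> card (outA Q i) = 2"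

text \<open>Simple (non-backtracking, vertex-distinct) walks in the underlying graph.\<close>
definition walk :: "('v,'a) quiver \<Rightarrow> 'v \<Rightarrow> 'v \<Rightarrow> 'v list \<Rightarrow> bool" where
  "walk Q a b w \<longleftrightarrow> w \<noteq> [] \<and> hd w = a \<and> last w = b \<and> distinct w \<and> set w \<subseteq> Q0 Q \<and>
     (\<forall>k. Suc k < length w \<longrightarrow> (w ! k, w ! Suc k) \<in> adj Q)"

text \<open>Vertex set of the subquiver <a,b> (the unique walk from a to b in the tree).\<close>
definition between :: "('v,'a) quiver \<Rightarrow> 'v \<Rightarrow> 'v \<Rightarrow> 'v set" where
  "between Q a b = \<Union> {set w | w. walk Q a b w}"

definition linear :: "('v,'a) quiver \<Rightarrow> 'v \<Rightarrow> 'v \<Rightarrow> bool" where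
  "linear Q a b \<longleftrightarrow> (\<exists>w. walk Q a b w \<and>
     (\<forall>k. Suc k < length w \<longrightarrow> (\<exists>\<alpha>\<in>Q1 Q. src Q \<alpha> = w ! k \<and> tgt Q \<alpha> = w ! Suc k)))"

text \<open>I restricted to the full subquiver on the vertex set W is zero
  (I being spanned by the paths it contains).\<close>
definition restr_zero :: "('v,'a) quiver \<Rightarrow> 'v set \<Rightarrow> bool" where
  "restr_zero Q W \<longleftrightarrow> \<not> (\<exists>p. is_path Q p \<and> (\<forall>\<alpha>\<in>set p. src Q \<alpha> \<in> W \<and> tgt Q \<alpha> \<in> W) \<and> in_I Q p)"

definition sink :: "('v,'a) quiver \<Rightarrow> 'v \<Rightarrow> bool" where
  "sink Q v \<longleftrightarrow> v \<in> Q0 Q \<and> outA Q v = {}"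

definition unique_sink :: "('v,'a) quiver \<Rightarrow> 'v \<Rightarrow> bool" where
  "unique_sink Q i \<longleftrightarrow> sink Q i \<and> (\<forall>v. sink Q v \<longrightarrow> v = i)"

definition cond_j :: "('v,'a) quiver \<Rightarrow> 'v \<Rightarrow> 'v \<Rightarrow> bool" where
  "cond_j Q i j \<longleftrightarrow> j \<in> Q0 Q \<and> card (outA Q j) = 2 \<and> linear Q j i \<and> restr_zero Q (between Q j i)"

datatype 'v vertex_ideal = VZero | VLambda | VI | VRestr "'v set" | VUndef

text \<open>The vertex ideal J_i; X_i is the full subquiver on i and its neighbours.
  For types (v3.2) and (v4) the vertices j1, j2 resp. j3, j4 are the end points of the
  two arrows starting at i.\<close>
definition J :: "('v,'a) quiver \<Rightarrow> 'v \<Rightarrow> 'v vertex_ideal" where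
  "J Q i =
    (if type_v12 Q i \<or> type_v22 Q i then
       (if \<exists>j. cond_j Q i j then VZero
        else if rels Q = {} \<and> unique_sink Q i then VLambda
        else VI)
     else if type_v31 Q i then VZero
     else if type_v32 Q i \<or> type_v4 Q i then
       (if \<exists>j. cond_j Q i j \<and> (\<forall>j'\<in>tgt Q ` outA Q i. \<not> restr_zero Q (between Q j j'))
        then VZero else VRestr (insert i (nbrs Q i)))
     else VUndef)"

fun vi_zero :: "('v,'a) quiver \<Rightarrow> 'v vertex_ideal \<Rightarrow> bool" where
  "vi_zero Q VZero = True"
| "vi_zero Q VLambda = False"
| "vi_zero Q VI = (rels Q = {})"
| "vi_zero Q (VRestr W) = restr_zero Q W"
| "vi_zero Q VUndef = False"

definition J_zero :: "('v,'a) quiver \<Rightarrow> 'v \<Rightarrow> bool" where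
  "J_zero Q i \<longleftrightarrow> vi_zero Q (J Q i)"

section \<open>Modules as representations of the bound quiver (Q, I)\<close>

text \<open>A finite dimensional module over KQ/I is a representation: a space K^(rdim v)
  at each vertex and a matrix for each arrow, satisfying the relations.\<close>

record ('v, 'a, 'k) qrep =
  rdim :: "'v \<Rightarrow> nat"
  rmap :: "'a \<Rightarrow> 'k mat"

fun path_mat :: "('v,'a,'k::semiring_1) qrep \<Rightarrow> 'a list \<Rightarrow> 'k mat" where
  "path_mat X [] = undefined"
| "path_mat X (\<alpha> # ps) = foldl (\<lambda>A \<beta>. rmap X \<beta> * A) (rmap X \<alpha>) ps"

definition is_rep :: "('v,'a) quiver \<Rightarrow> ('v,'a,'k::field) qrep \<Rightarrow> bool" where
  "is_rep Q X \<longleftrightarrow> (\<forall>v. v \<notin> Q0 Q \<longrightarrow> rdim X v = 0) \<and>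
     (\<forall>\<alpha>\<in>Q1 Q. rmap X \<alpha> \<in> carrier_mat (rdim X (tgt Q \<alpha>)) (rdim X (src Q \<alpha>))) \<and>
     (\<forall>r\<in>rels Q. path_mat X r = 0\<^sub>m (rdim X (tgt Q (last r))) (rdim X (src Q (hd r))))"

type_synonym ('v, 'k) qhom = "'v \<Rightarrow> 'k mat"

definition is_hom :: "('v,'a) quiver \<Rightarrow> ('v,'a,'k::field) qrep \<Rightarrow> ('v,'a,'k) qrep \<Rightarrow> ('v,'k) qhom \<Rightarrow> bool" where
  "is_hom Q X Y f \<longleftrightarrow> is_rep Q X \<and> is_rep Q Y \<and>
     (\<forall>v\<in>Q0 Q. f v \<in> carrier_mat (rdim Y v) (rdim X v)) \<and>
     (\<forall>\<alpha>\<in>Q1 Q. f (tgt Q \<alpha>) * rmap X \<alpha> = rmap Y \<alpha> * f (src Q \<alpha>))"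

definition hom_eq :: "('v,'a) quiver \<Rightarrow> ('v,'k) qhom \<Rightarrow> ('v,'k) qhom \<Rightarrow> bool" where
  "hom_eq Q f g \<longleftrightarrow> (\<forall>v\<in>Q0 Q. f v = g v)"

definition hcomp :: "('v,'k::semiring_1) qhom \<Rightarrow> ('v,'k) qhom \<Rightarrow> ('v,'k) qhom" where
  "hcomp g f = (\<lambda>v. g v * f v)"

definition hadd :: "('v,'k::semiring_1) qhom \<Rightarrow> ('v,'k) qhom \<Rightarrow> ('v,'k) qhom" where
  "hadd f g = (\<lambda>v. f v + g v)"

definition hid :: "('v,'a,'k::semiring_1) qrep \<Rightarrow> ('v,'k) qhom" where
  "hid X = (\<lambda>v. 1\<^sub>m (rdim X v))"

definition hzero :: "('v,'a,'k::semiring_1) qrep \<Rightarrow> ('v,'a,'k) qrep \<Rightarrow> ('v,'k) qhom" where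
  "hzero X Y = (\<lambda>v. 0\<^sub>m (rdim Y v) (rdim X v))"

definition split_mono :: "('v,'a) quiver \<Rightarrow> ('v,'a,'k::field) qrep \<Rightarrow> ('v,'a,'k) qrep \<Rightarrow> ('v,'k) qhom \<Rightarrow> bool" where
  "split_mono Q X Y f \<longleftrightarrow> (\<exists>g. is_hom Q Y X g \<and> hom_eq Q (hcomp g f) (hid X))"

definition split_epi :: "('v,'a) quiver \<Rightarrow> ('v,'a,'k::field) qrep \<Rightarrow> ('v,'a,'k) qrep \<Rightarrow> ('v,'k) qhom \<Rightarrow> bool" where
  "split_epi Q X Y f \<longleftrightarrow> (\<exists>g. is_hom Q Y X g \<and> hom_eq Q (hcomp f g) (hid Y))"

definition iso_hom :: "('v,'a) quiver \<Rightarrow> ('v,'a,'k::field) qrep \<Rightarrow> ('v,'a,'k) qrep \<Rightarrow> ('v,'k) qhom \<Rightarrow> bool" where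
  "iso_hom Q X Y f \<longleftrightarrow> is_hom Q X Y f \<and>
     (\<exists>g. is_hom Q Y X g \<and> hom_eq Q (hcomp g f) (hid X) \<and> hom_eq Q (hcomp f g) (hid Y))"

definition isomorphic :: "('v,'a) quiver \<Rightarrow> ('v,'a,'k::field) qrep \<Rightarrow> ('v,'a,'k) qrep \<Rightarrow> bool" where
  "isomorphic Q X Y \<longleftrightarrow> (\<exists>f. iso_hom Q X Y f)"

definition zero_rep :: "('v,'a) quiver \<Rightarrow> ('v,'a,'k) qrep \<Rightarrow> bool" where
  "zero_rep Q X \<longleftrightarrow> (\<forall>v\<in>Q0 Q. rdim X v = 0)"

text \<open>X = X1 (+) X2 as an (internal) direct sum, given by a biproduct diagram.\<close>
definition biproduct :: "('v,'a) quiver \<Rightarrow> ('v,'a,'k::field) qrep \<Rightarrow>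
    ('v,'a,'k) qrep \<Rightarrow> ('v,'k) qhom \<Rightarrow> ('v,'k) qhom \<Rightarrow>
    ('v,'a,'k) qrep \<Rightarrow> ('v,'k) qhom \<Rightarrow> ('v,'k) qhom \<Rightarrow> bool" where
  "biproduct Q X X1 i1 p1 X2 i2 p2 \<longleftrightarrow>
     is_hom Q X1 X i1 \<and> is_hom Q X X1 p1 \<and> is_hom Q X2 X i2 \<and> is_hom Q X X2 p2 \<and>
     hom_eq Q (hcomp p1 i1) (hid X1) \<and> hom_eq Q (hcomp p2 i2) (hid X2) \<and>
     hom_eq Q (hcomp p1 i2) (hzero X2 X1) \<and> hom_eq Q (hcomp p2 i1) (hzero X1 X2) \<and>
     hom_eq Q (hadd (hcomp i1 p1) (hcomp i2 p2)) (hid X)"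

definition indecomposable :: "('v,'a) quiver \<Rightarrow> ('v,'a,'k::field) qrep \<Rightarrow> bool" where
  "indecomposable Q X \<longleftrightarrow> is_rep Q X \<and> \<not> zero_rep Q X \<and>
     (\<forall>X1 i1 p1 X2 i2 p2. biproduct Q X X1 i1 p1 X2 i2 p2 \<longrightarrow> zero_rep Q X1 \<or> zero_rep Q X2)"

definition direct_summand :: "('v,'a) quiver \<Rightarrow> ('v,'a,'k::field) qrep \<Rightarrow> ('v,'a,'k) qrep \<Rightarrow> bool" where
  "direct_summand Q L K \<longleftrightarrow> (\<exists>L' i1 p1 i2 p2. biproduct Q K L i1 p1 L' i2 p2)"

definition irreducible :: "('v,'a) quiver \<Rightarrow> ('v,'a,'k::field) qrep \<Rightarrow> ('v,'a,'k) qrep \<Rightarrow> ('v,'k) qhom \<Rightarrow> bool" where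
  "irreducible Q X Y f \<longleftrightarrow> is_hom Q X Y f \<and> \<not> split_mono Q X Y f \<and> \<not> split_epi Q X Y f \<and>
     (\<forall>Z g h. is_hom Q X Z h \<and> is_hom Q Z Y g \<and> hom_eq Q (hcomp g h) f \<longrightarrow>
        split_mono Q X Z h \<or> split_epi Q Z Y g)"

text \<open>Vertexwise linear-algebra notions.\<close>

definition img :: "('v,'k::field) qhom \<Rightarrow> ('v,'a,'k) qrep \<Rightarrow> 'v \<Rightarrow> 'k vec set" where
  "img f X v = {f v *\<^sub>v x | x. x \<in> carrier_vec (rdim X v)}"

definition ker :: "('v,'k::field) qhom \<Rightarrow> ('v,'a,'k) qrep \<Rightarrow> ('v,'a,'k) qrep \<Rightarrow> 'v \<Rightarrow> 'k vec set" where
  "ker f X Y v = {x \<in> carrier_vec (rdim X v). f v *\<^sub>v x = 0\<^sub>v (rdim Y v)}"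

definition injective_hom :: "('v,'a) quiver \<Rightarrow> ('v,'a,'k::field) qrep \<Rightarrow> ('v,'a,'k) qrep \<Rightarrow> ('v,'k) qhom \<Rightarrow> bool" where
  "injective_hom Q X Y f \<longleftrightarrow> (\<forall>v\<in>Q0 Q. ker f X Y v = {0\<^sub>v (rdim X v)})"

definition surjective_hom :: "('v,'a) quiver \<Rightarrow> ('v,'a,'k::field) qrep \<Rightarrow> ('v,'a,'k) qrep \<Rightarrow> ('v,'k) qhom \<Rightarrow> bool" where
  "surjective_hom Q X Y f \<longleftrightarrow> (\<forall>v\<in>Q0 Q. img f X v = carrier_vec (rdim Y v))"

definition short_exact :: "('v,'a) quiver \<Rightarrow> ('v,'a,'k::field) qrep \<Rightarrow> ('v,'a,'k) qrep \<Rightarrow>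
    ('v,'a,'k) qrep \<Rightarrow> ('v,'k) qhom \<Rightarrow> ('v,'k) qhom \<Rightarrow> bool" where
  "short_exact Q L E N u w \<longleftrightarrow> is_hom Q L E u \<and> is_hom Q E N w \<and>
     injective_hom Q L E u \<and> surjective_hom Q E N w \<and> (\<forall>v\<in>Q0 Q. img u L v = ker w E N v)"

definition left_almost_split :: "('v,'a) quiver \<Rightarrow> ('v,'a,'k::field) qrep \<Rightarrow> ('v,'a,'k) qrep \<Rightarrow> ('v,'k) qhom \<Rightarrow> bool" where
  "left_almost_split Q L E u \<longleftrightarrow> is_hom Q L E u \<and> \<not> split_mono Q L E u \<and>
     (\<forall>Y h. is_hom Q L Y h \<and> \<not> split_mono Q L Y h \<longrightarrow>
        (\<exists>g. is_hom Q E Y g \<and> hom_eq Q (hcomp g u) h))"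

definition right_almost_split :: "('v,'a) quiver \<Rightarrow> ('v,'a,'k::field) qrep \<Rightarrow> ('v,'a,'k) qrep \<Rightarrow> ('v,'k) qhom \<Rightarrow> bool" where
  "right_almost_split Q E N w \<longleftrightarrow> is_hom Q E N w \<and> \<not> split_epi Q E N w \<and>
     (\<forall>X h. is_hom Q X N h \<and> \<not> split_epi Q X N h \<longrightarrow>
        (\<exists>g. is_hom Q X E g \<and> hom_eq Q (hcomp w g) h))"

definition almost_split_seq :: "('v,'a) quiver \<Rightarrow> ('v,'a,'k::field) qrep \<Rightarrow> ('v,'a,'k) qrep \<Rightarrow>
    ('v,'a,'k) qrep \<Rightarrow> ('v,'k) qhom \<Rightarrow> ('v,'k) qhom \<Rightarrow> bool" where
  "almost_split_seq Q L E N u w \<longleftrightarrow> short_exact Q L E N u w \<and>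
     left_almost_split Q L E u \<and> right_almost_split Q E N w"

text \<open>X is (isomorphic to) the nonzero module tau^-1 L: there is an almost split sequence
  0 -> L -> E -> X -> 0.  (For L injective, tau^-1 L = 0 and no such X exists.)\<close>
definition tau_inv_of :: "('v,'a) quiver \<Rightarrow> ('v,'a,'k::field) qrep \<Rightarrow> ('v,'a,'k) qrep \<Rightarrow> bool" where
  "tau_inv_of Q X L \<longleftrightarrow> (\<exists>E u w. almost_split_seq Q L E X u w)"

definition kernel_of :: "('v,'a) quiver \<Rightarrow> ('v,'a,'k::field) qrep \<Rightarrow> ('v,'a,'k) qrep \<Rightarrow> ('v,'k) qhom \<Rightarrow>
    ('v,'a,'k) qrep \<Rightarrow> ('v,'k) qhom \<Rightarrow> bool" where
  "kernel_of Q X C g K k \<longleftrightarrow> is_hom Q K X k \<and> injective_hom Q K X k \<and>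
     (\<forall>v\<in>Q0 Q. img k K v = ker g X C v)"

definition right_minimal :: "('v,'a) quiver \<Rightarrow> ('v,'a,'k::field) qrep \<Rightarrow> ('v,'a,'k) qrep \<Rightarrow> ('v,'k) qhom \<Rightarrow> bool" where
  "right_minimal Q X C g \<longleftrightarrow> is_hom Q X C g \<and>
     (\<forall>h. is_hom Q X X h \<and> hom_eq Q (hcomp g h) g \<longrightarrow> iso_hom Q X X h)"

text \<open>L is an indecomposable direct summand of the intrinsic kernel of f : B -> C:
  B = B1 (+) B2 with B1 in Ker f and f restricted to B2 right minimal, and L is an
  indecomposable direct summand of Ker (f restricted to B2).\<close>
definition intrinsic_kernel_summand :: "('v,'a) quiver \<Rightarrow> ('v,'a,'k::field) qrep \<Rightarrow> ('v,'a,'k) qrep \<Rightarrow>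
    ('v,'k) qhom \<Rightarrow> ('v,'a,'k) qrep \<Rightarrow> bool" where
  "intrinsic_kernel_summand Q B C f L \<longleftrightarrow> indecomposable Q L \<and>
     (\<exists>B1 i1 p1 B2 i2 p2 K k. biproduct Q B B1 i1 p1 B2 i2 p2 \<and>
        hom_eq Q (hcomp f i1) (hzero B1 C) \<and>
        right_minimal Q B2 C (hcomp f i2) \<and>
        kernel_of Q B2 C (hcomp f i2) K k \<and>
        direct_summand Q L K)"

definition projective :: "('v,'a) quiver \<Rightarrow> ('v,'a,'k::field) qrep \<Rightarrow> bool" where
  "projective Q P \<longleftrightarrow> is_rep Q P \<and>
     (\<forall>E N w h. is_hom Q E N w \<and> surjective_hom Q E N w \<and> is_hom Q P N h \<longrightarrow>
        (\<exists>g. is_hom Q P E g \<and> hom_eq Q (hcomp w g) h))"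

definition simple_rep :: "('v,'a) quiver \<Rightarrow> 'v \<Rightarrow> ('v,'a,'k::field) qrep" where
  "simple_rep Q i = \<lparr> rdim = (\<lambda>v. if v = i then 1 else 0),
     rmap = (\<lambda>\<alpha>. 0\<^sub>m (if tgt Q \<alpha> = i then 1 else 0) (if src Q \<alpha> = i then 1 else 0)) \<rparr>"

text \<open>P is (isomorphic to) P(i): the indecomposable projective module with top S(i).\<close>
definition proj_at :: "('v,'a) quiver \<Rightarrow> ('v,'a,'k::field) qrep \<Rightarrow> 'v \<Rightarrow> bool" where
  "proj_at Q P i \<longleftrightarrow> projective Q P \<and> indecomposable Q P \<and>
     (\<exists>h. is_hom Q P (simple_rep Q i) h \<and> \<not> hom_eq Q h (hzero P (simple_rep Q i)))"

text \<open>rad X = rad(Lambda) X, where rad Lambda is the arrow ideal (I admissible):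
  at vertex v it is the sum of the images of the arrows ending at v.\<close>
definition rad_space :: "('v,'a) quiver \<Rightarrow> ('v,'a,'k::field) qrep \<Rightarrow> 'v \<Rightarrow> 'k vec set" where
  "rad_space Q X v = {finsum_vec TYPE('k) (rdim X v) (\<lambda>\<alpha>. rmap X \<alpha> *\<^sub>v xs \<alpha>) (inA Q v) | xs.
      \<forall>\<alpha>\<in>inA Q v. xs \<alpha> \<in> carrier_vec (rdim X (src Q \<alpha>))}"

definition rad_incl :: "('v,'a) quiver \<Rightarrow> ('v,'a,'k::field) qrep \<Rightarrow> ('v,'a,'k) qrep \<Rightarrow> ('v,'k) qhom \<Rightarrow> bool" where
  "rad_incl Q P R j \<longleftrightarrow> is_hom Q R P j \<and> injective_hom Q R P j \<and>
     (\<forall>v\<in>Q0 Q. img j R v = rad_space Q P v)"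

text \<open>P almost factors through f : M -> N.\<close>
definition almost_factors :: "('v,'a) quiver \<Rightarrow> ('v,'a,'k::field) qrep \<Rightarrow> ('v,'a,'k) qrep \<Rightarrow>
    ('v,'a,'k) qrep \<Rightarrow> ('v,'k) qhom \<Rightarrow> bool" where
  "almost_factors Q P M N f \<longleftrightarrow> (\<exists>R j h g. rad_incl Q P R j \<and> is_hom Q P N h \<and> is_hom Q R M g \<and>
      hom_eq Q (hcomp h j) (hcomp f g) \<and> \<not> (\<forall>v\<in>Q0 Q. img h P v \<subseteq> img f M v))"

text \<open>X is (isomorphic to) an indecomposable direct summand of the minimal right determiner C(f).\<close>
definition in_Cf :: "('v,'a) quiver \<Rightarrow> ('v,'a,'k::field) qrep \<Rightarrow> ('v,'a,'k) qrep \<Rightarrow>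
    ('v,'k) qhom \<Rightarrow> ('v,'a,'k) qrep \<Rightarrow> bool" where
  "in_Cf Q M N f X \<longleftrightarrow>
     (\<exists>L. intrinsic_kernel_summand Q M N f L \<and> tau_inv_of Q X L) \<or>
     (projective Q X \<and> indecomposable Q X \<and> almost_factors Q X M N f)"

text \<open>C(f) is isomorphic to the indecomposable module P: its indecomposable summands
  (one from each isomorphism class) are exactly the modules isomorphic to P.\<close>
definition Cf_iso :: "('v,'a) quiver \<Rightarrow> ('v,'a,'k::field) qrep \<Rightarrow> ('v,'a,'k) qrep \<Rightarrow>
    ('v,'k) qhom \<Rightarrow> ('v,'a,'k) qrep \<Rightarrow> bool" where
  "Cf_iso Q M N f P \<longleftrightarrow> (\<forall>X. indecomposable Q X \<longrightarrow> (in_Cf Q M N f X \<longleftrightarrow> isomorphic Q X P))"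

text \<open>P(i) belongs to Det(Lambda), Lambda = KQ/I over the field 'k.\<close>
definition P_in_Det :: "'k::field itself \<Rightarrow> ('v,'a) quiver \<Rightarrow> 'v \<Rightarrow> bool" where
  "P_in_Det _ Q i \<longleftrightarrow> (\<exists>(M::('v,'a,'k) qrep) N f P.
     indecomposable Q M \<and> indecomposable Q N \<and> irreducible Q M N f \<and>
     proj_at Q P i \<and> Cf_iso Q M N f P)"

end

theory Submission
  imports Defs "Jordan_Normal_Form.Determinant"
begin

text \<open>An irreducible morphism \<open>f : M \<rightarrow> N\<close> between indecomposables is injective or surjective, and
  \<open>P(i) \<in> Det\<close> forces it to be injective with a cokernel whose socle is concentrated at \<open>i\<close>, because
  the projectives almost factoring through a monomorphism are the projective covers of the simple
  submodules of its cokernel. Over a string algebra of a tree such a cokernel \<open>C\<close> is a string module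
  with at most two arms, ending in \<open>i\<close>: of any map \<open>V \<rightarrow> C\<close> and the projection \<open>N \<rightarrow> C\<close>, one factors
  through the other, so the quotient of \<open>C\<close> given by its longest arms, not being a summand of \<open>N\<close>, is
  all of \<open>C\<close>. The same alternative applied to submodules and extensions of \<open>C\<close>, together with
  the locality of \<open>End(M)\<close> and \<open>End(N)\<close>, leaves only the uniserial modules given by a path from
  some \<open>y\<close> to \<open>i\<close> that cannot be prolonged without using a certain arrow \<open>\<beta>\<close> which starts at \<open>y\<close> and
  is not on the path. Conversely, for such a path the inclusion into \<open>P(y)\<close> of the submodule generated
  by \<open>\<beta>\<close> is irreducible. In terms of the neighbours of \<open>i\<close> this criterion is the list of vertex types.\<close>

section \<open>Finitely supported infinite matrices\<close>

text \<open>\<open>M\<close> and \<open>N\<close> stay arbitrary throughout, so the cokernel C of f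
  must be pinned down from outside. Three choices make this possible. A quotient of N that is thin,
  that is of dimension at most one at each vertex, with socle at i is encoded by one row \<nu> on
  N_i, transported to the other vertices along their unique paths to i. Exactness is expressed by
  linear maps chosen vertex by vertex, a retraction \<kappa> of f and a section L of the projection,
  which need not commute with the arrows; the failure of L to commute is the cocycle of an
  extension, and the alternative for V \<rightarrow> C comes from the resulting factorization of f.
  Finally, an unwanted shape of C is refuted by writing \<nu> as a sum of two rows that both extend
  to homomorphisms N \<rightarrow> C. Locality forces the projection to factor through one of the
  two, while some element on which the projection takes the value 1 is annihilated by that summand
  after every endomorphism of N. Producing such elements, by lifting maps from submodules and
  extensions of C, is where the relations of the string algebra enter.\<close>

text \<open>Embedding all matrices, of all sizes, into one ring removes the carrier conditions from
  matrix algebra: the size of a matrix is recorded by the truncated identities \<open>unit_imat n\<close>.\<close>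

typedef (overloaded) 'a imat =
  "{f :: nat \<Rightarrow> nat \<Rightarrow> 'a::zero. \<exists>n. \<forall>i j. f i j \<noteq> 0 \<longrightarrow> i < n \<and> j < n}"
  morphisms entry Abs_imat
  by (rule exI[of _ "\<lambda>_ _. 0"]) simp

setup_lifting type_definition_imat

lemma imat_eqI: "(\<And>i j. entry a i j = entry b i j) \<Longrightarrow> a = b"
  by (metis entry_inject ext)

lemma entry_bound: "\<exists>n. \<forall>i j. entry a i j \<noteq> 0 \<longrightarrow> i < n \<and> j < n"
  using entry[of a] by simp

instantiation imat :: (comm_ring_1) ring
begin

lift_definition zero_imat :: "'a imat" is "\<lambda>_ _. 0" by simp

lift_definition plus_imat :: "'a imat \<Rightarrow> 'a imat \<Rightarrow> 'a imat" is "\<lambda>f g i j. f i j + g i j"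
proof -
  fix f g :: "nat \<Rightarrow> nat \<Rightarrow> 'a"
  assume "\<exists>n. \<forall>i j. f i j \<noteq> 0 \<longrightarrow> i < n \<and> j < n" "\<exists>n. \<forall>i j. g i j \<noteq> 0 \<longrightarrow> i < n \<and> j < n"
  then obtain n m where nm: "\<forall>i j. f i j \<noteq> 0 \<longrightarrow> i < n \<and> j < n" "\<forall>i j. g i j \<noteq> 0 \<longrightarrow> i < m \<and> j < m"
    by blast
  show "\<exists>n. \<forall>i j. f i j + g i j \<noteq> 0 \<longrightarrow> i < n \<and> j < n"
    by (rule exI[of _ "n + m"]) (metis nm add.right_neutral trans_less_add1 trans_less_add2)
qed

lift_definition uminus_imat :: "'a imat \<Rightarrow> 'a imat" is "\<lambda>f i j. - f i j" by simp

definition minus_imat :: "'a imat \<Rightarrow> 'a imat \<Rightarrow> 'a imat" where "minus_imat a b = a + (- b)"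

text \<open>Summing over the support of row \<open>i\<close> of the left factor keeps the index set
  finite without choosing a size. \<open>entry_times\<close> and \<open>entry_times_right\<close>
  replace it by any initial segment containing the inner support of one of the two factors.\<close>

lift_definition times_imat :: "'a imat \<Rightarrow> 'a imat \<Rightarrow> 'a imat"
  is "\<lambda>f g i j. \<Sum>k | f i k \<noteq> 0. f i k * g k j"
proof -
  fix f g :: "nat \<Rightarrow> nat \<Rightarrow> 'a"
  assume "\<exists>n. \<forall>i j. f i j \<noteq> 0 \<longrightarrow> i < n \<and> j < n" "\<exists>n. \<forall>i j. g i j \<noteq> 0 \<longrightarrow> i < n \<and> j < n"
  then obtain n m where nm: "\<forall>i j. f i j \<noteq> 0 \<longrightarrow> i < n \<and> j < n" "\<forall>i j. g i j \<noteq> 0 \<longrightarrow> i < m \<and> j < m"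
    by blast
  have "i < n + m \<and> j < n + m" if nz: "(\<Sum>k | f i k \<noteq> 0. f i k * g k j) \<noteq> 0" for i j
  proof -
    obtain k where "f i k \<noteq> 0" "g k j \<noteq> 0"
      using nz by (metis (mono_tags, lifting) mem_Collect_eq mult_zero_right sum.neutral)
    then show ?thesis using nm by (meson trans_less_add1 trans_less_add2)
  qed
  then show "\<exists>n. \<forall>i j. (\<Sum>k | f i k \<noteq> 0. f i k * g k j) \<noteq> 0 \<longrightarrow> i < n \<and> j < n" by blast
qed

lemma entry_times:
  assumes "\<And>i k. entry a i k \<noteq> 0 \<Longrightarrow> k < n"
  shows "entry (a * b) i j = (\<Sum>k<n. entry a i k * entry b k j)"
  unfolding times_imat.rep_eq
  by (rule sum.mono_neutral_left) (use assms in auto)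

lemma entry_times_right:
  assumes "\<And>k j. entry b k j \<noteq> 0 \<Longrightarrow> k < n"
  shows "entry (a * b) i j = (\<Sum>k<n. entry a i k * entry b k j)"
proof -
  obtain m where m: "\<forall>i j. entry a i j \<noteq> 0 \<longrightarrow> i < m \<and> j < m" using entry_bound by blast
  have "entry (a * b) i j = (\<Sum>k<max m n. entry a i k * entry b k j)"
    by (rule entry_times) (use m in \<open>meson less_max_iff_disj\<close>)
  also have "\<dots> = (\<Sum>k<n. entry a i k * entry b k j)"
  proof (rule sum.mono_neutral_right)
    have "entry b k j = 0" if "\<not> k < n" for k using assms[of k j] that by blast
    then show "\<forall>k\<in>{..<max m n} - {..<n}. entry a i k * entry b k j = 0" by simp
  qed auto
  finally show ?thesis .
qed

instance
proof
  fix a b c :: "'a imat"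
  show "a * b * c = a * (b * c)"
  proof (rule imat_eqI)
    fix i j
    obtain n where n: "\<forall>i j. entry a i j \<noteq> 0 \<longrightarrow> i < n \<and> j < n" using entry_bound by blast
    obtain m where m: "\<forall>i j. entry b i j \<noteq> 0 \<longrightarrow> i < m \<and> j < m" using entry_bound by blast
    have ab: "entry (a * b) i k = (\<Sum>l<n. entry a i l * entry b l k)" for i k
      by (rule entry_times) (use n in auto)
    have "k < m" if "entry (a * b) i k \<noteq> 0" for i k
      using that m unfolding ab by (metis (no_types, lifting) mult_zero_right sum.neutral)
    then have "entry (a * b * c) i j = (\<Sum>k<m. entry (a * b) i k * entry c k j)"
      by (rule entry_times)
    also have "\<dots> = (\<Sum>l<n. \<Sum>k<m. entry a i l * entry b l k * entry c k j)"
      unfolding ab sum_distrib_right by (rule sum.swap)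
    also have "\<dots> = (\<Sum>l<n. entry a i l * entry (b * c) l j)"
      by (subst entry_times[of b m]) (use m in \<open>auto simp: sum_distrib_left mult.assoc\<close>)
    also have "\<dots> = entry (a * (b * c)) i j"
      by (rule entry_times[symmetric]) (use n in auto)
    finally show "entry (a * b * c) i j = entry (a * (b * c)) i j" .
  qed
  obtain n where n: "\<forall>i j. entry c i j \<noteq> 0 \<longrightarrow> i < n \<and> j < n" using entry_bound by blast
  show "(a + b) * c = a * c + b * c"
    by (rule imat_eqI)
      (use n in \<open>simp add: entry_times_right[of c n] plus_imat.rep_eq sum.distrib algebra_simps\<close>)
  show "c * (a + b) = c * a + c * b"
    by (rule imat_eqI)
      (use n in \<open>simp add: entry_times[of c n] plus_imat.rep_eq sum.distrib algebra_simps\<close>)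
qed (auto intro!: imat_eqI simp: plus_imat.rep_eq zero_imat.rep_eq uminus_imat.rep_eq minus_imat_def)

end

lemmas entry_simps [simp] = zero_imat.rep_eq plus_imat.rep_eq uminus_imat.rep_eq

lift_definition eps :: "nat \<Rightarrow> nat \<Rightarrow> 'a::zero_neq_one imat"
  is "\<lambda>i j k l. if k = i \<and> l = j then 1 else 0"
  by (metis add.commute less_add_Suc1)

lift_definition unit_imat :: "nat \<Rightarrow> 'a::zero_neq_one imat" ("\<one>\<^sub>i")
  is "\<lambda>n k l. if k = l \<and> k < n then 1 else 0"
  by metis

text \<open>The carrier condition for an n by m matrix as two absorption laws, so that it acts by
  rewriting in a ring without unit; \<open>fits_iff\<close> gives the equivalent bound on the
  support.\<close>

definition fits :: "nat \<Rightarrow> nat \<Rightarrow> 'a::comm_ring_1 imat \<Rightarrow> bool" where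
  "fits n m a \<longleftrightarrow> \<one>\<^sub>i n * a = a \<and> a * \<one>\<^sub>i m = a"

lemma entry_unit_times: "entry (\<one>\<^sub>i n * a) i j = (if i < n then entry a i j else 0)"
  for a :: "'a::comm_ring_1 imat"
proof -
  have "entry (\<one>\<^sub>i n * a) i j = (\<Sum>k<n. (if i = k \<and> i < n then 1 else 0) * entry a k j)"
    by (subst entry_times[of _ n]) (auto simp: unit_imat.rep_eq split: if_splits)
  also have "\<dots> = (\<Sum>k<n. if i = k then entry a i j else 0)" by (rule sum.cong) auto
  finally show ?thesis by simp
qed

lemma entry_times_unit: "entry (a * \<one>\<^sub>i n) i j = (if j < n then entry a i j else 0)"
  for a :: "'a::comm_ring_1 imat"
proof -
  have "entry (a * \<one>\<^sub>i n) i j = (\<Sum>k<n. entry a i k * (if k = j \<and> k < n then 1 else 0))"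
    by (subst entry_times_right[of _ n]) (auto simp: unit_imat.rep_eq split: if_splits)
  also have "\<dots> = (\<Sum>k<n. if k = j then entry a i j else 0)" by (rule sum.cong) auto
  finally show ?thesis by simp
qed

lemma entry_eps_times: "entry (eps i j * a) k l = (if k = i then entry a j l else 0)"
  for a :: "'a::comm_ring_1 imat"
proof -
  have "entry (eps i j * a) k l = (\<Sum>m<Suc j. (if k = i \<and> m = j then 1 else 0) * entry a m l)"
    by (subst entry_times[of _ "Suc j"]) (auto simp: eps.rep_eq split: if_splits)
  also have "\<dots> = (\<Sum>m<Suc j. if m = j then (if k = i then entry a j l else 0) else 0)"
    by (rule sum.cong) auto
  also have "\<dots> = (if k = i then entry a j l else 0)" by (subst sum.delta) auto
  finally show ?thesis .
qed

lemma entry_times_eps: "entry (a * eps i j) k l = (if l = j then entry a k i else 0)"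
  for a :: "'a::comm_ring_1 imat"
proof -
  have "entry (a * eps i j) k l = (\<Sum>m<Suc i. entry a k m * (if m = i \<and> l = j then 1 else 0))"
    by (subst entry_times_right[of _ "Suc i"]) (auto simp: eps.rep_eq split: if_splits)
  also have "\<dots> = (\<Sum>m<Suc i. if m = i then (if l = j then entry a k i else 0) else 0)"
    by (rule sum.cong) auto
  also have "\<dots> = (if l = j then entry a k i else 0)" by (subst sum.delta) auto
  finally show ?thesis .
qed

lemma fits_iff: "fits n m a \<longleftrightarrow> (\<forall>i j. entry a i j \<noteq> 0 \<longrightarrow> i < n \<and> j < m)"
proof
  assume f: "fits n m a"
  have "\<one>\<^sub>i n * a = a" "a * \<one>\<^sub>i m = a" using f by (auto simp: fits_def)
  then show "\<forall>i j. entry a i j \<noteq> 0 \<longrightarrow> i < n \<and> j < m"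
    by (metis entry_unit_times entry_times_unit)
next
  assume "\<forall>i j. entry a i j \<noteq> 0 \<longrightarrow> i < n \<and> j < m"
  then show "fits n m a"
    unfolding fits_def by (force intro!: imat_eqI simp: entry_unit_times entry_times_unit)
qed

lemma eps_eps: "eps i j * eps k l = (if j = k then eps i l else (0 :: 'a::comm_ring_1 imat))"
  by (rule imat_eqI) (auto simp: entry_eps_times eps.rep_eq)

lemma unit_unit [simp]: "\<one>\<^sub>i n * \<one>\<^sub>i n = (\<one>\<^sub>i n :: 'a::comm_ring_1 imat)"
  by (rule imat_eqI) (auto simp: entry_unit_times unit_imat.rep_eq)

lemma unit_0 [simp]: "\<one>\<^sub>i 0 = (0 :: 'a::comm_ring_1 imat)"
  by (rule imat_eqI) (auto simp: unit_imat.rep_eq)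

lemma unit_Suc: "\<one>\<^sub>i (Suc n) = \<one>\<^sub>i n + (eps n n :: 'a::comm_ring_1 imat)"
  by (rule imat_eqI) (auto simp: unit_imat.rep_eq eps.rep_eq)

lemma eps_00: "eps 0 0 = (\<one>\<^sub>i 1 :: 'a::comm_ring_1 imat)"
  by (rule imat_eqI) (auto simp: unit_imat.rep_eq eps.rep_eq)

lemma unit_neq_0: "0 < n \<Longrightarrow> \<one>\<^sub>i n \<noteq> (0 :: 'a::comm_ring_1 imat)"
  by (metis unit_imat.rep_eq zero_imat.rep_eq zero_neq_one)

lemma fits_times: "fits n k a \<Longrightarrow> fits k m b \<Longrightarrow> fits n m (a * b)"
  unfolding fits_def by (metis mult.assoc)

lemma fits_add: "fits n m a \<Longrightarrow> fits n m b \<Longrightarrow> fits n m (a + b)"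
  by (simp add: fits_def distrib_left distrib_right)

lemma fits_diff: "fits n m a \<Longrightarrow> fits n m b \<Longrightarrow> fits n m (a - b)"
  by (simp add: fits_def algebra_simps)

lemma fits_0 [simp]: "fits n m 0"
  by (simp add: fits_def)

lemma fits_unit [simp]: "fits n n (\<one>\<^sub>i n)"
  by (simp add: fits_def)

lemma fits_0_left: "fits 0 m a \<Longrightarrow> a = 0" and fits_0_right: "fits n 0 a \<Longrightarrow> a = 0"
  by (simp_all add: fits_def)

lemma fits_1_1_inverse:
  fixes a :: "'k::field imat"
  assumes "fits 1 1 a" "a \<noteq> 0"
  obtains b where "fits 1 1 b" "a * b = \<one>\<^sub>i 1" "b * a = \<one>\<^sub>i 1"
proof -
  have sup: "entry a i j = 0" if "i \<noteq> 0 \<or> j \<noteq> 0" for i j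
    using assms(1) that unfolding fits_iff by (metis less_one)
  have a0: "entry a 0 0 \<noteq> 0" using assms(2) sup by (metis imat_eqI zero_imat.rep_eq)
  define f where "f = (\<lambda>(i::nat) j. if i = 0 \<and> j = (0::nat) then inverse (entry a 0 0) else 0)"
  define b where "b = Abs_imat f"
  have "entry b = f"
    unfolding b_def
    by (rule Abs_imat_inverse) (auto simp: f_def split: if_splits intro!: exI[of _ "Suc 0"])
  then have eb: "entry b i j = (if i = 0 \<and> j = 0 then inverse (entry a 0 0) else 0)" for i j
    by (simp add: f_def)
  have fb: "fits 1 1 b" unfolding fits_iff eb by auto
  have "a * b = \<one>\<^sub>i 1"
  proof (rule imat_eqI)
    fix i j
    have "entry (a * b) i j = (\<Sum>k<1. entry a i k * entry b k j)"
      by (rule entry_times) (use sup in auto)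
    then show "entry (a * b) i j = entry (\<one>\<^sub>i 1) i j"
      using a0 sup by (simp add: eb unit_imat.rep_eq lessThan_Suc)
  qed
  moreover have "b * a = \<one>\<^sub>i 1"
  proof (rule imat_eqI)
    fix i j
    have "entry (b * a) i j = (\<Sum>k<1. entry b i k * entry a k j)"
      by (rule entry_times) (use eb in \<open>auto split: if_splits\<close>)
    then show "entry (b * a) i j = entry (\<one>\<^sub>i 1) i j"
      using a0 sup by (simp add: eb unit_imat.rep_eq lessThan_Suc)
  qed
  ultimately show thesis using fb that by blast
qed

subsection \<open>Rank factorization\<close>

text \<open>Gaussian elimination with one pivot per step. The remainder \<open>a'\<close> has fewer
  nonzero rows, and its factorization through \<open>d\<close> is enlarged by the pivot column and
  the pivot row. The one-sided inverses \<open>l\<close> and \<open>r\<close> are carried along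
  because they express injectivity of \<open>b\<close> and surjectivity of \<open>c\<close> by
  equations.\<close>

lemma rank_factorization:
  fixes a :: "'k::field imat"
  assumes "fits n m a"
  obtains d b c l r where "fits n d b" "fits d m c" "fits d n l" "fits m d r"
    "a = b * c" "l * b = \<one>\<^sub>i d" "c * r = \<one>\<^sub>i d"
proof -
  have "\<exists>d b c l r. fits n d b \<and> fits d m c \<and> fits d n l \<and> fits m d r \<and>
    a = b * c \<and> l * b = \<one>\<^sub>i d \<and> c * r = \<one>\<^sub>i d"
    using assms
  proof (induction "card {i. \<exists>j. entry a i j \<noteq> 0}" arbitrary: a rule: less_induct)
    case less
    show ?case
    proof (cases "a = 0")
      case True
      then show ?thesis by (intro exI[of _ 0]) simp
    next
      case False
      then obtain p q where pq: "entry a p q \<noteq> 0" by (metis imat_eqI zero_imat.rep_eq)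
      have pn: "p < n" "q < m" using less.prems pq by (auto simp: fits_iff)
      \<comment> \<open>\<open>w\<close> is the pivot entry as a 1 by 1 block and \<open>t\<close>
        its inverse. With \<open>u\<close> the pivot column divided by the pivot and
        \<open>v\<close> the pivot row, \<open>u * v\<close> agrees with \<open>a\<close> in row
        \<open>p\<close> and in column \<open>q\<close>.\<close>
      define w where "w = eps 0 p * a * eps q (0::nat)"
      have w: "fits 1 1 w" "w \<noteq> 0"
      proof -
        show "fits 1 1 w" by (auto simp: fits_iff w_def entry_eps_times entry_times_eps split: if_splits)
        have "entry w 0 0 = entry a p q" by (simp add: w_def entry_eps_times entry_times_eps)
        then show "w \<noteq> 0" using pq by auto
      qed
      obtain t where t: "fits 1 1 t" "w * t = \<one>\<^sub>i 1" "t * w = \<one>\<^sub>i 1" using fits_1_1_inverse w by metis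
      define u where "u = a * eps q 0 * t"
      define v where "v = eps 0 p * a"
      have fe: "fits 1 n (eps 0 p)" "fits m 1 (eps q 0)"
        using pn by (auto simp: fits_iff eps.rep_eq split: if_splits)
      have fu: "fits n 1 u" and fv: "fits 1 m v"
        unfolding u_def v_def by (meson fits_times less.prems fe t)+
      have pu: "eps 0 p * u = eps 0 0" using t by (simp add: u_def w_def mult.assoc eps_00)
      have vq: "v * eps q 0 * t = eps 0 0" using t by (simp add: v_def w_def mult.assoc eps_00)
      define a' where "a' = a - u * v"
      have fa': "fits n m a'" unfolding a'_def by (meson fits_diff fits_times less.prems fu fv)
      have e1: "eps 0 0 * v = v" using fv unfolding eps_00 by (simp add: fits_def)
      have pa': "eps 0 p * a' = 0"
        using pu e1 by (simp add: a'_def right_diff_distrib mult.assoc[symmetric]) (simp add: v_def)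
      have t1: "t * eps 0 0 = t" using t unfolding eps_00 by (simp add: fits_def)
      have u1: "u * eps 0 0 = u" using fu unfolding eps_00 by (simp add: fits_def)
      have a'q: "a' * (eps q 0 * t) = 0"
        using vq u1 by (simp add: a'_def algebra_simps u_def)
      have sub: "{i. \<exists>j. entry a' i j \<noteq> 0} \<subset> {i. \<exists>j. entry a i j \<noteq> 0}"
      proof
        show "{i. \<exists>j. entry a' i j \<noteq> 0} \<subseteq> {i. \<exists>j. entry a i j \<noteq> 0}"
        proof clarify
          fix i j assume ij: "entry a' i j \<noteq> 0"
          show "\<exists>j. entry a i j \<noteq> 0"
          proof (rule ccontr)
            assume "\<nexists>j. entry a i j \<noteq> 0"
            then have "eps 0 i * a = 0" by (auto intro!: imat_eqI simp: entry_eps_times)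
            then have "eps 0 i * a' = 0" by (simp add: a'_def right_diff_distrib mult.assoc[symmetric] u_def)
            then have "entry a' i j = 0" by (metis entry_eps_times zero_imat.rep_eq)
            then show False using ij by simp
          qed
        qed
        have "entry a' p j = 0" for j using pa' by (metis entry_eps_times zero_imat.rep_eq)
        then show "{i. \<exists>j. entry a' i j \<noteq> 0} \<noteq> {i. \<exists>j. entry a i j \<noteq> 0}" using pq by blast
      qed
      have "finite {i. \<exists>j. entry a i j \<noteq> 0}"
        by (rule finite_subset[of _ "{..<n}"]) (use less.prems in \<open>auto simp: fits_iff\<close>)
      then have "card {i. \<exists>j. entry a' i j \<noteq> 0} < card {i. \<exists>j. entry a i j \<noteq> 0}"
        using sub by (simp add: psubset_card_mono)
      from less.hyps[OF this fa'] obtain d b c l r where f: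
        "fits n d b" "fits d m c" "fits d n l" "fits m d r"
        and e: "a' = b * c" "l * b = \<one>\<^sub>i d" "c * r = \<one>\<^sub>i d" by blast
      let ?b = "b + u * eps 0 d" and ?c = "c + eps d 0 * v"
      \<comment> \<open>The correction terms separate the new index \<open>d\<close> from the old
        block: \<open>?l\<close> sends \<open>u\<close> to the new index alone and still inverts
        \<open>b\<close>, and dually \<open>v * ?r\<close> is the new unit row.\<close>
      let ?l = "l - l * u * eps 0 p + eps d p" and ?r = "r - eps q 0 * t * v * r + eps q 0 * t * eps 0 d"
      have Sd: "fits d (Suc d) x" if "fits d d x" for x :: "'k imat"
        using that by (auto simp: fits_iff less_Suc_eq)
      have w1: "fits n (Suc d) x" if "fits n d x" for x :: "'k imat" and n
        using that by (fastforce simp: fits_iff)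
      have w2: "fits (Suc d) n x" if "fits d n x" for x :: "'k imat" and n
        using that by (fastforce simp: fits_iff)
      have eps0d: "fits 1 (Suc d) (eps 0 d)" "fits (Suc d) 1 (eps d 0)"
        by (auto simp: fits_iff eps.rep_eq split: if_splits)
      have epsdp: "fits (Suc d) n (eps d p)"
        using pn by (auto simp: fits_iff eps.rep_eq split: if_splits)
      have F: "fits n (Suc d) ?b" "fits (Suc d) m ?c" "fits (Suc d) n ?l" "fits m (Suc d) ?r"
        using fits_add[OF w1[OF f(1)] fits_times[OF fu eps0d(1)]]
          fits_add[OF w2[OF f(2)] fits_times[OF eps0d(2) fv]]
          fits_add[OF fits_diff[OF w2[OF f(3)] w2[OF fits_times[OF fits_times[OF f(3) fu] fe(1)]]] epsdp]
          fits_add[OF fits_diff[OF w1[OF f(4)]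
              w1[OF fits_times[OF fits_times[OF fits_times[OF fe(2) t(1)] fv] f(4)]]]
              fits_times[OF fits_times[OF fe(2) t(1)] eps0d(1)]]
        by blast+
      have z1: "b * eps d x = 0" for x
        using f(1) unfolding fits_iff by (intro imat_eqI) (metis entry_times_eps zero_imat.rep_eq less_irrefl)
      have z2: "eps x d * c = 0" for x
        using f(2) unfolding fits_iff by (intro imat_eqI) (metis entry_eps_times zero_imat.rep_eq less_irrefl)
      have z3: "r * eps d x = 0" for x
        using f(4) unfolding fits_iff by (intro imat_eqI) (metis entry_times_eps zero_imat.rep_eq less_irrefl)
      have z4: "eps x d * l = 0" for x
        using f(3) unfolding fits_iff by (intro imat_eqI) (metis entry_eps_times zero_imat.rep_eq less_irrefl)
      have br: "a' * r = b" using e f by (simp add: mult.assoc fits_def)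
      have lc: "l * a' = c" using e f by (simp add: mult.assoc[symmetric] fits_def)
      have pb: "eps 0 p * b = 0" using pa' by (simp add: br[symmetric] mult.assoc[symmetric])
      have pb': "eps d p * b = 0"
      proof -
        have "eps d p = eps d 0 * (eps 0 p :: 'k imat)" by (simp add: eps_eps)
        then show ?thesis using pb by (simp add: mult.assoc)
      qed
      have pu': "eps d p * u = eps d 0"
      proof -
        have "eps d p * u = eps d 0 * (eps 0 p * u)" by (simp add: mult.assoc[symmetric] eps_eps)
        then show ?thesis unfolding pu by (simp add: eps_eps)
      qed
      have cq: "c * (eps q 0 * t) = 0" using a'q by (simp add: lc[symmetric] mult.assoc)
      have "?b * ?c = b * c + u * v"
        using z1[of 0] z2[of 0] u1
        by (simp add: distrib_left distrib_right mult.assoc)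
           (simp add: mult.assoc[symmetric] eps_eps u1)
      then have 1: "a = ?b * ?c" unfolding e(1)[symmetric] a'_def by simp
      have "?l * ?b = l * b + (l * u * eps 0 d - l * (u * (eps 0 p * u) * eps 0 d)) - l * u * (eps 0 p * b)
         + eps d p * b + eps d p * u * eps 0 d"
        by (simp add: algebra_simps)
      also have "\<dots> = \<one>\<^sub>i d + eps d d" unfolding pu pb pb' pu' using u1 e(2) by (simp add: eps_eps mult.assoc)
      finally have 2: "?l * ?b = \<one>\<^sub>i (Suc d)" by (simp add: unit_Suc)
      have "?c * ?r = c * r - (c * (eps q 0 * t)) * (v * r) + (c * (eps q 0 * t)) * eps 0 d
         + eps d 0 * v * r - eps d 0 * (v * eps q 0 * t) * (v * r) + eps d 0 * (v * eps q 0 * t) * eps 0 d"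
        by (simp add: algebra_simps)
      also have "\<dots> = \<one>\<^sub>i d + eps d d"
        unfolding cq vq using e(3) e1 by (simp add: eps_eps mult.assoc)
      finally have 3: "?c * ?r = \<one>\<^sub>i (Suc d)" by (simp add: unit_Suc)
      show ?thesis using F 1 2 3 by blast
    qed
  qed
  then show thesis using that by blast
qed

subsection \<open>Matrices and vectors as elements of the ring\<close>

definition imat_of :: "'a::zero mat \<Rightarrow> 'a imat" where
  "imat_of A = Abs_imat (\<lambda>i j. if i < dim_row A \<and> j < dim_col A then A $$ (i, j) else 0)"

definition mat_of :: "nat \<Rightarrow> nat \<Rightarrow> 'a::zero imat \<Rightarrow> 'a mat" where
  "mat_of n m a = mat n m (\<lambda>(i, j). entry a i j)"

definition icol :: "'a::zero vec \<Rightarrow> 'a imat" where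
  "icol x = Abs_imat (\<lambda>i j. if i < dim_vec x \<and> j = 0 then x $ i else 0)"

definition vec_of :: "nat \<Rightarrow> 'a::zero imat \<Rightarrow> 'a vec" where
  "vec_of n a = vec n (\<lambda>i. entry a i 0)"

lemma entry_imat_of:
  "entry (imat_of A) i j = (if i < dim_row A \<and> j < dim_col A then A $$ (i, j) else 0)"
proof -
  have "(\<lambda>i j. if i < dim_row A \<and> j < dim_col A then A $$ (i, j) else 0) \<in>
    {f. \<exists>n. \<forall>i j. f i j \<noteq> 0 \<longrightarrow> i < n \<and> j < n}"
    by (auto intro!: exI[of _ "dim_row A + dim_col A"])
  from Abs_imat_inverse[OF this] show ?thesis unfolding imat_of_def by simp
qed

lemma entry_icol: "entry (icol x) i j = (if i < dim_vec x \<and> j = 0 then x $ i else 0)"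
proof -
  have "(\<lambda>i j. if i < dim_vec x \<and> j = 0 then x $ i else 0) \<in>
    {f. \<exists>n. \<forall>i j. f i j \<noteq> 0 \<longrightarrow> i < n \<and> j < (n::nat)}"
    by (auto intro!: exI[of _ "Suc (dim_vec x)"])
  from Abs_imat_inverse[OF this] show ?thesis unfolding icol_def by simp
qed

lemma fits_imat_of [intro]: "A \<in> carrier_mat n m \<Longrightarrow> fits n m (imat_of A)"
  by (auto simp: fits_iff entry_imat_of split: if_splits)

lemma mat_of_carrier [simp, intro]: "mat_of n m a \<in> carrier_mat n m"
  by (simp add: mat_of_def)

lemma imat_of_mat_of [simp]: "fits n m a \<Longrightarrow> imat_of (mat_of n m a) = a"
  by (rule imat_eqI) (auto simp: fits_iff entry_imat_of mat_of_def)

lemma imat_of_inject: "A \<in> carrier_mat n m \<Longrightarrow> B \<in> carrier_mat n m \<Longrightarrow> imat_of A = imat_of B \<Longrightarrow> A = B"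
  by (rule eq_matI) (metis carrier_matD entry_imat_of)+

lemma imat_of_0 [simp]: "imat_of (0\<^sub>m n m) = (0 :: 'a::comm_ring_1 imat)"
  by (rule imat_eqI) (simp add: entry_imat_of)

lemma imat_of_1 [simp]: "imat_of (1\<^sub>m n) = (\<one>\<^sub>i n :: 'a::comm_ring_1 imat)"
  by (rule imat_eqI) (simp add: entry_imat_of unit_imat.rep_eq)

lemma imat_of_add:
  "A \<in> carrier_mat n m \<Longrightarrow> B \<in> carrier_mat n m \<Longrightarrow> imat_of (A + B) = imat_of A + (imat_of B :: 'a::comm_ring_1 imat)"
  by (rule imat_eqI) (auto simp: entry_imat_of)

lemma imat_of_mult:
  assumes "A \<in> carrier_mat n k" "B \<in> carrier_mat k m"
  shows "imat_of (A * B) = imat_of A * (imat_of B :: 'a::comm_ring_1 imat)"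
proof (rule imat_eqI)
  fix i j
  have "entry (imat_of A * imat_of B) i j = (\<Sum>l<k. entry (imat_of A) i l * entry (imat_of B) l j)"
    by (rule entry_times) (use assms in \<open>auto simp: entry_imat_of split: if_splits\<close>)
  then show "entry (imat_of (A * B)) i j = entry (imat_of A * imat_of B) i j"
    using assms by (auto simp: entry_imat_of scalar_prod_def atLeast0LessThan)
qed

lemma fits_icol [intro]: "x \<in> carrier_vec n \<Longrightarrow> fits n 1 (icol x)"
  by (auto simp: fits_iff entry_icol split: if_splits)

lemma vec_of_carrier [simp, intro]: "vec_of n a \<in> carrier_vec n"
  by (simp add: vec_of_def)

lemma icol_vec_of [simp]: "fits n 1 a \<Longrightarrow> icol (vec_of n a) = a"
  by (rule imat_eqI) (auto simp: fits_iff entry_icol vec_of_def)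

lemma icol_inject: "x \<in> carrier_vec n \<Longrightarrow> y \<in> carrier_vec n \<Longrightarrow> icol x = icol y \<Longrightarrow> x = y"
  by (rule eq_vecI) (metis carrier_vecD entry_icol)+

lemma icol_0 [simp]: "icol (0\<^sub>v n) = (0 :: 'a::comm_ring_1 imat)"
  by (rule imat_eqI) (simp add: entry_icol)

lemma icol_mult:
  assumes "A \<in> carrier_mat n k" "x \<in> carrier_vec k"
  shows "icol (A *\<^sub>v x) = imat_of A * (icol x :: 'a::comm_ring_1 imat)"
proof (rule imat_eqI)
  fix i j
  have "entry (imat_of A * icol x) i j = (\<Sum>l<k. entry (imat_of A) i l * entry (icol x) l j)"
    by (rule entry_times) (use assms in \<open>auto simp: entry_imat_of split: if_splits\<close>)
  then show "entry (icol (A *\<^sub>v x)) i j = entry (imat_of A * icol x) i j"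
    using assms by (auto simp: entry_imat_of entry_icol scalar_prod_def atLeast0LessThan)
qed

subsection \<open>Rank\<close>

lemma square_inverse_commutes:
  fixes x y :: "'k::field imat"
  assumes "fits d d x" "fits d d y" "x * y = \<one>\<^sub>i d"
  shows "y * x = \<one>\<^sub>i d"
proof -
  have "imat_of (mat_of d d x * mat_of d d y) = imat_of (1\<^sub>m d)"
    using assms by (subst imat_of_mult[of _ d d _ d]) auto
  then have "mat_of d d x * mat_of d d y = 1\<^sub>m d"
    by (rule imat_of_inject[rotated 2, of _ _ d d]) (auto intro: mult_carrier_mat)
  then have "mat_of d d y * mat_of d d x = 1\<^sub>m d"
    by (rule mat_mult_left_right_inverse[rotated 2]) auto
  then have "imat_of (mat_of d d y * mat_of d d x) = imat_of (1\<^sub>m d)" by simp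
  then show ?thesis using assms by (subst (asm) imat_of_mult[of _ d d _ d]) auto
qed

text \<open>If \<open>n < d\<close>, both factors can be read as d by d matrices, so their product
  in the other order is the identity too; but row \<open>n\<close> of \<open>y\<close> is
  zero.\<close>

lemma one_sided_inverse_le:
  fixes x y :: "'k::field imat"
  assumes "fits d n x" "fits n d y" "x * y = \<one>\<^sub>i d"
  shows "d \<le> n"
proof (rule ccontr)
  assume "\<not> d \<le> n"
  then have sq: "fits d d x" "fits d d y" using assms by (fastforce simp: fits_iff)+
  have "eps n n * \<one>\<^sub>i d = (eps n n :: 'k imat)"
    using \<open>\<not> d \<le> n\<close> by (intro imat_eqI) (auto simp: entry_times_unit eps.rep_eq)
  moreover have "eps n n * y = 0"
    using assms(2) by (intro imat_eqI) (auto simp: entry_eps_times fits_iff)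
  ultimately have "eps n n = (0 :: 'k imat)"
    using square_inverse_commutes[OF sq assms(3)] by (metis mult.assoc mult_zero_left)
  then show False by (metis eps.rep_eq zero_imat.rep_eq zero_neq_one)
qed

text \<open>Rank as the least inner dimension of a factorization: it visibly cannot grow under
  multiplication from either side.\<close>

definition irank :: "'k::field imat \<Rightarrow> nat" where
  "irank a = (LEAST d. \<exists>b c. a = b * \<one>\<^sub>i d * c)"

lemma irank_le: "a = b * \<one>\<^sub>i d * c \<Longrightarrow> irank a \<le> d"
  unfolding irank_def by (rule Least_le) blast

lemma irank_factors: "\<exists>b c. a = b * \<one>\<^sub>i (irank a) * c"
proof -
  obtain n where "\<forall>i j. entry a i j \<noteq> 0 \<longrightarrow> i < n \<and> j < n" using entry_bound by blast
  then have "a = \<one>\<^sub>i n * \<one>\<^sub>i n * a" by (auto simp: fits_iff[symmetric] fits_def)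
  then have "\<exists>d b c. a = b * \<one>\<^sub>i d * c" by blast
  then show ?thesis unfolding irank_def by (rule LeastI_ex)
qed

lemma irank_mult_left: "irank (a * b) \<le> irank a"
  and irank_mult_right: "irank (b * a) \<le> irank a"
  using irank_factors[of a] by (metis irank_le mult.assoc)+

lemma fits_right_unit: "fits n m a \<Longrightarrow> fits n d (a * x * \<one>\<^sub>i d)"
  and fits_left_unit: "fits n m a \<Longrightarrow> fits d m (\<one>\<^sub>i d * x * a)"
  unfolding fits_def by (metis mult.assoc unit_unit)+

text \<open>Multiplying any factorization of \<open>a\<close> by \<open>l\<close> and
  \<open>r\<close> gives one of the identity of size \<open>d\<close>, so no smaller inner dimension
  is possible.\<close>

lemma irank_factorization:
  fixes a :: "'k::field imat"
  assumes "fits n d b" "fits d m c" "fits d n l" "fits m d r"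
    "a = b * c" "l * b = \<one>\<^sub>i d" "c * r = \<one>\<^sub>i d"
  shows "irank a = d"
proof (rule antisym)
  show "irank a \<le> d" using assms by (intro irank_le[of a b d c]) (simp add: fits_def)
  obtain x y where xy: "a = x * \<one>\<^sub>i (irank a) * y" using irank_factors by blast
  have "(l * x * \<one>\<^sub>i d') * (\<one>\<^sub>i d' * y * r) = l * (x * (\<one>\<^sub>i d' * \<one>\<^sub>i d') * y) * r" for d'
    by (simp only: mult.assoc)
  from this[of "irank a"]
  have "(l * x * \<one>\<^sub>i (irank a)) * (\<one>\<^sub>i (irank a) * y * r) = l * a * r"
    unfolding unit_unit xy[symmetric] .
  also have "\<dots> = (l * b) * (c * r)" using assms(5) by (simp add: mult.assoc)
  also have "\<dots> = \<one>\<^sub>i d" using assms by simp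
  finally have 1: "(l * x * \<one>\<^sub>i (irank a)) * (\<one>\<^sub>i (irank a) * y * r) = \<one>\<^sub>i d" .
  have "fits d (irank a) (l * x * \<one>\<^sub>i (irank a))" "fits (irank a) d (\<one>\<^sub>i (irank a) * y * r)"
    using fits_right_unit[OF assms(3)] fits_left_unit[OF assms(4)] by auto
  then show "d \<le> irank a" using 1 by (rule one_sided_inverse_le)
qed

text \<open>If t and t^2 have equal rank, then t is invertible on its image. With t = b c and t^2 =
  b' c' through the same \<open>d\<close>, the square matrices \<open>l' * b\<close> and
  \<open>c * t * r'\<close> have product 1 in one order, hence in the other, which reads t = t t g.
  The pair \<open>l' * t * b\<close> and \<open>c * r'\<close> gives t = h t t.\<close>

lemma irank_square_eqE:
  fixes t :: "'k::field imat"
  assumes t: "fits n n t" and r: "irank (t * t) = irank t"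
  obtains g h where "fits n n g" "fits n n h" "t = t * t * g" "t = h * t * t"
proof -
  obtain d b c l r where f: "fits n d b" "fits d n c" "fits d n l" "fits n d r"
    and e: "t = b * c" "l * b = \<one>\<^sub>i d" "c * r = \<one>\<^sub>i d" using rank_factorization[OF t] by metis
  obtain d' b' c' l' r' where f': "fits n d' b'" "fits d' n c'" "fits d' n l'" "fits n d' r'"
    and e': "t * t = b' * c'" "l' * b' = \<one>\<^sub>i d'" "c' * r' = \<one>\<^sub>i d'"
    using rank_factorization[OF fits_times[OF t t]] by metis
  have [simp]: "d' = d" using r irank_factorization[OF f e] irank_factorization[OF f' e'] by simp
  have u: "b * \<one>\<^sub>i d = b" "\<one>\<^sub>i d * c = c" using f by (auto simp: fits_def)
  have "(l' * b) * (c * t * r') = l' * ((b * c) * t) * r'" by (simp add: mult.assoc)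
  also have "\<dots> = l' * (t * t) * r'" unfolding e(1)[symmetric] ..
  also have "\<dots> = (l' * b') * (c' * r')" unfolding e'(1) by (simp add: mult.assoc)
  finally have "(l' * b) * (c * t * r') = \<one>\<^sub>i d" using e' by simp
  moreover have "fits d d (l' * b)" "fits d d (c * t * r')"
    using fits_times[OF f'(3) f(1)] fits_times[OF fits_times[OF f(2) t] f'(4)] by auto
  ultimately have 1: "(c * t * r') * (l' * b) = \<one>\<^sub>i d" by (rule square_inverse_commutes[rotated 2])
  have "(l' * t * b) * (c * r') = l' * (t * (b * c)) * r'" by (simp add: mult.assoc)
  also have "\<dots> = l' * (t * t) * r'" unfolding e(1)[symmetric] ..
  also have "\<dots> = (l' * b') * (c' * r')" unfolding e'(1) by (simp add: mult.assoc)
  finally have "(l' * t * b) * (c * r') = \<one>\<^sub>i d" using e' by simp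
  moreover have "fits d d (l' * t * b)" "fits d d (c * r')"
    using fits_times[OF fits_times[OF f'(3) t] f(1)] fits_times[OF f(2) f'(4)] by auto
  ultimately have 2: "(c * r') * (l' * t * b) = \<one>\<^sub>i d" by (rule square_inverse_commutes[rotated 2])
  have "t = b * ((c * t * r') * (l' * b)) * c" unfolding 1 u by (rule e(1))
  also have "\<dots> = (b * c) * t * (r' * l' * (b * c))" by (simp add: mult.assoc)
  finally have 3: "t = t * t * (r' * l' * t)" unfolding e(1)[symmetric] .
  have "t = b * ((c * r') * (l' * t * b)) * c" unfolding 2 u by (rule e(1))
  also have "\<dots> = ((b * c) * r' * l') * t * (b * c)" by (simp add: mult.assoc)
  finally have 4: "t = (t * r' * l') * t * t" unfolding e(1)[symmetric] .
  have "fits n n (r' * l' * t)" "fits n n (t * r' * l')"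
    using fits_times[OF fits_times[OF f'(4,3)] t] fits_times[OF fits_times[OF t f'(4)] f'(3)] by auto
  then show thesis using that 3 4 by blast
qed

section \<open>Powers of a square matrix\<close>

fun ipow :: "nat \<Rightarrow> 'k::field imat \<Rightarrow> nat \<Rightarrow> 'k imat" where
  "ipow n s 0 = \<one>\<^sub>i n"
| "ipow n s (Suc k) = s * ipow n s k"

lemma fits_ipow: "fits n n s \<Longrightarrow> fits n n (ipow n s k)"
  by (induction k) (auto intro: fits_times)

lemma ipow_add: "fits n n s \<Longrightarrow> ipow n s (k + l) = ipow n s k * ipow n s l"
  by (induction k) (use fits_ipow[of n s l] in \<open>auto simp: fits_def mult.assoc\<close>)

lemma ipow_Suc2: "fits n n s \<Longrightarrow> ipow n s (Suc k) = ipow n s k * s"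
  using ipow_add[of n s k 1] by (simp add: fits_def)

text \<open>The total rank \<open>F\<close> over all vertices is nonincreasing in the exponent,
  hence constant beyond a minimizer; equal sums of termwise comparable ranks are equal termwise. So
  one exponent serves all vertices.\<close>

lemma ipow_strongly_regular:
  assumes V: "finite V" and s: "\<And>v. v \<in> V \<Longrightarrow> fits (n v) (n v) (s v)"
  obtains k g h where "0 < k"
    "\<And>v. v \<in> V \<Longrightarrow> fits (n v) (n v) (g v) \<and> fits (n v) (n v) (h v) \<and>
      ipow (n v) (s v) k = ipow (n v) (s v) k * ipow (n v) (s v) k * g v \<and>
      ipow (n v) (s v) k = h v * ipow (n v) (s v) k * ipow (n v) (s v) k"
proof -
  define F where "F k = (\<Sum>v\<in>V. irank (ipow (n v) (s v) k))" for k
  have mono: "irank (ipow (n v) (s v) (k + l)) \<le> irank (ipow (n v) (s v) k)" if "v \<in> V" for v k l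
    using irank_mult_left s[OF that] by (simp add: ipow_add)
  have Fmono: "F (k + l) \<le> F k" for k l unfolding F_def by (rule sum_mono) (rule mono)
  define k0 where "k0 = (ARG_MIN F k. True)"
  have k0: "F k0 \<le> F k" for k unfolding k0_def by (rule arg_min_nat_le) simp
  define k where "k = Suc k0"
  have "F (k + k) = F k"
    using k0[of "k + k"] Fmono[of k k] Fmono[of k0 1] by (simp add: k_def)
  then have eq: "irank (ipow (n v) (s v) (k + k)) = irank (ipow (n v) (s v) k)" if "v \<in> V" for v
    using sum_mono_inv[of "\<lambda>v. irank (ipow (n v) (s v) (k + k))" V "\<lambda>v. irank (ipow (n v) (s v) k)" v]
      mono[of _ k k] V that by (simp add: F_def)
  have "\<exists>g h. fits (n v) (n v) g \<and> fits (n v) (n v) h \<and>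
      ipow (n v) (s v) k = ipow (n v) (s v) k * ipow (n v) (s v) k * g \<and>
      ipow (n v) (s v) k = h * ipow (n v) (s v) k * ipow (n v) (s v) k" if "v \<in> V" for v
    using irank_square_eqE[OF fits_ipow[OF s[OF that]], of k] eq[OF that] s[OF that]
    by (metis ipow_add)
  then obtain g h where "\<And>v. v \<in> V \<Longrightarrow> fits (n v) (n v) (g v) \<and> fits (n v) (n v) (h v) \<and>
      ipow (n v) (s v) k = ipow (n v) (s v) k * ipow (n v) (s v) k * g v \<and>
      ipow (n v) (s v) k = h v * ipow (n v) (s v) k * ipow (n v) (s v) k" by metis
  then show thesis using that[of k g h] k_def by blast
qed

section \<open>Paths in tree quivers\<close>

fun dpath :: "('v, 'a) quiver \<Rightarrow> 'v \<Rightarrow> 'a list \<Rightarrow> 'v \<Rightarrow> bool" where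
  "dpath Q a [] b \<longleftrightarrow> a = b"
| "dpath Q a (\<alpha> # p) b \<longleftrightarrow> \<alpha> \<in> Q1 Q \<and> src Q \<alpha> = a \<and> dpath Q (tgt Q \<alpha>) p b"

definition verts :: "('v, 'a) quiver \<Rightarrow> 'v \<Rightarrow> 'a list \<Rightarrow> 'v list" where
  "verts Q a p = a # map (tgt Q) p"

lemma verts_simps [simp]:
  "verts Q a [] = [a]" "verts Q a (\<alpha> # p) = a # verts Q (tgt Q \<alpha>) p"
  by (simp_all add: verts_def)

lemma dpath_append: "dpath Q a (p @ q) b \<longleftrightarrow> (\<exists>c. dpath Q a p c \<and> dpath Q c q b)"
  by (induction p arbitrary: a) auto

lemma dpath_snoc: "dpath Q a (p @ [\<alpha>]) b \<longleftrightarrow> \<alpha> \<in> Q1 Q \<and> dpath Q a p (src Q \<alpha>) \<and> b = tgt Q \<alpha>"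
  by (auto simp: dpath_append)

lemma dpath_arrows: "dpath Q a p b \<Longrightarrow> set p \<subseteq> Q1 Q"
  by (induction p arbitrary: a) auto

lemma all_Suc_iff: "(\<forall>k. P k) \<longleftrightarrow> P 0 \<and> (\<forall>k. P (Suc k))"
  by (metis not0_implies_Suc)

lemma is_path_Cons:
  "is_path Q (\<alpha> # p) \<longleftrightarrow> \<alpha> \<in> Q1 Q \<and> (p = [] \<or> is_path Q p \<and> tgt Q \<alpha> = src Q (hd p))"
proof (cases p)
  case (Cons \<beta> q)
  have "(\<forall>k. Suc k < length (\<alpha> # \<beta> # q) \<longrightarrow> tgt Q ((\<alpha> # \<beta> # q) ! k) = src Q ((\<alpha> # \<beta> # q) ! Suc k))
    \<longleftrightarrow> tgt Q \<alpha> = src Q \<beta> \<and> (\<forall>k. Suc k < length (\<beta> # q) \<longrightarrow> tgt Q ((\<beta> # q) ! k) = src Q ((\<beta> # q) ! Suc k))"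
    unfolding all_Suc_iff[of "\<lambda>k. Suc k < length (\<alpha> # \<beta> # q) \<longrightarrow> tgt Q ((\<alpha> # \<beta> # q) ! k) = src Q ((\<alpha> # \<beta> # q) ! Suc k)"]
    by auto
  then show ?thesis using Cons by (auto simp: is_path_def)
qed (simp add: is_path_def)

lemma dpath_src_hd: "dpath Q a p b \<Longrightarrow> p \<noteq> [] \<Longrightarrow> a = src Q (hd p)"
  by (cases p) auto

lemma is_path_dpath: "p \<noteq> [] \<Longrightarrow> is_path Q p \<longleftrightarrow> dpath Q (src Q (hd p)) p (tgt Q (last p))"
proof (induction p)
  case (Cons \<alpha> p)
  show ?case
  proof (cases "p = []")
    case False
    have "dpath Q c p e \<longleftrightarrow> c = src Q (hd p) \<and> dpath Q (src Q (hd p)) p e" for c e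
      using dpath_src_hd[OF _ False] by metis
    then show ?thesis using Cons.IH[OF False] False by (metis dpath.simps(2) is_path_Cons last_ConsR list.sel(1))
  qed (simp add: is_path_Cons)
qed simp

lemma dpath_is_path: "dpath Q a p b \<Longrightarrow> p \<noteq> [] \<Longrightarrow> is_path Q p \<and> a = src Q (hd p) \<and> b = tgt Q (last p)"
  by (induction p arbitrary: a) (auto simp: is_path_Cons split: if_splits)

lemma verts_split:
  assumes "dpath Q a p b"
  shows "v \<in> set (verts Q a p) \<longleftrightarrow> (\<exists>u w. p = u @ w \<and> dpath Q a u v \<and> dpath Q v w b)"
  using assms
proof (induction p arbitrary: a)
  case (Cons \<alpha> p)
  show ?case
  proof
    assume v: "v \<in> set (verts Q a (\<alpha> # p))"
    show "\<exists>u w. \<alpha> # p = u @ w \<and> dpath Q a u v \<and> dpath Q v w b"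
    proof (cases "v = a")
      case True
      then show ?thesis using Cons.prems by (intro exI[of _ "[]"] exI[of _ "\<alpha> # p"]) auto
    next
      case False
      then have "v \<in> set (verts Q (tgt Q \<alpha>) p)" using v by simp
      then obtain u w where "p = u @ w \<and> dpath Q (tgt Q \<alpha>) u v \<and> dpath Q v w b"
        using Cons by auto
      then show ?thesis using Cons.prems by (intro exI[of _ "\<alpha> # u"] exI[of _ w]) auto
    qed
  next
    assume "\<exists>u w. \<alpha> # p = u @ w \<and> dpath Q a u v \<and> dpath Q v w b"
    then obtain u w where u: "\<alpha> # p = u @ w" "dpath Q a u v" "dpath Q v w b" by blast
    show "v \<in> set (verts Q a (\<alpha> # p))"
    proof (cases u)
      case (Cons \<beta> u')
      then show ?thesis using u Cons.IH Cons.prems by auto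
    qed (use u in auto)
  qed
qed auto

section \<open>Every arrow of a tree is a bridge\<close>

definition uadj :: "('v, 'a) quiver \<Rightarrow> 'a set \<Rightarrow> ('v \<times> 'v) set" where
  "uadj Q E = {(u, w). \<exists>\<alpha>\<in>E. u = src Q \<alpha> \<and> w = tgt Q \<alpha> \<or> u = tgt Q \<alpha> \<and> w = src Q \<alpha>}"

lemma adj_uadj: "adj Q = uadj Q (Q1 Q)"
  by (auto simp: adj_def uadj_def)

lemma sym_uadj_rtrancl: "(a, b) \<in> (uadj Q E)\<^sup>* \<Longrightarrow> (b, a) \<in> (uadj Q E)\<^sup>*"
  by (rule symD[OF sym_rtrancl]) (auto simp: sym_def uadj_def)

lemma crossing_edge:
  assumes "(a, b) \<in> R\<^sup>*" "a \<in> S" "b \<notin> S"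
  shows "\<exists>u w. (u, w) \<in> R \<and> u \<in> S \<and> w \<notin> S"
  using assms by (induction rule: rtrancl_induct) blast+

text \<open>A set grown from \<open>r\<close> one vertex at a time gains an inner arrow at each
  step, namely the arrow over which the new vertex is reached; so k + 1 vertices carry at least k
  arrows.\<close>

lemma connected_card_le:
  assumes V: "finite V" "r \<in> V" and E: "finite E" "\<And>\<alpha>. \<alpha> \<in> E \<Longrightarrow> src Q \<alpha> \<in> V \<and> tgt Q \<alpha> \<in> V"
    and conn: "\<And>w. w \<in> V \<Longrightarrow> (r, w) \<in> (uadj Q E)\<^sup>*"
  shows "card V \<le> card E + 1"
proof -
  define inner where "inner S = {\<alpha> \<in> E. src Q \<alpha> \<in> S \<and> tgt Q \<alpha> \<in> S}" for S
  have "\<exists>S\<subseteq>V. r \<in> S \<and> card S = Suc k \<and> k \<le> card (inner S)" if "Suc k \<le> card V" for k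
    using that
  proof (induction k)
    case 0
    then show ?case using V by (intro exI[of _ "{r}"]) auto
  next
    case (Suc k)
    then obtain S where S: "S \<subseteq> V" "r \<in> S" "card S = Suc k" "k \<le> card (inner S)" by auto
    have "S \<noteq> V" using Suc.prems S by auto
    then obtain w where w: "w \<in> V" "w \<notin> S" using S by blast
    obtain u v where uv: "(u, v) \<in> uadj Q E" "u \<in> S" "v \<notin> S"
      using crossing_edge[OF conn[OF w(1)] S(2) w(2)] by blast
    then obtain \<alpha> where \<alpha>: "\<alpha> \<in> E" "{src Q \<alpha>, tgt Q \<alpha>} = {u, v}" by (auto simp: uadj_def)
    have vV: "v \<in> V" using E(2)[OF \<alpha>(1)] \<alpha>(2) by (auto simp: doubleton_eq_iff)
    have fS: "finite S" using S(1) V(1) finite_subset by blast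
    have sub: "insert \<alpha> (inner S) \<subseteq> inner (insert v S)" "\<alpha> \<notin> inner S"
      using \<alpha> uv by (auto simp: inner_def doubleton_eq_iff)
    have "finite (inner (insert v S))" "finite (inner S)" using E(1) by (auto simp: inner_def)
    then have "Suc (card (inner S)) \<le> card (inner (insert v S))"
      using sub by (metis card_insert_disjoint card_mono)
    then show ?case using S vV uv fS by (intro exI[of _ "insert v S"]) auto
  qed
  moreover have "0 < card V" using V by (auto simp: card_gt_0_iff)
  ultimately obtain S where "S \<subseteq> V" "card S = card V" "card V - 1 \<le> card (inner S)"
    by (metis Suc_pred' le_refl)
  moreover have "card (inner S) \<le> card E" using E(1) by (intro card_mono) (auto simp: inner_def)
  ultimately show ?thesis by linarith
qed

lemma dpath_uadj: "dpath Q a p b \<Longrightarrow> set p \<subseteq> E \<Longrightarrow> (a, b) \<in> (uadj Q E)\<^sup>*"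
proof (induction p arbitrary: a)
  case (Cons \<alpha> p)
  then have "(a, tgt Q \<alpha>) \<in> uadj Q E" by (auto simp: uadj_def)
  with Cons show ?case by (auto intro: converse_rtrancl_into_rtrancl)
qed simp

locale tree =
  fixes Q :: "('v, 'a) quiver"
  assumes tree: "tree_quiver Q"
begin

lemma finite_Q0 [simp]: "finite (Q0 Q)" and finite_Q1 [simp]: "finite (Q1 Q)"
  and arrow_ends: "\<alpha> \<in> Q1 Q \<Longrightarrow> src Q \<alpha> \<in> Q0 Q" "\<alpha> \<in> Q1 Q \<Longrightarrow> tgt Q \<alpha> \<in> Q0 Q"
  and connected: "u \<in> Q0 Q \<Longrightarrow> w \<in> Q0 Q \<Longrightarrow> (u, w) \<in> (uadj Q (Q1 Q))\<^sup>*"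
  using tree unfolding tree_quiver_def adj_uadj by auto

lemma finite_outA [simp]: "finite (outA Q v)" and finite_inA [simp]: "finite (inA Q v)"
  by (simp_all add: outA_def inA_def)

text \<open>Otherwise Q would remain connected with one arrow less, against the edge count of a
  tree. Acyclicity and the uniqueness of paths and walks are derived from this.\<close>

lemma bridge:
  assumes \<alpha>: "\<alpha> \<in> Q1 Q"
  shows "(src Q \<alpha>, tgt Q \<alpha>) \<notin> (uadj Q (Q1 Q - {\<alpha>}))\<^sup>*"
proof
  assume b: "(src Q \<alpha>, tgt Q \<alpha>) \<in> (uadj Q (Q1 Q - {\<alpha>}))\<^sup>*"
  have "uadj Q (Q1 Q) \<subseteq> (uadj Q (Q1 Q - {\<alpha>}))\<^sup>*"
  proof clarify
    fix u w assume "(u, w) \<in> uadj Q (Q1 Q)"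
    then obtain \<beta> where \<beta>: "\<beta> \<in> Q1 Q" "u = src Q \<beta> \<and> w = tgt Q \<beta> \<or> u = tgt Q \<beta> \<and> w = src Q \<beta>"
      by (auto simp: uadj_def)
    show "(u, w) \<in> (uadj Q (Q1 Q - {\<alpha>}))\<^sup>*"
    proof (cases "\<beta> = \<alpha>")
      case True
      then show ?thesis using b sym_uadj_rtrancl[OF b] \<beta> by auto
    next
      case False
      then have "(u, w) \<in> uadj Q (Q1 Q - {\<alpha>})" using \<beta> by (auto simp: uadj_def)
      then show ?thesis by blast
    qed
  qed
  then have "(u, w) \<in> (uadj Q (Q1 Q - {\<alpha>}))\<^sup>*" if "u \<in> Q0 Q" "w \<in> Q0 Q" for u w
    using connected[OF that] rtrancl_subset_rtrancl by blast
  then have "card (Q0 Q) \<le> card (Q1 Q - {\<alpha>}) + 1"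
    by (intro connected_card_le[of _ "src Q \<alpha>" _ Q]) (auto simp: arrow_ends \<alpha>)
  moreover have "card (Q1 Q) = Suc (card (Q1 Q - {\<alpha>}))"
    by (rule card.remove[OF finite_Q1 \<alpha>])
  ultimately show False using tree by (simp add: tree_quiver_def)
qed

text \<open>The part of a cycle after its first arrow \<alpha>, up to the next occurrence of
  \<alpha>, joins the two ends of \<alpha> without using it.\<close>

lemma dpath_acyclic: "dpath Q a p a \<Longrightarrow> p = []"
proof (rule ccontr)
  assume p: "dpath Q a p a" "p \<noteq> []"
  then obtain \<alpha> q where q: "p = \<alpha> # q" by (cases p) auto
  have "\<exists>u. dpath Q (tgt Q \<alpha>) u (src Q \<alpha>) \<and> \<alpha> \<notin> set u"
  proof (cases "\<alpha> \<in> set q")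
    case True
    then obtain u w where "q = u @ \<alpha> # w" "\<alpha> \<notin> set u" by (meson split_list_first)
    then show ?thesis using p q by (auto simp: dpath_append)
  qed (use p q in auto)
  then obtain u where u: "dpath Q (tgt Q \<alpha>) u (src Q \<alpha>)" "\<alpha> \<notin> set u" by blast
  then have "(tgt Q \<alpha>, src Q \<alpha>) \<in> (uadj Q (Q1 Q - {\<alpha>}))\<^sup>*"
    using dpath_arrows by (intro dpath_uadj[OF u(1)]) fast
  then have "(src Q \<alpha>, tgt Q \<alpha>) \<in> (uadj Q (Q1 Q - {\<alpha>}))\<^sup>*" by (rule sym_uadj_rtrancl)
  then show False using bridge p q by auto
qed

text \<open>Where two paths diverge, the arrow \<alpha> of the first cannot occur in either
  continuation, since this would close a cycle at \<open>a\<close>. Hence the ends of \<alpha> are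
  joined through \<open>b\<close> without \<alpha>.\<close>

lemma dpath_unique: "dpath Q a p b \<Longrightarrow> dpath Q a q b \<Longrightarrow> p = q"
proof (induction p arbitrary: a q)
  case Nil
  then show ?case using dpath_acyclic by auto
next
  case (Cons \<alpha> p)
  then obtain \<beta> q' where q: "q = \<beta> # q'" using dpath_acyclic[of b "\<alpha> # p"] by (cases q) auto
  show ?case
  proof (cases "\<alpha> = \<beta>")
    case True
    then show ?thesis using Cons q by auto
  next
    case False
    have notin: "\<alpha> \<notin> set r" if r: "dpath Q c r b" and c: "src Q \<gamma> = a" "tgt Q \<gamma> = c" "\<gamma> \<in> Q1 Q" for \<gamma> c r
    proof
      assume "\<alpha> \<in> set r"
      then obtain u w where "r = u @ \<alpha> # w" by (meson split_list)
      then have "dpath Q a (\<gamma> # u) a" using r c Cons.prems by (auto simp: dpath_append)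
      then show False using dpath_acyclic by blast
    qed
    have p: "dpath Q (tgt Q \<alpha>) p b" "\<alpha> \<notin> set p" using Cons.prems notin[of "tgt Q \<alpha>" p \<alpha>] by auto
    have q': "dpath Q (tgt Q \<beta>) q' b" "\<alpha> \<notin> set q'" using Cons.prems q notin[of "tgt Q \<beta>" q' \<beta>] by auto
    have "(tgt Q \<alpha>, b) \<in> (uadj Q (Q1 Q - {\<alpha>}))\<^sup>*"
      using p dpath_arrows by (intro dpath_uadj[OF p(1)]) fast
    moreover have "(src Q \<alpha>, b) \<in> (uadj Q (Q1 Q - {\<alpha>}))\<^sup>*"
    proof (rule dpath_uadj)
      show "dpath Q (src Q \<alpha>) q b" using Cons.prems by simp
      show "set q \<subseteq> Q1 Q - {\<alpha>}" using q q' False Cons.prems(2) dpath_arrows by fastforce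
    qed
    ultimately have "(src Q \<alpha>, tgt Q \<alpha>) \<in> (uadj Q (Q1 Q - {\<alpha>}))\<^sup>*"
      by (meson rtrancl_trans sym_uadj_rtrancl)
    then show ?thesis using bridge Cons.prems by auto
  qed
qed

lemma dpath_end: "a \<in> Q0 Q \<Longrightarrow> dpath Q a p b \<Longrightarrow> b \<in> Q0 Q"
  by (induction p arbitrary: a) (auto dest: arrow_ends(2))

lemma dpath_start: "b \<in> Q0 Q \<Longrightarrow> dpath Q a p b \<Longrightarrow> a \<in> Q0 Q"
  by (cases p) (auto simp: arrow_ends)

lemma distinct_verts: "dpath Q a p b \<Longrightarrow> distinct (verts Q a p)"
proof (induction p arbitrary: a)
  case (Cons \<alpha> p)
  have "a \<notin> set (verts Q (tgt Q \<alpha>) p)"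
  proof
    assume "a \<in> set (verts Q (tgt Q \<alpha>) p)"
    moreover have "dpath Q (tgt Q \<alpha>) p b" using Cons.prems by simp
    ultimately obtain u where "dpath Q (tgt Q \<alpha>) u a" using verts_split by fastforce
    then have "dpath Q a (\<alpha> # u) a" using Cons.prems by simp
    then show False using dpath_acyclic by blast
  qed
  then show ?case using Cons by auto
qed simp

text \<open>A tree has no parallel arrows and no cycles of length two, so the vertex types become
  conditions on the numbers of incoming and outgoing arrows.\<close>

lemma card_nbrs: "card (nbrs Q v) = card (outA Q v) + card (inA Q v)"
proof -
  have 1: "\<alpha> = \<beta>" if "\<alpha> \<in> Q1 Q" "\<beta> \<in> Q1 Q" "src Q \<alpha> = src Q \<beta>" "tgt Q \<alpha> = tgt Q \<beta>" for \<alpha> \<beta>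
    using dpath_unique[of "src Q \<alpha>" "[\<alpha>]" "tgt Q \<alpha>" "[\<beta>]"] that by auto
  have 2: False if "\<alpha> \<in> Q1 Q" "\<beta> \<in> Q1 Q" "src Q \<alpha> = tgt Q \<beta>" "tgt Q \<alpha> = src Q \<beta>" for \<alpha> \<beta>
    using dpath_acyclic[of "src Q \<alpha>" "[\<alpha>, \<beta>]"] that by auto
  have "inj_on (tgt Q) (outA Q v)" "inj_on (src Q) (inA Q v)"
    using 1 by (auto simp: inj_on_def outA_def inA_def)
  moreover have "tgt Q ` outA Q v \<inter> src Q ` inA Q v = {}"
    using 2 by (fastforce simp: outA_def inA_def)
  ultimately show ?thesis unfolding nbrs_def
    by (subst card_Un_disjoint) (auto simp: card_image)
qed

text \<open>Oriented so that induction proves a property of a vertex from its successors; this is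
  the induction along which an element descends to the socle.\<close>

lemma wf_arrows: "wf {(tgt Q \<alpha>, src Q \<alpha>) |\<alpha>. \<alpha> \<in> Q1 Q}" (is "wf ?R")
proof (rule finite_acyclic_wf)
  have "?R = (\<lambda>\<alpha>. (tgt Q \<alpha>, src Q \<alpha>)) ` Q1 Q" by auto
  then show "finite ?R" by simp
  have "(b, a) \<in> ?R\<^sup>+ \<Longrightarrow> \<exists>p. p \<noteq> [] \<and> dpath Q a p b" for a b
  proof (induction rule: trancl_induct)
    case (base y)
    then obtain \<alpha> where "\<alpha> \<in> Q1 Q" "b = tgt Q \<alpha>" "y = src Q \<alpha>" by auto
    then show ?case by (intro exI[of _ "[\<alpha>]"]) auto
  next
    case (step y z)
    then obtain \<alpha> p where "\<alpha> \<in> Q1 Q" "y = tgt Q \<alpha>" "z = src Q \<alpha>" "dpath Q y p b" by auto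
    then show ?case by (intro exI[of _ "\<alpha> # p"]) auto
  qed
  then show "acyclic ?R" unfolding acyclic_def using dpath_acyclic by blast
qed

subsection \<open>Walks\<close>

lemma walk_avoiding:
  assumes "w \<noteq> []" "\<forall>k. Suc k < length w \<longrightarrow> (w ! k, w ! Suc k) \<in> adj Q"
    "\<not> {src Q \<alpha>, tgt Q \<alpha>} \<subseteq> set w"
  shows "(hd w, last w) \<in> (uadj Q (Q1 Q - {\<alpha>}))\<^sup>*"
  using assms
proof (induction w)
  case (Cons v w)
  show ?case
  proof (cases w)
    case (Cons u w')
    have e: "(v, u) \<in> uadj Q (Q1 Q)" using Cons.prems(2) Cons by (auto simp: adj_uadj dest: spec[of _ 0])
    then have "(v, u) \<in> uadj Q (Q1 Q - {\<alpha>})"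
      using Cons.prems(3) Cons by (auto simp: uadj_def)
    moreover have "(hd w, last w) \<in> (uadj Q (Q1 Q - {\<alpha>}))\<^sup>*"
    proof (rule Cons.IH)
      show "\<forall>k. Suc k < length w \<longrightarrow> (w ! k, w ! Suc k) \<in> adj Q"
        using Cons.prems(2) by (metis Suc_less_eq length_Cons nth_Cons_Suc)
    qed (use Cons.prems Cons in auto)
    ultimately show ?thesis using Cons by (auto intro: converse_rtrancl_into_rtrancl)
  qed simp
qed simp

text \<open>If an edge of \<open>w1\<close> had an end outside \<open>w2\<close>, then
  \<open>w2\<close> together with the two pieces of \<open>w1\<close> before and after that edge
  would join its ends without it; the pieces avoid it because \<open>w1\<close> repeats no
  vertex.\<close>

lemma walk_set_subset:
  assumes w1: "walk Q a b w1" and w2: "walk Q a b w2"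
  shows "set w1 \<subseteq> set w2"
proof
  fix v assume v: "v \<in> set w1"
  have w1': "w1 \<noteq> []" "hd w1 = a" "last w1 = b" "distinct w1"
      "\<And>k. Suc k < length w1 \<Longrightarrow> (w1 ! k, w1 ! Suc k) \<in> adj Q"
    using w1 by (auto simp: walk_def)
  have w2': "w2 \<noteq> []" "hd w2 = a" "last w2 = b"
      "\<forall>k. Suc k < length w2 \<longrightarrow> (w2 ! k, w2 ! Suc k) \<in> adj Q"
    using w2 by (auto simp: walk_def)
  have edge: "w1 ! k \<in> set w2 \<and> w1 ! Suc k \<in> set w2" if k: "Suc k < length w1" for k
  proof (rule ccontr)
    assume contra: "\<not> (w1 ! k \<in> set w2 \<and> w1 ! Suc k \<in> set w2)"
    obtain \<alpha> where \<alpha>: "\<alpha> \<in> Q1 Q" "{src Q \<alpha>, tgt Q \<alpha>} = {w1 ! k, w1 ! Suc k}"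
      using w1'(5)[OF k] unfolding adj_uadj uadj_def by (auto simp: insert_commute)
    have 1: "(a, b) \<in> (uadj Q (Q1 Q - {\<alpha>}))\<^sup>*"
      using walk_avoiding[of w2 \<alpha>] w2' contra \<alpha> by auto
    have 2: "(hd (take (Suc k) w1), last (take (Suc k) w1)) \<in> (uadj Q (Q1 Q - {\<alpha>}))\<^sup>*"
    proof (rule walk_avoiding)
      have "w1 ! Suc k \<notin> set (take (Suc k) w1)"
        using w1'(4) k by (auto simp: in_set_conv_nth nth_eq_iff_index_eq)
      then show "\<not> {src Q \<alpha>, tgt Q \<alpha>} \<subseteq> set (take (Suc k) w1)" using \<alpha> by simp
    qed (use w1' k in auto)
    have 3: "(hd (drop (Suc k) w1), last (drop (Suc k) w1)) \<in> (uadj Q (Q1 Q - {\<alpha>}))\<^sup>*"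
    proof (rule walk_avoiding)
      have "w1 ! k \<notin> set (drop (Suc k) w1)"
        using w1'(4) k by (auto simp: in_set_conv_nth nth_eq_iff_index_eq)
      then show "\<not> {src Q \<alpha>, tgt Q \<alpha>} \<subseteq> set (drop (Suc k) w1)" using \<alpha> by simp
    qed (use w1' k in auto)
    have "hd (take (Suc k) w1) = a" using w1' by (cases w1) auto
    moreover have "last (take (Suc k) w1) = w1 ! k" using k by (simp add: take_Suc_conv_app_nth)
    ultimately have "(a, w1 ! k) \<in> (uadj Q (Q1 Q - {\<alpha>}))\<^sup>*" using 2 by simp
    moreover have "(w1 ! Suc k, b) \<in> (uadj Q (Q1 Q - {\<alpha>}))\<^sup>*"
      using 3 w1' k by (simp add: hd_drop_conv_nth last_drop)
    ultimately have "(w1 ! k, w1 ! Suc k) \<in> (uadj Q (Q1 Q - {\<alpha>}))\<^sup>*"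
      using 1 by (meson rtrancl_trans sym_uadj_rtrancl)
    then have "(src Q \<alpha>, tgt Q \<alpha>) \<in> (uadj Q (Q1 Q - {\<alpha>}))\<^sup>*"
      using \<alpha>(2) sym_uadj_rtrancl by (fastforce simp: doubleton_eq_iff)
    then show False using bridge[OF \<alpha>(1)] by blast
  qed
  obtain k where k: "k < length w1" "v = w1 ! k" using v by (auto simp: in_set_conv_nth)
  show "v \<in> set w2"
  proof (cases k)
    case 0
    then show ?thesis using k w1' w2' by (metis hd_conv_nth hd_in_set)
  next
    case (Suc k')
    then show ?thesis using edge[of k'] k by simp
  qed
qed

lemma dpath_nth_arrow:
  "dpath Q a p b \<Longrightarrow> Suc k < length (verts Q a p) \<Longrightarrow>
    \<exists>\<alpha>\<in>Q1 Q. src Q \<alpha> = verts Q a p ! k \<and> tgt Q \<alpha> = verts Q a p ! Suc k"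
proof (induction p arbitrary: a k)
  case (Cons \<alpha> p)
  then show ?case by (cases k) (auto simp: verts_def)
qed simp

lemma last_verts: "dpath Q a p b \<Longrightarrow> last (verts Q a p) = b"
  by (induction p arbitrary: a) (auto simp: verts_def)

lemma dpath_walk:
  assumes "a \<in> Q0 Q" "dpath Q a p b"
  shows "walk Q a b (verts Q a p)"
  unfolding walk_def
proof (intro conjI allI impI)
  show "hd (verts Q a p) = a" "verts Q a p \<noteq> []" by (simp_all add: verts_def)
  show "set (verts Q a p) \<subseteq> Q0 Q"
    using assms dpath_arrows[OF assms(2)] arrow_ends by (auto simp: verts_def)
  show "(verts Q a p ! k, verts Q a p ! Suc k) \<in> adj Q" if "Suc k < length (verts Q a p)" for k
    using dpath_nth_arrow[OF assms(2) that] by (auto simp: adj_def)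
qed (use assms in \<open>auto simp: distinct_verts last_verts\<close>)

lemma between_dpath: "a \<in> Q0 Q \<Longrightarrow> dpath Q a p b \<Longrightarrow> between Q a b = set (verts Q a p)"
  unfolding between_def using dpath_walk walk_set_subset by blast

lemma linear_iff_dpath:
  assumes "a \<in> Q0 Q"
  shows "linear Q a b \<longleftrightarrow> (\<exists>p. dpath Q a p b)"
proof
  assume "\<exists>p. dpath Q a p b"
  then show "linear Q a b"
    unfolding linear_def using dpath_walk[OF assms] dpath_nth_arrow by metis
next
  assume "linear Q a b"
  then obtain w where w: "walk Q a b w"
    "\<forall>k. Suc k < length w \<longrightarrow> (\<exists>\<alpha>\<in>Q1 Q. src Q \<alpha> = w ! k \<and> tgt Q \<alpha> = w ! Suc k)"
    unfolding linear_def by blast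
  have "w \<noteq> [] \<Longrightarrow> \<exists>p. dpath Q (hd w) p (last w)"
    using w(2)
  proof (induction w)
    case (Cons v w)
    show ?case
    proof (cases w)
      case Nil
      then show ?thesis by (intro exI[of _ "[]"]) simp
    next
      case (Cons u w')
      have "\<forall>k. Suc k < length w \<longrightarrow> (\<exists>\<alpha>\<in>Q1 Q. src Q \<alpha> = w ! k \<and> tgt Q \<alpha> = w ! Suc k)"
        using Cons.prems(2) by (metis Suc_less_eq length_Cons nth_Cons_Suc)
      then obtain p where p: "dpath Q (hd w) p (last w)" using Cons.IH Cons by auto
      obtain \<alpha> where "\<alpha> \<in> Q1 Q" "src Q \<alpha> = v" "tgt Q \<alpha> = u"
        using Cons.prems(2)[rule_format, of 0] Cons by auto
      then have "dpath Q v (\<alpha> # p) (last (v # w))" using p Cons by auto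
      then show ?thesis by (metis list.sel(1))
    qed
  qed simp
  then show "\<exists>p. dpath Q a p b" using w(1) by (auto simp: walk_def)
qed

end

section \<open>The combinatorial criterion\<close>

lemma in_I_extend: "in_I Q p \<Longrightarrow> in_I Q (u @ p @ w)"
  unfolding in_I_def by (metis append.assoc)

lemma in_I_Cons: "in_I Q p \<Longrightarrow> in_I Q (\<alpha> # p)"
  using in_I_extend[of Q p "[\<alpha>]" "[]"] by simp

lemma in_I_append1: "in_I Q p \<Longrightarrow> in_I Q (p @ w)"
  using in_I_extend[of Q p "[]" w] by simp

lemma in_I_append2: "in_I Q p \<Longrightarrow> in_I Q (u @ p)"
  using in_I_extend[of Q p u "[]"] by simp

text \<open>If a single arrow \<open>\<beta>\<close> starts at \<open>i\<close>, or \<open>p\<close> is a nonzero path ending at \<open>i\<close> which cannot be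
  prolonged and whose start is also the start of an arrow \<open>\<beta>\<close> not in \<open>p\<close>, then the uniserial module
  with socle \<open>S(i)\<close> given by the maximal path avoiding \<open>\<beta>\<close> is the cokernel of an irreducible
  monomorphism.\<close>
definition hook_end :: "('v, 'a) quiver \<Rightarrow> 'v \<Rightarrow> bool" where
  "hook_end Q i \<longleftrightarrow> card (outA Q i) = 1 \<or>
     (\<exists>y p \<beta>. p \<noteq> [] \<and> dpath Q y p i \<and> \<not> in_I Q p \<and> \<beta> \<in> outA Q y \<and> \<beta> \<noteq> hd p \<and>
        (\<forall>\<alpha>\<in>outA Q i. in_I Q (p @ [\<alpha>])))"

locale string_tree =
  fixes Q :: "('v, 'a) quiver"
  assumes sta: "string_tree_algebra Q"
begin

sublocale tree Q
  using sta by unfold_locales (simp add: string_tree_algebra_def)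

lemma rels_path: "r \<in> rels Q \<Longrightarrow> is_path Q r" and rels_length: "r \<in> rels Q \<Longrightarrow> 2 \<le> length r"
  using sta by (auto simp: string_tree_algebra_def admissible_paths_def)

lemma card_outA: "v \<in> Q0 Q \<Longrightarrow> card (outA Q v) \<le> 2" and card_inA: "v \<in> Q0 Q \<Longrightarrow> card (inA Q v) \<le> 2"
  using sta by (auto simp: string_tree_algebra_def string_algebra_def)

lemma string_in:
  "\<lbrakk>\<alpha> \<in> Q1 Q; \<beta> \<in> Q1 Q; \<gamma> \<in> Q1 Q; \<alpha> \<noteq> \<beta>; tgt Q \<alpha> = src Q \<gamma>; tgt Q \<beta> = src Q \<gamma>\<rbrakk>
    \<Longrightarrow> in_I Q [\<alpha>, \<gamma>] \<or> in_I Q [\<beta>, \<gamma>]"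
  using sta unfolding string_tree_algebra_def string_algebra_def by metis

lemma string_out:
  "\<lbrakk>\<alpha> \<in> Q1 Q; \<beta> \<in> Q1 Q; \<gamma> \<in> Q1 Q; \<alpha> \<noteq> \<beta>; src Q \<alpha> = tgt Q \<gamma>; src Q \<beta> = tgt Q \<gamma>\<rbrakk>
    \<Longrightarrow> in_I Q [\<gamma>, \<alpha>] \<or> in_I Q [\<gamma>, \<beta>]"
  using sta unfolding string_tree_algebra_def string_algebra_def by metis

lemma in_I_length: "in_I Q p \<Longrightarrow> 2 \<le> length p"
  using rels_length by (force simp: in_I_def)

lemma not_in_I_Nil [simp]: "\<not> in_I Q []" and not_in_I_single [simp]: "\<not> in_I Q [\<alpha>]"
  using in_I_length by fastforce+

lemma subpath_verts:
  assumes p: "dpath Q a p b" and q: "dpath Q c q d" and "c \<in> set (verts Q a p)" "d \<in> set (verts Q a p)"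
  shows "\<exists>u w. p = u @ q @ w"
proof -
  obtain u where "dpath Q a u c" using verts_split[OF p] assms by blast
  moreover obtain w where "dpath Q d w b" using verts_split[OF p] assms by blast
  ultimately have "dpath Q a (u @ q @ w) b" using q by (auto simp: dpath_append)
  then show ?thesis using dpath_unique[OF p] by blast
qed

text \<open>By uniqueness of paths every path between vertices of \<open>p\<close> is a segment of
  \<open>p\<close>, so I restricted to these vertices is governed by \<open>p\<close> alone.\<close>

lemma restr_zero_verts:
  assumes p: "dpath Q a p b"
  shows "restr_zero Q (set (verts Q a p)) \<longleftrightarrow> \<not> in_I Q p"
proof
  assume z: "restr_zero Q (set (verts Q a p))"
  show "\<not> in_I Q p"
  proof
    assume I: "in_I Q p"
    then have "p \<noteq> []" by auto
    then have "is_path Q p" using dpath_is_path[OF p] by blast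
    moreover have "src Q \<alpha> \<in> set (verts Q a p) \<and> tgt Q \<alpha> \<in> set (verts Q a p)" if \<alpha>: "\<alpha> \<in> set p" for \<alpha>
    proof -
      obtain u w where uw: "p = u @ \<alpha> # w" using \<alpha> by (meson split_list)
      then have "dpath Q a u (src Q \<alpha>)" "dpath Q (src Q \<alpha>) (\<alpha> # w) b"
        using p by (auto simp: dpath_append)
      then have "src Q \<alpha> \<in> set (verts Q a p)" using iffD2[OF verts_split[OF p]] uw by blast
      then show ?thesis using \<alpha> by (simp add: verts_def)
    qed
    ultimately show False using z I by (auto simp: restr_zero_def)
  qed
next
  assume nI: "\<not> in_I Q p"
  show "restr_zero Q (set (verts Q a p))"
    unfolding restr_zero_def
  proof
    assume "\<exists>q. is_path Q q \<and> (\<forall>\<alpha>\<in>set q. src Q \<alpha> \<in> set (verts Q a p) \<and> tgt Q \<alpha> \<in> set (verts Q a p)) \<and> in_I Q q"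
    then obtain q where q: "is_path Q q" "in_I Q q"
      "\<And>\<alpha>. \<alpha> \<in> set q \<Longrightarrow> src Q \<alpha> \<in> set (verts Q a p) \<and> tgt Q \<alpha> \<in> set (verts Q a p)" by blast
    have "q \<noteq> []" using q by auto
    then have "dpath Q (src Q (hd q)) q (tgt Q (last q))" using is_path_dpath q by blast
    then have "\<exists>u w. p = u @ q @ w" using subpath_verts[OF p] q(3) \<open>q \<noteq> []\<close> by simp
    then show False using nI q(2) in_I_extend by blast
  qed
qed

lemma cond_j_iff: "cond_j Q i j \<longleftrightarrow> j \<in> Q0 Q \<and> card (outA Q j) = 2 \<and> (\<exists>p. dpath Q j p i \<and> \<not> in_I Q p)"
proof (cases "j \<in> Q0 Q")
  case True
  then show ?thesis
    using linear_iff_dpath[OF True] between_dpath[OF True] restr_zero_verts dpath_unique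
    unfolding cond_j_def by metis
qed (simp add: cond_j_def)

lemma outA_other:
  assumes "j \<in> Q0 Q" "\<alpha> \<in> outA Q j" "\<beta> \<in> outA Q j" "\<alpha> \<noteq> \<beta>"
  shows "outA Q j = {\<alpha>, \<beta>}" "card (outA Q j) = 2"
proof -
  have "card {\<alpha>, \<beta>} \<le> card (outA Q j)" using assms by (intro card_mono) auto
  then show c: "card (outA Q j) = 2" using card_outA[OF assms(1)] assms(4) by simp
  show "outA Q j = {\<alpha>, \<beta>}" using assms c by (intro card_subset_eq[symmetric]) auto
qed

lemma inA_other:
  assumes "j \<in> Q0 Q" "\<alpha> \<in> inA Q j" "\<beta> \<in> inA Q j" "\<alpha> \<noteq> \<beta>"
  shows "inA Q j = {\<alpha>, \<beta>}"
proof -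
  have "card {\<alpha>, \<beta>} \<le> card (inA Q j)" using assms by (intro card_mono) auto
  then have "card (inA Q j) = 2" using card_inA[OF assms(1)] assms(4) by simp
  then show ?thesis using assms by (intro card_subset_eq[symmetric]) auto
qed

lemma hd_in_outA: "dpath Q y p i \<Longrightarrow> p \<noteq> [] \<Longrightarrow> hd p \<in> outA Q y"
  by (cases p) (auto simp: outA_def)

lemma last_in_inA: "dpath Q y p i \<Longrightarrow> p \<noteq> [] \<Longrightarrow> last p \<in> inA Q i"
  by (cases p rule: rev_cases) (auto simp: inA_def dpath_snoc)

text \<open>Brings the criterion into the shape of the vertex ideals: two arrows at the start of
  \<open>p\<close> always leave one different from the first arrow of \<open>p\<close>.\<close>

lemma hook_end_not_single:
  assumes i: "i \<in> Q0 Q" and c: "card (outA Q i) \<noteq> 1"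
  shows "hook_end Q i \<longleftrightarrow> (\<exists>j p. p \<noteq> [] \<and> card (outA Q j) = 2 \<and> dpath Q j p i \<and> \<not> in_I Q p \<and>
     (\<forall>\<alpha>\<in>outA Q i. in_I Q (p @ [\<alpha>])))"
proof
  assume "hook_end Q i"
  then obtain y p \<beta> where h: "p \<noteq> []" "dpath Q y p i" "\<not> in_I Q p" "\<beta> \<in> outA Q y" "\<beta> \<noteq> hd p"
    "\<forall>\<alpha>\<in>outA Q i. in_I Q (p @ [\<alpha>])" using c by (auto simp: hook_end_def)
  have "card (outA Q y) = 2"
    using outA_other(2)[OF dpath_start[OF i h(2)] h(4) hd_in_outA[OF h(2,1)] h(5)] .
  then show "\<exists>j p. p \<noteq> [] \<and> card (outA Q j) = 2 \<and> dpath Q j p i \<and> \<not> in_I Q p \<and>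
     (\<forall>\<alpha>\<in>outA Q i. in_I Q (p @ [\<alpha>]))" using h by blast
next
  assume "\<exists>j p. p \<noteq> [] \<and> card (outA Q j) = 2 \<and> dpath Q j p i \<and> \<not> in_I Q p \<and>
     (\<forall>\<alpha>\<in>outA Q i. in_I Q (p @ [\<alpha>]))"
  then obtain j p where h: "p \<noteq> []" "card (outA Q j) = 2" "dpath Q j p i" "\<not> in_I Q p"
     "\<forall>\<alpha>\<in>outA Q i. in_I Q (p @ [\<alpha>])" by blast
  obtain x z where "outA Q j = {x, z}" "x \<noteq> z" using h(2) by (auto simp: card_2_iff)
  then obtain \<beta> where "\<beta> \<in> outA Q j" "\<beta> \<noteq> hd p" by (cases "x = hd p") auto
  then show "hook_end Q i" using h unfolding hook_end_def by blast
qed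

text \<open>If no ancestor of the sink \<open>i\<close> branches, an arrow out of an ancestor is the
  first arrow of its path to \<open>i\<close>, so the set of ancestors is closed under adjacency. By
  connectedness it is everything, and \<open>i\<close> is the only sink. Hence \<open>J\<close>
  takes the value \<open>VI\<close> only if there are relations, and is then nonzero.\<close>

lemma ex_branching_ancestor:
  assumes i: "i \<in> Q0 Q" "outA Q i = {}" and r: "rels Q = {}" and n: "\<not> unique_sink Q i"
  shows "\<exists>j. cond_j Q i j"
proof (rule ccontr)
  assume no: "\<nexists>j. cond_j Q i j"
  have nI: "\<not> in_I Q p" for p using r by (simp add: in_I_def)
  define A where "A = {v \<in> Q0 Q. \<exists>p. dpath Q v p i}"
  have step: "w \<in> A" if uw: "(u, w) \<in> uadj Q (Q1 Q)" "u \<in> A" for u w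
  proof -
    obtain p where p: "u \<in> Q0 Q" "dpath Q u p i" using uw by (auto simp: A_def)
    from uw(1) consider \<alpha> where "\<alpha> \<in> Q1 Q" "u = src Q \<alpha>" "w = tgt Q \<alpha>"
      | \<alpha> where "\<alpha> \<in> Q1 Q" "w = src Q \<alpha>" "u = tgt Q \<alpha>" by (auto simp: uadj_def)
    then show ?thesis
    proof cases
      case 1
      then have \<alpha>: "\<alpha> \<in> outA Q u" by (simp add: outA_def)
      then have "p \<noteq> []" using p i by auto
      have "\<alpha> = hd p"
      proof (rule ccontr)
        assume "\<alpha> \<noteq> hd p"
        then have "card (outA Q u) = 2"
          using outA_other(2) \<alpha> p hd_in_outA[OF p(2) \<open>p \<noteq> []\<close>] by blast
        then have "cond_j Q i u" using p nI by (auto simp: cond_j_iff)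
        then show False using no by blast
      qed
      then have "dpath Q w (tl p) i" using p \<open>p \<noteq> []\<close> 1 by (cases p) auto
      then show ?thesis using 1 by (auto simp: A_def arrow_ends)
    next
      case 2
      then have "dpath Q w (\<alpha> # p) i" using p by simp
      then show ?thesis using 2 unfolding A_def by (auto simp: arrow_ends simp del: dpath.simps)
    qed
  qed
  have "i \<in> A" using i by (auto simp: A_def intro: exI[of _ "[]"])
  have "w \<in> A" if "w \<in> Q0 Q" for w
    using connected[OF i(1) that] by (induction rule: rtrancl_induct) (use \<open>i \<in> A\<close> step in blast)+
  have "v = i" if v: "sink Q v" for v
  proof -
    have "v \<in> A" using v \<open>\<And>w. w \<in> Q0 Q \<Longrightarrow> w \<in> A\<close> by (simp add: sink_def)
    then obtain p where p: "dpath Q v p i" by (auto simp: A_def)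
    have "outA Q v = {}" using v by (simp add: sink_def)
    then have "p = []" using hd_in_outA[OF p] by blast
    then show ?thesis using p by simp
  qed
  then have "unique_sink Q i" unfolding unique_sink_def using i by (blast intro: sink_def[THEN iffD2])
  then show False using n by blast
qed

text \<open>The number of outgoing arrows separates the cases: one arrow gives (v1.1), (v2.3),
  (v3.1), none gives (v1.2) and (v2.2), two give (v3.2) and (v4). Vertices without incoming arrows
  in the last two cases are no hook ends, since a nontrivial path must end there.\<close>

theorem vertex_kinds_iff_hook_end:
  assumes i: "i \<in> Q0 Q"
  shows "type_v11 Q i \<or> (type_v12 Q i \<and> J_zero Q i) \<or> (type_v22 Q i \<and> J_zero Q i) \<or> type_v23 Q i \<or>
    type_v31 Q i \<or> (type_v32 Q i \<and> J_zero Q i) \<or> (type_v4 Q i \<and> J_zero Q i) \<longleftrightarrow> hook_end Q i"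
    (is "?L \<longleftrightarrow> _")
proof -
  have in2: "card (inA Q i) \<le> 2" and out2: "card (outA Q i) \<le> 2" using card_inA card_outA i by auto
  note types = type_v11_def type_v12_def type_v22_def type_v23_def type_v31_def type_v32_def type_v4_def card_nbrs
  have e0: "outA Q i = {} \<longleftrightarrow> card (outA Q i) = 0" "inA Q i = {} \<longleftrightarrow> card (inA Q i) = 0" by auto
  consider "card (outA Q i) = 1" | "card (outA Q i) = 0" | "card (outA Q i) = 2" using out2 by linarith
  then show ?thesis
  proof cases
    case 1
    then have "hook_end Q i" by (simp add: hook_end_def)
    moreover have ?L using 1 in2 unfolding types e0 by (auto simp del: card_eq_0_iff card_0_eq)
    ultimately show ?thesis by simp
  next
    case 2
    have o: "outA Q i = {}" using 2 by simp
    have L: "?L \<longleftrightarrow> inA Q i \<noteq> {} \<and> J_zero Q i" using 2 in2 unfolding types e0 by (auto simp del: card_eq_0_iff card_0_eq)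
    have h: "hook_end Q i \<longleftrightarrow> (\<exists>j. cond_j Q i j)"
    proof -
      have "hook_end Q i \<longleftrightarrow> (\<exists>j p. p \<noteq> [] \<and> card (outA Q j) = 2 \<and> dpath Q j p i \<and> \<not> in_I Q p)"
        using hook_end_not_single[OF i] 2 o by simp
      also have "\<dots> \<longleftrightarrow> (\<exists>j. cond_j Q i j)"
        unfolding cond_j_iff using dpath_start[OF i] 2 by (metis dpath.simps(1) zero_neq_numeral)
      finally show ?thesis .
    qed
    have J: "J_zero Q i \<longleftrightarrow> (\<exists>j. cond_j Q i j)" if "inA Q i \<noteq> {}"
    proof -
      have t: "type_v12 Q i \<or> type_v22 Q i" using that 2 in2 unfolding types e0 by (auto simp del: card_eq_0_iff card_0_eq)
      then show ?thesis using ex_branching_ancestor[OF i o]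
        by (auto simp: J_zero_def J_def)
    qed
    have "inA Q i \<noteq> {}" if "cond_j Q i j" for j
      using that 2 last_in_inA unfolding cond_j_iff by (metis dpath.simps(1) empty_iff zero_neq_numeral)
    then show ?thesis using L h J by blast
  next
    case 3
    have L: "?L \<longleftrightarrow> inA Q i \<noteq> {} \<and> J_zero Q i" using 3 in2 unfolding types e0 by (auto simp del: card_eq_0_iff card_0_eq)
    define good where "good = (\<exists>j. cond_j Q i j \<and> (\<forall>j'\<in>tgt Q ` outA Q i. \<not> restr_zero Q (between Q j j')))"
    have btw: "\<not> restr_zero Q (between Q j (tgt Q \<alpha>)) \<longleftrightarrow> in_I Q (p @ [\<alpha>])"
      if "dpath Q j p i" "\<alpha> \<in> outA Q i" for j p \<alpha>
    proof -
      have d: "dpath Q j (p @ [\<alpha>]) (tgt Q \<alpha>)" using that by (auto simp: dpath_snoc outA_def)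
      show ?thesis using between_dpath[OF dpath_start[OF i that(1)] d] restr_zero_verts[OF d] by simp
    qed
    have h: "hook_end Q i \<longleftrightarrow> good"
    proof
      assume "hook_end Q i"
      then obtain j p where "p \<noteq> []" "card (outA Q j) = 2" "dpath Q j p i" "\<not> in_I Q p"
         "\<forall>\<alpha>\<in>outA Q i. in_I Q (p @ [\<alpha>])" using hook_end_not_single[OF i] 3 by auto
      then show good unfolding good_def cond_j_iff using btw dpath_start[OF i] by blast
    next
      assume good
      then obtain j where j: "cond_j Q i j" "\<forall>j'\<in>tgt Q ` outA Q i. \<not> restr_zero Q (between Q j j')"
        unfolding good_def by blast
      then obtain p where p: "dpath Q j p i" "\<not> in_I Q p" by (auto simp: cond_j_iff)
      have I: "in_I Q (p @ [\<alpha>])" if "\<alpha> \<in> outA Q i" for \<alpha> using btw[OF p(1) that] j(2) that by simp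
      obtain \<alpha> where "\<alpha> \<in> outA Q i" using 3 by fastforce
      then have "p \<noteq> []" using I[of \<alpha>] by auto
      then show "hook_end Q i" using hook_end_not_single[OF i] 3 j(1) p I by (auto simp: cond_j_iff)
    qed
    have J: "J_zero Q i \<longleftrightarrow> good" if ne: "inA Q i \<noteq> {}"
    proof -
      have t: "type_v32 Q i \<or> type_v4 Q i" "\<not> (type_v12 Q i \<or> type_v22 Q i)" "\<not> type_v31 Q i"
        using that 3 in2 unfolding types e0 by (auto simp del: card_eq_0_iff card_0_eq)
      obtain \<gamma> where \<gamma>: "\<gamma> \<in> inA Q i" using ne by blast
      obtain \<alpha> \<beta> where ab: "\<alpha> \<in> outA Q i" "\<beta> \<in> outA Q i" "\<alpha> \<noteq> \<beta>"
        using 3 by (metis card_2_iff insertI1 insertI2)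
      \<comment> \<open>By \<open>string_out\<close> one of the two arrows at \<open>i\<close>
        composes to zero with \<gamma>. So the full subquiver on \<open>i\<close> and its neighbours
        always carries a relation, and the value \<open>VRestr\<close> of \<open>J\<close> is never
        zero.\<close>
      have "\<exists>\<delta>\<in>outA Q i. in_I Q [\<gamma>, \<delta>]"
        using string_out[of \<alpha> \<beta> \<gamma>] \<gamma> ab by (auto simp: inA_def outA_def)
      then obtain \<delta> where \<delta>: "\<delta> \<in> outA Q i" "in_I Q [\<gamma>, \<delta>]" by blast
      have "is_path Q [\<gamma>, \<delta>]" using \<gamma> \<delta> by (auto simp: is_path_Cons inA_def outA_def)
      then have "\<not> restr_zero Q (insert i (nbrs Q i))"
        unfolding restr_zero_def using \<gamma> \<delta> by (auto simp: nbrs_def inA_def outA_def intro!: exI[of _ "[\<gamma>, \<delta>]"])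
      then show ?thesis using t unfolding J_zero_def J_def good_def by auto
    qed
    have "inA Q i \<noteq> {}" if "hook_end Q i"
      using that 3 last_in_inA hook_end_not_single[OF i] by fastforce
    then show ?thesis using L h J by blast
  qed
qed

end

section \<open>Representations over the ring of matrices\<close>

definition amap :: "('v, 'a, 'k::field) qrep \<Rightarrow> 'a \<Rightarrow> 'k imat" where
  "amap X \<alpha> = imat_of (rmap X \<alpha>)"

text \<open>Unlike \<open>path_mat\<close> this also covers the trivial path; the vertex argument
  says at which vertex its identity is taken.\<close>

fun pmap :: "('v, 'a) quiver \<Rightarrow> ('v, 'a, 'k::field) qrep \<Rightarrow> 'v \<Rightarrow> 'a list \<Rightarrow> 'k imat" where
  "pmap Q X v [] = \<one>\<^sub>i (rdim X v)"
| "pmap Q X v (\<alpha> # p) = pmap Q X (tgt Q \<alpha>) p * amap X \<alpha>"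

text \<open>Homomorphisms as families of ring elements, kept apart from the representation axioms so
  that a map can be used while its source is still being shown to satisfy the relations.
  \<open>is_hom_ihom\<close> and \<open>hmat\<close> translate in both directions.\<close>

definition ihom ::
  "('v, 'a) quiver \<Rightarrow> ('v, 'a, 'k::field) qrep \<Rightarrow> ('v, 'a, 'k) qrep \<Rightarrow> ('v \<Rightarrow> 'k imat) \<Rightarrow> bool" where
  "ihom Q X Y \<phi> \<longleftrightarrow> (\<forall>v\<in>Q0 Q. fits (rdim Y v) (rdim X v) (\<phi> v)) \<and>
     (\<forall>\<alpha>\<in>Q1 Q. \<phi> (tgt Q \<alpha>) * amap X \<alpha> = amap Y \<alpha> * \<phi> (src Q \<alpha>))"

definition hmat ::
  "('v, 'a, 'k::field) qrep \<Rightarrow> ('v, 'a, 'k) qrep \<Rightarrow> ('v \<Rightarrow> 'k imat) \<Rightarrow> 'v \<Rightarrow> 'k mat" where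
  "hmat X Y \<phi> = (\<lambda>v. mat_of (rdim Y v) (rdim X v) (\<phi> v))"

lemma ihom_fits: "ihom Q X Y \<phi> \<Longrightarrow> v \<in> Q0 Q \<Longrightarrow> fits (rdim Y v) (rdim X v) (\<phi> v)"
  by (simp add: ihom_def)

lemma ihom_commute: "ihom Q X Y \<phi> \<Longrightarrow> \<alpha> \<in> Q1 Q \<Longrightarrow> \<phi> (tgt Q \<alpha>) * amap X \<alpha> = amap Y \<alpha> * \<phi> (src Q \<alpha>)"
  by (simp add: ihom_def)

lemma ihom_comp: "ihom Q X Y \<phi> \<Longrightarrow> ihom Q Y Z \<psi> \<Longrightarrow> ihom Q X Z (\<lambda>v. \<psi> v * \<phi> v)"
  unfolding ihom_def
proof (intro conjI ballI; elim conjE)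
  fix \<alpha> assume \<alpha>: "\<alpha> \<in> Q1 Q"
    and "\<forall>\<alpha>\<in>Q1 Q. \<phi> (tgt Q \<alpha>) * amap X \<alpha> = amap Y \<alpha> * \<phi> (src Q \<alpha>)"
    and "\<forall>\<alpha>\<in>Q1 Q. \<psi> (tgt Q \<alpha>) * amap Y \<alpha> = amap Z \<alpha> * \<psi> (src Q \<alpha>)"
  then have e: "\<phi> (tgt Q \<alpha>) * amap X \<alpha> = amap Y \<alpha> * \<phi> (src Q \<alpha>)"
    "\<psi> (tgt Q \<alpha>) * amap Y \<alpha> = amap Z \<alpha> * \<psi> (src Q \<alpha>)" by blast+
  show "\<psi> (tgt Q \<alpha>) * \<phi> (tgt Q \<alpha>) * amap X \<alpha> = amap Z \<alpha> * (\<psi> (src Q \<alpha>) * \<phi> (src Q \<alpha>))"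
    by (simp only: mult.assoc e(1)) (simp only: mult.assoc[symmetric] e(2))
qed (meson fits_times)

lemma ihom_diff: "ihom Q X Y \<phi> \<Longrightarrow> ihom Q X Y \<psi> \<Longrightarrow> ihom Q X Y (\<lambda>v. \<phi> v - \<psi> v)"
  by (simp add: ihom_def fits_diff left_diff_distrib right_diff_distrib)

lemma fits_unitD: "fits n m a \<Longrightarrow> \<one>\<^sub>i n * a = a" "fits n m a \<Longrightarrow> a * \<one>\<^sub>i m = a"
  by (simp_all add: fits_def)

definition iauto :: "('v, 'a) quiver \<Rightarrow> ('v, 'a, 'k::field) qrep \<Rightarrow> ('v \<Rightarrow> 'k imat) \<Rightarrow> bool" where
  "iauto Q X s \<longleftrightarrow> (\<exists>t. ihom Q X X t \<and> (\<forall>v\<in>Q0 Q. s v * t v = \<one>\<^sub>i (rdim X v) \<and> t v * s v = \<one>\<^sub>i (rdim X v)))"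

context tree
begin

lemma fits_amap: "is_rep Q X \<Longrightarrow> \<alpha> \<in> Q1 Q \<Longrightarrow> fits (rdim X (tgt Q \<alpha>)) (rdim X (src Q \<alpha>)) (amap X \<alpha>)"
  unfolding amap_def by (rule fits_imat_of) (simp add: is_rep_def)

lemma fits_pmap: "is_rep Q X \<Longrightarrow> dpath Q v p w \<Longrightarrow> fits (rdim X w) (rdim X v) (pmap Q X v p)"
proof (induction p arbitrary: v)
  case (Cons \<alpha> p)
  then show ?case using fits_times[OF Cons.IH fits_amap[of X \<alpha>]] by auto
qed simp

lemma pmap_append: "is_rep Q X \<Longrightarrow> dpath Q v p w \<Longrightarrow> dpath Q w q u \<Longrightarrow>
    pmap Q X v (p @ q) = pmap Q X w q * pmap Q X v p"
  by (induction p arbitrary: v) (auto simp: fits_unitD[OF fits_pmap] mult.assoc)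

lemma pmap_single: "is_rep Q X \<Longrightarrow> \<alpha> \<in> Q1 Q \<Longrightarrow> pmap Q X v [\<alpha>] = amap X \<alpha>"
  using fits_amap by (auto simp: fits_def)

lemma ihom_pmap:
  "ihom Q X Y \<phi> \<Longrightarrow> v \<in> Q0 Q \<Longrightarrow> dpath Q v p w \<Longrightarrow> \<phi> w * pmap Q X v p = pmap Q Y v p * \<phi> v"
proof (induction p arbitrary: v)
  case Nil
  then show ?case using ihom_fits[OF Nil(1,2)] by (simp add: fits_def)
next
  case (Cons \<alpha> p)
  then have "\<phi> w * pmap Q X v (\<alpha> # p) = pmap Q Y (tgt Q \<alpha>) p * (\<phi> (tgt Q \<alpha>) * amap X \<alpha>)"
    by (simp add: mult.assoc[symmetric] arrow_ends)
  then show ?case using Cons.prems by (simp add: ihom_commute mult.assoc)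
qed

lemma path_mat_foldl:
  assumes "\<And>\<alpha>. \<alpha> \<in> Q1 Q \<Longrightarrow> rmap X \<alpha> \<in> carrier_mat (rdim X (tgt Q \<alpha>)) (rdim X (src Q \<alpha>))"
  shows "dpath Q c p d \<Longrightarrow> A \<in> carrier_mat (rdim X c) n \<Longrightarrow>
    foldl (\<lambda>A \<beta>. rmap X \<beta> * A) A p \<in> carrier_mat (rdim X d) n \<and>
    imat_of (foldl (\<lambda>A \<beta>. rmap X \<beta> * A) A p) = pmap Q X c p * imat_of A"
proof (induction p arbitrary: c A)
  case Nil
  then show ?case by (auto simp: fits_unitD[OF fits_imat_of])
next
  case (Cons \<alpha> p)
  have c: "rmap X \<alpha> \<in> carrier_mat (rdim X (tgt Q \<alpha>)) (rdim X c)" using assms Cons.prems by auto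
  have "rmap X \<alpha> * A \<in> carrier_mat (rdim X (tgt Q \<alpha>)) n" using c Cons.prems by auto
  with Cons.IH[of "tgt Q \<alpha>" "rmap X \<alpha> * A"] Cons.prems show ?case
    by (auto simp: imat_of_mult[OF c Cons.prems(2)] amap_def mult.assoc)
qed

lemma path_mat_pmap:
  assumes "\<And>\<alpha>. \<alpha> \<in> Q1 Q \<Longrightarrow> rmap X \<alpha> \<in> carrier_mat (rdim X (tgt Q \<alpha>)) (rdim X (src Q \<alpha>))"
    and p: "dpath Q v p w" "p \<noteq> []"
  shows "path_mat X p \<in> carrier_mat (rdim X w) (rdim X v) \<and> imat_of (path_mat X p) = pmap Q X v p"
proof -
  obtain \<alpha> q where q: "p = \<alpha> # q" using p by (cases p) auto
  then have "rmap X \<alpha> \<in> carrier_mat (rdim X (tgt Q \<alpha>)) (rdim X v)" "dpath Q (tgt Q \<alpha>) q w"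
    using assms(1) p by auto
  from path_mat_foldl[OF assms(1) this(2,1)] show ?thesis by (simp add: q amap_def)
qed

lemma is_hom_ihom: "is_hom Q X Y f \<Longrightarrow> ihom Q X Y (\<lambda>v. imat_of (f v))"
  unfolding ihom_def
proof (intro conjI ballI)
  assume h: "is_hom Q X Y f"
  show "fits (rdim Y v) (rdim X v) (imat_of (f v))" if "v \<in> Q0 Q" for v
    using h that by (auto simp: is_hom_def)
  fix \<alpha> assume \<alpha>: "\<alpha> \<in> Q1 Q"
  have c: "f (tgt Q \<alpha>) \<in> carrier_mat (rdim Y (tgt Q \<alpha>)) (rdim X (tgt Q \<alpha>))"
      "f (src Q \<alpha>) \<in> carrier_mat (rdim Y (src Q \<alpha>)) (rdim X (src Q \<alpha>))"
      "rmap X \<alpha> \<in> carrier_mat (rdim X (tgt Q \<alpha>)) (rdim X (src Q \<alpha>))"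
      "rmap Y \<alpha> \<in> carrier_mat (rdim Y (tgt Q \<alpha>)) (rdim Y (src Q \<alpha>))"
    using h \<alpha> by (auto simp: is_hom_def is_rep_def arrow_ends)
  have "f (tgt Q \<alpha>) * rmap X \<alpha> = rmap Y \<alpha> * f (src Q \<alpha>)" using h \<alpha> by (simp add: is_hom_def)
  then show "imat_of (f (tgt Q \<alpha>)) * amap X \<alpha> = amap Y \<alpha> * imat_of (f (src Q \<alpha>))"
    unfolding amap_def using imat_of_mult[OF c(1,3)] imat_of_mult[OF c(4,2)] by simp
qed

lemma imat_of_hmat: "ihom Q X Y \<phi> \<Longrightarrow> v \<in> Q0 Q \<Longrightarrow> imat_of (hmat X Y \<phi> v) = \<phi> v"
  unfolding hmat_def using ihom_fits by fastforce

lemma hmat_is_hom: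
  assumes "is_rep Q X" "is_rep Q Y" and h: "ihom Q X Y \<phi>"
  shows "is_hom Q X Y (hmat X Y \<phi>)"
  unfolding is_hom_def
proof (intro conjI ballI)
  show "hmat X Y \<phi> v \<in> carrier_mat (rdim Y v) (rdim X v)" for v by (simp add: hmat_def)
  then have c: "hmat X Y \<phi> v \<in> carrier_mat (rdim Y v) (rdim X v)" for v .
  fix \<alpha> assume \<alpha>: "\<alpha> \<in> Q1 Q"
  have r: "rmap X \<alpha> \<in> carrier_mat (rdim X (tgt Q \<alpha>)) (rdim X (src Q \<alpha>))"
      "rmap Y \<alpha> \<in> carrier_mat (rdim Y (tgt Q \<alpha>)) (rdim Y (src Q \<alpha>))"
    using assms \<alpha> by (auto simp: is_rep_def)
  show "hmat X Y \<phi> (tgt Q \<alpha>) * rmap X \<alpha> = rmap Y \<alpha> * hmat X Y \<phi> (src Q \<alpha>)"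
    by (rule imat_of_inject[OF mult_carrier_mat[OF c r(1)] mult_carrier_mat[OF r(2) c]])
      (use ihom_commute[OF h \<alpha>] in \<open>simp add: imat_of_mult[OF c r(1)] imat_of_mult[OF r(2) c]
        imat_of_hmat[OF h] arrow_ends[OF \<alpha>] amap_def\<close>)
qed (use assms in auto)

lemma hom_eq_iff:
  assumes "\<And>v. v \<in> Q0 Q \<Longrightarrow> f v \<in> carrier_mat (n v) (m v)" "\<And>v. v \<in> Q0 Q \<Longrightarrow> g v \<in> carrier_mat (n v) (m v)"
  shows "hom_eq Q f g \<longleftrightarrow> (\<forall>v\<in>Q0 Q. imat_of (f v) = imat_of (g v))"
  unfolding hom_eq_def using assms imat_of_inject by metis

lemma is_homD: "is_hom Q X Y f \<Longrightarrow> is_rep Q X" "is_hom Q X Y f \<Longrightarrow> is_rep Q Y"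
  "is_hom Q X Y f \<Longrightarrow> v \<in> Q0 Q \<Longrightarrow> f v \<in> carrier_mat (rdim Y v) (rdim X v)"
  by (simp_all add: is_hom_def)

lemma hom_eq_comp_iff:
  assumes f: "is_hom Q X Y f" and g: "is_hom Q Y Z g" and h: "\<And>v. v \<in> Q0 Q \<Longrightarrow> h v \<in> carrier_mat (rdim Z v) (rdim X v)"
  shows "hom_eq Q (hcomp g f) h \<longleftrightarrow> (\<forall>v\<in>Q0 Q. imat_of (g v) * imat_of (f v) = imat_of (h v))"
proof -
  have "hcomp g f v \<in> carrier_mat (rdim Z v) (rdim X v)" if "v \<in> Q0 Q" for v
    unfolding hcomp_def by (rule mult_carrier_mat[OF is_homD(3)[OF g that] is_homD(3)[OF f that]])
  moreover have "imat_of (hcomp g f v) = imat_of (g v) * imat_of (f v)" if "v \<in> Q0 Q" for v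
    unfolding hcomp_def by (rule imat_of_mult[OF is_homD(3)[OF g that] is_homD(3)[OF f that]])
  ultimately show ?thesis by (subst hom_eq_iff[where n = "rdim Z" and m = "rdim X"]) (auto simp: h)
qed

lemma hom_eq_comp_hid_iff:
  assumes "is_hom Q X Y f" "is_hom Q Y X g"
  shows "hom_eq Q (hcomp g f) (hid X) \<longleftrightarrow> (\<forall>v\<in>Q0 Q. imat_of (g v) * imat_of (f v) = \<one>\<^sub>i (rdim X v))"
  by (subst hom_eq_comp_iff[OF assms]) (auto simp: hid_def)

lemma split_mono_iff:
  assumes f: "is_hom Q X Y f"
  shows "split_mono Q X Y f \<longleftrightarrow> (\<exists>\<psi>. ihom Q Y X \<psi> \<and> (\<forall>v\<in>Q0 Q. \<psi> v * imat_of (f v) = \<one>\<^sub>i (rdim X v)))"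
    (is "?L \<longleftrightarrow> ?R")
proof
  assume ?L
  then obtain g where "is_hom Q Y X g" "hom_eq Q (hcomp g f) (hid X)" unfolding split_mono_def by blast
  then show ?R using hom_eq_comp_hid_iff[OF f] is_hom_ihom by blast
next
  assume ?R
  then obtain \<psi> where p: "ihom Q Y X \<psi>" "\<forall>v\<in>Q0 Q. \<psi> v * imat_of (f v) = \<one>\<^sub>i (rdim X v)" by blast
  have "is_hom Q Y X (hmat Y X \<psi>)" by (rule hmat_is_hom[OF is_homD(2)[OF f] is_homD(1)[OF f] p(1)])
  with p show ?L unfolding split_mono_def using hom_eq_comp_hid_iff[OF f] imat_of_hmat[OF p(1)] by metis
qed

lemma split_epi_iff:
  assumes f: "is_hom Q X Y f"
  shows "split_epi Q X Y f \<longleftrightarrow> (\<exists>\<psi>. ihom Q Y X \<psi> \<and> (\<forall>v\<in>Q0 Q. imat_of (f v) * \<psi> v = \<one>\<^sub>i (rdim Y v)))"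
    (is "?L \<longleftrightarrow> ?R")
proof
  assume ?L
  then obtain g where "is_hom Q Y X g" "hom_eq Q (hcomp f g) (hid Y)" unfolding split_epi_def by blast
  then show ?R using hom_eq_comp_hid_iff[OF _ f] is_hom_ihom by blast
next
  assume ?R
  then obtain \<psi> where p: "ihom Q Y X \<psi>" "\<forall>v\<in>Q0 Q. imat_of (f v) * \<psi> v = \<one>\<^sub>i (rdim Y v)" by blast
  have "is_hom Q Y X (hmat Y X \<psi>)" by (rule hmat_is_hom[OF is_homD(2)[OF f] is_homD(1)[OF f] p(1)])
  with p show ?L unfolding split_epi_def using hom_eq_comp_hid_iff[OF _ f] imat_of_hmat[OF p(1)] by metis
qed

lemma split_mono_hmat:
  assumes "is_rep Q X" "is_rep Q Y" "ihom Q X Y \<phi>"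
  shows "split_mono Q X Y (hmat X Y \<phi>) \<longleftrightarrow> (\<exists>\<psi>. ihom Q Y X \<psi> \<and> (\<forall>v\<in>Q0 Q. \<psi> v * \<phi> v = \<one>\<^sub>i (rdim X v)))"
  using split_mono_iff[OF hmat_is_hom[OF assms]] imat_of_hmat[OF assms(3)] by auto

lemma split_epi_hmat:
  assumes "is_rep Q X" "is_rep Q Y" "ihom Q X Y \<phi>"
  shows "split_epi Q X Y (hmat X Y \<phi>) \<longleftrightarrow> (\<exists>\<psi>. ihom Q Y X \<psi> \<and> (\<forall>v\<in>Q0 Q. \<phi> v * \<psi> v = \<one>\<^sub>i (rdim Y v)))"
  using split_epi_iff[OF hmat_is_hom[OF assms]] imat_of_hmat[OF assms(3)] by auto

lemma ihom_id: "is_rep Q X \<Longrightarrow> ihom Q X X (\<lambda>v. \<one>\<^sub>i (rdim X v))"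
  using fits_amap[of X] unfolding ihom_def by (auto simp: fits_def)

end

context string_tree
begin

lemma pmap_in_I:
  assumes X: "is_rep Q X" and p: "dpath Q v p w" "in_I Q p"
  shows "pmap Q X v p = 0"
proof -
  obtain r u t where r: "r \<in> rels Q" "p = u @ r @ t" using p by (auto simp: in_I_def)
  obtain c d where d: "dpath Q v u c" "dpath Q c r d" "dpath Q d t w"
    using p r by (auto simp: dpath_append)
  have ne: "r \<noteq> []" using rels_length[OF r(1)] by auto
  have cd: "c = src Q (hd r)" "d = tgt Q (last r)" using dpath_is_path[OF d(2) ne] by auto
  have "imat_of (path_mat X r) = pmap Q X c r"
    using path_mat_pmap[OF _ d(2) ne, of X] X by (auto simp: is_rep_def)
  moreover have "path_mat X r = 0\<^sub>m (rdim X d) (rdim X c)" using X r cd by (simp add: is_rep_def)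
  ultimately have "pmap Q X c r = 0" by (metis imat_of_0)
  then show ?thesis
    unfolding r(2) using pmap_append[OF X d(1)] pmap_append[OF X d(2,3)] d by (metis dpath_append mult_zero_left mult_zero_right)
qed

lemma is_repI:
  assumes "\<And>v. v \<notin> Q0 Q \<Longrightarrow> rdim X v = 0"
    and c: "\<And>\<alpha>. \<alpha> \<in> Q1 Q \<Longrightarrow> rmap X \<alpha> \<in> carrier_mat (rdim X (tgt Q \<alpha>)) (rdim X (src Q \<alpha>))"
    and z: "\<And>v r w. r \<in> rels Q \<Longrightarrow> dpath Q v r w \<Longrightarrow> v \<in> Q0 Q \<Longrightarrow> w \<in> Q0 Q \<Longrightarrow> pmap Q X v r = 0"
  shows "is_rep Q X"
  unfolding is_rep_def
proof (intro conjI allI ballI impI)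
  fix r assume r: "r \<in> rels Q"
  have ne: "r \<noteq> []" using rels_length[OF r] by auto
  then have d: "dpath Q (src Q (hd r)) r (tgt Q (last r))" using rels_path[OF r] is_path_dpath by blast
  have v: "src Q (hd r) \<in> Q0 Q" "tgt Q (last r) \<in> Q0 Q"
    using dpath_arrows[OF d] ne by (auto intro!: arrow_ends)
  show "path_mat X r = 0\<^sub>m (rdim X (tgt Q (last r))) (rdim X (src Q (hd r)))"
    using path_mat_pmap[OF c d ne] z[OF r d v] by (intro imat_of_inject[where A = "path_mat X r"]) auto
qed (use assms in auto)

definition mk_rep :: "('v \<Rightarrow> nat) \<Rightarrow> ('a \<Rightarrow> 'k::field imat) \<Rightarrow> ('v, 'a, 'k) qrep" where
  "mk_rep d a = \<lparr>rdim = (\<lambda>v. if v \<in> Q0 Q then d v else 0),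
     rmap = (\<lambda>\<alpha>. mat_of (d (tgt Q \<alpha>)) (d (src Q \<alpha>)) (a \<alpha>))\<rparr>"

lemma rdim_mk_rep [simp]: "v \<in> Q0 Q \<Longrightarrow> rdim (mk_rep d a) v = d v"
  by (simp add: mk_rep_def)

lemma amap_mk_rep: "fits (d (tgt Q \<alpha>)) (d (src Q \<alpha>)) (a \<alpha>) \<Longrightarrow> amap (mk_rep d a) \<alpha> = a \<alpha>"
  by (simp add: mk_rep_def amap_def)

lemma mk_rep_is_rep:
  assumes "\<And>v r w. r \<in> rels Q \<Longrightarrow> dpath Q v r w \<Longrightarrow> v \<in> Q0 Q \<Longrightarrow> w \<in> Q0 Q \<Longrightarrow> pmap Q (mk_rep d a) v r = 0"
  shows "is_rep Q (mk_rep d a)"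
proof (rule is_repI)
  show "rmap (mk_rep d a) \<alpha> \<in> carrier_mat (rdim (mk_rep d a) (tgt Q \<alpha>)) (rdim (mk_rep d a) (src Q \<alpha>))"
    if "\<alpha> \<in> Q1 Q" for \<alpha> using arrow_ends[OF that] by (simp add: mk_rep_def)
qed (use assms in \<open>auto simp: mk_rep_def\<close>)

text \<open>A rank factorization at each vertex gives the spaces of the image; injectivity of
  \<open>b\<close> and surjectivity of \<open>c\<close> force its maps and transfer the relations
  from \<open>Y\<close>. The one-sided inverses \<open>l\<close> and \<open>r\<close> are only
  linear.\<close>

lemma image_rep:
  assumes X: "is_rep Q X" and Y: "is_rep Q Y" and h: "ihom Q X Y \<phi>"
  obtains Z b c l r where "is_rep Q Z" "ihom Q X Z c" "ihom Q Z Y b"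
    "\<And>v. v \<in> Q0 Q \<Longrightarrow> \<phi> v = b v * c v \<and> l v * b v = \<one>\<^sub>i (rdim Z v) \<and> c v * r v = \<one>\<^sub>i (rdim Z v) \<and>
      fits (rdim Z v) (rdim Y v) (l v) \<and> fits (rdim X v) (rdim Z v) (r v)"
proof -
  have "\<exists>d b c l r. fits (rdim Y v) d b \<and> fits d (rdim X v) c \<and> fits d (rdim Y v) l \<and> fits (rdim X v) d r \<and>
    \<phi> v = b * c \<and> l * b = \<one>\<^sub>i d \<and> c * r = \<one>\<^sub>i d" if "v \<in> Q0 Q" for v
    using rank_factorization[OF ihom_fits[OF h that]] by metis
  then obtain d b c l r where f: "\<And>v. v \<in> Q0 Q \<Longrightarrow>
    fits (rdim Y v) (d v) (b v) \<and> fits (d v) (rdim X v) (c v) \<and> fits (d v) (rdim Y v) (l v) \<and> fits (rdim X v) (d v) (r v) \<and>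
    \<phi> v = b v * c v \<and> l v * b v = \<one>\<^sub>i (d v) \<and> c v * r v = \<one>\<^sub>i (d v)" by metis
  define Z where "Z = mk_rep d (\<lambda>\<alpha>. l (tgt Q \<alpha>) * amap Y \<alpha> * b (src Q \<alpha>))"
  have dZ: "rdim Z v = d v" if "v \<in> Q0 Q" for v using that by (simp add: Z_def)
  have aZ: "amap Z \<alpha> = l (tgt Q \<alpha>) * amap Y \<alpha> * b (src Q \<alpha>)" if "\<alpha> \<in> Q1 Q" for \<alpha>
    unfolding Z_def
    by (rule amap_mk_rep) (meson fits_times f arrow_ends[OF that] fits_amap[OF Y that])
  have b: "ihom Q Z Y b" unfolding ihom_def
  proof (intro conjI ballI)
    fix \<alpha> assume \<alpha>: "\<alpha> \<in> Q1 Q"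
    let ?s = "src Q \<alpha>" and ?t = "tgt Q \<alpha>"
    note fs = f[OF arrow_ends(1)[OF \<alpha>]] and ft = f[OF arrow_ends(2)[OF \<alpha>]]
    \<comment> \<open>The image is stable under the arrows: \<open>b\<close> equals \<phi> times
      \<open>r\<close>, and \<phi> commutes with \<alpha>.\<close>
    have e: "amap Y \<alpha> * b ?s = b ?t * (c ?t * amap X \<alpha> * r ?s)"
    proof -
      have "amap Y \<alpha> * b ?s = (amap Y \<alpha> * \<phi> ?s) * r ?s"
        using fs by (simp add: mult.assoc fits_def)
      also have "\<dots> = \<phi> ?t * amap X \<alpha> * r ?s" using ihom_commute[OF h \<alpha>] by simp
      finally show ?thesis using ft by (simp add: mult.assoc)
    qed
    have "b ?t * amap Z \<alpha> = b ?t * l ?t * (amap Y \<alpha> * b ?s)" by (simp add: aZ[OF \<alpha>] mult.assoc)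
    also have "\<dots> = b ?t * (l ?t * b ?t) * (c ?t * amap X \<alpha> * r ?s)" unfolding e by (simp add: mult.assoc)
    also have "\<dots> = amap Y \<alpha> * b ?s" unfolding e using ft by (simp add: fits_def)
    finally show "b ?t * amap Z \<alpha> = amap Y \<alpha> * b ?s" .
  qed (use f dZ in auto)
  have c: "ihom Q X Z c" unfolding ihom_def
  proof (intro conjI ballI)
    fix \<alpha> assume \<alpha>: "\<alpha> \<in> Q1 Q"
    let ?s = "src Q \<alpha>" and ?t = "tgt Q \<alpha>"
    note fs = f[OF arrow_ends(1)[OF \<alpha>]] and ft = f[OF arrow_ends(2)[OF \<alpha>]]
    have "b ?t * (c ?t * amap X \<alpha>) = \<phi> ?t * amap X \<alpha>" using ft by (simp add: mult.assoc)
    also have "\<dots> = amap Y \<alpha> * (b ?s * c ?s)" using ihom_commute[OF h \<alpha>] fs by simp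
    also have "\<dots> = b ?t * (amap Z \<alpha> * c ?s)"
      using ihom_commute[OF b \<alpha>] by (simp add: mult.assoc[symmetric])
    finally have "(l ?t * b ?t) * (c ?t * amap X \<alpha>) = (l ?t * b ?t) * (amap Z \<alpha> * c ?s)"
      by (simp add: mult.assoc)
    moreover have "\<one>\<^sub>i (d ?t) * (c ?t * amap X \<alpha>) = c ?t * amap X \<alpha>"
      using ft by (simp add: fits_def mult.assoc[symmetric])
    moreover have "\<one>\<^sub>i (d ?t) * (amap Z \<alpha> * c ?s) = amap Z \<alpha> * c ?s"
      unfolding aZ[OF \<alpha>] using ft by (simp add: fits_def mult.assoc[symmetric])
    ultimately show "c ?t * amap X \<alpha> = amap Z \<alpha> * c ?s" using ft by simp
  qed (use f dZ in auto)
  have "is_rep Q Z" unfolding Z_def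
  proof (rule mk_rep_is_rep, fold Z_def)
    fix v p w assume p: "p \<in> rels Q" "dpath Q v p w" "v \<in> Q0 Q" "w \<in> Q0 Q"
    have "in_I Q p" unfolding in_I_def using p(1) by (metis append_Nil append_Nil2)
    then have "pmap Q Y v p = 0" using pmap_in_I[OF Y p(2)] by blast
    then have "b w * pmap Q Z v p = 0" using ihom_pmap[OF b p(3,2)] by simp
    then have "(l w * b w) * pmap Q Z v p = 0" by (simp add: mult.assoc)
    moreover have "fits (d w) (d v) (pmap Q Z v p)"
      using p(2,3)
    proof (induction p arbitrary: v)
      case (Cons \<alpha> p)
      have \<alpha>: "\<alpha> \<in> Q1 Q" "src Q \<alpha> = v" using Cons.prems by auto
      have "fits (d (tgt Q \<alpha>)) (d v) (amap Z \<alpha>)"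
        unfolding aZ[OF \<alpha>(1)] using f \<alpha> arrow_ends[OF \<alpha>(1)] fits_amap[OF Y \<alpha>(1)] fits_times by metis
      moreover have "fits (d w) (d (tgt Q \<alpha>)) (pmap Q Z (tgt Q \<alpha>) p)"
        using Cons arrow_ends[OF \<alpha>(1)] by simp
      ultimately show ?case using fits_times by fastforce
    qed (use dZ in auto)
    ultimately show "pmap Q Z v p = 0" using f[OF p(4)] by (simp add: fits_unitD)
  qed
  then show thesis using that[OF _ c b, of l r] f dZ by auto
qed

end

subsection \<open>Indecomposable representations\<close>

context string_tree
begin

text \<open>\<open>X\<close> is the direct sum of the images of \<open>e\<close> and of 1 -
  \<open>e\<close>. The four products of inclusions and projections are recovered from the products
  of the two idempotents by cancelling outer factors, which is the content of
  \<open>key\<close>.\<close>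

lemma idempotent_hom_trivial:
  fixes X :: "('v, 'a, 'k::field) qrep"
  assumes X: "indecomposable Q X" and h: "ihom Q X X e"
    and idem: "\<And>v. v \<in> Q0 Q \<Longrightarrow> e v * e v = e v"
  shows "(\<forall>v\<in>Q0 Q. e v = 0) \<or> (\<forall>v\<in>Q0 Q. e v = \<one>\<^sub>i (rdim X v))"
proof -
  have rX: "is_rep Q X" using X by (simp add: indecomposable_def)
  define e' where "e' v = \<one>\<^sub>i (rdim X v) - e v" for v
  have h': "ihom Q X X e'" unfolding e'_def by (rule ihom_diff[OF ihom_id[OF rX] h])
  have idem': "e' v * e' v = e' v" if "v \<in> Q0 Q" for v
    using ihom_fits[OF h that] idem[OF that] by (simp add: e'_def left_diff_distrib right_diff_distrib fits_def)
  have ee': "e v * e' v = 0" "e' v * e v = 0" if "v \<in> Q0 Q" for v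
    using ihom_fits[OF h that] idem[OF that] by (simp_all add: e'_def left_diff_distrib right_diff_distrib fits_def)
  obtain R b c l r where R: "is_rep Q R" "ihom Q X R c" "ihom Q R X b"
    and f: "\<And>v. v \<in> Q0 Q \<Longrightarrow> e v = b v * c v \<and> l v * b v = \<one>\<^sub>i (rdim R v) \<and> c v * r v = \<one>\<^sub>i (rdim R v) \<and>
      fits (rdim R v) (rdim X v) (l v) \<and> fits (rdim X v) (rdim R v) (r v)" using image_rep[OF rX rX h] by metis
  obtain R' b' c' l' r' where R': "is_rep Q R'" "ihom Q X R' c'" "ihom Q R' X b'"
    and f': "\<And>v. v \<in> Q0 Q \<Longrightarrow> e' v = b' v * c' v \<and> l' v * b' v = \<one>\<^sub>i (rdim R' v) \<and> c' v * r' v = \<one>\<^sub>i (rdim R' v) \<and>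
      fits (rdim R' v) (rdim X v) (l' v) \<and> fits (rdim X v) (rdim R' v) (r' v)" using image_rep[OF rX rX h'] by metis
  have key: "c2 * b1 = l2 * (b2 * c2) * (b1 * c1) * r1"
    if "l2 * b2 = \<one>\<^sub>i n2" "c1 * r1 = \<one>\<^sub>i n1" "fits n2 m c2" "fits m n1 b1"
    for b1 c1 r1 l2 b2 c2 :: "'k imat" and n1 n2 m
  proof -
    have "l2 * (b2 * c2) * (b1 * c1) * r1 = (l2 * b2) * c2 * (b1 * (c1 * r1))" by (simp only: mult.assoc)
    then show ?thesis using that by (simp add: fits_def)
  qed
  have cb: "c v * b v = \<one>\<^sub>i (rdim R v)" "c' v * b' v = \<one>\<^sub>i (rdim R' v)" "c v * b' v = 0" "c' v * b v = 0"
    if v: "v \<in> Q0 Q" for v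
  proof -
    note F = f[OF v] f'[OF v] ihom_fits[OF R(2) v] ihom_fits[OF R(3) v] ihom_fits[OF R'(2) v] ihom_fits[OF R'(3) v]
    have "c v * b v = l v * (e v * e v) * r v"
      using key[of "l v" "b v" _ "c v" "r v" _ _ "c v" "b v"] F by (metis mult.assoc)
    also have "\<dots> = (l v * b v) * (c v * r v)" using idem[OF v] F by (metis mult.assoc)
    finally show "c v * b v = \<one>\<^sub>i (rdim R v)" using F by simp
    have "c' v * b' v = l' v * (e' v * e' v) * r' v"
      using key[of "l' v" "b' v" _ "c' v" "r' v" _ _ "c' v" "b' v"] F by (metis mult.assoc)
    also have "\<dots> = (l' v * b' v) * (c' v * r' v)" using idem'[OF v] F by (metis mult.assoc)
    finally show "c' v * b' v = \<one>\<^sub>i (rdim R' v)" using F by simp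
    have "c v * b' v = l v * (e v * e' v) * r' v"
      using key[of "l v" "b v" _ "c' v" "r' v" _ _ "c v" "b' v"] F by (metis mult.assoc)
    then show "c v * b' v = 0" using ee'[OF v] by simp
    have "c' v * b v = l' v * (e' v * e v) * r v"
      using key[of "l' v" "b' v" _ "c v" "r v" _ _ "c' v" "b v"] F by (metis mult.assoc)
    then show "c' v * b v = 0" using ee'[OF v] by simp
  qed
  let ?b = "hmat R X b" and ?c = "hmat X R c" and ?b' = "hmat R' X b'" and ?c' = "hmat X R' c'"
  have H: "is_hom Q R X ?b" "is_hom Q X R ?c" "is_hom Q R' X ?b'" "is_hom Q X R' ?c'"
    using hmat_is_hom R R' rX by blast+
  note I = imat_of_hmat[OF R(3)] imat_of_hmat[OF R(2)] imat_of_hmat[OF R'(3)] imat_of_hmat[OF R'(2)]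
  have "hom_eq Q (hadd (hcomp ?b ?c) (hcomp ?b' ?c')) (hid X)"
  proof -
    have cc: "hcomp ?b ?c v \<in> carrier_mat (rdim X v) (rdim X v)" "hcomp ?b' ?c' v \<in> carrier_mat (rdim X v) (rdim X v)" for v
      unfolding hcomp_def hmat_def by (rule mult_carrier_mat[OF mat_of_carrier mat_of_carrier])+
    have "imat_of (hadd (hcomp ?b ?c) (hcomp ?b' ?c') v) = imat_of (hid X v)" if v: "v \<in> Q0 Q" for v
    proof -
      have "imat_of (hcomp ?b ?c v) = e v" "imat_of (hcomp ?b' ?c' v) = e' v"
        unfolding hcomp_def using f[OF v] f'[OF v] I[OF v]
          imat_of_mult[OF is_homD(3)[OF H(1) v] is_homD(3)[OF H(2) v]]
          imat_of_mult[OF is_homD(3)[OF H(3) v] is_homD(3)[OF H(4) v]] by simp_all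
      then show ?thesis unfolding hadd_def hid_def using imat_of_add[OF cc] by (simp add: e'_def)
    qed
    moreover have "hadd (hcomp ?b ?c) (hcomp ?b' ?c') v \<in> carrier_mat (rdim X v) (rdim X v)"
        "hid X v \<in> carrier_mat (rdim X v) (rdim X v)" for v
      using cc by (auto simp: hadd_def hid_def)
    ultimately show ?thesis by (subst hom_eq_iff[where n = "rdim X" and m = "rdim X"]) auto
  qed
  then have "biproduct Q X R ?b ?c R' ?b' ?c'"
    unfolding biproduct_def using H cb I
    by (auto simp: hom_eq_comp_hid_iff[OF H(1,2)] hom_eq_comp_hid_iff[OF H(3,4)]
        hom_eq_comp_iff[OF H(3,2)] hom_eq_comp_iff[OF H(1,4)] hzero_def)
  then have "zero_rep Q R \<or> zero_rep Q R'" using X unfolding indecomposable_def by blast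
  then show ?thesis
  proof
    assume "zero_rep Q R"
    then have "e v = 0" if "v \<in> Q0 Q" for v
      using f[OF that] ihom_fits[OF R(3) that] that by (auto simp: zero_rep_def dest: fits_0_right)
    then show ?thesis by blast
  next
    assume "zero_rep Q R'"
    then have "e' v = 0" if "v \<in> Q0 Q" for v
      using f'[OF that] ihom_fits[OF R'(3) that] that by (auto simp: zero_rep_def dest: fits_0_right)
    then show ?thesis unfolding e'_def by auto
  qed
qed

lemma indecomposableI:
  fixes X :: "('v, 'a, 'k::field) qrep"
  assumes rX: "is_rep Q X" and nz: "\<not> zero_rep Q X"
    and triv: "\<And>e. ihom Q X X e \<Longrightarrow> (\<And>v. v \<in> Q0 Q \<Longrightarrow> e v * e v = e v) \<Longrightarrow>
      (\<forall>v\<in>Q0 Q. e v = 0) \<or> (\<forall>v\<in>Q0 Q. e v = \<one>\<^sub>i (rdim X v))"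
  shows "indecomposable Q X"
  unfolding indecomposable_def
proof (intro conjI allI impI rX nz)
  fix X1 i1 p1 X2 i2 p2
  assume "biproduct Q X X1 i1 p1 X2 i2 p2"
  then have H: "is_hom Q X1 X i1" "is_hom Q X X1 p1" "is_hom Q X2 X i2" "is_hom Q X X2 p2"
    and e: "hom_eq Q (hcomp p1 i1) (hid X1)" "hom_eq Q (hcomp p2 i2) (hid X2)"
      "hom_eq Q (hcomp p1 i2) (hzero X2 X1)" by (auto simp: biproduct_def)
  let ?i = "\<lambda>v. imat_of (i1 v)" and ?p = "\<lambda>v. imat_of (p1 v)"
  let ?i' = "\<lambda>v. imat_of (i2 v)" and ?p' = "\<lambda>v. imat_of (p2 v)"
  have pi: "?p v * ?i v = \<one>\<^sub>i (rdim X1 v)" "?p' v * ?i' v = \<one>\<^sub>i (rdim X2 v)" "?p v * ?i' v = 0" if "v \<in> Q0 Q" for v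
    using that e hom_eq_comp_hid_iff[OF H(1,2)] hom_eq_comp_hid_iff[OF H(3,4)]
      hom_eq_comp_iff[OF H(3,2), of "hzero X2 X1"] by (auto simp: hzero_def)
  have h: "ihom Q X X (\<lambda>v. ?i v * ?p v)" using ihom_comp[OF is_hom_ihom[OF H(2)] is_hom_ihom[OF H(1)]] .
  have idem: "?i v * ?p v * (?i v * ?p v) = ?i v * ?p v" if v: "v \<in> Q0 Q" for v
  proof -
    have "?i v * ?p v * (?i v * ?p v) = ?i v * (?p v * ?i v) * ?p v" by (simp only: mult.assoc)
    then show ?thesis using pi(1)[OF v] ihom_fits[OF is_hom_ihom[OF H(1)] v] by (simp add: fits_def)
  qed
  from triv[OF h idem] show "zero_rep Q X1 \<or> zero_rep Q X2"
  proof
    assume z: "\<forall>v\<in>Q0 Q. ?i v * ?p v = 0"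
    have "rdim X1 v = 0" if v: "v \<in> Q0 Q" for v
    proof -
      have "\<one>\<^sub>i (rdim X1 v) * \<one>\<^sub>i (rdim X1 v) = ?p v * (?i v * ?p v) * ?i v"
        unfolding pi(1)[OF v, symmetric] by (simp only: mult.assoc)
      then have "\<one>\<^sub>i (rdim X1 v) = (0 :: 'k imat)" using z v by simp
      then show ?thesis using unit_neq_0 by blast
    qed
    then show ?thesis by (simp add: zero_rep_def)
  next
    assume z: "\<forall>v\<in>Q0 Q. ?i v * ?p v = \<one>\<^sub>i (rdim X v)"
    have "rdim X2 v = 0" if v: "v \<in> Q0 Q" for v
    proof -
      have "?i' v = \<one>\<^sub>i (rdim X v) * ?i' v" using ihom_fits[OF is_hom_ihom[OF H(3)] v] by (simp add: fits_def)
      also have "\<dots> = ?i v * (?p v * ?i' v)" using z v by (simp add: mult.assoc[symmetric])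
      also have "\<dots> = 0" using pi(3)[OF v] by simp
      finally have "\<one>\<^sub>i (rdim X2 v) = (0 :: 'k imat)" using pi(2)[OF v] by simp
      then show ?thesis using unit_neq_0 by blast
    qed
    then show ?thesis by (simp add: zero_rep_def)
  qed
qed

section \<open>Fitting's lemma and local endomorphism rings\<close>

lemma ihom_ipow:
  assumes X: "is_rep Q X" and s: "ihom Q X X s"
  shows "ihom Q X X (\<lambda>v. ipow (rdim X v) (s v) k)"
  by (induction k) (auto intro: ihom_id[OF X] ihom_comp[OF _ s])

text \<open>For a strongly regular power t = t t g = h t t, the element e = t g = h t is the
  projection onto the image of t along its kernel. The witnesses \<open>g\<close> and
  \<open>h\<close> are chosen vertex by vertex and need not commute with the arrows, but e does,
  because t determines it. Being 0 or 1, it makes s nilpotent or invertible.\<close>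

lemma fitting:
  assumes X: "indecomposable Q X" and s: "ihom Q X X s"
  shows "iauto Q X s \<or> (\<exists>k. \<forall>v\<in>Q0 Q. ipow (rdim X v) (s v) k = 0)"
proof -
  have rX: "is_rep Q X" using X by (simp add: indecomposable_def)
  obtain k g h where k: "0 < k" and kgh: "\<And>v. v \<in> Q0 Q \<Longrightarrow>
      fits (rdim X v) (rdim X v) (g v) \<and> fits (rdim X v) (rdim X v) (h v) \<and>
      ipow (rdim X v) (s v) k = ipow (rdim X v) (s v) k * ipow (rdim X v) (s v) k * g v \<and>
      ipow (rdim X v) (s v) k = h v * ipow (rdim X v) (s v) k * ipow (rdim X v) (s v) k"
    using ipow_strongly_regular[OF finite_Q0, of "rdim X" s] ihom_fits[OF s] by metis
  define t where "t v = ipow (rdim X v) (s v) k" for v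
  have ht: "ihom Q X X t" unfolding t_def by (rule ihom_ipow[OF rX s])
  have t: "t v = t v * t v * g v" "t v = h v * t v * t v" if "v \<in> Q0 Q" for v
    using kgh[OF that] by (simp_all only: t_def)
  define e where "e v = t v * g v" for v
  have e2: "e v = h v * t v" if "v \<in> Q0 Q" for v
  proof -
    have "h v * t v = h v * (t v * t v * g v)" using t(1)[OF that] by simp
    also have "\<dots> = (h v * t v * t v) * g v" by (simp only: mult.assoc)
    finally show ?thesis using t(2)[OF that] by (simp add: e_def)
  qed
  have te: "t v * e v = t v" "e v * t v = t v" if "v \<in> Q0 Q" for v
  proof -
    have "t v * e v = t v * t v * g v" by (simp only: e_def mult.assoc)
    then show "t v * e v = t v" using t(1)[OF that, symmetric] by (rule trans)
    have "e v * t v = h v * t v * t v" by (simp only: e2[OF that])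
    then show "e v * t v = t v" using t(2)[OF that, symmetric] by (rule trans)
  qed
  have ee: "e v * e v = e v" if "v \<in> Q0 Q" for v
  proof -
    have "e v * e v = (e v * t v) * g v" by (simp add: e_def mult.assoc)
    then show ?thesis using te[OF that] by (simp add: e_def)
  qed
  have he: "ihom Q X X e" unfolding ihom_def
  proof (intro conjI ballI)
    show "fits (rdim X v) (rdim X v) (e v)" if "v \<in> Q0 Q" for v
      unfolding e_def using fits_times[OF ihom_fits[OF ht that]] kgh[OF that] by blast
    fix \<alpha> assume \<alpha>: "\<alpha> \<in> Q1 Q"
    let ?s = "src Q \<alpha>" and ?t = "tgt Q \<alpha>"
    note se = arrow_ends(1)[OF \<alpha>] and ts = arrow_ends(2)[OF \<alpha>]
    note cm = ihom_commute[OF ht \<alpha>]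
    \<comment> \<open>The form h t of the idempotent is used at the target and the form t g at the
      source, so that only t ever has to pass the arrow.\<close>
    have "e ?t * amap X \<alpha> = h ?t * (t ?t * amap X \<alpha>)" by (simp add: e2[OF ts] mult.assoc)
    also have "\<dots> = h ?t * (amap X \<alpha> * (t ?s * e ?s))" by (simp add: cm te[OF se])
    also have "\<dots> = h ?t * (t ?t * amap X \<alpha>) * e ?s" by (simp only: cm mult.assoc)
    also have "\<dots> = e ?t * (amap X \<alpha> * t ?s) * g ?s" by (simp add: e2[OF ts] e_def[of ?s] mult.assoc)
    also have "\<dots> = (e ?t * t ?t) * amap X \<alpha> * g ?s" unfolding cm[symmetric] by (simp only: mult.assoc)
    also have "\<dots> = amap X \<alpha> * e ?s" using te[OF ts] cm by (simp add: e_def[of ?s] mult.assoc[symmetric])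
    finally show "e ?t * amap X \<alpha> = amap X \<alpha> * e ?s" .
  qed
  from idempotent_hom_trivial[OF X he ee] show ?thesis
  proof
    assume "\<forall>v\<in>Q0 Q. e v = 0"
    then have "\<forall>v\<in>Q0 Q. t v = 0" using te(1) by (metis mult_zero_right)
    then show ?thesis unfolding t_def by blast
  next
    assume e1: "\<forall>v\<in>Q0 Q. e v = \<one>\<^sub>i (rdim X v)"
    obtain l where l: "k = Suc l" using k by (cases k) auto
    define u where "u v = ipow (rdim X v) (s v) l * g v" for v
    define w where "w v = h v * ipow (rdim X v) (s v) l" for v
    have su: "s v * u v = \<one>\<^sub>i (rdim X v)" and ws: "w v * s v = \<one>\<^sub>i (rdim X v)" if v: "v \<in> Q0 Q" for v
    proof -
      show "s v * u v = \<one>\<^sub>i (rdim X v)" using e1 v by (simp add: u_def e_def t_def l mult.assoc)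
      have "w v * s v = h v * t v"
        unfolding w_def t_def l ipow_Suc2[OF ihom_fits[OF s v]] by (simp only: mult.assoc)
      then show "w v * s v = \<one>\<^sub>i (rdim X v)" using e1 v e2[OF v] by simp
    qed
    have fu: "fits (rdim X v) (rdim X v) (u v)" "fits (rdim X v) (rdim X v) (w v)" if v: "v \<in> Q0 Q" for v
      unfolding u_def w_def using fits_times fits_ipow[OF ihom_fits[OF s v]] kgh[OF v] by blast+
    have uw: "u v = w v" if v: "v \<in> Q0 Q" for v
    proof -
      have "w v * (s v * u v) = (w v * s v) * u v" by (simp only: mult.assoc)
      then show ?thesis using su[OF v] ws[OF v] fu[OF v] by (simp add: fits_def)
    qed
    have "ihom Q X X u" unfolding ihom_def
    proof (intro conjI ballI fu)
      fix \<alpha> assume \<alpha>: "\<alpha> \<in> Q1 Q"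
      let ?s = "src Q \<alpha>" and ?t = "tgt Q \<alpha>"
      note se = arrow_ends(1)[OF \<alpha>] and ts = arrow_ends(2)[OF \<alpha>]
      have "u ?t * amap X \<alpha> = u ?t * (amap X \<alpha> * s ?s) * u ?s"
        using su[OF se] fits_amap[OF rX \<alpha>] by (simp add: mult.assoc fits_def)
      also have "\<dots> = (u ?t * s ?t) * amap X \<alpha> * u ?s"
        unfolding ihom_commute[OF s \<alpha>, symmetric] by (simp only: mult.assoc)
      also have "\<dots> = amap X \<alpha> * u ?s" using ws[OF ts] uw[OF ts] fits_amap[OF rX \<alpha>] by (simp add: fits_def)
      finally show "u ?t * amap X \<alpha> = amap X \<alpha> * u ?s" .
    qed
    then have "iauto Q X s" unfolding iauto_def using su ws uw by metis
    then show ?thesis ..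
  qed
qed

text \<open>If neither were invertible, both would be nilpotent. The last nonzero power of
  \<open>s\<close> is annihilated by \<open>s\<close>, hence fixed by every power of 1 -
  \<open>s\<close>.\<close>

lemma local_endomorphisms:
  assumes X: "indecomposable Q X" and s: "ihom Q X X s"
  shows "iauto Q X s \<or> iauto Q X (\<lambda>v. \<one>\<^sub>i (rdim X v) - s v)"
proof (rule ccontr)
  assume no: "\<not> ?thesis"
  have rX: "is_rep Q X" using X by (simp add: indecomposable_def)
  define u where "u v = \<one>\<^sub>i (rdim X v) - s v" for v
  have u: "ihom Q X X u" unfolding u_def by (rule ihom_diff[OF ihom_id[OF rX] s])
  have ex: "\<exists>k. \<forall>v\<in>Q0 Q. ipow (rdim X v) (s v) k = 0" using fitting[OF X s] no by blast
  define k where "k = (LEAST k. \<forall>v\<in>Q0 Q. ipow (rdim X v) (s v) k = 0)"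
  have k0: "\<forall>v\<in>Q0 Q. ipow (rdim X v) (s v) k = 0" unfolding k_def using ex by (rule LeastI_ex)
  have "k \<noteq> 0"
  proof
    assume "k = 0"
    then have "rdim X v = 0" if "v \<in> Q0 Q" for v using k0 that unit_neq_0[of "rdim X v"] by fastforce
    then show False using X by (simp add: indecomposable_def zero_rep_def)
  qed
  then obtain l where l: "k = Suc l" by (cases k) auto
  then obtain v where v: "v \<in> Q0 Q" "ipow (rdim X v) (s v) l \<noteq> 0"
    using not_less_Least[of l "\<lambda>k. \<forall>v\<in>Q0 Q. ipow (rdim X v) (s v) k = 0"] by (auto simp: k_def[symmetric])
  let ?a = "ipow (rdim X v) (s v) l"
  have "s v * ?a = 0" using k0 v l by auto
  then have ua: "u v * ?a = ?a"
    using fits_ipow[OF ihom_fits[OF s v(1)], of l] by (simp add: u_def left_diff_distrib fits_def)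
  have "ipow (rdim X v) (u v) m * ?a = ?a" for m
    by (induction m) (use ua fits_ipow[OF ihom_fits[OF s v(1)], of l] in \<open>auto simp: fits_def mult.assoc\<close>)
  moreover obtain m where "ipow (rdim X v) (u v) m = 0"
    using fitting[OF X u] no v(1) unfolding u_def by blast
  ultimately show False using v(2) by (metis mult_zero_left)
qed

text \<open>The product of \<open>e\<close> and \<open>r\<close> is an idempotent endomorphism of
  \<open>X\<close>; if it were 0, the retract would be 0.\<close>

lemma retract_of_indecomposable:
  fixes X :: "('v, 'a, 'k::field) qrep"
  assumes X: "indecomposable Q X" and P: "\<not> zero_rep Q P" and e: "ihom Q P X e" and r: "ihom Q X P r"
    and re: "\<And>v. v \<in> Q0 Q \<Longrightarrow> r v * e v = \<one>\<^sub>i (rdim P v)" and v: "v \<in> Q0 Q"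
  shows "e v * r v = \<one>\<^sub>i (rdim X v)"
proof -
  have "ihom Q X X (\<lambda>v. e v * r v)" by (rule ihom_comp[OF r e])
  moreover have "e v * r v * (e v * r v) = e v * r v" if "v \<in> Q0 Q" for v
  proof -
    have "e v * r v * (e v * r v) = e v * (r v * e v) * r v" by (simp only: mult.assoc)
    then show ?thesis using re[OF that] ihom_fits[OF e that] by (simp add: fits_def)
  qed
  ultimately consider "\<forall>v\<in>Q0 Q. e v * r v = 0" | "\<forall>v\<in>Q0 Q. e v * r v = \<one>\<^sub>i (rdim X v)"
    using idempotent_hom_trivial[OF X] by blast
  then show ?thesis
  proof cases
    case 1
    have "rdim P v = 0" if "v \<in> Q0 Q" for v
    proof -
      have "\<one>\<^sub>i (rdim P v) * \<one>\<^sub>i (rdim P v) = r v * (e v * r v) * e v"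
        unfolding re[OF that, symmetric] by (simp only: mult.assoc)
      then have "\<one>\<^sub>i (rdim P v) = (0 :: 'k imat)" using 1 that by simp
      then show ?thesis using unit_neq_0 by blast
    qed
    then show ?thesis using P by (simp add: zero_rep_def)
  qed (use v in blast)
qed

end

subsection \<open>Irreducible monomorphisms\<close>

text \<open>The first summand occupies the first \<open>m\<close> coordinates; the induction adds
  the coordinate \<open>m + k\<close> for the last basis vector of the second summand.\<close>

lemma direct_sum_imats:
  "\<exists>i1 p1 i2 p2 :: 'k::comm_ring_1 imat. fits (m + k) m i1 \<and> fits m (m + k) p1 \<and> fits (m + k) k i2 \<and> fits k (m + k) p2 \<and>
    p1 * i1 = \<one>\<^sub>i m \<and> p2 * i2 = \<one>\<^sub>i k \<and> p1 * i2 = 0 \<and> p2 * i1 = 0 \<and> i1 * p1 + i2 * p2 = \<one>\<^sub>i (m + k)"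
proof (induction k)
  case 0
  show ?case by (intro exI[of _ "\<one>\<^sub>i m"] exI[of _ 0]) simp
next
  case (Suc k)
  then obtain i1 p1 i2 p2 :: "'k imat" where f: "fits (m + k) m i1" "fits m (m + k) p1" "fits (m + k) k i2" "fits k (m + k) p2"
    and e: "p1 * i1 = \<one>\<^sub>i m" "p2 * i2 = \<one>\<^sub>i k" "p1 * i2 = 0" "p2 * i1 = 0" "i1 * p1 + i2 * p2 = \<one>\<^sub>i (m + k)" by blast
  let ?i = "i2 + eps (m + k) k" and ?p = "p2 + eps k (m + k)"
  have r: "x * eps d j = 0" if "fits n d x" for x :: "'k imat" and n d j
    using that unfolding fits_iff by (intro imat_eqI) (metis entry_times_eps zero_imat.rep_eq less_irrefl)
  have l: "eps j d * x = 0" if "fits d n x" for x :: "'k imat" and n d j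
    using that unfolding fits_iff by (intro imat_eqI) (metis entry_eps_times zero_imat.rep_eq less_irrefl)
  have s: "fits (Suc n) d x" "fits n (Suc d) x" if "fits n d x" for x :: "'k imat" and n d
    using that by (fastforce simp: fits_iff)+
  have ee: "fits (Suc (m + k)) (Suc k) (eps (m + k) k :: 'k imat)" "fits (Suc k) (Suc (m + k)) (eps k (m + k) :: 'k imat)"
    by (auto simp: fits_iff eps.rep_eq split: if_splits)
  have z: "p1 * eps (m + k) k = 0" "p2 * eps (m + k) k = 0" "eps k (m + k) * i1 = 0" "eps k (m + k) * i2 = 0"
    "i2 * eps k (m + k) = 0" "eps (m + k) k * p2 = 0"
    using r[OF f(2)] r[OF f(4)] l[OF f(1)] l[OF f(3)] r[OF f(3)] l[OF f(4)] by auto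
  have "i1 * p1 + ?i * ?p = (i1 * p1 + i2 * p2) + eps (m + k) (m + k)"
    using z by (simp add: distrib_left distrib_right eps_eps add.assoc)
  then have "i1 * p1 + ?i * ?p = \<one>\<^sub>i (m + Suc k)" using e(5) by (simp add: unit_Suc)
  moreover have "p1 * ?i = 0" "?p * i1 = 0" using e z by (simp_all add: distrib_left distrib_right)
  moreover have "?p * ?i = \<one>\<^sub>i (Suc k)" using e z by (simp add: distrib_left distrib_right eps_eps unit_Suc)
  ultimately show ?case
    using e(1) s(1)[OF f(1)] s(2)[OF f(2)] fits_add[OF s(1)[OF s(2)[OF f(3)]] ee(1)] fits_add[OF s(1)[OF s(2)[OF f(4)]] ee(2)]
    by (intro exI[of _ i1] exI[of _ p1] exI[of _ ?i] exI[of _ ?p]) simp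
qed

context string_tree
begin

lemma irreducibleD:
  assumes f: "irreducible Q M N f" and Z: "is_rep Q Z" and h: "ihom Q M Z h" and g: "ihom Q Z N g"
    and gh: "\<forall>v\<in>Q0 Q. g v * h v = imat_of (f v)"
  shows "(\<exists>\<psi>. ihom Q Z M \<psi> \<and> (\<forall>v\<in>Q0 Q. \<psi> v * h v = \<one>\<^sub>i (rdim M v))) \<or>
    (\<exists>\<psi>. ihom Q N Z \<psi> \<and> (\<forall>v\<in>Q0 Q. g v * \<psi> v = \<one>\<^sub>i (rdim N v)))"
proof -
  have fh: "is_hom Q M N f" using f by (simp add: irreducible_def)
  note r = is_homD(1)[OF fh] is_homD(2)[OF fh]
  have H: "is_hom Q M Z (hmat M Z h)" "is_hom Q Z N (hmat Z N g)" using hmat_is_hom r Z h g by blast+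
  have "hom_eq Q (hcomp (hmat Z N g) (hmat M Z h)) f"
    by (subst hom_eq_comp_iff[OF H]) (auto simp: imat_of_hmat[OF h] imat_of_hmat[OF g] gh is_homD(3)[OF fh])
  then have "split_mono Q M Z (hmat M Z h) \<or> split_epi Q Z N (hmat Z N g)"
    using f H unfolding irreducible_def by blast
  then show ?thesis using split_mono_hmat[OF r(1) Z h] split_epi_hmat[OF Z r(2) g] by blast
qed

text \<open>Irreducibility applied to the factorization through the image: a retraction of the
  epimorphism onto the image makes f injective, a section of the inclusion makes it surjective. The
  resulting \<kappa> is claimed to be linear only.\<close>

lemma irreducible_injective_or_surjective:
  assumes f: "irreducible Q M N f"
  shows "(\<exists>\<kappa>. \<forall>v\<in>Q0 Q. fits (rdim M v) (rdim N v) (\<kappa> v) \<and> \<kappa> v * imat_of (f v) = \<one>\<^sub>i (rdim M v)) \<or>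
    (\<exists>\<kappa>. \<forall>v\<in>Q0 Q. fits (rdim M v) (rdim N v) (\<kappa> v) \<and> imat_of (f v) * \<kappa> v = \<one>\<^sub>i (rdim N v))"
proof -
  have fh: "is_hom Q M N f" using f by (simp add: irreducible_def)
  obtain Z b c l r where Z: "is_rep Q Z" "ihom Q M Z c" "ihom Q Z N b"
    and e: "\<And>v. v \<in> Q0 Q \<Longrightarrow> imat_of (f v) = b v * c v \<and> l v * b v = \<one>\<^sub>i (rdim Z v) \<and> c v * r v = \<one>\<^sub>i (rdim Z v) \<and>
      fits (rdim Z v) (rdim N v) (l v) \<and> fits (rdim M v) (rdim Z v) (r v)"
    using image_rep[OF is_homD(1)[OF fh] is_homD(2)[OF fh] is_hom_ihom[OF fh]] by metis
  have "\<forall>v\<in>Q0 Q. b v * c v = imat_of (f v)" using e by simp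
  from irreducibleD[OF f Z this] show ?thesis
  proof (elim disjE exE conjE)
    fix \<psi> assume p: "ihom Q Z M \<psi>" "\<forall>v\<in>Q0 Q. \<psi> v * c v = \<one>\<^sub>i (rdim M v)"
    have "(\<psi> v * l v) * imat_of (f v) = \<one>\<^sub>i (rdim M v)" if v: "v \<in> Q0 Q" for v
    proof -
      have "imat_of (f v) = b v * c v" using e[OF v] by blast
      then have "(\<psi> v * l v) * imat_of (f v) = \<psi> v * (l v * b v) * c v" by (simp only: mult.assoc)
      then show ?thesis using e[OF v] p(2) v ihom_fits[OF p(1) v] by (simp add: fits_def)
    qed
    moreover have "fits (rdim M v) (rdim N v) (\<psi> v * l v)" if "v \<in> Q0 Q" for v
      using fits_times[OF ihom_fits[OF p(1) that]] e[OF that] by blast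
    ultimately show ?thesis by (intro disjI1 exI[of _ "\<lambda>v. \<psi> v * l v"]) blast
  next
    fix \<psi> assume p: "ihom Q N Z \<psi>" "\<forall>v\<in>Q0 Q. b v * \<psi> v = \<one>\<^sub>i (rdim N v)"
    have "imat_of (f v) * (r v * \<psi> v) = \<one>\<^sub>i (rdim N v)" if v: "v \<in> Q0 Q" for v
    proof -
      have "imat_of (f v) = b v * c v" using e[OF v] by blast
      then have "imat_of (f v) * (r v * \<psi> v) = b v * (c v * r v) * \<psi> v" by (simp only: mult.assoc)
      then show ?thesis using e[OF v] p(2) v ihom_fits[OF Z(3) v] by (simp add: fits_def)
    qed
    moreover have "fits (rdim M v) (rdim N v) (r v * \<psi> v)" if "v \<in> Q0 Q" for v
      using fits_times[OF _ ihom_fits[OF p(1) that]] e[OF that] by blast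
    ultimately show ?thesis by (intro disjI2 exI[of _ "\<lambda>v. r v * \<psi> v"]) blast
  qed
qed

text \<open>The linear maps \<open>L\<close> represent a homomorphism from \<open>V\<close> to the cokernel \<open>C\<close> of \<open>f\<close>: it lifts
  to \<open>N\<close>, or the projection of \<open>N\<close> onto \<open>C\<close> factors through it. The factorization of \<open>f\<close> used is the
  one over the pullback of \<open>N\<close> and \<open>V\<close> over \<open>C\<close>, an extension of \<open>V\<close> by \<open>M\<close>.\<close>
lemma irreducible_lift_or_factor:
  fixes M :: "('v, 'a, 'k::field) qrep"
  assumes f: "irreducible Q M N f"
    and k: "\<And>v. v \<in> Q0 Q \<Longrightarrow> fits (rdim M v) (rdim N v) (\<kappa> v) \<and> \<kappa> v * imat_of (f v) = \<one>\<^sub>i (rdim M v)"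
    and V: "is_rep Q V"
    and l: "\<And>v. v \<in> Q0 Q \<Longrightarrow> fits (rdim N v) (rdim V v) (L v)"
    and chi: "\<And>\<alpha>. \<alpha> \<in> Q1 Q \<Longrightarrow>
      imat_of (f (tgt Q \<alpha>)) * \<kappa> (tgt Q \<alpha>) * (amap N \<alpha> * L (src Q \<alpha>) - L (tgt Q \<alpha>) * amap V \<alpha>) =
      amap N \<alpha> * L (src Q \<alpha>) - L (tgt Q \<alpha>) * amap V \<alpha>"
  shows "(\<exists>\<rho>. ihom Q V N (\<lambda>v. L v - imat_of (f v) * \<rho> v)) \<or>
    (\<exists>s \<sigma>. ihom Q N V s \<and> (\<forall>v\<in>Q0 Q. imat_of (f v) * \<sigma> v + L v * s v = \<one>\<^sub>i (rdim N v)))"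
proof -
  have fh: "is_hom Q M N f" using f by (simp add: irreducible_def)
  note rM = is_homD(1)[OF fh] and rN = is_homD(2)[OF fh]
  define F where "F v = imat_of (f v)" for v
  have F: "ihom Q M N F" unfolding F_def by (rule is_hom_ihom[OF fh])
  \<comment> \<open>The failure of \<open>L\<close> to commute with an arrow. By the hypothesis on
    \<open>L\<close> it lies in the image of f, so it can be read as a map from V to M.\<close>
  define \<chi> where "\<chi> \<alpha> = \<kappa> (tgt Q \<alpha>) * (amap N \<alpha> * L (src Q \<alpha>) - L (tgt Q \<alpha>) * amap V \<alpha>)" for \<alpha>
  have Fchi: "F (tgt Q \<alpha>) * \<chi> \<alpha> = amap N \<alpha> * L (src Q \<alpha>) - L (tgt Q \<alpha>) * amap V \<alpha>" if "\<alpha> \<in> Q1 Q" for \<alpha>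
    using chi[OF that] by (simp add: F_def \<chi>_def mult.assoc)
  have fchi: "fits (rdim M (tgt Q \<alpha>)) (rdim V (src Q \<alpha>)) (\<chi> \<alpha>)" if \<alpha>: "\<alpha> \<in> Q1 Q" for \<alpha>
    unfolding \<chi>_def
    using fits_times[OF conjunct1[OF k[OF arrow_ends(2)[OF \<alpha>]]]
        fits_diff[OF fits_times[OF fits_amap[OF rN \<alpha>] l[OF arrow_ends(1)[OF \<alpha>]]]
          fits_times[OF l[OF arrow_ends(2)[OF \<alpha>]] fits_amap[OF V \<alpha>]]]] .
  have "\<forall>v. \<exists>i1 p1 i2 p2 :: 'k imat. fits (rdim M v + rdim V v) (rdim M v) i1 \<and> fits (rdim M v) (rdim M v + rdim V v) p1 \<and>
      fits (rdim M v + rdim V v) (rdim V v) i2 \<and> fits (rdim V v) (rdim M v + rdim V v) p2 \<and>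
      p1 * i1 = \<one>\<^sub>i (rdim M v) \<and> p2 * i2 = \<one>\<^sub>i (rdim V v) \<and> p1 * i2 = 0 \<and> p2 * i1 = 0 \<and>
      i1 * p1 + i2 * p2 = \<one>\<^sub>i (rdim M v + rdim V v)"
    by (intro allI direct_sum_imats)
  then obtain i1 p1 i2 p2 :: "'v \<Rightarrow> 'k imat" where
    A: "\<forall>v. fits (rdim M v + rdim V v) (rdim M v) (i1 v) \<and> fits (rdim M v) (rdim M v + rdim V v) (p1 v) \<and>
      fits (rdim M v + rdim V v) (rdim V v) (i2 v) \<and> fits (rdim V v) (rdim M v + rdim V v) (p2 v) \<and>
      p1 v * i1 v = \<one>\<^sub>i (rdim M v) \<and> p2 v * i2 v = \<one>\<^sub>i (rdim V v) \<and> p1 v * i2 v = 0 \<and> p2 v * i1 v = 0 \<and>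
      i1 v * p1 v + i2 v * p2 v = \<one>\<^sub>i (rdim M v + rdim V v)"
    unfolding choice_iff by blast
  have fi: "\<And>v. fits (rdim M v + rdim V v) (rdim M v) (i1 v)" "\<And>v. fits (rdim M v) (rdim M v + rdim V v) (p1 v)"
      "\<And>v. fits (rdim M v + rdim V v) (rdim V v) (i2 v)" "\<And>v. fits (rdim V v) (rdim M v + rdim V v) (p2 v)"
    and e: "\<And>v. p1 v * i1 v = \<one>\<^sub>i (rdim M v)" "\<And>v. p2 v * i2 v = \<one>\<^sub>i (rdim V v)" "\<And>v. p1 v * i2 v = 0"
      "\<And>v. p2 v * i1 v = 0" "\<And>v. i1 v * p1 v + i2 v * p2 v = \<one>\<^sub>i (rdim M v + rdim V v)"
    using A by blast+
  \<comment> \<open>Block triangular maps with M as subrepresentation, V as quotient and \<chi> as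
    the mixed entry; the maps \<open>g\<close> and \<open>p2\<close> together embed this extension
    into N \<oplus> V as the pullback.\<close>
  define z where "z \<alpha> = i1 (tgt Q \<alpha>) * amap M \<alpha> * p1 (src Q \<alpha>) + i1 (tgt Q \<alpha>) * \<chi> \<alpha> * p2 (src Q \<alpha>)
     + i2 (tgt Q \<alpha>) * amap V \<alpha> * p2 (src Q \<alpha>)" for \<alpha>
  define Z where "Z = mk_rep (\<lambda>v. rdim M v + rdim V v) z"
  have dZ: "rdim Z v = rdim M v + rdim V v" if "v \<in> Q0 Q" for v using that by (simp add: Z_def)
  have fz: "fits (rdim M (tgt Q \<alpha>) + rdim V (tgt Q \<alpha>)) (rdim M (src Q \<alpha>) + rdim V (src Q \<alpha>)) (z \<alpha>)" if \<alpha>: "\<alpha> \<in> Q1 Q" for \<alpha>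
    unfolding z_def
    by (intro fits_add fits_times[OF fits_times[OF fi(1) fits_amap[OF rM \<alpha>]] fi(2)]
        fits_times[OF fits_times[OF fi(1) fchi[OF \<alpha>]] fi(4)] fits_times[OF fits_times[OF fi(3) fits_amap[OF V \<alpha>]] fi(4)])
  have aZ: "amap Z \<alpha> = z \<alpha>" if "\<alpha> \<in> Q1 Q" for \<alpha>
    unfolding Z_def by (rule amap_mk_rep) (rule fz[OF that])
  have p1z: "p1 (tgt Q \<alpha>) * z \<alpha> = amap M \<alpha> * p1 (src Q \<alpha>) + \<chi> \<alpha> * p2 (src Q \<alpha>)"
    and p2z: "p2 (tgt Q \<alpha>) * z \<alpha> = amap V \<alpha> * p2 (src Q \<alpha>)"
    and zi1: "z \<alpha> * i1 (src Q \<alpha>) = i1 (tgt Q \<alpha>) * amap M \<alpha>"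
    and zi2: "z \<alpha> * i2 (src Q \<alpha>) = i1 (tgt Q \<alpha>) * \<chi> \<alpha> + i2 (tgt Q \<alpha>) * amap V \<alpha>" if \<alpha>: "\<alpha> \<in> Q1 Q" for \<alpha>
  proof -
    let ?s = "src Q \<alpha>" and ?t = "tgt Q \<alpha>"
    note fM = fits_amap[OF rM \<alpha>] and fV = fits_amap[OF V \<alpha>] and fc = fchi[OF \<alpha>]
    have "p1 ?t * z \<alpha> = (p1 ?t * i1 ?t) * amap M \<alpha> * p1 ?s + (p1 ?t * i1 ?t) * \<chi> \<alpha> * p2 ?s + (p1 ?t * i2 ?t) * amap V \<alpha> * p2 ?s"
      by (simp add: z_def distrib_left mult.assoc)
    then show "p1 ?t * z \<alpha> = amap M \<alpha> * p1 ?s + \<chi> \<alpha> * p2 ?s" using e fM fc by (simp add: fits_def)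
    have "p2 ?t * z \<alpha> = (p2 ?t * i1 ?t) * amap M \<alpha> * p1 ?s + (p2 ?t * i1 ?t) * \<chi> \<alpha> * p2 ?s + (p2 ?t * i2 ?t) * amap V \<alpha> * p2 ?s"
      by (simp add: z_def distrib_left mult.assoc)
    then show "p2 ?t * z \<alpha> = amap V \<alpha> * p2 ?s" using e fV by (simp add: fits_def)
    have "z \<alpha> * i1 ?s = i1 ?t * amap M \<alpha> * (p1 ?s * i1 ?s) + i1 ?t * \<chi> \<alpha> * (p2 ?s * i1 ?s) + i2 ?t * amap V \<alpha> * (p2 ?s * i1 ?s)"
      by (simp add: z_def distrib_right mult.assoc)
    then show "z \<alpha> * i1 ?s = i1 ?t * amap M \<alpha>" using e fM by (simp add: fits_def mult.assoc)
    have "z \<alpha> * i2 ?s = i1 ?t * amap M \<alpha> * (p1 ?s * i2 ?s) + i1 ?t * \<chi> \<alpha> * (p2 ?s * i2 ?s) + i2 ?t * amap V \<alpha> * (p2 ?s * i2 ?s)"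
      by (simp add: z_def distrib_right mult.assoc)
    then show "z \<alpha> * i2 ?s = i1 ?t * \<chi> \<alpha> + i2 ?t * amap V \<alpha>" using e fc fV by (simp add: fits_def mult.assoc)
  qed
  have P2: "ihom Q Z V p2" unfolding ihom_def using fi(4) dZ aZ p2z by simp
  define g where "g v = F v * p1 v + L v * p2 v" for v
  have G: "ihom Q Z N g" unfolding ihom_def
  proof (intro conjI ballI)
    show "fits (rdim N v) (rdim Z v) (g v)" if "v \<in> Q0 Q" for v
      unfolding g_def dZ[OF that]
      by (rule fits_add[OF fits_times[OF ihom_fits[OF F that] fi(2)] fits_times[OF l[OF that] fi(4)]])
    fix \<alpha> assume \<alpha>: "\<alpha> \<in> Q1 Q"
    let ?s = "src Q \<alpha>" and ?t = "tgt Q \<alpha>"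
    have "g ?t * amap Z \<alpha> = F ?t * (p1 ?t * z \<alpha>) + L ?t * (p2 ?t * z \<alpha>)"
      by (simp add: g_def aZ[OF \<alpha>] distrib_right mult.assoc)
    also have "\<dots> = (F ?t * amap M \<alpha>) * p1 ?s + (F ?t * \<chi> \<alpha>) * p2 ?s + L ?t * amap V \<alpha> * p2 ?s"
      by (simp add: p1z[OF \<alpha>] p2z[OF \<alpha>] distrib_left mult.assoc)
    also have "\<dots> = amap N \<alpha> * g ?s"
      unfolding Fchi[OF \<alpha>] ihom_commute[OF F \<alpha>] by (simp add: g_def distrib_left left_diff_distrib mult.assoc)
    finally show "g ?t * amap Z \<alpha> = amap N \<alpha> * g ?s" .
  qed
  \<comment> \<open>The relations hold because they hold in N and in V, and \<open>g\<close> and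
    \<open>p2\<close> are jointly injective: \<open>p2\<close> detects the component in V and, on
    its kernel, \<kappa> times \<open>g\<close> the one in M.\<close>
  have rZ: "is_rep Q Z" unfolding Z_def
  proof (rule mk_rep_is_rep, fold Z_def)
    fix v r w assume r: "r \<in> rels Q" "dpath Q v r w" "v \<in> Q0 Q" "w \<in> Q0 Q"
    have "in_I Q r" unfolding in_I_def using r(1) by (metis append_Nil append_Nil2)
    then have "pmap Q N v r = 0" "pmap Q V v r = 0" using pmap_in_I[OF rN r(2)] pmap_in_I[OF V r(2)] by blast+
    then have gz: "g w * pmap Q Z v r = 0" and p2z: "p2 w * pmap Q Z v r = 0"
      using ihom_pmap[OF G r(3,2)] ihom_pmap[OF P2 r(3,2)] by simp_all
    have "(\<kappa> w * F w) * (p1 w * pmap Q Z v r) = \<kappa> w * (g w * pmap Q Z v r - L w * (p2 w * pmap Q Z v r))"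
      by (simp add: g_def distrib_right distrib_left mult.assoc)
    then have p1z: "p1 w * pmap Q Z v r = 0"
      using gz p2z k[OF r(4)] fi(2)[of w] by (simp add: F_def fits_def mult.assoc[symmetric])
    have "pmap Q Z v r = \<one>\<^sub>i (rdim M w + rdim V w) * pmap Q Z v r"
    proof -
      have "fits (rdim M w + rdim V w) (rdim M v + rdim V v) (pmap Q Z v r)" using r(2,3)
      proof (induction r arbitrary: v)
        case (Cons \<alpha> r)
        have \<alpha>: "\<alpha> \<in> Q1 Q" "src Q \<alpha> = v" "dpath Q (tgt Q \<alpha>) r w" using Cons.prems by auto
        show ?case using fits_times[OF Cons.IH[OF \<alpha>(3) arrow_ends(2)[OF \<alpha>(1)]] fz[OF \<alpha>(1)]] \<alpha>(2)
          by (simp add: aZ[OF \<alpha>(1)])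
      qed (use dZ in auto)
      then show ?thesis by (simp add: fits_def)
    qed
    also have "\<dots> = i1 w * (p1 w * pmap Q Z v r) + i2 w * (p2 w * pmap Q Z v r)"
      unfolding e(5)[symmetric] by (simp add: distrib_right mult.assoc)
    finally show "pmap Q Z v r = 0" using p1z p2z by simp
  qed
  have I1: "ihom Q M Z i1" unfolding ihom_def using fi(1) dZ aZ zi1 by simp
  have "\<forall>v\<in>Q0 Q. g v * i1 v = imat_of (f v)"
    using e ihom_fits[OF F] by (auto simp add: g_def distrib_right mult.assoc fits_def F_def)
  from irreducibleD[OF f rZ I1 G this] show ?thesis
  proof (elim disjE exE conjE)
    fix \<psi> assume p: "ihom Q Z M \<psi>" "\<forall>v\<in>Q0 Q. \<psi> v * i1 v = \<one>\<^sub>i (rdim M v)"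
    \<comment> \<open>A retraction onto M splits the extension; its component on V is exactly the
      correction that makes \<open>L\<close> commute with the arrows.\<close>
    define \<rho> where "\<rho> v = \<psi> v * i2 v" for v
    have "ihom Q V N (\<lambda>v. L v - F v * \<rho> v)" unfolding ihom_def
    proof (intro conjI ballI)
      show "fits (rdim N v) (rdim V v) (L v - F v * \<rho> v)" if "v \<in> Q0 Q" for v
        unfolding \<rho>_def using ihom_fits[OF p(1) that]
        by (intro fits_diff[OF l[OF that] fits_times[OF ihom_fits[OF F that] fits_times[OF _ fi(3)]]])
          (simp add: dZ[OF that])
      fix \<alpha> assume \<alpha>: "\<alpha> \<in> Q1 Q"
      let ?s = "src Q \<alpha>" and ?t = "tgt Q \<alpha>"
      note se = arrow_ends(1)[OF \<alpha>] and ts = arrow_ends(2)[OF \<alpha>]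
      have "amap M \<alpha> * \<rho> ?s = (\<psi> ?t * amap Z \<alpha>) * i2 ?s"
        by (simp add: \<rho>_def ihom_commute[OF p(1) \<alpha>] mult.assoc)
      also have "\<dots> = (\<psi> ?t * i1 ?t) * \<chi> \<alpha> + \<rho> ?t * amap V \<alpha>"
        by (simp add: aZ[OF \<alpha>] zi2[OF \<alpha>] mult.assoc distrib_left \<rho>_def)
      finally have r: "amap M \<alpha> * \<rho> ?s = \<chi> \<alpha> + \<rho> ?t * amap V \<alpha>"
        using p(2) ts fchi[OF \<alpha>] by (simp add: fits_def)
      have "amap N \<alpha> * (L ?s - F ?s * \<rho> ?s) = amap N \<alpha> * L ?s - F ?t * (amap M \<alpha> * \<rho> ?s)"
        using ihom_commute[OF F \<alpha>] by (simp add: right_diff_distrib mult.assoc[symmetric])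
      also have "\<dots> = (L ?t - F ?t * \<rho> ?t) * amap V \<alpha>"
        unfolding r using Fchi[OF \<alpha>] by (simp add: algebra_simps)
      finally show "(L ?t - F ?t * \<rho> ?t) * amap V \<alpha> = amap N \<alpha> * (L ?s - F ?s * \<rho> ?s)" by simp
    qed
    then show ?thesis unfolding F_def by blast
  next
    fix \<psi> assume p: "ihom Q N Z \<psi>" "\<forall>v\<in>Q0 Q. g v * \<psi> v = \<one>\<^sub>i (rdim N v)"
    have 1: "ihom Q N V (\<lambda>v. p2 v * \<psi> v)" by (rule ihom_comp[OF p(1) P2])
    have 2: "\<forall>v\<in>Q0 Q. imat_of (f v) * (p1 v * \<psi> v) + L v * (p2 v * \<psi> v) = \<one>\<^sub>i (rdim N v)"
      using p(2) by (simp add: g_def F_def distrib_right mult.assoc)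
    show ?thesis
      by (rule disjI2, rule exI[of _ "\<lambda>v. p2 v * \<psi> v"], rule exI[of _ "\<lambda>v. p1 v * \<psi> v"]) (rule conjI[OF 1 2])
  qed
qed

end

section \<open>Thin representations and projectives\<close>

declare One_nat_def [simp del]

lemma idempotent_1_1:
  fixes a :: "'k::field imat"
  assumes "fits 1 1 a" "a * a = a"
  shows "a = 0 \<or> a = \<one>\<^sub>i 1"
proof (rule disjCI)
  assume "a \<noteq> \<one>\<^sub>i 1"
  show "a = 0"
  proof (rule ccontr)
    assume "a \<noteq> 0"
    then obtain b where b: "a * b = \<one>\<^sub>i 1" using fits_1_1_inverse[OF assms(1)] by metis
    have "a * (a * b) = a * b" using assms(2) by (simp add: mult.assoc[symmetric])
    then have "a = \<one>\<^sub>i 1" using b assms(1) by (simp add: fits_def)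
    then show False using \<open>a \<noteq> \<one>\<^sub>i 1\<close> by blast
  qed
qed

lemma mem_img_iff:
  assumes "f v \<in> carrier_mat n (rdim X v)"
  shows "y \<in> img f X v \<longleftrightarrow> y \<in> carrier_vec n \<and> (\<exists>z. fits (rdim X v) 1 z \<and> icol y = imat_of (f v) * z)"
proof
  assume "y \<in> img f X v"
  then obtain x where x: "x \<in> carrier_vec (rdim X v)" "y = f v *\<^sub>v x" by (auto simp: img_def)
  then have "icol y = imat_of (f v) * icol x" using icol_mult[OF assms x(1)] by simp
  then show "y \<in> carrier_vec n \<and> (\<exists>z. fits (rdim X v) 1 z \<and> icol y = imat_of (f v) * z)"
    using x assms by auto
next
  assume "y \<in> carrier_vec n \<and> (\<exists>z. fits (rdim X v) 1 z \<and> icol y = imat_of (f v) * z)"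
  then obtain z where z: "y \<in> carrier_vec n" "fits (rdim X v) 1 z" "icol y = imat_of (f v) * z" by blast
  have "icol (f v *\<^sub>v vec_of (rdim X v) z) = icol y"
    using icol_mult[OF assms vec_of_carrier] z by simp
  then have "y = f v *\<^sub>v vec_of (rdim X v) z"
    using icol_inject[OF _ z(1), of "f v *\<^sub>v vec_of (rdim X v) z"] assms by auto
  then show "y \<in> img f X v" unfolding img_def by auto
qed

lemma icol_finsum:
  assumes "finite A" "\<And>a. a \<in> A \<Longrightarrow> g a \<in> carrier_vec n"
  shows "finsum_vec TYPE('a::comm_ring_1) n g A \<in> carrier_vec n \<and>
    icol (finsum_vec TYPE('a) n g A) = (\<Sum>a\<in>A. icol (g a))"
proof -
  have c: "finsum_vec TYPE('a) n g A \<in> carrier_vec n" using assms by (intro finsum_vec_closed) auto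
  have "entry (\<Sum>a\<in>A. icol (g a)) i j = (\<Sum>a\<in>A. entry (icol (g a)) i j)" for i j
    using assms(1) by induction auto
  moreover have "entry (icol (finsum_vec TYPE('a) n g A)) i j = (\<Sum>a\<in>A. entry (icol (g a)) i j)" for i j
  proof (cases "i < n \<and> j = 0")
    case True
    then show ?thesis using assms c index_finsum_vec[OF assms(1), of i n g]
      by (auto simp: entry_icol carrier_vecD[OF assms(2)] intro!: sum.cong)
  next
    case False
    then show ?thesis using c by (auto simp: entry_icol carrier_vecD[OF assms(2)])
  qed
  ultimately show ?thesis using c by (auto intro: imat_eqI)
qed

context tree
begin

lemma mem_rad_space_iff:
  fixes X :: "('v, 'a, 'k::field) qrep"
  assumes X: "is_rep Q X" and v: "v \<in> Q0 Q"
  shows "y \<in> rad_space Q X v \<longleftrightarrow> y \<in> carrier_vec (rdim X v) \<and>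
    (\<exists>x. (\<forall>\<alpha>\<in>inA Q v. fits (rdim X (src Q \<alpha>)) 1 (x \<alpha>)) \<and> icol y = (\<Sum>\<alpha>\<in>inA Q v. amap X \<alpha> * x \<alpha>))"
    (is "_ \<longleftrightarrow> ?R")
proof -
  have cm: "rmap X \<alpha> \<in> carrier_mat (rdim X v) (rdim X (src Q \<alpha>))" if "\<alpha> \<in> inA Q v" for \<alpha>
    using X that by (auto simp: is_rep_def inA_def)
  have key: "finsum_vec TYPE('k) (rdim X v) (\<lambda>\<alpha>. rmap X \<alpha> *\<^sub>v xs \<alpha>) (inA Q v) \<in> carrier_vec (rdim X v) \<and>
      icol (finsum_vec TYPE('k) (rdim X v) (\<lambda>\<alpha>. rmap X \<alpha> *\<^sub>v xs \<alpha>) (inA Q v)) =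
      (\<Sum>\<alpha>\<in>inA Q v. amap X \<alpha> * icol (xs \<alpha>))"
    if xs: "\<forall>\<alpha>\<in>inA Q v. xs \<alpha> \<in> carrier_vec (rdim X (src Q \<alpha>))" for xs
  proof -
    have "(\<Sum>\<alpha>\<in>inA Q v. icol (rmap X \<alpha> *\<^sub>v xs \<alpha>)) = (\<Sum>\<alpha>\<in>inA Q v. amap X \<alpha> * icol (xs \<alpha>))"
      by (rule sum.cong) (use xs icol_mult[OF cm] in \<open>auto simp: amap_def\<close>)
    then show ?thesis
      using icol_finsum[OF finite_inA, of v "\<lambda>\<alpha>. rmap X \<alpha> *\<^sub>v xs \<alpha>" "rdim X v"] xs cm
      by (auto intro: mult_mat_vec_carrier)
  qed
  show ?thesis
  proof
    assume "y \<in> rad_space Q X v"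
    then obtain xs where xs: "y = finsum_vec TYPE('k) (rdim X v) (\<lambda>\<alpha>. rmap X \<alpha> *\<^sub>v xs \<alpha>) (inA Q v)"
        "\<forall>\<alpha>\<in>inA Q v. xs \<alpha> \<in> carrier_vec (rdim X (src Q \<alpha>))" by (auto simp: rad_space_def)
    then show ?R using key[OF xs(2)] by (intro conjI exI[of _ "\<lambda>\<alpha>. icol (xs \<alpha>)"]) auto
  next
    assume ?R
    then obtain x where x: "y \<in> carrier_vec (rdim X v)" "\<forall>\<alpha>\<in>inA Q v. fits (rdim X (src Q \<alpha>)) 1 (x \<alpha>)"
        "icol y = (\<Sum>\<alpha>\<in>inA Q v. amap X \<alpha> * x \<alpha>)" by blast
    define xs where "xs \<alpha> = vec_of (rdim X (src Q \<alpha>)) (x \<alpha>)" for \<alpha>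
    have xs: "\<forall>\<alpha>\<in>inA Q v. xs \<alpha> \<in> carrier_vec (rdim X (src Q \<alpha>))" by (simp add: xs_def)
    have "(\<Sum>\<alpha>\<in>inA Q v. amap X \<alpha> * icol (xs \<alpha>)) = icol y"
      unfolding x(3) by (rule sum.cong) (use x(2) in \<open>auto simp: xs_def\<close>)
    then have "y = finsum_vec TYPE('k) (rdim X v) (\<lambda>\<alpha>. rmap X \<alpha> *\<^sub>v xs \<alpha>) (inA Q v)"
      using key[OF xs] x(1) icol_inject by metis
    then show "y \<in> rad_space Q X v" using xs unfolding rad_space_def by blast
  qed
qed

lemma amap_in_rad_space:
  assumes X: "is_rep Q X" and \<alpha>: "\<alpha> \<in> Q1 Q" and x: "fits (rdim X (src Q \<alpha>)) 1 x"
  shows "vec_of (rdim X (tgt Q \<alpha>)) (amap X \<alpha> * x) \<in> rad_space Q X (tgt Q \<alpha>)"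
proof -
  have i: "\<alpha> \<in> inA Q (tgt Q \<alpha>)" using \<alpha> by (simp add: inA_def)
  have "(\<Sum>\<beta>\<in>inA Q (tgt Q \<alpha>). amap X \<beta> * (if \<beta> = \<alpha> then x else 0)) =
      (\<Sum>\<beta>\<in>inA Q (tgt Q \<alpha>). if \<beta> = \<alpha> then amap X \<alpha> * x else 0)" by (rule sum.cong) auto
  then have "(\<Sum>\<beta>\<in>inA Q (tgt Q \<alpha>). amap X \<beta> * (if \<beta> = \<alpha> then x else 0)) = amap X \<alpha> * x" using i by simp
  moreover have "icol (vec_of (rdim X (tgt Q \<alpha>)) (amap X \<alpha> * x)) = amap X \<alpha> * x"
    using fits_times[OF fits_amap[OF X \<alpha>] x] by simp
  ultimately show ?thesis unfolding mem_rad_space_iff[OF X arrow_ends(2)[OF \<alpha>]]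
    by (intro conjI exI[of _ "\<lambda>\<beta>. if \<beta> = \<alpha> then x else 0"]) (auto simp: x)
qed

definition pth :: "'v \<Rightarrow> 'v \<Rightarrow> 'a list" where
  "pth u v = (THE p. dpath Q u p v)"

lemma pth_eq: "dpath Q u p v \<Longrightarrow> pth u v = p"
  unfolding pth_def using dpath_unique by blast

end

context string_tree
begin

text \<open>On a tree at most one path joins two vertices, so spaces of dimension one with identity
  maps already describe the projectives P(k) and the string modules whose arms run into a common
  vertex.\<close>

definition thin :: "'v set \<Rightarrow> ('v, 'a, 'k::field) qrep" where
  "thin T = mk_rep (\<lambda>v. if v \<in> T then 1 else 0)
     (\<lambda>\<alpha>. if src Q \<alpha> \<in> T \<and> tgt Q \<alpha> \<in> T then \<one>\<^sub>i 1 else 0)"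

lemma rdim_thin: "v \<in> Q0 Q \<Longrightarrow> rdim (thin T) v = (if v \<in> T then 1 else 0)"
  by (simp add: thin_def)

lemma amap_thin: "\<alpha> \<in> Q1 Q \<Longrightarrow> amap (thin T) \<alpha> = (if src Q \<alpha> \<in> T \<and> tgt Q \<alpha> \<in> T then \<one>\<^sub>i 1 else 0)"
  unfolding thin_def by (rule amap_mk_rep) auto

lemma pmap_thin_0:
  "dpath Q v p w \<Longrightarrow> \<alpha> \<in> set p \<Longrightarrow> src Q \<alpha> \<notin> T \<or> tgt Q \<alpha> \<notin> T \<Longrightarrow> pmap Q (thin T) v p = 0"
  by (induction p arbitrary: v) (auto simp: amap_thin)

lemma pmap_thin_1:
  "dpath Q v p w \<Longrightarrow> v \<in> Q0 Q \<Longrightarrow> set (verts Q v p) \<subseteq> T \<Longrightarrow> pmap Q (thin T) v p = \<one>\<^sub>i 1"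
  by (induction p arbitrary: v) (auto simp: amap_thin rdim_thin arrow_ends verts_def)

lemma thin_is_rep:
  assumes "restr_zero Q T"
  shows "is_rep Q (thin T)"
  unfolding thin_def
proof (rule mk_rep_is_rep, fold thin_def)
  fix v r w assume r: "r \<in> rels Q" "dpath Q v r w"
  have "in_I Q r" unfolding in_I_def using r(1) by (metis append_Nil append_Nil2)
  then have "\<not> (\<forall>\<alpha>\<in>set r. src Q \<alpha> \<in> T \<and> tgt Q \<alpha> \<in> T)"
    using assms rels_path[OF r(1)] unfolding restr_zero_def by blast
  then show "pmap Q (thin T) v r = 0" using pmap_thin_0[OF r(2)] by blast
qed

lemma thin_hom_out:
  assumes "\<And>v. v \<in> T \<Longrightarrow> v \<in> Q0 Q \<Longrightarrow> fits (rdim X v) 1 (x v)"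
    and "\<And>\<alpha>. \<alpha> \<in> Q1 Q \<Longrightarrow> src Q \<alpha> \<in> T \<Longrightarrow> amap X \<alpha> * x (src Q \<alpha>) = (if tgt Q \<alpha> \<in> T then x (tgt Q \<alpha>) else 0)"
  shows "ihom Q (thin T) X (\<lambda>v. if v \<in> T then x v else 0)"
proof -
  have "x v * \<one>\<^sub>i 1 = x v" if "v \<in> T" "v \<in> Q0 Q" for v using assms(1)[OF that] by (simp add: fits_def)
  then show ?thesis using assms unfolding ihom_def by (auto simp: rdim_thin amap_thin arrow_ends)
qed

lemma thin_hom_in:
  assumes "\<And>v. v \<in> T \<Longrightarrow> v \<in> Q0 Q \<Longrightarrow> fits 1 (rdim X v) (y v)"
    and "\<And>\<alpha>. \<alpha> \<in> Q1 Q \<Longrightarrow> tgt Q \<alpha> \<in> T \<Longrightarrow> y (tgt Q \<alpha>) * amap X \<alpha> = (if src Q \<alpha> \<in> T then y (src Q \<alpha>) else 0)"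
  shows "ihom Q X (thin T) (\<lambda>v. if v \<in> T then y v else 0)"
proof -
  have "\<one>\<^sub>i 1 * y v = y v" if "v \<in> T" "v \<in> Q0 Q" for v using assms(1)[OF that] by (simp add: fits_def)
  then show ?thesis using assms unfolding ihom_def by (auto simp: rdim_thin amap_thin arrow_ends)
qed

lemma thin_hom_path:
  assumes "ihom Q (thin T) X \<phi>" "v \<in> Q0 Q" "dpath Q v p w" "set (verts Q v p) \<subseteq> T"
  shows "\<phi> w = pmap Q X v p * \<phi> v"
proof -
  have w: "w \<in> T" "w \<in> Q0 Q"
    using assms last_verts[OF assms(3)] dpath_end[OF assms(2,3)] last_in_set[of "verts Q v p"]
    by (auto simp: verts_def)
  have "\<phi> w * \<one>\<^sub>i 1 = pmap Q X v p * \<phi> v"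
    using ihom_pmap[OF assms(1,2,3)] by (simp add: pmap_thin_1[OF assms(3,2,4)])
  then show ?thesis using ihom_fits[OF assms(1) w(2)] w by (simp add: rdim_thin fits_def)
qed

text \<open>The vector at \<open>k\<close> generates the representation, so its image determines the
  homomorphism.\<close>

lemma thin_hom_unique:
  assumes \<phi>: "ihom Q (thin T) X \<phi>" and \<psi>: "ihom Q (thin T) X \<psi>"
    and k: "k \<in> Q0 Q" "\<phi> k = \<psi> k"
    and root: "\<And>v. v \<in> T \<Longrightarrow> \<exists>p. dpath Q k p v \<and> set (verts Q k p) \<subseteq> T"
    and v: "v \<in> Q0 Q"
  shows "\<phi> v = \<psi> v"
proof (cases "v \<in> T")
  case True
  then obtain p where "dpath Q k p v" "set (verts Q k p) \<subseteq> T" using root by blast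
  then show ?thesis using thin_hom_path[OF \<phi> k(1)] thin_hom_path[OF \<psi> k(1)] k(2) by simp
next
  case False
  then show ?thesis using ihom_fits[OF \<phi> v] ihom_fits[OF \<psi> v] v by (simp add: rdim_thin fits_def)
qed

lemma ihom_zero: "ihom Q X Y (\<lambda>_. 0)"
  by (simp add: ihom_def)

text \<open>An endomorphism is determined at the root \<open>k\<close>, where the space has
  dimension one and an idempotent is 0 or 1.\<close>

lemma thin_indecomposable:
  assumes T: "restr_zero Q T" and k: "k \<in> T" "k \<in> Q0 Q"
    and root: "\<And>v. v \<in> T \<Longrightarrow> \<exists>p. dpath Q k p v \<and> set (verts Q k p) \<subseteq> T"
  shows "indecomposable Q (thin T :: ('v, 'a, 'k::field) qrep)"
proof (rule indecomposableI)
  show r: "is_rep Q (thin T :: ('v, 'a, 'k) qrep)" by (rule thin_is_rep[OF T])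
  show "\<not> zero_rep Q (thin T :: ('v, 'a, 'k) qrep)" using k by (auto simp: zero_rep_def rdim_thin)
  fix e :: "'v \<Rightarrow> 'k imat"
  assume e: "ihom Q (thin T) (thin T) e" and idem: "\<And>v. v \<in> Q0 Q \<Longrightarrow> e v * e v = e v"
  have "e k = 0 \<or> e k = \<one>\<^sub>i 1"
    using idempotent_1_1[OF _ idem[OF k(2)]] ihom_fits[OF e k(2)] k by (simp add: rdim_thin)
  then show "(\<forall>v\<in>Q0 Q. e v = 0) \<or> (\<forall>v\<in>Q0 Q. e v = \<one>\<^sub>i (rdim (thin T :: ('v, 'a, 'k) qrep) v))"
  proof
    assume "e k = 0"
    then have "\<forall>v\<in>Q0 Q. e v = 0" using thin_hom_unique[OF e ihom_zero k(2) _ root] by blast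
    then show ?thesis ..
  next
    assume "e k = \<one>\<^sub>i 1"
    then have "e k = \<one>\<^sub>i (rdim (thin T :: ('v, 'a, 'k) qrep) k)" using k by (simp add: rdim_thin)
    then have "\<forall>v\<in>Q0 Q. e v = \<one>\<^sub>i (rdim (thin T :: ('v, 'a, 'k) qrep) v)"
      using thin_hom_unique[OF e ihom_id[OF r] k(2) _ root] by blast
    then show ?thesis ..
  qed
qed

section \<open>The indecomposable projectives as thin representations\<close>

definition reach :: "'v \<Rightarrow> 'v set" where
  "reach k = {v. \<exists>p. dpath Q k p v \<and> \<not> in_I Q p}"

lemma reach_refl [simp]: "k \<in> reach k"
  by (auto simp: reach_def intro!: exI[of _ "[]"])

lemma reachD: "v \<in> reach k \<Longrightarrow> dpath Q k (pth k v) v \<and> \<not> in_I Q (pth k v)"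
  unfolding reach_def using pth_eq by blast

lemma restr_zero_subset: "restr_zero Q T \<Longrightarrow> S \<subseteq> T \<Longrightarrow> restr_zero Q S"
  unfolding restr_zero_def by blast

text \<open>A path of I inside this set, preceded by the path from \<open>k\<close> to its start, is
  the only path from \<open>k\<close> to its end and lies in I.\<close>

lemma restr_zero_reach: "restr_zero Q (reach k)"
  unfolding restr_zero_def
proof
  assume "\<exists>q. is_path Q q \<and> (\<forall>\<alpha>\<in>set q. src Q \<alpha> \<in> reach k \<and> tgt Q \<alpha> \<in> reach k) \<and> in_I Q q"
  then obtain q where q: "is_path Q q" "in_I Q q" "\<And>\<alpha>. \<alpha> \<in> set q \<Longrightarrow> src Q \<alpha> \<in> reach k \<and> tgt Q \<alpha> \<in> reach k" by blast
  have ne: "q \<noteq> []" using q by auto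
  then have d: "dpath Q (src Q (hd q)) q (tgt Q (last q))" using is_path_dpath q by blast
  obtain p where p: "dpath Q k p (src Q (hd q))" using q(3)[of "hd q"] ne by (auto simp: reach_def)
  have "dpath Q k (p @ q) (tgt Q (last q))" using p d by (auto simp: dpath_append)
  moreover obtain r where "dpath Q k r (tgt Q (last q))" "\<not> in_I Q r"
    using q(3)[of "last q"] ne by (auto simp: reach_def)
  ultimately show False using dpath_unique in_I_append2[OF q(2)] by blast
qed

lemma reach_root:
  assumes "v \<in> reach k"
  shows "\<exists>p. dpath Q k p v \<and> set (verts Q k p) \<subseteq> reach k"
proof (intro exI conjI subsetI)
  show d: "dpath Q k (pth k v) v" using reachD[OF assms] by blast
  fix w assume "w \<in> set (verts Q k (pth k v))"
  then obtain u t where "pth k v = u @ t" "dpath Q k u w" using verts_split[OF d] by blast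
  then show "w \<in> reach k" using reachD[OF assms] in_I_append1 unfolding reach_def by force
qed

text \<open>The surjective half of Hom(P(k), X) = X_k: the generator goes to \<open>x\<close>, which
  is carried along the paths from \<open>k\<close>. An arrow leaving the support completes a path of
  I, so it annihilates what has been carried so far.\<close>

lemma proj_hom:
  assumes X: "is_rep Q X" and k: "k \<in> Q0 Q" and x: "fits (rdim X k) 1 x"
  shows "ihom Q (thin (reach k)) X (\<lambda>v. if v \<in> reach k then pmap Q X k (pth k v) * x else 0)"
proof (rule thin_hom_out)
  show "fits (rdim X v) 1 (pmap Q X k (pth k v) * x)" if "v \<in> reach k" for v
    using fits_times[OF fits_pmap[OF X] x] reachD[OF that] by blast
  fix \<alpha> assume \<alpha>: "\<alpha> \<in> Q1 Q" "src Q \<alpha> \<in> reach k"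
  let ?p = "pth k (src Q \<alpha>)"
  have p: "dpath Q k ?p (src Q \<alpha>)" using reachD[OF \<alpha>(2)] by blast
  then have d: "dpath Q k (?p @ [\<alpha>]) (tgt Q \<alpha>)" using \<alpha> by (simp add: dpath_snoc)
  have e: "pmap Q X k (?p @ [\<alpha>]) = amap X \<alpha> * pmap Q X k ?p"
    using pmap_append[OF X p, of "[\<alpha>]"] pmap_single[OF X \<alpha>(1)] \<alpha>(1) by simp
  show "amap X \<alpha> * (pmap Q X k ?p * x) = (if tgt Q \<alpha> \<in> reach k then pmap Q X k (pth k (tgt Q \<alpha>)) * x else 0)"
  proof (cases "tgt Q \<alpha> \<in> reach k")
    case True
    then show ?thesis using e pth_eq[OF d] by (simp add: mult.assoc)
  next
    case False
    then have "in_I Q (?p @ [\<alpha>])" using d by (auto simp: reach_def)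
    then have "pmap Q X k (?p @ [\<alpha>]) = 0" using pmap_in_I[OF X d] by blast
    then show ?thesis using e False by (simp add: mult.assoc[symmetric])
  qed
qed

lemma pth_refl [simp]: "pth k k = []"
  by (rule pth_eq) simp

lemma surjective_hom_col:
  assumes w: "is_hom Q E N w" "surjective_hom Q E N w" and v: "v \<in> Q0 Q" and c: "fits (rdim N v) 1 c"
  shows "\<exists>z. fits (rdim E v) 1 z \<and> imat_of (w v) * z = c"
proof -
  have "vec_of (rdim N v) c \<in> img w E v" using w(2) v by (auto simp: surjective_hom_def)
  then show ?thesis using mem_img_iff[of w v "rdim N v" E, OF is_homD(3)[OF w(1) v]] c by auto
qed

lemma surjective_homI:
  assumes w: "is_hom Q E N w" and s: "\<And>v c. v \<in> Q0 Q \<Longrightarrow> fits (rdim N v) 1 c \<Longrightarrow> \<exists>z. fits (rdim E v) 1 z \<and> imat_of (w v) * z = c"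
  shows "surjective_hom Q E N w"
proof -
  have "y \<in> img w E v \<longleftrightarrow> y \<in> carrier_vec (rdim N v)" if v: "v \<in> Q0 Q" for v y
    unfolding mem_img_iff[of w v "rdim N v" E, OF is_homD(3)[OF w v]] using s[OF v] fits_icol by metis
  then show ?thesis unfolding surjective_hom_def by blast
qed

lemma thin_reach_projective:
  assumes k: "k \<in> Q0 Q"
  shows "projective Q (thin (reach k) :: ('v, 'a, 'k::field) qrep)"
  unfolding projective_def
proof (intro conjI allI impI)
  let ?P = "thin (reach k) :: ('v, 'a, 'k) qrep"
  show rP: "is_rep Q ?P" by (rule thin_is_rep[OF restr_zero_reach])
  fix E N w h assume "is_hom Q E N w \<and> surjective_hom Q E N w \<and> is_hom Q ?P N h"
  then have w: "is_hom Q E N w" "surjective_hom Q E N w" and h: "is_hom Q ?P N h" by auto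
  have hh: "ihom Q ?P N (\<lambda>v. imat_of (h v))" by (rule is_hom_ihom[OF h])
  have "fits (rdim N k) 1 (imat_of (h k))" using ihom_fits[OF hh k] k by (simp add: rdim_thin)
  then obtain z where z: "fits (rdim E k) 1 z" "imat_of (w k) * z = imat_of (h k)"
    using surjective_hom_col[OF w k] by blast
  define g where "g v = (if v \<in> reach k then pmap Q E k (pth k v) * z else 0)" for v
  have g: "ihom Q ?P E g" unfolding g_def by (rule proj_hom[OF is_homD(1)[OF w(1)] k z(1)])
  have "imat_of (w v) * g v = imat_of (h v)" if "v \<in> Q0 Q" for v
  proof -
    have "imat_of (w k) * g k = imat_of (h k)" using z k by (simp add: g_def fits_def)
    from thin_hom_unique[OF ihom_comp[OF g is_hom_ihom[OF w(1)]] hh k this reach_root that]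
    show ?thesis by simp
  qed
  then have "hom_eq Q (hcomp w (hmat ?P E g)) h"
    using hom_eq_comp_iff[OF hmat_is_hom[OF rP is_homD(1)[OF w(1)] g] w(1), of h] is_homD(3)[OF h]
    by (simp add: imat_of_hmat[OF g])
  then show "\<exists>g. is_hom Q ?P E g \<and> hom_eq Q (hcomp w g) h"
    using hmat_is_hom[OF rP is_homD(1)[OF w(1)] g] by blast
qed

lemma thin_reach_indecomposable: "k \<in> Q0 Q \<Longrightarrow> indecomposable Q (thin (reach k) :: ('v, 'a, 'k::field) qrep)"
  using thin_indecomposable[OF restr_zero_reach reach_refl _ reach_root] by blast

lemma simple_rep_facts:
  assumes "k \<in> Q0 Q"
  shows "is_rep Q (simple_rep Q k)" "rdim (simple_rep Q k) v = (if v = k then 1 else 0)"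
    "amap (simple_rep Q k) \<alpha> = 0"
proof -
  show a: "amap (simple_rep Q k) \<alpha> = 0" for \<alpha> by (simp add: amap_def simple_rep_def)
  show "rdim (simple_rep Q k) v = (if v = k then 1 else 0)" by (simp add: simple_rep_def)
  show "is_rep Q (simple_rep Q k)"
  proof (rule is_repI)
    fix v r w assume "r \<in> rels Q"
    then have "r \<noteq> []" using rels_length by fastforce
    then show "pmap Q (simple_rep Q k) v r = 0" by (cases r) (simp_all add: a)
  qed (use assms in \<open>auto simp: simple_rep_def\<close>)
qed

lemma no_arrow_into_root:
  assumes "\<alpha> \<in> Q1 Q" "tgt Q \<alpha> = k" "src Q \<alpha> \<in> reach k"
  shows False
proof -
  obtain p where "dpath Q k p (src Q \<alpha>)" using assms by (auto simp: reach_def)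
  then have "dpath Q k (p @ [\<alpha>]) k" using assms by (auto simp: dpath_snoc)
  then show False using dpath_acyclic by blast
qed

lemma thin_reach_to_simple:
  assumes k: "k \<in> Q0 Q"
  shows "ihom Q (thin (reach k)) (simple_rep Q k) (\<lambda>v. if v = k then \<one>\<^sub>i 1 else 0)"
  unfolding ihom_def using no_arrow_into_root k
  by (auto simp: simple_rep_facts[OF k] rdim_thin amap_thin)

lemma thin_reach_proj_at:
  assumes k: "k \<in> Q0 Q"
  shows "proj_at Q (thin (reach k) :: ('v, 'a, 'k::field) qrep) k"
  unfolding proj_at_def
proof (intro conjI exI)
  let ?P = "thin (reach k) :: ('v, 'a, 'k) qrep" and ?\<phi> = "\<lambda>v. if v = k then \<one>\<^sub>i 1 else (0 :: 'k imat)"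
  have \<phi>: "ihom Q ?P (simple_rep Q k) ?\<phi>" by (rule thin_reach_to_simple[OF k])
  show "is_hom Q ?P (simple_rep Q k) (hmat ?P (simple_rep Q k) ?\<phi>)"
    by (rule hmat_is_hom[OF thin_is_rep[OF restr_zero_reach] simple_rep_facts(1)[OF k] \<phi>])
  have "imat_of (hmat ?P (simple_rep Q k) ?\<phi> k) \<noteq> imat_of (hzero ?P (simple_rep Q k) k)"
    using imat_of_hmat[OF \<phi> k] unit_neq_0[of 1] by (simp add: hzero_def)
  then show "\<not> hom_eq Q (hmat ?P (simple_rep Q k) ?\<phi>) (hzero ?P (simple_rep Q k))"
    using k unfolding hom_eq_def by metis
qed (use thin_reach_projective[OF k] thin_reach_indecomposable[OF k] in auto)

end

section \<open>Projectives almost factoring through a monomorphism\<close>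

lemma zero_if_cols_zero:
  fixes a :: "'k::field imat"
  assumes "fits n m a" "\<And>x. fits m 1 x \<Longrightarrow> a * x = 0"
  shows "a = 0"
proof (rule imat_eqI)
  fix i j
  show "entry a i j = entry 0 i j"
  proof (cases "j < m")
    case True
    then have "fits m 1 (eps j 0 :: 'k imat)" by (auto simp: fits_iff eps.rep_eq split: if_splits)
    then have "a * eps j 0 = 0" by (rule assms(2))
    then have "entry (a * eps j 0) i 0 = 0" by simp
    then show ?thesis by (simp add: entry_times_eps)
  next
    case False
    then show ?thesis using assms(1) by (auto simp: fits_iff)
  qed
qed

lemma nonzero_row_onto:
  fixes a :: "'k::field imat"
  assumes "fits 1 m a" "a \<noteq> 0"
  obtains x where "fits m 1 x" "a * x = \<one>\<^sub>i 1"
proof -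
  obtain x where x: "fits m 1 x" "a * x \<noteq> 0" using zero_if_cols_zero[OF assms(1)] assms(2) by blast
  obtain b where b: "fits 1 1 b" "a * x * b = \<one>\<^sub>i 1"
    using fits_1_1_inverse[OF fits_times[OF assms(1) x(1)] x(2)] by metis
  show thesis using that[of "x * b"] fits_times[OF x(1) b(1)] b(2) by (simp add: mult.assoc)
qed

context string_tree
begin

text \<open>Almost factoring in terms of elements: \<open>h\<close> moves some \<open>x\<close>
  outside the image of f, while everything an arrow produces in \<open>X\<close> is moved into
  it.\<close>

lemma almost_factorsE:
  assumes af: "almost_factors Q X M N f" and f: "is_hom Q M N f"
  obtains h v x where "ihom Q X N h" "v \<in> Q0 Q" "fits (rdim X v) 1 x"
    "\<And>m. fits (rdim M v) 1 m \<Longrightarrow> h v * x \<noteq> imat_of (f v) * m"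
    "\<And>\<alpha> x'. \<alpha> \<in> Q1 Q \<Longrightarrow> fits (rdim X (src Q \<alpha>)) 1 x' \<Longrightarrow>
      \<exists>m. fits (rdim M (tgt Q \<alpha>)) 1 m \<and> h (tgt Q \<alpha>) * (amap X \<alpha> * x') = imat_of (f (tgt Q \<alpha>)) * m"
proof -
  obtain R j h g where j: "rad_incl Q X R j" and h: "is_hom Q X N h" and g: "is_hom Q R M g"
    and e: "hom_eq Q (hcomp h j) (hcomp f g)" and n: "\<not> (\<forall>v\<in>Q0 Q. img h X v \<subseteq> img f M v)"
    using af unfolding almost_factors_def by blast
  obtain v y where v: "v \<in> Q0 Q" "y \<in> img h X v" "y \<notin> img f M v" using n by blast
  note hv = is_homD(3)[OF h v(1)] and fv = is_homD(3)[OF f v(1)]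
  obtain x where x: "y \<in> carrier_vec (rdim N v)" "fits (rdim X v) 1 x" "icol y = imat_of (h v) * x"
    using v(2) unfolding mem_img_iff[of h v "rdim N v" X, OF hv] by blast
  have nx: "imat_of (h v) * x \<noteq> imat_of (f v) * m" if "fits (rdim M v) 1 m" for m
    using v(3) x that unfolding mem_img_iff[of f v "rdim N v" M, OF fv] by metis
  have jh: "is_hom Q R X j" using j by (simp add: rad_incl_def)
  have fc: "hcomp f g w \<in> carrier_mat (rdim N w) (rdim R w)" if "w \<in> Q0 Q" for w
    unfolding hcomp_def by (rule mult_carrier_mat[OF is_homD(3)[OF f that] is_homD(3)[OF g that]])
  have hj: "imat_of (h w) * imat_of (j w) = imat_of (f w) * imat_of (g w)" if w: "w \<in> Q0 Q" for w
    using iffD1[OF hom_eq_comp_iff[OF jh h, of "hcomp f g", OF fc] e] w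
      imat_of_mult[OF is_homD(3)[OF f w] is_homD(3)[OF g w]] by (simp add: hcomp_def)
  have "\<exists>m. fits (rdim M (tgt Q \<alpha>)) 1 m \<and> imat_of (h (tgt Q \<alpha>)) * (amap X \<alpha> * x') = imat_of (f (tgt Q \<alpha>)) * m"
    if \<alpha>: "\<alpha> \<in> Q1 Q" and x': "fits (rdim X (src Q \<alpha>)) 1 x'" for \<alpha> x'
  proof -
    let ?t = "tgt Q \<alpha>"
    note t = arrow_ends(2)[OF \<alpha>]
    have "vec_of (rdim X ?t) (amap X \<alpha> * x') \<in> img j R ?t"
      using amap_in_rad_space[OF is_homD(1)[OF h] \<alpha> x'] j t by (simp add: rad_incl_def)
    then obtain z where z: "fits (rdim R ?t) 1 z" "icol (vec_of (rdim X ?t) (amap X \<alpha> * x')) = imat_of (j ?t) * z"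
      using mem_img_iff[of j ?t "rdim X ?t" R, OF is_homD(3)[OF jh t]] by blast
    then have "amap X \<alpha> * x' = imat_of (j ?t) * z"
      using fits_times[OF fits_amap[OF is_homD(1)[OF h] \<alpha>] x'] by simp
    then have "imat_of (h ?t) * (amap X \<alpha> * x') = imat_of (f ?t) * (imat_of (g ?t) * z)"
      using hj[OF t] by (simp add: mult.assoc[symmetric])
    then show ?thesis using fits_times[OF ihom_fits[OF is_hom_ihom[OF g] t] z(1)] by blast
  qed
  then show thesis using that[OF is_hom_ihom[OF h] v(1) x(2) nx] by blast
qed

lemma injective_homI:
  assumes f: "is_hom Q X Y f" and l: "\<And>v. v \<in> Q0 Q \<Longrightarrow> \<exists>l. l * imat_of (f v) = \<one>\<^sub>i (rdim X v)"
  shows "injective_hom Q X Y f"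
  unfolding injective_hom_def
proof (intro ballI)
  fix v assume v: "v \<in> Q0 Q"
  note fv = is_homD(3)[OF f v]
  obtain l where l: "l * imat_of (f v) = \<one>\<^sub>i (rdim X v)" using l[OF v] by blast
  have "x = 0\<^sub>v (rdim X v)" if x: "x \<in> carrier_vec (rdim X v)" "f v *\<^sub>v x = 0\<^sub>v (rdim Y v)" for x
  proof (rule icol_inject[OF x(1)])
    have "imat_of (f v) * icol x = 0" using icol_mult[OF fv x(1)] x(2) by simp
    then have "(l * imat_of (f v)) * icol x = 0" by (simp add: mult.assoc)
    then show "icol x = icol (0\<^sub>v (rdim X v))" using fits_icol[OF x(1)] l by (simp add: fits_def)
  qed simp
  then show "ker f X Y v = {0\<^sub>v (rdim X v)}" using fv by (auto simp: ker_def)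
qed

text \<open>rad P(k) is everything away from \<open>k\<close>: no arrow arrives at \<open>k\<close>
  from the support, and each other vertex of the support is entered by the last arrow of its path.
  The isomorphic copy \<open>X\<close> is needed since \<open>Cf_iso\<close> speaks of all modules
  isomorphic to P(k).\<close>

lemma mem_rad_space_thin_reach_iso:
  fixes X :: "('v, 'a, 'k::field) qrep"
  assumes X: "is_rep Q X" and k: "k \<in> Q0 Q" and \<phi>: "ihom Q X (thin (reach k)) \<phi>" and \<psi>: "ihom Q (thin (reach k)) X \<psi>"
    and inv: "\<And>v. v \<in> Q0 Q \<Longrightarrow> \<psi> v * \<phi> v = \<one>\<^sub>i (rdim X v)" and v: "v \<in> Q0 Q"
  shows "y \<in> rad_space Q X v \<longleftrightarrow> y \<in> carrier_vec (rdim X v) \<and> (v = k \<longrightarrow> icol y = 0)"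
proof -
  have rP: "is_rep Q (thin (reach k) :: ('v, 'a, 'k) qrep)" by (rule thin_is_rep[OF restr_zero_reach])
  have aX: "amap X \<alpha> = \<psi> (tgt Q \<alpha>) * amap (thin (reach k)) \<alpha> * \<phi> (src Q \<alpha>)" if \<alpha>: "\<alpha> \<in> Q1 Q" for \<alpha>
  proof -
    have "\<psi> (tgt Q \<alpha>) * amap (thin (reach k)) \<alpha> * \<phi> (src Q \<alpha>) = amap X \<alpha> * (\<psi> (src Q \<alpha>) * \<phi> (src Q \<alpha>))"
      using ihom_commute[OF \<psi> \<alpha>] by (simp add: mult.assoc)
    then show ?thesis using inv[OF arrow_ends(1)[OF \<alpha>]] fits_amap[OF X \<alpha>] by (simp add: fits_def)
  qed
  show ?thesis
  proof
    assume y: "y \<in> rad_space Q X v"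
    then obtain x where x: "icol y = (\<Sum>\<alpha>\<in>inA Q v. amap X \<alpha> * x \<alpha>)" "y \<in> carrier_vec (rdim X v)"
      unfolding mem_rad_space_iff[OF X v] by blast
    have "icol y = 0" if "v = k"
    proof -
      have "amap X \<alpha> * x \<alpha> = 0" if "\<alpha> \<in> inA Q v" for \<alpha>
        using aX[of \<alpha>] no_arrow_into_root[of \<alpha> k] that \<open>v = k\<close> by (auto simp: inA_def amap_thin)
      then show ?thesis unfolding x(1) by (simp add: sum.neutral)
    qed
    then show "y \<in> carrier_vec (rdim X v) \<and> (v = k \<longrightarrow> icol y = 0)" using x(2) by blast
  next
    assume y: "y \<in> carrier_vec (rdim X v) \<and> (v = k \<longrightarrow> icol y = 0)"
    consider "v = k" | "v \<noteq> k" "v \<in> reach k" | "v \<notin> reach k" by blast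
    then show "y \<in> rad_space Q X v"
    proof cases
      case 1
      then show ?thesis unfolding mem_rad_space_iff[OF X v] using y by (intro conjI exI[of _ "\<lambda>_. 0"]) auto
    next
      case 2
      let ?p = "pth k v"
      have p: "dpath Q k ?p v" "\<not> in_I Q ?p" using reachD[OF 2(2)] by auto
      then have "?p \<noteq> []" using 2(1) by (cases ?p) auto
      then obtain q \<alpha> where q: "?p = q @ [\<alpha>]" by (metis rev_exhaust)
      then have \<alpha>: "\<alpha> \<in> Q1 Q" "dpath Q k q (src Q \<alpha>)" "tgt Q \<alpha> = v" using p(1) by (auto simp: dpath_snoc)
      have s: "src Q \<alpha> \<in> reach k" using \<alpha>(2) p(2) q in_I_append1 unfolding reach_def by fastforce
      have s0: "src Q \<alpha> \<in> Q0 Q" using arrow_ends[OF \<alpha>(1)] by blast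
      have fy: "fits (rdim X v) 1 (icol y)" using y by auto
      define z where "z = \<psi> (src Q \<alpha>) * (\<phi> v * icol y)"
      have fv: "fits 1 (rdim X v) (\<phi> v)" using ihom_fits[OF \<phi> v] 2 v by (simp add: rdim_thin)
      have z: "fits (rdim X (src Q \<alpha>)) 1 z"
        unfolding z_def using fits_times[OF ihom_fits[OF \<psi> s0], of 1 "\<phi> v * icol y"] fits_times[OF fv fy] s s0
        by (simp add: rdim_thin)
      have "amap X \<alpha> * z = \<psi> v * amap (thin (reach k)) \<alpha> * (\<phi> v * icol y)"
        unfolding z_def using ihom_commute[OF \<psi> \<alpha>(1)] \<alpha>(3) by (simp add: mult.assoc[symmetric])
      also have "\<dots> = \<psi> v * (\<one>\<^sub>i 1 * (\<phi> v * icol y))" using s 2 \<alpha>(3) by (simp add: amap_thin[OF \<alpha>(1)] mult.assoc)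
      also have "\<dots> = (\<psi> v * \<phi> v) * icol y" using fits_times[OF fv fy] by (simp add: fits_def mult.assoc)
      also have "\<dots> = icol y" using inv[OF v] fy by (simp add: fits_def)
      finally have "vec_of (rdim X (tgt Q \<alpha>)) (amap X \<alpha> * z) = y"
        using y \<alpha>(3) icol_inject[of "vec_of (rdim X v) (icol y)" _ y] fy by auto
      then show ?thesis using amap_in_rad_space[OF X \<alpha>(1) z] \<alpha>(3) by simp
    next
      case 3
      then have "fits 0 (rdim X v) (\<phi> v)" using ihom_fits[OF \<phi> v] v by (simp add: rdim_thin)
      then have "\<one>\<^sub>i (rdim X v) = (0 :: 'k imat)" using inv[OF v] fits_0_left by force
      then have "rdim X v = 0" using unit_neq_0 by blast
      then have "icol y = 0" using y fits_icol[of y 0] fits_0_left by auto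
      then show ?thesis unfolding mem_rad_space_iff[OF X v] using y by (intro conjI exI[of _ "\<lambda>_. 0"]) auto
    qed
  qed
qed

text \<open>The element \<open>n\<close> represents a nonzero socle element of the cokernel at
  \<open>k\<close>. The map P(k) \<rightarrow> N it defines sends the radical, which is thin on the
  support without \<open>k\<close>, into the image of f, and \<kappa> pulls this back to a
  homomorphism into M.\<close>

lemma almost_factorsI:
  fixes X :: "('v, 'a, 'k::field) qrep"
  assumes f: "is_hom Q M N f"
    and kap: "\<And>v. v \<in> Q0 Q \<Longrightarrow> fits (rdim M v) (rdim N v) (\<kappa> v) \<and> \<kappa> v * imat_of (f v) = \<one>\<^sub>i (rdim M v)"
    and X: "is_rep Q X" and k: "k \<in> Q0 Q"
    and \<phi>: "ihom Q X (thin (reach k)) \<phi>" and \<psi>: "ihom Q (thin (reach k)) X \<psi>"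
    and inv: "\<And>v. v \<in> Q0 Q \<Longrightarrow> \<psi> v * \<phi> v = \<one>\<^sub>i (rdim X v) \<and> \<phi> v * \<psi> v = \<one>\<^sub>i (rdim (thin (reach k) :: ('v, 'a, 'k) qrep) v)"
    and n: "fits (rdim N k) 1 n" "\<And>m. fits (rdim M k) 1 m \<Longrightarrow> n \<noteq> imat_of (f k) * m"
    and out: "\<And>\<alpha>. \<alpha> \<in> outA Q k \<Longrightarrow> \<exists>m. amap N \<alpha> * n = imat_of (f (tgt Q \<alpha>)) * m"
  shows "almost_factors Q X M N f"
proof -
  note rM = is_homD(1)[OF f] and rN = is_homD(2)[OF f]
  let ?P = "thin (reach k) :: ('v, 'a, 'k) qrep"
  define T where "T = reach k - {k}"
  let ?R = "thin T :: ('v, 'a, 'k) qrep"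
  have rP: "is_rep Q ?P" by (rule thin_is_rep[OF restr_zero_reach])
  have rR: "is_rep Q ?R" by (rule thin_is_rep[OF restr_zero_subset[OF restr_zero_reach]]) (auto simp: T_def)
  define F where "F v = imat_of (f v)" for v
  have F: "ihom Q M N F" unfolding F_def by (rule is_hom_ihom[OF f])
  have kF: "\<kappa> v * F v = \<one>\<^sub>i (rdim M v)" if "v \<in> Q0 Q" for v using kap[OF that] by (simp add: F_def)
  have Fk: "F v * (\<kappa> v * (F v * m)) = F v * m" if "v \<in> Q0 Q" for v m
  proof -
    have "F v * (\<kappa> v * (F v * m)) = F v * (\<kappa> v * F v) * m" by (simp only: mult.assoc)
    then show ?thesis using kF[OF that] ihom_fits[OF F that] by (simp add: fits_def)
  qed
  define i where "i v = (if v \<in> T then \<one>\<^sub>i 1 else (0 :: 'k imat))" for v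
  have hi: "ihom Q ?R ?P i" unfolding i_def
    by (rule thin_hom_out) (use no_arrow_into_root in \<open>auto simp: T_def rdim_thin amap_thin\<close>)
  define H where "H v = (if v \<in> reach k then pmap Q N k (pth k v) * n else 0)" for v
  have HH: "ihom Q ?P N H" unfolding H_def by (rule proj_hom[OF rN k n(1)])
  have Hk: "H k = n" using n(1) k by (simp add: H_def fits_def)
  have HT: "\<exists>m. H v = F v * m" if v: "v \<in> T" for v
  proof -
    let ?p = "pth k v"
    have p: "dpath Q k ?p v" using v reachD by (auto simp: T_def)
    have "?p \<noteq> []" using p v by (cases ?p) (auto simp: T_def)
    then obtain \<alpha> q where q: "?p = \<alpha> # q" by (cases ?p) auto
    have \<alpha>: "\<alpha> \<in> Q1 Q" "\<alpha> \<in> outA Q k" "dpath Q (tgt Q \<alpha>) q v" using p q by (auto simp: outA_def)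
    obtain m where m: "amap N \<alpha> * n = F (tgt Q \<alpha>) * m" using out[OF \<alpha>(2)] by (auto simp: F_def)
    have "H v = pmap Q N (tgt Q \<alpha>) q * (amap N \<alpha> * n)" using v q by (simp add: H_def T_def mult.assoc)
    also have "\<dots> = F v * (pmap Q M (tgt Q \<alpha>) q * m)"
      unfolding m using ihom_pmap[OF F arrow_ends(2)[OF \<alpha>(1)] \<alpha>(3)] by (simp add: mult.assoc[symmetric])
    finally show ?thesis by blast
  qed
  have FkH: "F v * (\<kappa> v * H v) = H v" if "v \<in> T" "v \<in> Q0 Q" for v
    using HT[OF that(1)] Fk[OF that(2)] by auto
  have T0: "v \<in> T \<Longrightarrow> v \<in> reach k" for v by (simp add: T_def)
  define G where "G v = (if v \<in> T then \<kappa> v * H v else 0)" for v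
  have HG: "ihom Q ?R M G" unfolding G_def
  proof (rule thin_hom_out)
    show "fits (rdim M v) 1 (\<kappa> v * H v)" if "v \<in> T" "v \<in> Q0 Q" for v
      using fits_times[OF conjunct1[OF kap[OF that(2)]] ihom_fits[OF HH that(2)]] T0[OF that(1)] that(2) by (simp add: rdim_thin)
    fix \<alpha> assume \<alpha>: "\<alpha> \<in> Q1 Q" "src Q \<alpha> \<in> T"
    let ?s = "src Q \<alpha>" and ?t = "tgt Q \<alpha>"
    note s = arrow_ends(1)[OF \<alpha>(1)] and t = arrow_ends(2)[OF \<alpha>(1)]
    have "amap M \<alpha> * (\<kappa> ?s * H ?s) = (\<kappa> ?t * F ?t) * (amap M \<alpha> * (\<kappa> ?s * H ?s))"
      using kF[OF t] fits_amap[OF rM \<alpha>(1)] by (simp add: fits_def mult.assoc[symmetric])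
    also have "\<dots> = \<kappa> ?t * ((F ?t * amap M \<alpha>) * (\<kappa> ?s * H ?s))" by (simp only: mult.assoc)
    also have "\<dots> = \<kappa> ?t * (amap N \<alpha> * (F ?s * (\<kappa> ?s * H ?s)))" unfolding ihom_commute[OF F \<alpha>(1)] by (simp only: mult.assoc)
    also have "\<dots> = \<kappa> ?t * (H ?t * amap ?P \<alpha>)" unfolding FkH[OF \<alpha>(2) s] ihom_commute[OF HH \<alpha>(1)] ..
    also have "\<dots> = (if ?t \<in> T then \<kappa> ?t * H ?t else 0)"
      using T0[OF \<alpha>(2)] no_arrow_into_root[OF \<alpha>(1)] ihom_fits[OF HH t] t
      by (auto simp: amap_thin[OF \<alpha>(1)] T_def rdim_thin fits_def)
    finally show "amap M \<alpha> * (\<kappa> ?s * H ?s) = (if ?t \<in> T then \<kappa> ?t * H ?t else 0)" .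
  qed
  define j where "j = hmat ?R X (\<lambda>v. \<psi> v * i v)"
  have hj: "ihom Q ?R X (\<lambda>v. \<psi> v * i v)" by (rule ihom_comp[OF hi \<psi>])
  have jj: "is_hom Q ?R X j" unfolding j_def by (rule hmat_is_hom[OF rR X hj])
  have ij: "imat_of (j v) = \<psi> v * i v" if "v \<in> Q0 Q" for v unfolding j_def by (rule imat_of_hmat[OF hj that])
  have hh: "ihom Q X N (\<lambda>v. H v * \<phi> v)" by (rule ihom_comp[OF \<phi> HH])
  let ?h = "hmat X N (\<lambda>v. H v * \<phi> v)"
  have h: "is_hom Q X N ?h" by (rule hmat_is_hom[OF X rN hh])
  have ih: "imat_of (?h v) = H v * \<phi> v" if "v \<in> Q0 Q" for v by (rule imat_of_hmat[OF hh that])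
  have g: "is_hom Q ?R M (hmat ?R M G)" by (rule hmat_is_hom[OF rR rM HG])
  have "rad_incl Q X ?R j"
    unfolding rad_incl_def
  proof (intro conjI ballI jj)
    show "injective_hom Q ?R X j"
    proof (rule injective_homI[OF jj])
      fix v assume v: "v \<in> Q0 Q"
      have "\<phi> v * imat_of (j v) = (\<phi> v * \<psi> v) * i v" using ij[OF v] by (simp add: mult.assoc)
      also have "\<dots> = i v" using inv[OF v] ihom_fits[OF hi v] by (simp add: fits_def)
      also have "\<dots> = \<one>\<^sub>i (rdim ?R v)" using v by (simp add: i_def rdim_thin)
      finally show "\<exists>l. l * imat_of (j v) = \<one>\<^sub>i (rdim ?R v)" by blast
    qed
    fix v assume v: "v \<in> Q0 Q"
    have "y \<in> img j ?R v \<longleftrightarrow> y \<in> rad_space Q X v" for y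
    proof -
    have rad: "y \<in> rad_space Q X v \<longleftrightarrow> y \<in> carrier_vec (rdim X v) \<and> (v = k \<longrightarrow> icol y = 0)"
      by (rule mem_rad_space_thin_reach_iso[OF X k \<phi> \<psi> _ v]) (use inv in blast)
    have "(\<exists>z. fits (rdim ?R v) 1 z \<and> icol y = imat_of (j v) * z) \<longleftrightarrow> (v = k \<longrightarrow> icol y = 0)"
      if y: "y \<in> carrier_vec (rdim X v)"
    proof
      assume "\<exists>z. fits (rdim ?R v) 1 z \<and> icol y = imat_of (j v) * z"
      then show "v = k \<longrightarrow> icol y = 0" using ij[OF v] by (auto simp: i_def T_def)
    next
      assume r: "v = k \<longrightarrow> icol y = 0"
      have fy: "fits (rdim X v) 1 (icol y)" using y by auto
      show "\<exists>z. fits (rdim ?R v) 1 z \<and> icol y = imat_of (j v) * z"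
      proof (cases "v \<in> T")
        case True
        have "fits (rdim ?R v) 1 (\<phi> v * icol y)"
          using fits_times[OF ihom_fits[OF \<phi> v] fy] T0[OF True] True v by (simp add: rdim_thin)
        moreover have "imat_of (j v) * (\<phi> v * icol y) = \<psi> v * \<phi> v * icol y"
          using calculation ij[OF v] True v by (simp add: i_def mult.assoc fits_def rdim_thin)
        ultimately show ?thesis using inv[OF v] fy by (metis fits_unitD(1))
      next
        case False
        have "icol y = 0"
        proof (cases "v = k")
          case False
          then have "fits 0 (rdim X v) (\<phi> v)" using \<open>v \<notin> T\<close> ihom_fits[OF \<phi> v] v by (simp add: T_def rdim_thin)
          then have "\<one>\<^sub>i (rdim X v) = (0 :: 'k imat)" using inv[OF v] fits_0_left by force
          then have "rdim X v = 0" using unit_neq_0 by blast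
          then show ?thesis using fy fits_0_left by auto
        qed (use r in blast)
        then show ?thesis by (intro exI[of _ 0]) simp
      qed
    qed
    then show ?thesis
      unfolding mem_img_iff[of j v "rdim X v" ?R, OF is_homD(3)[OF jj v]] rad by blast
    qed
    then show "img j ?R v = rad_space Q X v" by blast
  qed
  moreover have "hom_eq Q (hcomp ?h j) (hcomp f (hmat ?R M G))"
  proof -
    have fc: "hcomp f (hmat ?R M G) w \<in> carrier_mat (rdim N w) (rdim ?R w)" if "w \<in> Q0 Q" for w
      unfolding hcomp_def by (rule mult_carrier_mat[OF is_homD(3)[OF f that] is_homD(3)[OF g that]])
    have "imat_of (?h v) * imat_of (j v) = imat_of (hcomp f (hmat ?R M G) v)" if v: "v \<in> Q0 Q" for v
    proof -
      have "imat_of (?h v) * imat_of (j v) = H v * (\<phi> v * \<psi> v) * i v"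
        unfolding ih[OF v] ij[OF v] by (simp only: mult.assoc)
      also have "\<dots> = H v * i v" using inv[OF v] ihom_fits[OF HH v] by (simp add: fits_def)
      also have "\<dots> = F v * G v"
        using FkH[of v] v ihom_fits[OF HH v] T0[of v] by (auto simp: i_def G_def rdim_thin fits_def)
      also have "\<dots> = imat_of (hcomp f (hmat ?R M G) v)"
        unfolding hcomp_def imat_of_mult[OF is_homD(3)[OF f v] is_homD(3)[OF g v]] F_def imat_of_hmat[OF HG v] ..
      finally show ?thesis .
    qed
    then show ?thesis by (subst hom_eq_comp_iff[OF jj h]) (auto intro: fc)
  qed
  moreover have "\<not> (\<forall>v\<in>Q0 Q. img ?h X v \<subseteq> img f M v)"
  proof
    assume s: "\<forall>v\<in>Q0 Q. img ?h X v \<subseteq> img f M v"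
    have fp: "fits (rdim X k) 1 (\<psi> k)" using ihom_fits[OF \<psi> k] k by (simp add: rdim_thin)
    have "imat_of (?h k) * \<psi> k = n * (\<phi> k * \<psi> k)" unfolding ih[OF k] Hk by (simp only: mult.assoc)
    then have "imat_of (?h k) * \<psi> k = n" using inv[OF k] n(1) k by (simp add: rdim_thin fits_def)
    then have "vec_of (rdim N k) n \<in> img ?h X k"
      unfolding mem_img_iff[of ?h k "rdim N k" X, OF is_homD(3)[OF h k]] using fp n(1) by auto
    then have "vec_of (rdim N k) n \<in> img f M k" using s k by blast
    then show False unfolding mem_img_iff[of f k "rdim N k" M, OF is_homD(3)[OF f k]] using n by auto
  qed
  ultimately show ?thesis unfolding almost_factors_def using h g by blast
qed

text \<open>An injective f stays injective on the summand \<open>B2\<close>, so the kernel is zero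
  and has no indecomposable summand.\<close>

lemma no_intrinsic_kernel:
  fixes M :: "('v, 'a, 'k::field) qrep"
  assumes f: "is_hom Q M N f" and kap: "\<And>v. v \<in> Q0 Q \<Longrightarrow> \<kappa> v * imat_of (f v) = \<one>\<^sub>i (rdim M v)"
  shows "\<not> intrinsic_kernel_summand Q M N f L"
proof
  assume "intrinsic_kernel_summand Q M N f L"
  then obtain B1 i1 p1 B2 i2 p2 K k where L: "indecomposable Q L" and bp: "biproduct Q M B1 i1 p1 B2 i2 p2"
    and kk: "kernel_of Q B2 N (hcomp f i2) K k" and ds: "direct_summand Q L K"
    unfolding intrinsic_kernel_summand_def by blast
  have i2: "is_hom Q B2 M i2" "is_hom Q M B2 p2" "hom_eq Q (hcomp p2 i2) (hid B2)" using bp by (auto simp: biproduct_def)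
  have pi: "imat_of (p2 v) * imat_of (i2 v) = \<one>\<^sub>i (rdim B2 v)" if "v \<in> Q0 Q" for v
    using iffD1[OF hom_eq_comp_hid_iff[OF i2(1,2)] i2(3)] that by blast
  have K0: "rdim K v = 0" if v: "v \<in> Q0 Q" for v
  proof (rule ccontr)
    assume nz: "rdim K v \<noteq> 0"
    have hk: "is_hom Q K B2 k" and inj: "injective_hom Q K B2 k" and im: "img k K v = ker (hcomp f i2) B2 N v"
      using kk v by (auto simp: kernel_of_def)
    note fi = is_homD(3)[OF f v] is_homD(3)[OF i2(1) v] and kv = is_homD(3)[OF hk v]
    have fc: "hcomp f i2 v \<in> carrier_mat (rdim N v) (rdim B2 v)" unfolding hcomp_def by (rule mult_carrier_mat[OF fi])
    have kz: "x = 0\<^sub>v (rdim B2 v)" if x: "x \<in> ker (hcomp f i2) B2 N v" for x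
    proof (rule icol_inject)
      have xc: "x \<in> carrier_vec (rdim B2 v)" "hcomp f i2 v *\<^sub>v x = 0\<^sub>v (rdim N v)" using x by (auto simp: ker_def)
      show "x \<in> carrier_vec (rdim B2 v)" by (rule xc(1))
      have z: "imat_of (f v) * imat_of (i2 v) * icol x = 0"
        using icol_mult[OF fc xc(1)] xc(2) imat_of_mult[OF fi] by (simp add: hcomp_def)
      have "imat_of (p2 v) * (\<kappa> v * imat_of (f v)) * imat_of (i2 v) * icol x =
          imat_of (p2 v) * \<kappa> v * (imat_of (f v) * imat_of (i2 v) * icol x)" by (simp only: mult.assoc)
      then have "imat_of (p2 v) * \<one>\<^sub>i (rdim M v) * imat_of (i2 v) * icol x = 0" using kap[OF v] z by simp
      then show "icol x = icol (0\<^sub>v (rdim B2 v))"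
        using pi[OF v] fits_icol[OF xc(1)] ihom_fits[OF is_hom_ihom[OF i2(2)] v] by (simp add: fits_def)
    qed simp
    define u :: "'k vec" where "u = unit_vec (rdim K v) 0"
    have u: "u \<in> carrier_vec (rdim K v)" "u \<noteq> (0\<^sub>v (rdim K v))"
      using nz by (auto simp: u_def)
    have "k v *\<^sub>v u \<in> img k K v" using u by (auto simp: img_def)
    then have "k v *\<^sub>v u = 0\<^sub>v (rdim B2 v)" using kz im by blast
    then have "u \<in> ker k K B2 v" using u by (simp add: ker_def)
    then show False using inj v u(2) by (auto simp: injective_hom_def)
  qed
  obtain L' a b c d where bp: "biproduct Q K L a b L' c d" using ds unfolding direct_summand_def by blast
  then have ab: "is_hom Q L K a" "is_hom Q K L b" "hom_eq Q (hcomp b a) (hid L)" by (auto simp: biproduct_def)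
  have "rdim L v = 0" if v: "v \<in> Q0 Q" for v
  proof (rule ccontr)
    assume "rdim L v \<noteq> 0"
    have "imat_of (a v) = 0" using ihom_fits[OF is_hom_ihom[OF ab(1)] v] K0[OF v] fits_0_left by force
    then have "\<one>\<^sub>i (rdim L v) = (0 :: 'k imat)"
      using iffD1[OF hom_eq_comp_hid_iff[OF ab(1,2)] ab(3)] v by (metis mult_zero_right)
    then show False using \<open>rdim L v \<noteq> 0\<close> unit_neq_0 by blast
  qed
  then show False using L by (simp add: indecomposable_def zero_rep_def)
qed

text \<open>An almost split sequence ending in a projective module would split.\<close>

lemma projective_not_tau_inv:
  assumes "projective Q X"
  shows "\<not> tau_inv_of Q X L"
proof
  assume "tau_inv_of Q X L"
  then obtain E u w where "almost_split_seq Q L E X u w" unfolding tau_inv_of_def by blast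
  then have w: "is_hom Q E X w" "surjective_hom Q E X w" "\<not> split_epi Q E X w"
    by (auto simp: almost_split_seq_def short_exact_def right_almost_split_def)
  have "is_hom Q X X (hmat X X (\<lambda>v. \<one>\<^sub>i (rdim X v)))"
    using hmat_is_hom ihom_id is_homD(2)[OF w(1)] by blast
  then obtain g where g: "is_hom Q X E g" "hom_eq Q (hcomp w g) (hmat X X (\<lambda>v. \<one>\<^sub>i (rdim X v)))"
    using assms w unfolding projective_def by blast
  have "\<forall>v\<in>Q0 Q. imat_of (w v) * imat_of (g v) = \<one>\<^sub>i (rdim X v)"
    using iffD1[OF hom_eq_comp_iff[OF g(1) w(1)] g(2)] imat_of_hmat[OF ihom_id[OF is_homD(2)[OF w(1)]]]
    by (simp add: hmat_def)
  then have "split_epi Q E X w" using split_epi_iff[OF w(1)] is_hom_ihom[OF g(1)] by blast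
  then show False using w(3) by blast
qed

lemma isomorphic_iff:
  assumes X: "is_rep Q X" and Y: "is_rep Q Y"
  shows "isomorphic Q X Y \<longleftrightarrow> (\<exists>\<phi> \<psi>. ihom Q X Y \<phi> \<and> ihom Q Y X \<psi> \<and>
    (\<forall>v\<in>Q0 Q. \<psi> v * \<phi> v = \<one>\<^sub>i (rdim X v) \<and> \<phi> v * \<psi> v = \<one>\<^sub>i (rdim Y v)))" (is "_ \<longleftrightarrow> ?R")
proof
  assume "isomorphic Q X Y"
  then obtain f g where f: "is_hom Q X Y f" and g: "is_hom Q Y X g"
    and e: "hom_eq Q (hcomp g f) (hid X)" "hom_eq Q (hcomp f g) (hid Y)"
    unfolding isomorphic_def iso_hom_def by blast
  then show ?R
    using is_hom_ihom[OF f] is_hom_ihom[OF g] hom_eq_comp_hid_iff[OF f g] hom_eq_comp_hid_iff[OF g f] by blast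
next
  assume ?R
  then obtain \<phi> \<psi> where p: "ihom Q X Y \<phi>" "ihom Q Y X \<psi>"
    "\<forall>v\<in>Q0 Q. \<psi> v * \<phi> v = \<one>\<^sub>i (rdim X v) \<and> \<phi> v * \<psi> v = \<one>\<^sub>i (rdim Y v)" by blast
  note f = hmat_is_hom[OF X Y p(1)] and g = hmat_is_hom[OF Y X p(2)]
  have "hom_eq Q (hcomp (hmat Y X \<psi>) (hmat X Y \<phi>)) (hid X)" "hom_eq Q (hcomp (hmat X Y \<phi>) (hmat Y X \<psi>)) (hid Y)"
    unfolding hom_eq_comp_hid_iff[OF f g] hom_eq_comp_hid_iff[OF g f]
    using p(3) imat_of_hmat[OF p(1)] imat_of_hmat[OF p(2)] by auto
  then show "isomorphic Q X Y" unfolding isomorphic_def iso_hom_def using f g by blast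
qed

end

section \<open>Ends of hooks belong to Det\<close>

lemma unit_1_neq_0 [simp]: "\<one>\<^sub>i 1 \<noteq> (0 :: 'a::comm_ring_1 imat)"
  by (rule unit_neq_0) simp

lemma dpath_end_unique: "dpath Q a p b \<Longrightarrow> dpath Q a p c \<Longrightarrow> b = c"
  by (induction p arbitrary: a) auto

lemma dpath_extension:
  assumes "dpath Q a p b" "dpath Q a (p @ \<alpha> # q) c"
  shows "\<alpha> \<in> outA Q b" "dpath Q a (p @ [\<alpha>]) (tgt Q \<alpha>)" "dpath Q (tgt Q \<alpha>) q c"
proof -
  obtain d where d: "dpath Q a p d" "dpath Q d (\<alpha> # q) c" using assms(2) by (auto simp: dpath_append)
  moreover have "d = b" by (rule dpath_end_unique[OF d(1) assms(1)])
  ultimately show "\<alpha> \<in> outA Q b" "dpath Q a (p @ [\<alpha>]) (tgt Q \<alpha>)" "dpath Q (tgt Q \<alpha>) q c"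
    by (auto simp: outA_def dpath_snoc)
qed

context string_tree
begin

text \<open>By \<open>string_out\<close> an arrow has at most one nonzero continuation, so nonzero
  paths with a common first arrow cannot diverge.\<close>

lemma nonzero_paths_comparable:
  assumes "dpath Q y p a" "dpath Q y q b" "\<not> in_I Q p" "\<not> in_I Q q" "p \<noteq> []" "q \<noteq> []" "hd p = hd q"
  shows "\<exists>r. q = p @ r \<or> p = q @ r"
  using assms
proof (induction p arbitrary: y q)
  case (Cons \<alpha> p)
  then obtain q' where q: "q = \<alpha> # q'" by (cases q) auto
  show ?case
  proof (cases "p = [] \<or> q' = []")
    case False
    then obtain \<beta> p' \<gamma> q'' where pq: "p = \<beta> # p'" "q' = \<gamma> # q''" by (meson neq_Nil_conv)
    have "\<not> in_I Q [\<alpha>, \<beta>]" "\<not> in_I Q [\<alpha>, \<gamma>]"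
      using Cons.prems(3,4) in_I_append1[of Q "[\<alpha>, \<beta>]" p'] in_I_append1[of Q "[\<alpha>, \<gamma>]" q''] pq q by auto
    then have "\<beta> = \<gamma>" using string_out[of \<beta> \<gamma> \<alpha>] Cons.prems(1,2) pq q by auto
    then have "\<exists>r. q' = p @ r \<or> p = q' @ r"
      using Cons.IH[of "tgt Q \<alpha>" q'] Cons.prems q pq in_I_Cons by fastforce
    then show ?thesis using q by auto
  qed (use q in auto)
qed simp

lemma projective_iso:
  fixes X :: "('v, 'a, 'k::field) qrep"
  assumes P: "projective Q P" and X: "is_rep Q X"
    and \<phi>: "ihom Q X P \<phi>" and \<psi>: "ihom Q P X \<psi>" and inv: "\<And>v. v \<in> Q0 Q \<Longrightarrow> \<psi> v * \<phi> v = \<one>\<^sub>i (rdim X v)"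
  shows "projective Q X"
  unfolding projective_def
proof (intro conjI allI impI X)
  have rP: "is_rep Q P" using P by (simp add: projective_def)
  fix E N w h assume "is_hom Q E N w \<and> surjective_hom Q E N w \<and> is_hom Q X N h"
  then have w: "is_hom Q E N w" "surjective_hom Q E N w" and h: "is_hom Q X N h" by auto
  have hp: "ihom Q P N (\<lambda>v. imat_of (h v) * \<psi> v)" by (rule ihom_comp[OF \<psi> is_hom_ihom[OF h]])
  note hpm = hmat_is_hom[OF rP is_homD(2)[OF h] hp]
  obtain g where g: "is_hom Q P E g" "hom_eq Q (hcomp w g) (hmat P N (\<lambda>v. imat_of (h v) * \<psi> v))"
    using P w hpm unfolding projective_def by blast
  have e: "imat_of (w v) * imat_of (g v) = imat_of (h v) * \<psi> v" if "v \<in> Q0 Q" for v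
    using iffD1[OF hom_eq_comp_iff[OF g(1) w(1) is_homD(3)[OF hpm]] g(2)] imat_of_hmat[OF hp that] that by simp
  have gp: "ihom Q X E (\<lambda>v. imat_of (g v) * \<phi> v)" by (rule ihom_comp[OF \<phi> is_hom_ihom[OF g(1)]])
  note gpm = hmat_is_hom[OF X is_homD(2)[OF g(1)] gp]
  have "imat_of (w v) * imat_of (hmat X E (\<lambda>v. imat_of (g v) * \<phi> v) v) = imat_of (h v)" if v: "v \<in> Q0 Q" for v
  proof -
    have "imat_of (w v) * (imat_of (g v) * \<phi> v) = imat_of (h v) * (\<psi> v * \<phi> v)"
      using e[OF v] by (simp add: mult.assoc[symmetric])
    then show ?thesis
      using inv[OF v] ihom_fits[OF is_hom_ihom[OF h] v] imat_of_hmat[OF gp v] by (simp add: fits_def)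
  qed
  then have "hom_eq Q (hcomp w (hmat X E (\<lambda>v. imat_of (g v) * \<phi> v))) h"
    using hom_eq_comp_iff[OF gpm w(1) is_homD(3)[OF h]] by blast
  then show "\<exists>g. is_hom Q X E g \<and> hom_eq Q (hcomp w g) h" using gpm by blast
qed

text \<open>Projectivity of \<open>X\<close> lifts \<theta> along P(i) \<rightarrow> S(i) to a map
  \<open>r\<close> into P(i), and \<open>x\<close> defines a map back. Their composite on P(i) fixes
  the generator, so P(i) is a nonzero retract of the indecomposable \<open>X\<close>.\<close>

lemma almost_factors_imp_isomorphic:
  fixes X :: "('v, 'a, 'k::field) qrep"
  assumes X: "indecomposable Q X" "projective Q X" and i: "i \<in> Q0 Q"
    and \<theta>: "ihom Q X (simple_rep Q i) \<theta>" and x: "fits (rdim X i) 1 x" "\<theta> i * x = \<one>\<^sub>i 1"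
  shows "isomorphic Q X (thin (reach i))"
proof -
  let ?P = "thin (reach i) :: ('v, 'a, 'k) qrep" and ?S = "simple_rep Q i :: ('v, 'a, 'k) qrep"
  have rX: "is_rep Q X" using X by (simp add: indecomposable_def)
  have rP: "is_rep Q ?P" by (rule thin_is_rep[OF restr_zero_reach])
  note S = simple_rep_facts[OF i]
  define \<pi> where "\<pi> v = (if v = i then \<one>\<^sub>i 1 else (0 :: 'k imat))" for v
  have \<pi>: "ihom Q ?P ?S \<pi>" unfolding \<pi>_def by (rule thin_reach_to_simple[OF i])
  note \<pi>m = hmat_is_hom[OF rP S(1) \<pi>]
  have "surjective_hom Q ?P ?S (hmat ?P ?S \<pi>)"
  proof (rule surjective_homI[OF \<pi>m])
    fix v c assume v: "v \<in> Q0 Q" and c: "fits (rdim ?S v) 1 (c :: 'k imat)"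
    show "\<exists>z. fits (rdim ?P v) 1 z \<and> imat_of (hmat ?P ?S \<pi> v) * z = c"
    proof (cases "v = i")
      case True
      then show ?thesis using c i by (intro exI[of _ c]) (simp add: S rdim_thin imat_of_hmat[OF \<pi>] \<pi>_def fits_def)
    next
      case False
      then have "c = 0" using c fits_0_left by (simp add: S)
      then show ?thesis by (intro exI[of _ 0]) simp
    qed
  qed
  moreover note \<theta>m = hmat_is_hom[OF rX S(1) \<theta>]
  ultimately obtain r where r: "is_hom Q X ?P r" "hom_eq Q (hcomp (hmat ?P ?S \<pi>) r) (hmat X ?S \<theta>)"
    using X(2) \<pi>m unfolding projective_def by blast
  have "imat_of (hmat ?P ?S \<pi> i) * imat_of (r i) = imat_of (hmat X ?S \<theta> i)"
    using iffD1[OF hom_eq_comp_iff[OF r(1) \<pi>m is_homD(3)[OF \<theta>m]] r(2)] i by blast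
  then have ri: "imat_of (r i) = \<theta> i"
    using imat_of_hmat[OF \<pi> i] imat_of_hmat[OF \<theta> i] ihom_fits[OF is_hom_ihom[OF r(1)] i] i
    by (simp add: \<pi>_def rdim_thin fits_def)
  define e where "e v = (if v \<in> reach i then pmap Q X i (pth i v) * x else 0)" for v
  have e: "ihom Q ?P X e" unfolding e_def by (rule proj_hom[OF rX i x(1)])
  have ei: "e i = x" using x(1) by (simp add: e_def fits_def)
  have re: "imat_of (r v) * e v = \<one>\<^sub>i (rdim ?P v)" if v: "v \<in> Q0 Q" for v
  proof -
    have "imat_of (r i) * e i = \<one>\<^sub>i (rdim ?P i)" using ri ei x(2) i by (simp add: rdim_thin)
    from thin_hom_unique[OF ihom_comp[OF e is_hom_ihom[OF r(1)]] ihom_id[OF rP] i this reach_root v]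
    show ?thesis by simp
  qed
  have "indecomposable Q ?P" by (rule thin_reach_indecomposable[OF i])
  then have "\<not> zero_rep Q ?P" by (simp add: indecomposable_def)
  then have "e v * imat_of (r v) = \<one>\<^sub>i (rdim X v)" if "v \<in> Q0 Q" for v
    using retract_of_indecomposable[OF X(1) _ e is_hom_ihom[OF r(1)] re that] by blast
  then show ?thesis unfolding isomorphic_iff[OF rX rP]
    using re e is_hom_ihom[OF r(1)] by (intro exI[of _ "\<lambda>v. imat_of (r v)"] exI[of _ e]) auto
qed

theorem hook_end_imp_P_in_Det:
  assumes i: "i \<in> Q0 Q" and hook: "hook_end Q i"
  shows "P_in_Det TYPE('k::field) Q i"
proof -
  \<comment> \<open>Both cases of \<open>hook_end\<close> are merged: for a single arrow \<beta> at
    \<open>i\<close> the path is trivial, the submodule generated by \<beta> is the radical of P(i),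
    and the cokernel is S(i).\<close>
  have "\<exists>y p \<beta>. dpath Q y p i \<and> \<not> in_I Q p \<and> \<beta> \<in> outA Q y \<and> (p = [] \<and> outA Q y = {\<beta>} \<or> p \<noteq> [] \<and> \<beta> \<noteq> hd p \<and>
      (\<forall>\<alpha>\<in>outA Q i. in_I Q (p @ [\<alpha>])))"
    using hook unfolding hook_end_def
  proof
    assume "card (outA Q i) = 1"
    then obtain \<beta> where "outA Q i = {\<beta>}" by (auto simp: card_1_singleton_iff One_nat_def)
    then show ?thesis by (intro exI[of _ i] exI[of _ "[]"] exI[of _ \<beta>]) simp
  qed blast
  then obtain y p \<beta> where p: "dpath Q y p i" "\<not> in_I Q p" and \<beta>: "\<beta> \<in> outA Q y"
    and pb: "p = [] \<and> outA Q y = {\<beta>} \<or> p \<noteq> [] \<and> \<beta> \<noteq> hd p \<and> (\<forall>\<alpha>\<in>outA Q i. in_I Q (p @ [\<alpha>]))" by blast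
  have y: "y \<in> Q0 Q" by (rule dpath_start[OF i p(1)])
  define T where "T = reach y"
  \<comment> \<open>The support of the submodule of P(y) generated by \<beta>: a nonzero path from
    \<open>y\<close> belongs to it iff it starts with \<beta>.\<close>
  define B where "B = {v \<in> T. pth y v \<noteq> [] \<and> hd (pth y v) = \<beta>}"
  have BT: "v \<in> B \<Longrightarrow> v \<in> T" for v by (simp add: B_def)
  have yB: "y \<notin> B" by (simp add: B_def)
  have yT: "y \<in> T" by (simp add: T_def)
  have ipth: "pth y i = p" by (rule pth_eq[OF p(1)])
  have iT: "i \<in> T" using p by (auto simp: T_def reach_def)
  have iB: "i \<notin> B" using pb by (auto simp: B_def ipth)
  have succ: "pth y (tgt Q \<alpha>) = pth y (src Q \<alpha>) @ [\<alpha>]" if "\<alpha> \<in> Q1 Q" "src Q \<alpha> \<in> T" for \<alpha>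
    using that reachD[of "src Q \<alpha>" y] by (intro pth_eq) (simp add: T_def dpath_snoc)
  have Bsucc: "tgt Q \<alpha> \<in> T \<longleftrightarrow> tgt Q \<alpha> \<in> B" if "\<alpha> \<in> Q1 Q" "src Q \<alpha> \<in> B" for \<alpha>
    using succ[OF that(1) BT[OF that(2)]] that(2) by (auto simp: B_def)
  have Bpred: "src Q \<alpha> = y \<or> src Q \<alpha> \<in> B" if "\<alpha> \<in> Q1 Q" "src Q \<alpha> \<in> T" "tgt Q \<alpha> \<in> B" for \<alpha>
  proof (cases "pth y (src Q \<alpha>) = []")
    case True
    then show ?thesis using reachD[of "src Q \<alpha>" y] that(2) by (auto simp: T_def)
  next
    case False
    then show ?thesis using succ[OF that(1,2)] that(2,3) by (simp add: B_def)
  qed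
  text \<open>The cokernel is uniserial: its socle sits at \<open>i\<close>.\<close>
  have socle: "v = i" if v: "v \<in> T" "v \<notin> B" and out: "\<And>\<alpha>. \<alpha> \<in> outA Q v \<Longrightarrow> tgt Q \<alpha> \<in> T \<Longrightarrow> tgt Q \<alpha> \<in> B" for v
  proof -
    define q where "q = pth y v"
    have q: "dpath Q y q v" "\<not> in_I Q q" using reachD v(1) by (auto simp: T_def q_def)
    have qb: "q = [] \<or> hd q \<noteq> \<beta>" using v by (auto simp: B_def q_def)
    have noext: False if s0: "s \<noteq> []" and sd: "dpath Q y (q @ s) w" and sI: "\<not> in_I Q (q @ s)" and sb: "hd (q @ s) \<noteq> \<beta>" for s w
    proof -
      obtain \<alpha> s' where s: "s = \<alpha> # s'" using s0 by (cases s) auto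
      have d: "dpath Q y (q @ [\<alpha>]) (tgt Q \<alpha>)" "\<alpha> \<in> outA Q v"
        using dpath_extension[OF q(1), of \<alpha> s' w] sd by (auto simp: s)
      have nI: "\<not> in_I Q (q @ [\<alpha>])" using sI in_I_append1[of Q "q @ [\<alpha>]" s'] by (auto simp: s)
      then have "tgt Q \<alpha> \<in> T" using d by (auto simp: T_def reach_def)
      then have "tgt Q \<alpha> \<in> B" using out d by blast
      then have "hd (q @ [\<alpha>]) = \<beta>" using pth_eq[OF d(1)] by (simp add: B_def)
      then show False using sb by (cases q) (auto simp: s)
    qed
    show ?thesis
    proof (cases "p = []")
      case True
      then have "q = []" using pb q qb hd_in_outA[OF q(1)] by auto
      then show ?thesis using True p q by simp
    next
      case False
      then have pb': "\<beta> \<noteq> hd p" "\<And>\<alpha>. \<alpha> \<in> outA Q i \<Longrightarrow> in_I Q (p @ [\<alpha>])" using pb by auto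
      have "q \<noteq> []" using noext[of p i] False p pb' by auto
      have "outA Q y = {\<beta>, hd p}" by (rule outA_other(1)[OF y \<beta> hd_in_outA[OF p(1) False] pb'(1)])
      then have "hd q = hd p" using hd_in_outA[OF q(1) \<open>q \<noteq> []\<close>] qb \<open>q \<noteq> []\<close> by blast
      then obtain r where r: "q = p @ r \<or> p = q @ r"
        using nonzero_paths_comparable[OF p(1) q(1) p(2) q(2) False \<open>q \<noteq> []\<close>] by auto
      have "r = []"
      proof (rule ccontr)
        assume "r \<noteq> []"
        from r show False
        proof
          assume pr: "p = q @ r"
          then show False using noext[OF \<open>r \<noteq> []\<close>, of i] p pb' by auto
        next
          assume qr: "q = p @ r"
          obtain \<alpha> r' where ra: "r = \<alpha> # r'" using \<open>r \<noteq> []\<close> by (cases r) auto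
          have "\<alpha> \<in> outA Q i" using dpath_extension(1)[OF p(1), of \<alpha> r' v] q(1) by (simp add: qr ra)
          then have "in_I Q (p @ [\<alpha>])" by (rule pb'(2))
          then show False using q(2) in_I_append1[of Q "p @ [\<alpha>]" r'] by (simp add: qr ra)
        qed
      qed
      then have "q = p" using r by auto
      then show ?thesis using dpath_end_unique q(1) p(1) by metis
    qed
  qed
  let ?N = "thin T :: ('v, 'a, 'k) qrep" and ?M = "thin B :: ('v, 'a, 'k) qrep"
  have rT: "restr_zero Q T" unfolding T_def by (rule restr_zero_reach)
  have rB: "restr_zero Q B" using restr_zero_subset[OF rT] BT by blast
  have rN: "is_rep Q ?N" and rM: "is_rep Q ?M" using thin_is_rep[OF rT] thin_is_rep[OF rB] by auto
  have iN: "indecomposable Q ?N" unfolding T_def by (rule thin_reach_indecomposable[OF y])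
  have \<beta>1: "\<beta> \<in> Q1 Q" "src Q \<beta> = y" using \<beta> by (auto simp: outA_def)
  have pb1: "pth y (tgt Q \<beta>) = [\<beta>]" using \<beta>1 by (intro pth_eq) simp
  have xB: "tgt Q \<beta> \<in> B" using \<beta>1 pb1 by (auto simp: B_def T_def reach_def intro!: exI[of _ "[\<beta>]"])
  have x0: "tgt Q \<beta> \<in> Q0 Q" using \<beta>1 arrow_ends by blast
  have rootB: "\<exists>q. dpath Q (tgt Q \<beta>) q v \<and> set (verts Q (tgt Q \<beta>) q) \<subseteq> B" if v: "v \<in> B" for v
  proof -
    have d: "dpath Q y (pth y v) v" "\<not> in_I Q (pth y v)" using reachD BT[OF v] by (auto simp: T_def)
    obtain q where q: "pth y v = \<beta> # q" using v by (cases "pth y v") (auto simp: B_def)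
    have "set (verts Q (tgt Q \<beta>) q) \<subseteq> B"
    proof
      fix w assume "w \<in> set (verts Q (tgt Q \<beta>) q)"
      moreover have dq: "dpath Q (tgt Q \<beta>) q v" using d(1) q by simp
      ultimately obtain u t where u: "q = u @ t" "dpath Q (tgt Q \<beta>) u w" using verts_split[OF dq] by blast
      have dw: "dpath Q y (\<beta> # u) w" using u \<beta>1 by simp
      have "\<not> in_I Q (\<beta> # u)" using d(2) in_I_append1[of Q "\<beta> # u" t] by (auto simp: q u)
      then show "w \<in> B" using dw pth_eq[OF dw] unfolding B_def T_def reach_def by (auto intro!: exI[of _ "\<beta> # u"])
    qed
    then show ?thesis using d q by auto
  qed
  have iM: "indecomposable Q ?M" by (rule thin_indecomposable[OF rB xB x0 rootB])
  define F where "F v = (if v \<in> B then \<one>\<^sub>i 1 else (0 :: 'k imat))" for v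
  have F: "ihom Q ?M ?N F" unfolding F_def
    by (rule thin_hom_out) (use BT Bsucc in \<open>auto simp: rdim_thin amap_thin\<close>)
  define f where "f = hmat ?M ?N F"
  have f: "is_hom Q ?M ?N f" unfolding f_def by (rule hmat_is_hom[OF rM rN F])
  have fF: "imat_of (f v) = F v" if "v \<in> Q0 Q" for v unfolding f_def by (rule imat_of_hmat[OF F that])
  have kF: "fits (rdim ?M v) (rdim ?N v) (F v) \<and> F v * imat_of (f v) = \<one>\<^sub>i (rdim ?M v)" if "v \<in> Q0 Q" for v
    using that BT by (auto simp: fF F_def rdim_thin)
  have irr: "irreducible Q ?M ?N f"
    unfolding irreducible_def
  proof (intro conjI allI impI f)
    show "\<not> split_mono Q ?M ?N f"
    proof
      assume "split_mono Q ?M ?N f"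
      then obtain \<psi> where \<psi>: "ihom Q ?N ?M \<psi>" "\<forall>v\<in>Q0 Q. \<psi> v * imat_of (f v) = \<one>\<^sub>i (rdim ?M v)"
        using split_mono_iff[OF f] by blast
      have "\<psi> y = 0" using ihom_fits[OF \<psi>(1) y] y yB fits_0_left by (simp add: rdim_thin)
      then have "\<psi> (tgt Q \<beta>) = 0" using thin_hom_unique[OF \<psi>(1) ihom_zero y _ _ x0] reach_root by (auto simp: T_def)
      then have "\<one>\<^sub>i (rdim ?M (tgt Q \<beta>)) = (0 :: 'k imat)" using \<psi>(2) x0 by fastforce
      then show False using xB x0 by (simp add: rdim_thin)
    qed
    show "\<not> split_epi Q ?M ?N f"
    proof
      assume "split_epi Q ?M ?N f"
      then obtain \<psi> where \<psi>: "\<forall>v\<in>Q0 Q. imat_of (f v) * \<psi> v = \<one>\<^sub>i (rdim ?N v)"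
        using split_epi_iff[OF f] by blast
      then have "\<one>\<^sub>i (rdim ?N y) = (0 :: 'k imat)" using y yB fF[OF y] by (metis F_def mult_zero_left)
      then show False using y yT by (simp add: rdim_thin)
    qed
    fix Z g h assume "is_hom Q ?M Z h \<and> is_hom Q Z ?N g \<and> hom_eq Q (hcomp g h) f"
    then have h: "is_hom Q ?M Z h" and g: "is_hom Q Z ?N g" and e: "hom_eq Q (hcomp g h) f" by auto
    define G where "G v = imat_of (g v)" for v
    have G: "ihom Q Z ?N G" unfolding G_def by (rule is_hom_ihom[OF g])
    have GH: "G v * imat_of (h v) = F v" if "v \<in> Q0 Q" for v
      using iffD1[OF hom_eq_comp_iff[OF h g is_homD(3)[OF f]] e] that fF by (simp add: G_def)
    show "split_mono Q ?M Z h \<or> split_epi Q Z ?N g"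
    proof (cases "G y = 0")
      case False
      \<comment> \<open>\<open>g\<close> reaches the top of P(y), so the generator has a preimage
        and \<open>g\<close> splits.\<close>
      have "fits 1 (rdim Z y) (G y)" using ihom_fits[OF G y] y yT by (simp add: rdim_thin)
      then obtain z where z: "fits (rdim Z y) 1 z" "G y * z = \<one>\<^sub>i 1" using nonzero_row_onto False by metis
      define s where "s v = (if v \<in> reach y then pmap Q Z y (pth y v) * z else 0)" for v
      have s: "ihom Q ?N Z s" unfolding s_def T_def by (rule proj_hom[OF is_homD(1)[OF g] y z(1)])
      have "G y * s y = \<one>\<^sub>i (rdim ?N y)" using z y yT by (simp add: s_def rdim_thin fits_def)
      then have "G v * s v = \<one>\<^sub>i (rdim ?N v)" if "v \<in> Q0 Q" for v
        using thin_hom_unique[OF ihom_comp[OF s G] ihom_id[OF rN] y _ _ that] reach_root by (auto simp: T_def)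
      then show ?thesis using split_epi_iff[OF g] s by (auto simp: G_def)
    next
      case True
      \<comment> \<open>Now \<open>g\<close> has image in the radical of P(y), which is the direct
        sum of the parts generated by the individual arrows at \<open>y\<close>; so cutting
        \<open>g\<close> down to the part on \<open>B\<close> is a homomorphism, and it retracts
        \<open>h\<close>.\<close>
      define \<psi> where "\<psi> v = (if v \<in> B then G v else 0)" for v
      have \<psi>: "ihom Q Z ?M \<psi>" unfolding \<psi>_def
      proof (rule thin_hom_in)
        show "fits 1 (rdim Z v) (G v)" if "v \<in> B" "v \<in> Q0 Q" for v
          using ihom_fits[OF G that(2)] that BT by (simp add: rdim_thin)
        fix \<alpha> assume \<alpha>: "\<alpha> \<in> Q1 Q" "tgt Q \<alpha> \<in> B"
        have "G (tgt Q \<alpha>) * amap Z \<alpha> = amap ?N \<alpha> * G (src Q \<alpha>)" by (rule ihom_commute[OF G \<alpha>(1)])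
        also have "\<dots> = (if src Q \<alpha> \<in> B then G (src Q \<alpha>) else 0)"
          using Bpred[OF \<alpha>(1) _ \<alpha>(2)] BT \<alpha> True ihom_fits[OF G arrow_ends(1)[OF \<alpha>(1)]] arrow_ends(1)[OF \<alpha>(1)]
          by (auto simp: amap_thin rdim_thin fits_def)
        finally show "G (tgt Q \<alpha>) * amap Z \<alpha> = (if src Q \<alpha> \<in> B then G (src Q \<alpha>) else 0)" .
      qed
      have "\<psi> v * imat_of (h v) = \<one>\<^sub>i (rdim ?M v)" if "v \<in> Q0 Q" for v
        using GH[OF that] that by (simp add: \<psi>_def rdim_thin F_def)
      then show ?thesis using split_mono_iff[OF h] \<psi> by blast
    qed
  qed
  let ?P = "thin (reach i) :: ('v, 'a, 'k) qrep"
  have rP: "is_rep Q ?P" by (rule thin_is_rep[OF restr_zero_reach])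
  have "in_Cf Q ?M ?N f X \<longleftrightarrow> isomorphic Q X ?P" if X: "indecomposable Q X" for X
  proof
    have rX: "is_rep Q X" using X by (simp add: indecomposable_def)
    assume "isomorphic Q X ?P"
    then obtain \<phi> \<psi> where iso: "ihom Q X ?P \<phi>" "ihom Q ?P X \<psi>"
      "\<forall>v\<in>Q0 Q. \<psi> v * \<phi> v = \<one>\<^sub>i (rdim X v) \<and> \<phi> v * \<psi> v = \<one>\<^sub>i (rdim ?P v)" unfolding isomorphic_iff[OF rX rP] by blast
    have "projective Q X" using projective_iso[OF thin_reach_projective[OF i] rX iso(1,2)] iso(3) by blast
    moreover have "almost_factors Q X ?M ?N f"
    proof (rule almost_factorsI[OF f kF rX i iso(1,2), where n = "\<one>\<^sub>i 1"])
      show "\<psi> v * \<phi> v = \<one>\<^sub>i (rdim X v) \<and> \<phi> v * \<psi> v = \<one>\<^sub>i (rdim ?P v)" if "v \<in> Q0 Q" for v using iso(3) that by blast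
      show "fits (rdim ?N i) 1 (\<one>\<^sub>i 1)" using i iT by (simp add: rdim_thin)
      show "\<one>\<^sub>i 1 \<noteq> imat_of (f i) * m" for m using fF[OF i] iB by (simp add: F_def)
      fix \<alpha> assume \<alpha>: "\<alpha> \<in> outA Q i"
      then have \<alpha>1: "\<alpha> \<in> Q1 Q" "src Q \<alpha> = i" by (auto simp: outA_def)
      have "tgt Q \<alpha> \<in> B" if "tgt Q \<alpha> \<in> T"
        using pb
      proof
        assume "p = [] \<and> outA Q y = {\<beta>}"
        then show ?thesis using \<alpha> p xB by auto
      next
        assume a: "p \<noteq> [] \<and> \<beta> \<noteq> hd p \<and> (\<forall>\<alpha>\<in>outA Q i. in_I Q (p @ [\<alpha>]))"
        then have "in_I Q (pth y (tgt Q \<alpha>))" using succ[OF \<alpha>1(1)] \<alpha>1 iT ipth \<alpha> by simp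
        then show ?thesis using reachD that unfolding T_def by blast
      qed
      then show "\<exists>m. amap ?N \<alpha> * \<one>\<^sub>i 1 = imat_of (f (tgt Q \<alpha>)) * m"
        using fF[OF arrow_ends(2)[OF \<alpha>1(1)]] BT
        by (intro exI[of _ "if tgt Q \<alpha> \<in> B then \<one>\<^sub>i 1 else 0"]) (auto simp: amap_thin[OF \<alpha>1(1)] F_def \<alpha>1 iT)
    qed
    ultimately show "in_Cf Q ?M ?N f X" using X by (simp add: in_Cf_def)
  next
    have rX: "is_rep Q X" using X by (simp add: indecomposable_def)
    assume "in_Cf Q ?M ?N f X"
    moreover have "\<not> intrinsic_kernel_summand Q ?M ?N f L" for L
      by (rule no_intrinsic_kernel[OF f, of F]) (use kF in blast)
    ultimately have pX: "projective Q X" and af: "almost_factors Q X ?M ?N f" unfolding in_Cf_def by auto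
    obtain h v x where h: "ihom Q X ?N h" and v: "v \<in> Q0 Q" and x: "fits (rdim X v) 1 x"
      and n: "\<And>m. fits (rdim ?M v) 1 m \<Longrightarrow> h v * x \<noteq> imat_of (f v) * m"
      and r: "\<And>\<alpha> x'. \<alpha> \<in> Q1 Q \<Longrightarrow> fits (rdim X (src Q \<alpha>)) 1 x' \<Longrightarrow>
        \<exists>m. fits (rdim ?M (tgt Q \<alpha>)) 1 m \<and> h (tgt Q \<alpha>) * (amap X \<alpha> * x') = imat_of (f (tgt Q \<alpha>)) * m"
      using almost_factorsE[OF af f] by blast
    have hx: "fits (rdim ?N v) 1 (h v * x)" by (rule fits_times[OF ihom_fits[OF h v] x])
    have hx0: "h v * x \<noteq> 0" using n[of 0] by simp
    have vT: "v \<in> T" using hx hx0 v fits_0_left by (auto simp: rdim_thin split: if_splits)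
    have vB: "v \<notin> B" using n[of "h v * x"] hx v vT by (auto simp: fF F_def rdim_thin fits_def)
    have "v = i"
    proof (rule socle[OF vT vB], rule ccontr)
      fix \<alpha> assume \<alpha>: "\<alpha> \<in> outA Q v" "tgt Q \<alpha> \<in> T" "tgt Q \<alpha> \<notin> B"
      then have \<alpha>1: "\<alpha> \<in> Q1 Q" "src Q \<alpha> = v" by (auto simp: outA_def)
      have "h (tgt Q \<alpha>) * (amap X \<alpha> * x) = 0"
        using r[OF \<alpha>1(1), of x] x \<alpha>1 fF[OF arrow_ends(2)[OF \<alpha>1(1)]] \<alpha>(3) by (auto simp: F_def)
      moreover have "h (tgt Q \<alpha>) * (amap X \<alpha> * x) = amap ?N \<alpha> * (h v * x)"
        using ihom_commute[OF h \<alpha>1(1)] \<alpha>1 by (simp add: mult.assoc[symmetric])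
      moreover have "amap ?N \<alpha> * (h v * x) = h v * x"
        using \<alpha> \<alpha>1 vT hx v by (simp add: amap_thin[OF \<alpha>1(1)] rdim_thin fits_def)
      ultimately show False using hx0 by simp
    qed
    \<comment> \<open>The image of f vanishes at \<open>i\<close>, so \<open>h\<close> annihilates
      the radical of \<open>X\<close> there and induces a map to S(i).\<close>
    define \<theta> where "\<theta> w = (if w = i then h i else 0)" for w
    note S = simple_rep_facts[OF i]
    have hi: "fits 1 (rdim X i) (h i)" using ihom_fits[OF h i] i iT by (simp add: rdim_thin)
    have \<theta>: "ihom Q X (simple_rep Q i) \<theta>" unfolding ihom_def
    proof (intro conjI ballI)
      show "fits (rdim (simple_rep Q i :: ('v, 'a, 'k) qrep) w) (rdim X w) (\<theta> w)" if "w \<in> Q0 Q" for w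
        using hi by (simp add: \<theta>_def S)
      fix \<alpha> assume \<alpha>: "\<alpha> \<in> Q1 Q"
      have "h i * amap X \<alpha> = 0" if t: "tgt Q \<alpha> = i"
      proof (rule zero_if_cols_zero)
        show "fits 1 (rdim X (src Q \<alpha>)) (h i * amap X \<alpha>)" using fits_times[OF hi] fits_amap[OF rX \<alpha>] t by simp
        fix x' assume "fits (rdim X (src Q \<alpha>)) 1 (x' :: 'k imat)"
        from r[OF \<alpha> this] show "h i * amap X \<alpha> * x' = 0" using t fF[OF i] iB by (auto simp: F_def mult.assoc)
      qed
      then show "\<theta> (tgt Q \<alpha>) * amap X \<alpha> = amap (simple_rep Q i) \<alpha> * \<theta> (src Q \<alpha>)" by (simp add: \<theta>_def S)
    qed
    have "fits 1 1 (h i * x)" using hx \<open>v = i\<close> i iT by (simp add: rdim_thin)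
    then obtain b where b: "fits 1 1 b" "h i * x * b = \<one>\<^sub>i 1" using fits_1_1_inverse hx0 \<open>v = i\<close> by metis
    show "isomorphic Q X ?P"
      by (rule almost_factors_imp_isomorphic[OF X pX i \<theta>, of "x * b"])
        (use b x fits_times \<open>v = i\<close> in \<open>auto simp: \<theta>_def mult.assoc\<close>)
  qed
  then have "Cf_iso Q ?M ?N f ?P" unfolding Cf_iso_def by blast
  then show ?thesis unfolding P_in_Det_def using iM iN irr thin_reach_proj_at[OF i, where 'k = 'k] by blast
qed

end

section \<open>Cokernels with socle at a single vertex\<close>

lemma von_neumann_regular:
  fixes a :: "'k::field imat"
  assumes "fits n m a"
  obtains g where "fits m n g" "a * g * a = a"
proof -
  obtain d b c l r where f: "fits n d b" "fits d m c" "fits d n l" "fits m d r"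
    and e: "a = b * c" "l * b = \<one>\<^sub>i d" "c * r = \<one>\<^sub>i d" using rank_factorization[OF assms] by metis
  have "b * c * (r * l) * (b * c) = b * (c * r) * (l * b) * c" by (simp only: mult.assoc)
  then have "b * c * (r * l) * (b * c) = b * c" unfolding e(2,3) using f by (simp add: fits_def)
  then show thesis using that[OF fits_times[OF f(4,3)]] e(1) by simp
qed

text \<open>Generalized inverses yield a matrix \<open>p\<close> killing \<open>a\<close> and then
  \<open>q\<close> killing \<open>a\<close> and \<open>b\<close>. If \<open>q\<close> killed
  \<open>w\<close> as well, unfolding both would write \<open>w\<close> as a combination excluded by
  \<open>sep\<close>; so some coordinate of \<open>q * w\<close> is nonzero and can be scaled to
  1.\<close>

lemma separating_row:
  fixes a b :: "'k::field imat"
  assumes a: "fits n m a" and b: "fits n l b" and w: "fits n 1 w"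
    and sep: "\<And>x z. fits m 1 x \<Longrightarrow> fits l 1 z \<Longrightarrow> w \<noteq> a * x + b * z"
  obtains \<nu> where "fits 1 n \<nu>" "\<nu> * a = 0" "\<nu> * b = 0" "\<nu> * w = \<one>\<^sub>i 1"
proof -
  obtain g where g: "fits m n g" "a * g * a = a" using von_neumann_regular[OF a] .
  define p where "p = \<one>\<^sub>i n - a * g"
  have fp: "fits n n p" unfolding p_def by (rule fits_diff[OF fits_unit fits_times[OF a g(1)]])
  have pa: "p * a = 0" using a g by (simp add: p_def left_diff_distrib fits_def)
  have fpb: "fits n l (p * b)" by (rule fits_times[OF fp b])
  obtain h where h: "fits l n h" "p * b * h * (p * b) = p * b" using von_neumann_regular[OF fpb] .
  define q where "q = p - p * b * h * p"
  have fq: "fits n n q" unfolding q_def by (rule fits_diff[OF fp fits_times[OF fits_times[OF fpb h(1)] fp]])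
  have qa: "q * a = 0" using pa by (simp add: q_def left_diff_distrib mult.assoc)
  have qb: "q * b = 0" using h(2) by (simp add: q_def left_diff_distrib mult.assoc)
  have "q * w \<noteq> 0"
  proof
    assume "q * w = 0"
    then have "p * w = p * (b * (h * (p * w)))" by (simp add: q_def left_diff_distrib mult.assoc)
    then have "w - a * (g * w) = b * (h * (p * w)) - a * (g * (b * (h * (p * w))))"
      using w b by (simp add: p_def left_diff_distrib fits_def mult.assoc) (simp add: mult.assoc[symmetric])
    then have "w = a * (g * w - g * (b * (h * (p * w)))) + b * (h * (p * w))"
      by (simp add: right_diff_distrib algebra_simps)
    moreover have fz: "fits l 1 (h * (p * w))" by (rule fits_times[OF h(1) fits_times[OF fp w]])
    moreover have "fits m 1 (g * w - g * (b * (h * (p * w))))"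
      by (rule fits_diff[OF fits_times[OF g(1) w] fits_times[OF g(1) fits_times[OF b fz]]])
    ultimately show False using sep by blast
  qed
  then obtain j where j: "entry (q * w) j 0 \<noteq> 0"
  proof -
    obtain j k where jk: "entry (q * w) j k \<noteq> 0" using \<open>q * w \<noteq> 0\<close> by (metis imat_eqI zero_imat.rep_eq)
    have "fits n 1 (q * w)" by (rule fits_times[OF fq w])
    then have "k = 0" using jk unfolding fits_iff by (metis less_one)
    then show thesis using that jk by blast
  qed
  define u where "u = eps 0 j * q"
  have fqw: "fits n 1 (q * w)" by (rule fits_times[OF fq w])
  then have jn: "j < n" using j by (auto simp: fits_iff)
  then have fu: "fits 1 n u" unfolding u_def
    by (intro fits_times[OF _ fq]) (auto simp: fits_iff eps.rep_eq split: if_splits)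
  have "entry (u * w) 0 0 \<noteq> 0" using j by (simp add: u_def mult.assoc entry_eps_times)
  then have "u * w \<noteq> 0" by auto
  then obtain c where c: "fits 1 1 c" "c * (u * w) = \<one>\<^sub>i 1" using fits_1_1_inverse[OF fits_times[OF fu w]] by metis
  have "(c * u) * a = 0" "(c * u) * b = 0" "(c * u) * w = \<one>\<^sub>i 1"
    using qa qb c(2) by (simp_all add: u_def mult.assoc)
  then show thesis using that[OF fits_times[OF c(1) fu]] by blast
qed

context string_tree
begin

text \<open>The support of the injective hull of S(i), dual to \<open>reach\<close>.\<close>

definition coreach :: "'v \<Rightarrow> 'v set" where
  "coreach i = {v. \<exists>p. dpath Q v p i \<and> \<not> in_I Q p}"

lemma coreachD: "v \<in> coreach i \<Longrightarrow> dpath Q v (pth v i) i \<and> \<not> in_I Q (pth v i)"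
  unfolding coreach_def using pth_eq by blast

lemma restr_zero_coreach: "restr_zero Q (coreach i)"
  unfolding restr_zero_def
proof
  assume "\<exists>q. is_path Q q \<and> (\<forall>\<alpha>\<in>set q. src Q \<alpha> \<in> coreach i \<and> tgt Q \<alpha> \<in> coreach i) \<and> in_I Q q"
  then obtain q where q: "is_path Q q" "in_I Q q" "\<And>\<alpha>. \<alpha> \<in> set q \<Longrightarrow> src Q \<alpha> \<in> coreach i \<and> tgt Q \<alpha> \<in> coreach i" by blast
  have ne: "q \<noteq> []" using q by auto
  then have d: "dpath Q (src Q (hd q)) q (tgt Q (last q))" using is_path_dpath q by blast
  obtain p where p: "dpath Q (tgt Q (last q)) p i" using q(3)[of "last q"] ne by (auto simp: coreach_def)
  have "dpath Q (src Q (hd q)) (q @ p) i" using p d by (auto simp: dpath_append)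
  moreover obtain r where "dpath Q (src Q (hd q)) r i" "\<not> in_I Q r"
    using q(3)[of "hd q"] ne by (auto simp: coreach_def)
  ultimately show False using dpath_unique in_I_append1[OF q(2)] by blast
qed

lemma isomorphic_refl: "is_rep Q X \<Longrightarrow> isomorphic Q X X"
  unfolding isomorphic_iff using ihom_id by (intro exI conjI) auto

text \<open>Nothing almost factors through a surjection, so f is injective. A socle element of the
  cokernel at \<open>k\<close> makes P(k) almost factor through f, hence isomorphic to P(i), and a
  nonzero map from it to S(i) forces k = i.\<close>

lemma P_in_DetE:
  assumes det: "P_in_Det TYPE('k::field) Q i" and i: "i \<in> Q0 Q"
  obtains M N :: "('v, 'a, 'k::field) qrep" and f \<kappa> where
    "indecomposable Q M" "indecomposable Q N" "irreducible Q M N f"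
    "\<And>v. v \<in> Q0 Q \<Longrightarrow> fits (rdim M v) (rdim N v) (\<kappa> v) \<and> \<kappa> v * imat_of (f v) = \<one>\<^sub>i (rdim M v)"
    "\<And>v n. \<lbrakk>v \<in> Q0 Q; fits (rdim N v) 1 n; \<And>m. fits (rdim M v) 1 m \<Longrightarrow> n \<noteq> imat_of (f v) * m;
      \<And>\<alpha>. \<alpha> \<in> outA Q v \<Longrightarrow> \<exists>m. amap N \<alpha> * n = imat_of (f (tgt Q \<alpha>)) * m\<rbrakk> \<Longrightarrow> v = i"
    "\<exists>n. fits (rdim N i) 1 n \<and> (\<forall>m. fits (rdim M i) 1 m \<longrightarrow> n \<noteq> imat_of (f i) * m)"
proof -
  obtain M N :: "('v, 'a, 'k) qrep" and f P where ind: "indecomposable Q M" "indecomposable Q N"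
    and irr: "irreducible Q M N f" and P: "proj_at Q P i" and cf: "Cf_iso Q M N f P"
    using det unfolding P_in_Det_def by blast
  have f: "is_hom Q M N f" using irr by (simp add: irreducible_def)
  have iP: "indecomposable Q P" and pP: "projective Q P" using P by (auto simp: proj_at_def)
  have rP: "is_rep Q P" using pP by (simp add: projective_def)
  have "in_Cf Q M N f P" using cf iP isomorphic_refl[OF rP] by (simp add: Cf_iso_def)
  then have af: "almost_factors Q P M N f" using projective_not_tau_inv[OF pP] by (auto simp: in_Cf_def)
  obtain h v x where h: "ihom Q P N h" and v: "v \<in> Q0 Q" and x: "fits (rdim P v) 1 x"
    and nx: "\<And>m. fits (rdim M v) 1 m \<Longrightarrow> h v * x \<noteq> imat_of (f v) * m"
    and r: "\<And>\<alpha> x'. \<alpha> \<in> Q1 Q \<Longrightarrow> fits (rdim P (src Q \<alpha>)) 1 x' \<Longrightarrow>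
      \<exists>m. fits (rdim M (tgt Q \<alpha>)) 1 m \<and> h (tgt Q \<alpha>) * (amap P \<alpha> * x') = imat_of (f (tgt Q \<alpha>)) * m"
    using almost_factorsE[OF af f] by blast
  have hx: "fits (rdim N v) 1 (h v * x)" by (rule fits_times[OF ihom_fits[OF h v] x])
  have "\<nexists>\<kappa>. \<forall>v\<in>Q0 Q. fits (rdim M v) (rdim N v) (\<kappa> v) \<and> imat_of (f v) * \<kappa> v = \<one>\<^sub>i (rdim N v)"
  proof
    assume "\<exists>\<kappa>. \<forall>v\<in>Q0 Q. fits (rdim M v) (rdim N v) (\<kappa> v) \<and> imat_of (f v) * \<kappa> v = \<one>\<^sub>i (rdim N v)"
    then obtain \<kappa> where k: "fits (rdim M v) (rdim N v) (\<kappa> v)" "imat_of (f v) * \<kappa> v = \<one>\<^sub>i (rdim N v)" using v by blast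
    have "h v * x = imat_of (f v) * (\<kappa> v * (h v * x))" using k(2) hx by (simp add: fits_def mult.assoc[symmetric])
    then show False using nx fits_times[OF k(1) hx] by blast
  qed
  then obtain \<kappa> where kap: "\<And>v. v \<in> Q0 Q \<Longrightarrow> fits (rdim M v) (rdim N v) (\<kappa> v) \<and> \<kappa> v * imat_of (f v) = \<one>\<^sub>i (rdim M v)"
    using irreducible_injective_or_surjective[OF irr] by blast
  have soc: "k = i" if k: "k \<in> Q0 Q" and n: "fits (rdim N k) 1 n" "\<And>m. fits (rdim M k) 1 m \<Longrightarrow> n \<noteq> imat_of (f k) * m"
    and out: "\<And>\<alpha>. \<alpha> \<in> outA Q k \<Longrightarrow> \<exists>m. amap N \<alpha> * n = imat_of (f (tgt Q \<alpha>)) * m" for k n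
  proof (rule ccontr)
    assume ki: "k \<noteq> i"
    let ?X = "thin (reach k) :: ('v, 'a, 'k) qrep"
    have iX: "indecomposable Q ?X" and pX: "projective Q ?X"
      by (rule thin_reach_indecomposable[OF k], rule thin_reach_projective[OF k])
    have rX: "is_rep Q ?X" by (rule thin_is_rep[OF restr_zero_reach])
    have "almost_factors Q ?X M N f"
      by (rule almost_factorsI[OF f kap rX k ihom_id[OF rX] ihom_id[OF rX] _ n out]) auto
    then have "isomorphic Q ?X P" using cf iX pX by (auto simp: Cf_iso_def in_Cf_def)
    then obtain \<phi> \<psi> where iso: "ihom Q ?X P \<phi>" "ihom Q P ?X \<psi>" "\<forall>v\<in>Q0 Q. \<phi> v * \<psi> v = \<one>\<^sub>i (rdim P v)"
      unfolding isomorphic_iff[OF rX rP] by blast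
    obtain g where g: "is_hom Q P (simple_rep Q i) g" "\<not> hom_eq Q g (hzero P (simple_rep Q i))"
      using P unfolding proj_at_def by blast
    note gi = is_hom_ihom[OF g(1)]
    have c: "ihom Q ?X (simple_rep Q i) (\<lambda>v. imat_of (g v) * \<phi> v)" by (rule ihom_comp[OF iso(1) gi])
    have "imat_of (g k) * \<phi> k = 0" using ihom_fits[OF c k] ki fits_0_left by (simp add: simple_rep_facts[OF i])
    from thin_hom_unique[OF c ihom_zero k this reach_root]
    have z: "imat_of (g v) * \<phi> v = 0" if "v \<in> Q0 Q" for v using that by blast
    have "imat_of (g v) = 0" if v: "v \<in> Q0 Q" for v
    proof -
      have "imat_of (g v) = imat_of (g v) * \<phi> v * \<psi> v"
        using iso(3) v ihom_fits[OF gi v] by (simp add: mult.assoc fits_def)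
      then show ?thesis using z[OF v] by simp
    qed
    then have "hom_eq Q g (hzero P (simple_rep Q i))"
      by (subst hom_eq_iff[OF is_homD(3)[OF g(1)]]) (auto simp: hzero_def)
    then show False using g(2) by blast
  qed
  have "v = i"
  proof (rule soc[OF v hx nx])
    fix \<alpha> assume "\<alpha> \<in> outA Q v"
    then have \<alpha>: "\<alpha> \<in> Q1 Q" "src Q \<alpha> = v" by (auto simp: outA_def)
    have "amap N \<alpha> * (h v * x) = h (tgt Q \<alpha>) * (amap P \<alpha> * x)"
      using ihom_commute[OF h \<alpha>(1)] \<alpha>(2) by (simp add: mult.assoc[symmetric])
    then show "\<exists>m. amap N \<alpha> * (h v * x) = imat_of (f (tgt Q \<alpha>)) * m" using r[OF \<alpha>(1), of x] x \<alpha>(2) by auto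
  qed
  then have ex: "\<exists>n. fits (rdim N i) 1 n \<and> (\<forall>m. fits (rdim M i) 1 m \<longrightarrow> n \<noteq> imat_of (f i) * m)" using hx nx by blast
  show thesis by (rule that[OF ind irr], erule kap, erule soc, assumption+, rule ex)
qed

end

text \<open>Injectivity of f is recorded by the retraction \<kappa>, taken at each vertex separately
  and only linear.\<close>

locale irreducible_mono = string_tree Q for Q :: "('v, 'a) quiver" +
  fixes M N :: "('v, 'a, 'k::field) qrep" and f \<kappa> F
  defines "F \<equiv> \<lambda>v. imat_of (f v)"
  assumes indM: "indecomposable Q M" and indN: "indecomposable Q N" and irr: "irreducible Q M N f"
    and kap: "\<And>v. v \<in> Q0 Q \<Longrightarrow> fits (rdim M v) (rdim N v) (\<kappa> v) \<and> \<kappa> v * F v = \<one>\<^sub>i (rdim M v)"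
begin

lemma rN: "is_rep Q N" and rM: "is_rep Q M" and fhom: "is_hom Q M N f"
  using irr is_homD by (auto simp: irreducible_def)

lemma F: "ihom Q M N F"
  unfolding F_def by (rule is_hom_ihom[OF fhom])

end

text \<open>The thin interval \<open>I\<close> has peaks \<open>y\<close> and \<open>y'\<close> and socle at \<open>i\<close>; it is uniserial if \<open>y' = i\<close>.
  The row \<open>\<nu>\<close> induces the projection \<open>\<pi>\<close> of \<open>N\<close> onto it.\<close>
locale thin_quotient = irreducible_mono Q M N f \<kappa> F
  for Q :: "('v, 'a) quiver" and M N :: "('v, 'a, 'k::field) qrep" and f \<kappa> F +
  fixes i y y' p p' \<nu> I \<pi>
  defines "I \<equiv> set (verts Q y p) \<union> set (verts Q y' p')"
    and "\<pi> \<equiv> \<lambda>v. if v \<in> I then \<nu> * pmap Q N v (pth v i) else 0"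
  assumes i: "i \<in> Q0 Q"
    and arm1: "dpath Q y p i" "\<not> in_I Q p" and arm2: "dpath Q y' p' i" "\<not> in_I Q p'"
    and arms: "p' = [] \<or> p \<noteq> [] \<and> last p \<noteq> last p'"
    and nu: "fits 1 (rdim N i) \<nu>" "\<nu> * F i = 0"
    and pi: "ihom Q N (thin I) \<pi>"

text \<open>Now \<open>I\<close> is the whole cokernel of \<open>f\<close>, with the vertexwise linear section \<open>L\<close>.\<close>
locale thin_cokernel = thin_quotient Q M N f \<kappa> F i y y' p p' \<nu> I \<pi>
  for Q :: "('v, 'a) quiver" and M N :: "('v, 'a, 'k::field) qrep" and f \<kappa> F i y y' p p' \<nu> I \<pi> +
  fixes L
  assumes L: "\<And>v. v \<in> I \<Longrightarrow> fits (rdim N v) 1 (L v)" "\<And>v. v \<notin> I \<Longrightarrow> L v = 0"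
      "\<And>v. v \<in> I \<Longrightarrow> \<pi> v * L v = \<one>\<^sub>i 1"
    and exact: "\<And>v. v \<in> Q0 Q \<Longrightarrow> F v * (\<kappa> v * (\<one>\<^sub>i (rdim N v) - L v * \<pi> v)) = \<one>\<^sub>i (rdim N v) - L v * \<pi> v"

section \<open>Paths into a fixed vertex and the maps along them\<close>

context string_tree
begin

lemma verts_decomp:
  assumes "dpath Q a p b" "v \<in> set (verts Q a p)"
  shows "dpath Q a (pth a v) v" "dpath Q v (pth v b) b" "p = pth a v @ pth v b"
proof -
  obtain u w where "p = u @ w" "dpath Q a u v" "dpath Q v w b" using verts_split[OF assms(1)] assms(2) by blast
  then show "dpath Q a (pth a v) v" "dpath Q v (pth v b) b" "p = pth a v @ pth v b" using pth_eq by auto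
qed

lemma verts_end: "dpath Q a p b \<Longrightarrow> b \<in> set (verts Q a p)"
  using last_verts[of a p b] last_in_set[of "verts Q a p"] by (auto simp: verts_def)

lemma verts_start: "a \<in> set (verts Q a p)"
  by (simp add: verts_def)

lemma verts_coreach:
  assumes "dpath Q a p b" "\<not> in_I Q p"
  shows "set (verts Q a p) \<subseteq> coreach b"
  using verts_decomp[OF assms(1)] assms(2) in_I_append2 unfolding coreach_def by fastforce

lemma coreach_Q0: "i \<in> Q0 Q \<Longrightarrow> v \<in> coreach i \<Longrightarrow> v \<in> Q0 Q"
  using coreachD dpath_start by blast

lemma pth_Cons: "\<alpha> \<in> Q1 Q \<Longrightarrow> tgt Q \<alpha> \<in> coreach i \<Longrightarrow> pth (src Q \<alpha>) i = \<alpha> # pth (tgt Q \<alpha>) i"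
  using coreachD by (intro pth_eq) auto

text \<open>An arrow leading from the path to a vertex with a path to \<open>i\<close> continues
  along the unique path to \<open>i\<close>, so it is the next arrow of \<open>p\<close>.\<close>

lemma verts_next:
  assumes p: "dpath Q a p i" and \<alpha>: "\<alpha> \<in> Q1 Q" and s: "src Q \<alpha> \<in> set (verts Q a p)" and t: "tgt Q \<alpha> \<in> coreach i"
  shows "tgt Q \<alpha> \<in> set (verts Q a p)" "pth a (tgt Q \<alpha>) = pth a (src Q \<alpha>) @ [\<alpha>]"
proof -
  note d = verts_decomp[OF p s]
  have e: "p = (pth a (src Q \<alpha>) @ [\<alpha>]) @ pth (tgt Q \<alpha>) i" using d(3) pth_Cons[OF \<alpha> t] by simp
  have a: "dpath Q a (pth a (src Q \<alpha>) @ [\<alpha>]) (tgt Q \<alpha>)" using d(1) \<alpha> by (simp add: dpath_snoc)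
  then show "pth a (tgt Q \<alpha>) = pth a (src Q \<alpha>) @ [\<alpha>]" by (rule pth_eq)
  show "tgt Q \<alpha> \<in> set (verts Q a p)"
    unfolding verts_split[OF p] using e a coreachD[OF t] by blast
qed

lemma pmap_via:
  assumes "is_rep Q N" "dpath Q a p b" "v \<in> set (verts Q a p)"
  shows "pmap Q N v (pth v b) * pmap Q N a (pth a v) = pmap Q N a p"
  using pmap_append[OF assms(1) verts_decomp(1,2)[OF assms(2,3)]] verts_decomp(3)[OF assms(2,3)] by simp

text \<open>At an inner vertex the arriving arrow \<eta> of \<open>p\<close> already has the nonzero
  continuation \<gamma>, so by \<open>string_out\<close> every other arrow composes to zero with
  \<eta>.\<close>

lemma pmap_inner_zero:
  assumes N: "is_rep Q N" and p: "dpath Q a p i" "\<not> in_I Q p" and \<alpha>: "\<alpha> \<in> Q1 Q"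
    and s: "src Q \<alpha> \<in> set (verts Q a p)" "src Q \<alpha> \<noteq> a" "src Q \<alpha> \<noteq> i" and t: "tgt Q \<alpha> \<notin> set (verts Q a p)"
  shows "amap N \<alpha> * pmap Q N a (pth a (src Q \<alpha>)) = 0"
proof -
  let ?v = "src Q \<alpha>"
  note d = verts_decomp[OF p(1) s(1)]
  have "pth a ?v \<noteq> []" using d(1) s(2) by auto
  then obtain u \<eta> where u: "pth a ?v = u @ [\<eta>]" by (metis rev_exhaust)
  have "pth ?v i \<noteq> []" using d(2) s(3) by auto
  then obtain \<gamma> w where w: "pth ?v i = \<gamma> # w" by (meson neq_Nil_conv)
  have e: "p = u @ [\<eta>, \<gamma>] @ w" using d(3) u w by simp
  have \<eta>: "\<eta> \<in> Q1 Q" "tgt Q \<eta> = ?v" using d(1) u by (auto simp: dpath_snoc)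
  have \<gamma>: "\<gamma> \<in> Q1 Q" "src Q \<gamma> = ?v" "dpath Q (tgt Q \<gamma>) w i" using d(2) w by auto
  have nI: "\<not> in_I Q [\<eta>, \<gamma>]" using p(2) e in_I_extend by metis
  have e': "p = ((u @ [\<eta>]) @ [\<gamma>]) @ w" using e by simp
  have "dpath Q a ((u @ [\<eta>]) @ [\<gamma>]) (tgt Q \<gamma>)"
    unfolding dpath_snoc[of Q a "u @ [\<eta>]"] using d(1)[unfolded u] \<gamma>(1,2) by metis
  then have "tgt Q \<gamma> \<in> set (verts Q a p)" unfolding verts_split[OF p(1)] using e' \<gamma>(3) by blast
  then have "\<alpha> \<noteq> \<gamma>" using t by blast
  then have I: "in_I Q [\<eta>, \<alpha>]"
    using string_out[OF \<gamma>(1) \<alpha> \<eta>(1)] \<eta>(2) \<gamma>(2) nI by metis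
  have da: "dpath Q ?v [\<alpha>] (tgt Q \<alpha>)" using \<alpha> by simp
  have "dpath Q a (pth a ?v @ [\<alpha>]) (tgt Q \<alpha>)" using d(1) da by (auto simp: dpath_append)
  moreover have "in_I Q (pth a ?v @ [\<alpha>])" using in_I_append2[OF I, of u] u by simp
  ultimately have "pmap Q N a (pth a ?v @ [\<alpha>]) = 0" using pmap_in_I[OF N] by blast
  then show ?thesis using pmap_append[OF N d(1) da] pmap_single[OF N \<alpha>] by simp
qed

text \<open>Pulled back along the paths to \<open>i\<close>, a row commutes with the arrows inside
  \<open>I\<close> by construction; only arrows entering \<open>I\<close> from outside impose a
  condition.\<close>

lemma row_hom:
  assumes N: "is_rep Q N" and i: "i \<in> Q0 Q" and I: "I \<subseteq> coreach i" and nu: "fits 1 (rdim N i) \<nu>"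
    and border: "\<And>\<alpha>. \<alpha> \<in> Q1 Q \<Longrightarrow> tgt Q \<alpha> \<in> I \<Longrightarrow> src Q \<alpha> \<notin> I \<Longrightarrow>
      \<nu> * (pmap Q N (tgt Q \<alpha>) (pth (tgt Q \<alpha>) i) * amap N \<alpha>) = 0"
  shows "ihom Q N (thin I) (\<lambda>v. if v \<in> I then \<nu> * pmap Q N v (pth v i) else 0)"
proof (rule thin_hom_in)
  show "fits 1 (rdim N v) (\<nu> * pmap Q N v (pth v i))" if "v \<in> I" for v
    using fits_times[OF nu fits_pmap[OF N]] coreachD[of v i] I that by blast
  fix \<alpha> assume \<alpha>: "\<alpha> \<in> Q1 Q" "tgt Q \<alpha> \<in> I"
  show "\<nu> * pmap Q N (tgt Q \<alpha>) (pth (tgt Q \<alpha>) i) * amap N \<alpha> =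
      (if src Q \<alpha> \<in> I then \<nu> * pmap Q N (src Q \<alpha>) (pth (src Q \<alpha>) i) else 0)"
    using border[OF \<alpha>] pth_Cons[OF \<alpha>(1), of i] \<alpha> I by (auto simp: mult.assoc)
qed

text \<open>Uniform treatment of at most one arrow: its map, or a matrix with no rows if there is
  none. The last property says that endomorphisms of N preserve the kernel.\<close>

lemma single_arrow_kernel:
  assumes N: "is_rep Q N" and O: "O' \<subseteq> {\<delta>}" "O' \<subseteq> outA Q v" and v: "v \<in> Q0 Q"
  obtains q e where "fits q (rdim N v) e" "\<And>x. e * x = 0 \<longleftrightarrow> (\<forall>\<delta>\<in>O'. amap N \<delta> * x = 0)"
    "\<And>s. ihom Q N N s \<Longrightarrow> \<exists>s'. e * s v = s' * e"
proof (cases "O' = {}")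
  case True
  show thesis by (rule that[of 0 0]) (use True in auto)
next
  case False
  then have O': "O' = {\<delta>}" using O by auto
  then have \<delta>: "\<delta> \<in> Q1 Q" "src Q \<delta> = v" using O by (auto simp: outA_def)
  show thesis
  proof (rule that[of _ "amap N \<delta>"])
    show "fits (rdim N (tgt Q \<delta>)) (rdim N v) (amap N \<delta>)" using fits_amap[OF N \<delta>(1)] \<delta>(2) by simp
    show "amap N \<delta> * x = 0 \<longleftrightarrow> (\<forall>\<delta>\<in>O'. amap N \<delta> * x = 0)" for x by (simp add: O')
    show "\<exists>s'. amap N \<delta> * s v = s' * amap N \<delta>" if "ihom Q N N s" for s
      using ihom_commute[OF that \<delta>(1)] \<delta>(2) by (intro exI[of _ "s (tgt Q \<delta>)"]) simp
  qed
qed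

end

context thin_quotient
begin

abbreviation "R v \<equiv> pmap Q N v (pth v i)"

lemma I_coreach: "I \<subseteq> coreach i"
  unfolding I_def using verts_coreach[OF arm1] verts_coreach[OF arm2] by blast

lemma I_Q0: "v \<in> I \<Longrightarrow> v \<in> Q0 Q"
  using I_coreach coreach_Q0[OF i] by blast

lemma fits_R: "v \<in> I \<Longrightarrow> fits (rdim N i) (rdim N v) (R v)"
  using fits_pmap[OF rN] coreachD I_coreach by blast

lemma ends_I: "y \<in> I" "y' \<in> I" "i \<in> I"
  using verts_start verts_end[OF arm1(1)] by (auto simp: I_def)

lemma rD: "is_rep Q (thin I :: ('v, 'a, 'k) qrep)"
  by (rule thin_is_rep[OF restr_zero_subset[OF restr_zero_coreach I_coreach]])

text \<open>From a common vertex other than \<open>i\<close> both arms would follow the same path,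
  so they would have the same last arrow.\<close>

lemma arms_meet: "v \<in> set (verts Q y p) \<Longrightarrow> v \<in> set (verts Q y' p') \<Longrightarrow> v = i"
proof (rule ccontr)
  assume v: "v \<in> set (verts Q y p)" "v \<in> set (verts Q y' p')" "v \<noteq> i"
  have ne: "pth v i \<noteq> []" using verts_decomp(2)[OF arm1(1) v(1)] v(3) by auto
  then have "last p = last p'" "p' \<noteq> []"
    using verts_decomp(3)[OF arm1(1) v(1)] verts_decomp(3)[OF arm2(1) v(2)] by (metis last_appendR, metis append_is_Nil_conv)
  then show False using arms by blast
qed

lemma next_I: "\<alpha> \<in> Q1 Q \<Longrightarrow> src Q \<alpha> \<in> I \<Longrightarrow> tgt Q \<alpha> \<in> coreach i \<Longrightarrow> tgt Q \<alpha> \<in> I"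
  using verts_next(1)[OF arm1(1)] verts_next(1)[OF arm2(1)] unfolding I_def by blast

lemma no_arrow_from_i: "\<alpha> \<in> Q1 Q \<Longrightarrow> src Q \<alpha> = i \<Longrightarrow> tgt Q \<alpha> \<notin> I"
proof
  assume "\<alpha> \<in> Q1 Q" "src Q \<alpha> = i" "tgt Q \<alpha> \<in> I"
  then have "dpath Q i (\<alpha> # pth (tgt Q \<alpha>) i) i" using coreachD I_coreach by auto
  then show False using dpath_acyclic by blast
qed

lemma piF: "v \<in> Q0 Q \<Longrightarrow> \<pi> v * F v = 0"
proof (cases "v \<in> I")
  case True
  have "R v * F v = F i * pmap Q M v (pth v i)"
  proof -
    have "dpath Q v (pth v i) i" using coreachD[of v i] True I_coreach by blast
    then show ?thesis using ihom_pmap[OF F I_Q0[OF True]] by simp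
  qed
  then show ?thesis using nu(2) True by (simp add: \<pi>_def mult.assoc) (simp add: mult.assoc[symmetric])
qed (simp add: \<pi>_def)

text \<open>A section exhibits the thin module as a retract of the indecomposable N, which makes
  \<pi> invertible; since \<pi> vanishes on the image of f, M would be zero.\<close>

lemma no_section:
  assumes s: "ihom Q (thin I) N s" and ps: "\<And>v. v \<in> I \<Longrightarrow> \<pi> v * s v = \<one>\<^sub>i 1"
  shows False
proof -
  have nz: "\<not> zero_rep Q (thin I :: ('v, 'a, 'k) qrep)" using ends_I(3) i by (auto simp: zero_rep_def rdim_thin)
  have "\<pi> v * s v = \<one>\<^sub>i (rdim (thin I :: ('v, 'a, 'k) qrep) v)" if "v \<in> Q0 Q" for v
    using ps[of v] that by (auto simp: rdim_thin \<pi>_def)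
  from retract_of_indecomposable[OF indN nz s pi this]
  have sp: "s v * \<pi> v = \<one>\<^sub>i (rdim N v)" if "v \<in> Q0 Q" for v using that by blast
  have "rdim M v = 0" if v: "v \<in> Q0 Q" for v
  proof -
    have "F v = s v * (\<pi> v * F v)" using sp[OF v] ihom_fits[OF F v] by (simp add: mult.assoc[symmetric] fits_def)
    then have "\<one>\<^sub>i (rdim M v) = (0 :: 'k imat)" using kap[OF v] piF[OF v] by (metis mult_zero_right)
    then show ?thesis using unit_neq_0 by blast
  qed
  then show False using indM by (simp add: indecomposable_def zero_rep_def)
qed

end

context thin_cokernel
begin

text \<open>The linear lift of \<mu> through \<open>L\<close> fails to commute with arrows only by
  elements of the kernel of \<pi>, and \<open>exact\<close> puts these into the image of f.\<close>

lemma lift_or_factor: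
  assumes V: "is_rep Q V" and \<mu>: "ihom Q V (thin I) \<mu>"
  shows "(\<exists>s. ihom Q V N s \<and> (\<forall>v\<in>Q0 Q. \<pi> v * s v = \<mu> v)) \<or> (\<exists>s. ihom Q N V s \<and> (\<forall>v\<in>Q0 Q. \<mu> v * s v = \<pi> v))"
proof -
  have fL: "fits (rdim N v) (rdim V v) (L v * \<mu> v)" if v: "v \<in> Q0 Q" for v
  proof (cases "v \<in> I")
    case True
    have "fits 1 (rdim V v) (\<mu> v)" using ihom_fits[OF \<mu> v] v True by (simp add: rdim_thin)
    then show ?thesis by (rule fits_times[OF L(1)[OF True]])
  qed (simp add: L(2))
  have piL: "\<pi> v * (L v * \<mu> v) = \<mu> v" if v: "v \<in> Q0 Q" for v
  proof (cases "v \<in> I")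
    case True
    then have "fits 1 (rdim V v) (\<mu> v)" using ihom_fits[OF \<mu> v] v by (simp add: rdim_thin)
    then show ?thesis using L(3)[OF True] by (simp add: mult.assoc[symmetric] fits_def)
  next
    case False
    then have "\<mu> v = 0" using ihom_fits[OF \<mu> v] v fits_0_left by (simp add: rdim_thin)
    then show ?thesis by simp
  qed
  have chi: "imat_of (f (tgt Q \<alpha>)) * \<kappa> (tgt Q \<alpha>) *
      (amap N \<alpha> * (L (src Q \<alpha>) * \<mu> (src Q \<alpha>)) - L (tgt Q \<alpha>) * \<mu> (tgt Q \<alpha>) * amap V \<alpha>) =
      amap N \<alpha> * (L (src Q \<alpha>) * \<mu> (src Q \<alpha>)) - L (tgt Q \<alpha>) * \<mu> (tgt Q \<alpha>) * amap V \<alpha>" if \<alpha>: "\<alpha> \<in> Q1 Q" for \<alpha>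
  proof -
    let ?s = "src Q \<alpha>" and ?t = "tgt Q \<alpha>"
    note s = arrow_ends(1)[OF \<alpha>] and t = arrow_ends(2)[OF \<alpha>]
    define \<Delta> where "\<Delta> = amap N \<alpha> * (L ?s * \<mu> ?s) - L ?t * \<mu> ?t * amap V \<alpha>"
    have fD: "fits (rdim N ?t) (rdim V ?s) \<Delta>" unfolding \<Delta>_def
      by (rule fits_diff[OF fits_times[OF fits_amap[OF rN \<alpha>] fL[OF s]] fits_times[OF fL[OF t] fits_amap[OF V \<alpha>]]])
    have "\<pi> ?t * \<Delta> = (\<pi> ?t * amap N \<alpha>) * (L ?s * \<mu> ?s) - (\<pi> ?t * (L ?t * \<mu> ?t)) * amap V \<alpha>"
      by (simp add: \<Delta>_def right_diff_distrib mult.assoc)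
    also have "\<dots> = amap (thin I) \<alpha> * (\<pi> ?s * (L ?s * \<mu> ?s)) - \<mu> ?t * amap V \<alpha>"
      unfolding ihom_commute[OF pi \<alpha>] piL[OF t] by (simp only: mult.assoc)
    also have "\<dots> = 0" unfolding piL[OF s] using ihom_commute[OF \<mu> \<alpha>] by simp
    finally have "(\<one>\<^sub>i (rdim N ?t) - L ?t * \<pi> ?t) * \<Delta> = \<Delta>"
      using fD by (simp add: left_diff_distrib mult.assoc fits_def)
    moreover have "F ?t * \<kappa> ?t * ((\<one>\<^sub>i (rdim N ?t) - L ?t * \<pi> ?t) * \<Delta>) = (\<one>\<^sub>i (rdim N ?t) - L ?t * \<pi> ?t) * \<Delta>"
      using exact[OF t] by (simp add: mult.assoc[symmetric])
    ultimately have "F ?t * \<kappa> ?t * \<Delta> = \<Delta>" by simp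
    then show ?thesis by (simp only: \<Delta>_def F_def)
  qed
  have kap': "fits (rdim M v) (rdim N v) (\<kappa> v) \<and> \<kappa> v * imat_of (f v) = \<one>\<^sub>i (rdim M v)" if "v \<in> Q0 Q" for v
    using kap[OF that] by (simp only: F_def)
  have "(\<exists>\<rho>. ihom Q V N (\<lambda>v. L v * \<mu> v - imat_of (f v) * \<rho> v)) \<or>
    (\<exists>s \<sigma>. ihom Q N V s \<and> (\<forall>v\<in>Q0 Q. imat_of (f v) * \<sigma> v + L v * \<mu> v * s v = \<one>\<^sub>i (rdim N v)))"
    by (rule irreducible_lift_or_factor[OF irr kap' V fL chi])
  then show ?thesis
  proof (elim disjE exE conjE)
    fix \<rho> assume r: "ihom Q V N (\<lambda>v. L v * \<mu> v - imat_of (f v) * \<rho> v)"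
    have "\<pi> v * (L v * \<mu> v - imat_of (f v) * \<rho> v) = \<mu> v" if v: "v \<in> Q0 Q" for v
    proof -
      have "\<pi> v * (imat_of (f v) * \<rho> v) = (\<pi> v * F v) * \<rho> v" by (simp only: F_def mult.assoc)
      then show ?thesis using piL[OF v] piF[OF v] by (simp add: right_diff_distrib)
    qed
    then show ?thesis using r by (intro disjI1 exI[of _ "\<lambda>v. L v * \<mu> v - imat_of (f v) * \<rho> v"] conjI ballI)
  next
    fix s \<sigma> assume s: "ihom Q N V s" "\<forall>v\<in>Q0 Q. imat_of (f v) * \<sigma> v + L v * \<mu> v * s v = \<one>\<^sub>i (rdim N v)"
    have "\<mu> v * s v = \<pi> v" if v: "v \<in> Q0 Q" for v
    proof -
      have "\<pi> v = \<pi> v * (imat_of (f v) * \<sigma> v + L v * \<mu> v * s v)" using s(2) v ihom_fits[OF pi v] by (simp add: fits_def)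
      also have "\<dots> = (\<pi> v * F v) * \<sigma> v + (\<pi> v * (L v * \<mu> v)) * s v" by (simp only: F_def distrib_left mult.assoc)
      finally show ?thesis using piF[OF v] piL[OF v] by simp
    qed
    then show ?thesis using s(1) by blast
  qed
qed

text \<open>Transported along the two arms, \<open>x\<close> and \<open>x'\<close> agree at
  \<open>i\<close> and span a copy of the thin module in N: arrows leaving it at the ends annihilate
  them by hypothesis, at inner vertices by \<open>pmap_inner_zero\<close>. This copy would be a
  section of \<pi>.\<close>

lemma no_common_element:
  assumes x: "fits (rdim N y) 1 x" and x': "fits (rdim N y') 1 x'" and e: "R y * x = R y' * x'" and n: "\<nu> * (R y * x) = \<one>\<^sub>i 1"
    and k1: "\<And>\<alpha>. \<alpha> \<in> outA Q y \<Longrightarrow> y \<noteq> i \<Longrightarrow> tgt Q \<alpha> \<notin> I \<Longrightarrow> amap N \<alpha> * x = 0"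
    and k2: "\<And>\<alpha>. \<alpha> \<in> outA Q y' \<Longrightarrow> y' \<noteq> i \<Longrightarrow> tgt Q \<alpha> \<notin> I \<Longrightarrow> amap N \<alpha> * x' = 0"
    and k3: "\<And>\<alpha>. \<alpha> \<in> outA Q i \<Longrightarrow> amap N \<alpha> * (R y * x) = 0"
  shows False
proof -
  have py: "pth y i = p" "pth y' i = p'" using pth_eq arm1 arm2 by auto
  define s where "s v = (if v \<in> set (verts Q y p) then pmap Q N y (pth y v) * x else pmap Q N y' (pth y' v) * x')" for v
  have si: "s i = R y * x" using verts_end[OF arm1(1)] by (simp add: s_def)
  have s2: "s v = pmap Q N y' (pth y' v) * x'" if "v \<in> set (verts Q y' p')" for v
    using that arms_meet[OF _ that] e by (auto simp: s_def)
  have s1: "s v = pmap Q N y (pth y v) * x" if "v \<in> set (verts Q y p)" for v using that by (simp add: s_def)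
  have sy: "s y = x" "s y' = x'"
    using s1[OF verts_start] s2[OF verts_start] x x' by (simp_all add: fits_def)
  have step: "amap N \<alpha> * (pmap Q N a (pth a (src Q \<alpha>)) * z) = pmap Q N a (pth a (tgt Q \<alpha>)) * z"
    if "\<alpha> \<in> Q1 Q" "dpath Q a q i" "src Q \<alpha> \<in> set (verts Q a q)" "tgt Q \<alpha> \<in> coreach i" for \<alpha> a q z
  proof -
    have "dpath Q (src Q \<alpha>) [\<alpha>] (tgt Q \<alpha>)" using that(1) by simp
    then have "pmap Q N a (pth a (src Q \<alpha>) @ [\<alpha>]) = amap N \<alpha> * pmap Q N a (pth a (src Q \<alpha>))"
      using pmap_append[OF rN verts_decomp(1)[OF that(2,3)]] pmap_single[OF rN that(1)] by metis
    then show ?thesis unfolding verts_next(2)[OF that(2,1,3,4)] by (simp only: mult.assoc)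
  qed
  have S: "ihom Q (thin I) N (\<lambda>v. if v \<in> I then s v else 0)"
  proof (rule thin_hom_out)
    fix v assume "v \<in> I"
    then consider "v \<in> set (verts Q y p)" | "v \<in> set (verts Q y' p')" by (auto simp: I_def)
    then show "fits (rdim N v) 1 (s v)"
    proof cases
      case 1
      then show ?thesis using fits_times[OF fits_pmap[OF rN verts_decomp(1)[OF arm1(1) 1]] x] by (simp add: s1)
    next
      case 2
      then show ?thesis using fits_times[OF fits_pmap[OF rN verts_decomp(1)[OF arm2(1) 2]] x'] by (simp add: s2)
    qed
  next
    fix \<alpha> assume \<alpha>: "\<alpha> \<in> Q1 Q" "src Q \<alpha> \<in> I"
    show "amap N \<alpha> * s (src Q \<alpha>) = (if tgt Q \<alpha> \<in> I then s (tgt Q \<alpha>) else 0)"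
    proof (cases "tgt Q \<alpha> \<in> I")
      case True
      then have t: "tgt Q \<alpha> \<in> coreach i" using I_coreach by blast
      from \<alpha>(2) consider "src Q \<alpha> \<in> set (verts Q y p)" | "src Q \<alpha> \<in> set (verts Q y' p')" by (auto simp: I_def)
      then show ?thesis
      proof cases
        case 1
        then show ?thesis using step[OF \<alpha>(1) arm1(1) 1 t] verts_next(1)[OF arm1(1) \<alpha>(1) 1 t] True by (simp add: s1)
      next
        case 2
        then show ?thesis using step[OF \<alpha>(1) arm2(1) 2 t] verts_next(1)[OF arm2(1) \<alpha>(1) 2 t] True by (simp add: s2)
      qed
    next
      case False
      have out: "\<alpha> \<in> outA Q (src Q \<alpha>)" using \<alpha> by (simp add: outA_def)
      have "amap N \<alpha> * s (src Q \<alpha>) = 0"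
      proof (cases "src Q \<alpha> = i")
        case True
        then show ?thesis using k3 out si by simp
      next
        case ni: False
        from \<alpha>(2) consider "src Q \<alpha> \<in> set (verts Q y p)" | "src Q \<alpha> \<in> set (verts Q y' p')" by (auto simp: I_def)
        then show ?thesis
        proof cases
          case 1
          show ?thesis
          proof (cases "src Q \<alpha> = y")
            case True
            then show ?thesis using k1 out ni \<open>tgt Q \<alpha> \<notin> I\<close> sy(1) by simp
          next
            case False
            then have "amap N \<alpha> * pmap Q N y (pth y (src Q \<alpha>)) = 0"
              using pmap_inner_zero[OF rN arm1 \<alpha>(1) 1 _ ni] \<open>tgt Q \<alpha> \<notin> I\<close> by (simp add: I_def)
            then show ?thesis by (simp add: s1[OF 1] mult.assoc[symmetric])
          qed
        next
          case 2
          show ?thesis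
          proof (cases "src Q \<alpha> = y'")
            case True
            then show ?thesis using k2 out ni \<open>tgt Q \<alpha> \<notin> I\<close> sy(2) by simp
          next
            case False
            then have "amap N \<alpha> * pmap Q N y' (pth y' (src Q \<alpha>)) = 0"
              using pmap_inner_zero[OF rN arm2 \<alpha>(1) 2 _ ni] \<open>tgt Q \<alpha> \<notin> I\<close> by (simp add: I_def)
            then show ?thesis by (simp add: s2[OF 2] mult.assoc[symmetric])
          qed
        qed
      qed
      then show ?thesis using False by simp
    qed
  qed
  have "\<pi> v * s v = \<one>\<^sub>i 1" if v: "v \<in> I" for v
  proof -
    from v consider "v \<in> set (verts Q y p)" | "v \<in> set (verts Q y' p')" by (auto simp: I_def)
    then have "R v * s v = R y * x"
    proof cases
      case 1
      then show ?thesis using pmap_via[OF rN arm1(1) 1] by (simp add: s1 mult.assoc[symmetric] py)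
    next
      case 2
      then show ?thesis using pmap_via[OF rN arm2(1) 2] e by (simp add: s2 mult.assoc[symmetric] py)
    qed
    then show ?thesis using v n by (simp add: \<pi>_def mult.assoc)
  qed
  then show False using no_section[OF S] by simp
qed

text \<open>The row \<open>\<nu>\<close> is split into a part vanishing on the elements killed at the first end and a part
  vanishing on those killed at the second end; as \<open>End(N)\<close> is local, \<open>\<pi>\<close> factors through one of
  the two resulting homomorphisms from \<open>N\<close> to the cokernel, against the existence of \<open>n\<close> and \<open>n'\<close>.\<close>
lemma two_ends_contradiction:
  assumes O1: "O1 \<subseteq> {\<delta>}" "O1 \<subseteq> outA Q y" and O2: "O2 \<subseteq> {\<delta>'}" "O2 \<subseteq> outA Q y'"
    and n1: "fits (rdim N y) 1 n" "\<And>\<delta>. \<delta> \<in> O1 \<Longrightarrow> amap N \<delta> * n = 0" "\<nu> * (R y * n) = \<one>\<^sub>i 1"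
    and n2: "fits (rdim N y') 1 n'" "\<And>\<delta>. \<delta> \<in> O2 \<Longrightarrow> amap N \<delta> * n' = 0" "\<nu> * (R y' * n') = \<one>\<^sub>i 1"
    and border: "\<And>\<alpha>. \<alpha> \<in> Q1 Q \<Longrightarrow> tgt Q \<alpha> \<in> I \<Longrightarrow> src Q \<alpha> \<notin> I \<Longrightarrow>
      (\<exists>\<beta>. R (tgt Q \<alpha>) * amap N \<alpha> = R y * \<beta> \<and> (\<forall>\<delta>\<in>O1. amap N \<delta> * \<beta> = 0)) \<or>
      (\<exists>\<beta>. R (tgt Q \<alpha>) * amap N \<alpha> = R y' * \<beta> \<and> (\<forall>\<delta>\<in>O2. amap N \<delta> * \<beta> = 0))"
    and sec: "\<And>x x'. \<lbrakk>fits (rdim N y) 1 x; fits (rdim N y') 1 x'; \<And>\<delta>. \<delta> \<in> O1 \<Longrightarrow> amap N \<delta> * x = 0;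
      \<And>\<delta>. \<delta> \<in> O2 \<Longrightarrow> amap N \<delta> * x' = 0; R y * x = R y' * x'; \<nu> * (R y * x) = \<one>\<^sub>i 1\<rbrakk> \<Longrightarrow> False"
  shows False
proof -
  obtain q1 e1 where e1: "fits q1 (rdim N y) e1" "\<And>x. e1 * x = 0 \<longleftrightarrow> (\<forall>\<delta>\<in>O1. amap N \<delta> * x = 0)"
      "\<And>s. ihom Q N N s \<Longrightarrow> \<exists>s'. e1 * s y = s' * e1"
    using single_arrow_kernel[OF rN O1 I_Q0[OF ends_I(1)]] by blast
  obtain q2 e2 where e2: "fits q2 (rdim N y') e2" "\<And>x. e2 * x = 0 \<longleftrightarrow> (\<forall>\<delta>\<in>O2. amap N \<delta> * x = 0)"
      "\<And>s. ihom Q N N s \<Longrightarrow> \<exists>s'. e2 * s y' = s' * e2"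
    using single_arrow_kernel[OF rN O2 I_Q0[OF ends_I(2)]] by blast
  obtain g1 where g1: "fits (rdim N y) q1 g1" "e1 * g1 * e1 = e1" using von_neumann_regular[OF e1(1)] .
  obtain g2 where g2: "fits (rdim N y') q2 g2" "e2 * g2 * e2 = e2" using von_neumann_regular[OF e2(1)] .
  \<comment> \<open>\<open>k1\<close> and \<open>k2\<close> are projections onto the kernels of
    \<open>e1\<close> and \<open>e2\<close>, so the columns of \<open>w1\<close> and
    \<open>w2\<close> below span the parts of N_i coming from elements that the chosen arrows at the
    two ends annihilate.\<close>
  define k1 where "k1 = \<one>\<^sub>i (rdim N y) - g1 * e1"
  define k2 where "k2 = \<one>\<^sub>i (rdim N y') - g2 * e2"
  have fk: "fits (rdim N y) (rdim N y) k1" "fits (rdim N y') (rdim N y') k2"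
    unfolding k1_def k2_def using fits_diff[OF fits_unit fits_times[OF g1(1) e1(1)]] fits_diff[OF fits_unit fits_times[OF g2(1) e2(1)]] by auto
  have ek: "e1 * k1 = 0" "e2 * k2 = 0"
    using e1(1) e2(1) g1(2) g2(2) by (simp_all add: k1_def k2_def right_diff_distrib mult.assoc fits_def)
  note fR1 = fits_R[OF ends_I(1)] and fR2 = fits_R[OF ends_I(2)]
  have Rk1: "R y * (k1 * \<beta>) = R y * \<beta>" if "e1 * \<beta> = 0" for \<beta>
    using that fR1 by (simp add: k1_def left_diff_distrib right_diff_distrib mult.assoc fits_def) (simp add: mult.assoc[symmetric])
  have Rk2: "R y' * (k2 * \<beta>) = R y' * \<beta>" if "e2 * \<beta> = 0" for \<beta>
    using that fR2 by (simp add: k2_def left_diff_distrib right_diff_distrib mult.assoc fits_def) (simp add: mult.assoc[symmetric])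
  define w1 where "w1 = R y * k1"
  define w2 where "w2 = R y' * k2"
  have fw1: "fits (rdim N i) (rdim N y) w1" unfolding w1_def by (rule fits_times[OF fR1 fk(1)])
  have fw2: "fits (rdim N i) (rdim N y') w2" unfolding w2_def by (rule fits_times[OF fR2 fk(2)])
  obtain g where g: "fits (rdim N y) (rdim N i) g" "w1 * g * w1 = w1" using von_neumann_regular[OF fw1] .
  define P where "P = \<one>\<^sub>i (rdim N i) - w1 * g"
  have fP: "fits (rdim N i) (rdim N i) P" unfolding P_def by (rule fits_diff[OF fits_unit fits_times[OF fw1 g(1)]])
  have Pw1: "P * w1 = 0" using fw1 g(2) by (simp add: P_def left_diff_distrib fits_def)
  have fPw: "fits (rdim N i) (rdim N y') (P * w2)" by (rule fits_times[OF fP fw2])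
  obtain h where h: "fits (rdim N y') (rdim N i) h" "P * w2 * h * (P * w2) = P * w2" using von_neumann_regular[OF fPw] .
  \<comment> \<open>A row that vanishes on the image of \<open>w1\<close>, because \<open>P\<close>
    does, and should agree with \<nu> on the image of \<open>w2\<close>. This is consistent iff
    \<nu> vanishes on the intersection of the two images, to which the columns of
    \<open>w2 * z\<close> belong.\<close>
  define \<nu>1 where "\<nu>1 = \<nu> * w2 * h * P"
  have fn1: "fits 1 (rdim N i) \<nu>1" unfolding \<nu>1_def by (rule fits_times[OF fits_times[OF fits_times[OF nu(1) fw2] h(1)] fP])
  have n1w1: "\<nu>1 * w1 = 0" using Pw1 by (simp add: \<nu>1_def mult.assoc)
  define z where "z = \<one>\<^sub>i (rdim N y') - h * (P * w2)"
  have fz: "fits (rdim N y') (rdim N y') z" unfolding z_def by (rule fits_diff[OF fits_unit fits_times[OF h(1) fPw]])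
  have "P * w2 * z = 0" using fPw h(2) by (simp add: z_def right_diff_distrib mult.assoc fits_def)
  moreover have "P * w2 * z = \<one>\<^sub>i (rdim N i) * w2 * z - w1 * (g * (w2 * z))"
    by (simp add: P_def left_diff_distrib mult.assoc)
  ultimately have w2z: "w2 * z = w1 * (g * (w2 * z))" using fw2 by (simp add: fits_def)
  \<comment> \<open>A column of \<open>w2 * z\<close> with nonzero value under \<nu>, scaled to 1,
    comes from an element at each end; this is the common element excluded by
    \<open>sec\<close>.\<close>
  have "\<nu> * (w2 * z) = 0"
  proof (rule zero_if_cols_zero)
    show "fits 1 (rdim N y') (\<nu> * (w2 * z))" by (rule fits_times[OF nu(1) fits_times[OF fw2 fz]])
    fix c assume c: "fits (rdim N y') 1 (c :: 'k imat)"
    show "\<nu> * (w2 * z) * c = 0"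
    proof (rule ccontr)
      assume "\<nu> * (w2 * z) * c \<noteq> 0"
      moreover have "fits 1 1 (\<nu> * (w2 * z) * c)" by (rule fits_times[OF fits_times[OF nu(1) fits_times[OF fw2 fz]] c])
      ultimately obtain b where b: "fits 1 1 b" "\<nu> * (w2 * z) * c * b = \<one>\<^sub>i 1" using fits_1_1_inverse by metis
      define x where "x = k1 * (g * (w2 * z) * c * b)"
      define x' where "x' = k2 * (z * c * b)"
      have fx: "fits (rdim N y) 1 x" unfolding x_def
        by (rule fits_times[OF fk(1) fits_times[OF fits_times[OF fits_times[OF g(1) fits_times[OF fw2 fz]] c] b(1)]])
      have fx': "fits (rdim N y') 1 x'" unfolding x'_def by (rule fits_times[OF fk(2) fits_times[OF fits_times[OF fz c] b(1)]])
      have "e1 * x = 0" "e2 * x' = 0" using ek by (simp_all add: x_def x'_def mult.assoc[symmetric])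
      moreover have "R y * x = w2 * z * c * b"
      proof -
        have "R y * x = w1 * (g * (w2 * z)) * c * b" by (simp only: x_def w1_def mult.assoc)
        then show ?thesis unfolding w2z[symmetric] .
      qed
      moreover have "R y' * x' = w2 * z * c * b" by (simp add: x'_def w2_def mult.assoc)
      ultimately show False using sec[OF fx fx'] e1(2) e2(2) b(2) by (simp add: mult.assoc)
    qed
  qed
  moreover have "\<nu> * (w2 * z) = \<nu> * (w2 * \<one>\<^sub>i (rdim N y')) - \<nu>1 * w2"
    by (simp add: \<nu>1_def z_def right_diff_distrib mult.assoc)
  ultimately have n1w2: "\<nu>1 * w2 = \<nu> * w2" using fw2 by (simp add: fits_def)
  define \<pi>1 where "\<pi>1 v = (if v \<in> I then \<nu>1 * R v else 0)" for v
  have border0: "\<nu> * (R (tgt Q \<alpha>) * amap N \<alpha>) = 0" if \<alpha>: "\<alpha> \<in> Q1 Q" "tgt Q \<alpha> \<in> I" "src Q \<alpha> \<notin> I" for \<alpha>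
    using ihom_commute[OF pi \<alpha>(1)] \<alpha> by (simp add: \<pi>_def mult.assoc)
  \<comment> \<open>Each arrow entering \<open>I\<close> lands in one of the two images: on the
    first \<nu>1 is zero, on the second it equals \<nu>, which vanishes on entering arrows because
    \<pi> is a homomorphism.\<close>
  have p1: "ihom Q N (thin I) \<pi>1" unfolding \<pi>1_def
  proof (rule row_hom[OF rN i I_coreach fn1])
    fix \<alpha> assume \<alpha>: "\<alpha> \<in> Q1 Q" "tgt Q \<alpha> \<in> I" "src Q \<alpha> \<notin> I"
    from border[OF this] show "\<nu>1 * (R (tgt Q \<alpha>) * amap N \<alpha>) = 0"
    proof (elim disjE exE conjE)
      fix \<beta> assume b: "R (tgt Q \<alpha>) * amap N \<alpha> = R y * \<beta>" "\<forall>\<delta>\<in>O1. amap N \<delta> * \<beta> = 0"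
      then have "R y * \<beta> = w1 * \<beta>" using Rk1 e1(2) by (simp add: w1_def mult.assoc)
      then show ?thesis using b(1) n1w1 by (simp add: mult.assoc[symmetric])
    next
      fix \<beta> assume b: "R (tgt Q \<alpha>) * amap N \<alpha> = R y' * \<beta>" "\<forall>\<delta>\<in>O2. amap N \<delta> * \<beta> = 0"
      then have "R y' * \<beta> = w2 * \<beta>" using Rk2 e2(2) by (simp add: w2_def mult.assoc)
      then have "\<nu>1 * (R (tgt Q \<alpha>) * amap N \<alpha>) = (\<nu>1 * w2) * \<beta>" using b(1) by (simp add: mult.assoc)
      also have "\<dots> = \<nu> * (R (tgt Q \<alpha>) * amap N \<alpha>)" using n1w2 b(1) \<open>R y' * \<beta> = w2 * \<beta>\<close> by (simp add: mult.assoc)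
      finally show ?thesis using border0[OF \<alpha>] by simp
    qed
  qed
  have van1: "\<nu>1 * (R y * x) = 0" if "e1 * x = 0" for x
    using Rk1[OF that] n1w1 by (metis mult.assoc mult_zero_left w1_def)
  have van2: "\<nu>1 * (R y' * x) = \<nu> * (R y' * x)" if "e2 * x = 0" for x
    using Rk2[OF that] n1w2 by (metis mult.assoc w2_def)
  have nat1: "e1 * (s y * x) = 0" if "ihom Q N N s" "e1 * x = 0" for s x
    using e1(3)[OF that(1)] that(2) by (metis mult.assoc mult_zero_right)
  have nat2: "e2 * (s y' * x) = 0" if "ihom Q N N s" "e2 * x = 0" for s x
    using e2(3)[OF that(1)] that(2) by (metis mult.assoc mult_zero_right)
  have en: "e1 * n = 0" "e2 * n' = 0" using n1(2) n2(2) e1(2) e2(2) by auto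
  have y0: "y \<in> Q0 Q" "y' \<in> Q0 Q" using I_Q0 ends_I by auto
  \<comment> \<open>\<open>s\<close> keeps \<open>n\<close> in the kernel of \<open>e1\<close>,
    where \<pi>1 vanishes at \<open>y\<close>, whereas \<pi> is 1 on \<open>n\<close>. The statement
    for \<pi> - \<pi>1 is the same with \<open>n'\<close> at the other end.\<close>
  have not1: False if s: "ihom Q N N s" "\<And>v. v \<in> Q0 Q \<Longrightarrow> \<pi>1 v * s v = \<pi> v" for s
  proof -
    have "\<pi> y * n = \<nu>1 * (R y * (s y * n))" using s(2)[OF y0(1)] ends_I by (simp add: \<pi>1_def mult.assoc[symmetric])
    then have "\<pi> y * n = 0" using van1[OF nat1[OF s(1) en(1)]] by simp
    then show False using n1(3) ends_I by (simp add: \<pi>_def mult.assoc)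
  qed
  have not2: False if s: "ihom Q N N s" "\<And>v. v \<in> Q0 Q \<Longrightarrow> (\<pi> v - \<pi>1 v) * s v = \<pi> v" for s
  proof -
    have "\<pi> y' * n' = \<nu> * (R y' * (s y' * n')) - \<nu>1 * (R y' * (s y' * n'))"
    proof -
      have "\<pi> y' * n' = (\<nu> * R y' - \<nu>1 * R y') * s y' * n'"
        using s(2)[OF y0(2)] ends_I by (simp add: \<pi>_def \<pi>1_def)
      then show ?thesis by (simp add: left_diff_distrib mult.assoc)
    qed
    then have "\<pi> y' * n' = 0" using van2[OF nat2[OF s(1) en(2)]] by simp
    then show False using n2(3) ends_I by (simp add: \<pi>_def mult.assoc)
  qed
  from lift_or_factor[OF rN p1] show False
  proof (elim disjE exE conjE)
    fix s assume s: "ihom Q N N s" "\<forall>v\<in>Q0 Q. \<pi> v * s v = \<pi>1 v"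
    \<comment> \<open>As \<pi> s = \<pi>1 and \<pi> (1 - s) = \<pi> - \<pi>1, the inverse of s or of
      1 - s factors \<pi> through one of the two summands.\<close>
    from local_endomorphisms[OF indN s(1)] show False
    proof
      assume "iauto Q N s"
      then obtain t where t: "ihom Q N N t" "\<forall>v\<in>Q0 Q. s v * t v = \<one>\<^sub>i (rdim N v)" unfolding iauto_def by blast
      have "\<pi>1 v * t v = \<pi> v" if v: "v \<in> Q0 Q" for v
      proof -
        have "\<pi>1 v * t v = \<pi> v * (s v * t v)" using s(2) v by (simp add: mult.assoc[symmetric])
        then show ?thesis using t(2) v ihom_fits[OF pi v] by (simp add: fits_def)
      qed
      then show False using not1[OF t(1)] by blast
    next
      assume "iauto Q N (\<lambda>v. \<one>\<^sub>i (rdim N v) - s v)"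
      then obtain t where t: "ihom Q N N t" "\<forall>v\<in>Q0 Q. (\<one>\<^sub>i (rdim N v) - s v) * t v = \<one>\<^sub>i (rdim N v)"
        unfolding iauto_def by blast
      have "(\<pi> v - \<pi>1 v) * t v = \<pi> v" if v: "v \<in> Q0 Q" for v
      proof -
        have "\<pi> v - \<pi>1 v = \<pi> v * (\<one>\<^sub>i (rdim N v) - s v)"
          using s(2) v ihom_fits[OF pi v] by (simp add: fits_def right_diff_distrib)
        then have "(\<pi> v - \<pi>1 v) * t v = \<pi> v * ((\<one>\<^sub>i (rdim N v) - s v) * t v)" by (simp only: mult.assoc)
        then show ?thesis using t(2) v ihom_fits[OF pi v] by (simp add: fits_def)
      qed
      then show False using not2[OF t(1)] by blast
    qed
  next
    fix s assume "ihom Q N N s" "\<forall>v\<in>Q0 Q. \<pi>1 v * s v = \<pi> v"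
    then show False using not1 by blast
  qed
qed

text \<open>\<open>S\<close> supports a proper submodule of the cokernel. As \<pi> is surjective, it
  does not factor through the inclusion, so the inclusion lifts to N; \<open>n\<close> is the lifted
  basis vector at \<open>v\<close>, and arrows leaving \<open>S\<close> annihilate it.\<close>

lemma element_of_subinterval:
  assumes S: "S \<subset> I" "v \<in> S" and closed: "\<And>\<alpha>. \<alpha> \<in> Q1 Q \<Longrightarrow> src Q \<alpha> \<in> S \<Longrightarrow> tgt Q \<alpha> \<in> I \<Longrightarrow> tgt Q \<alpha> \<in> S"
  shows "\<exists>n. fits (rdim N v) 1 n \<and> \<nu> * (R v * n) = \<one>\<^sub>i 1 \<and> (\<forall>\<delta>\<in>outA Q v. tgt Q \<delta> \<notin> S \<longrightarrow> amap N \<delta> * n = 0)"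
proof -
  let ?V = "thin S :: ('v, 'a, 'k) qrep"
  have rV: "is_rep Q ?V" using thin_is_rep restr_zero_subset[OF restr_zero_coreach] I_coreach S(1) by blast
  have v: "v \<in> I" "v \<in> Q0 Q" using S I_Q0 by auto
  define \<mu> where "\<mu> v = (if v \<in> S then \<one>\<^sub>i 1 else (0 :: 'k imat))" for v
  have \<mu>: "ihom Q ?V (thin I) \<mu>" unfolding \<mu>_def
    by (rule thin_hom_out) (use S(1) closed in \<open>auto simp: rdim_thin amap_thin\<close>)
  from lift_or_factor[OF rV \<mu>] show ?thesis
  proof (elim disjE exE conjE)
    fix s assume s: "ihom Q ?V N s" "\<forall>v\<in>Q0 Q. \<pi> v * s v = \<mu> v"
    have "fits (rdim N v) 1 (s v)" using ihom_fits[OF s(1) v(2)] S(2) v(2) by (simp add: rdim_thin)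
    moreover have "\<nu> * (R v * s v) = \<one>\<^sub>i 1"
    proof -
      have "\<pi> v * s v = \<mu> v" using s(2) v(2) by blast
      then show ?thesis using v(1) S(2) by (simp add: \<pi>_def \<mu>_def mult.assoc)
    qed
    moreover have "amap N \<delta> * s v = 0" if "\<delta> \<in> outA Q v" "tgt Q \<delta> \<notin> S" for \<delta>
      using ihom_commute[OF s(1), of \<delta>] that by (auto simp: outA_def amap_thin)
    ultimately show ?thesis by blast
  next
    fix s assume s: "\<forall>v\<in>Q0 Q. \<mu> v * s v = \<pi> v"
    obtain u where u: "u \<in> I" "u \<notin> S" using S(1) by blast
    then have "\<pi> u = 0" using s I_Q0[OF u(1)] by (auto simp: \<mu>_def)
    then show ?thesis using L(3)[OF u(1)] by simp
  qed
qed

text \<open>Prolonging the uniserial cokernel by \<alpha> gives a uniserial module with the cokernel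
  as quotient. If \<pi> factored through the quotient map, \<nu> would factor through \<alpha> and
  vanish on \<open>n'\<close>. So the quotient map lifts to N, and \<open>n\<close> is its value at
  the peak.\<close>

lemma element_from_extension:
  assumes p': "p' = []" and \<alpha>: "\<alpha> \<in> outA Q i" "\<not> in_I Q (p @ [\<alpha>])"
    and n': "fits (rdim N i) 1 n'" "amap N \<alpha> * n' = 0" "\<nu> * n' = \<one>\<^sub>i 1"
  shows "\<exists>n. fits (rdim N y) 1 n \<and> \<nu> * (R y * n) = \<one>\<^sub>i 1 \<and> (\<forall>\<delta>\<in>outA Q y. \<delta> \<noteq> hd (p @ [\<alpha>]) \<longrightarrow> amap N \<delta> * n = 0)"
proof -
  have \<alpha>1: "\<alpha> \<in> Q1 Q" "src Q \<alpha> = i" using \<alpha> by (auto simp: outA_def)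
  have d: "dpath Q y (p @ [\<alpha>]) (tgt Q \<alpha>)" using arm1 \<alpha>1 by (simp add: dpath_snoc)
  define W where "W = set (verts Q y (p @ [\<alpha>]))"
  have W: "W = insert (tgt Q \<alpha>) I" using p' arm2 verts_end[OF arm1(1)] by (auto simp: W_def I_def verts_def)
  let ?V = "thin W :: ('v, 'a, 'k) qrep"
  have rV: "is_rep Q ?V" unfolding W_def using thin_is_rep restr_zero_verts[OF d] \<alpha>(2) by blast
  have t0: "tgt Q \<alpha> \<notin> I" by (rule no_arrow_from_i[OF \<alpha>1])
  have y: "y \<in> I" "y \<in> Q0 Q" "y \<in> W" using ends_I I_Q0 by (auto simp: W)
  have tne: "tgt Q \<delta> \<notin> W" if \<delta>: "\<delta> \<in> outA Q y" "\<delta> \<noteq> hd (p @ [\<alpha>])" for \<delta>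
  proof
    assume "tgt Q \<delta> \<in> W"
    then obtain w where w: "dpath Q (tgt Q \<delta>) w (tgt Q \<alpha>)" using verts_decomp(2)[OF d] by (auto simp: W_def)
    then have "dpath Q y (\<delta> # w) (tgt Q \<alpha>)" using \<delta>(1) by (simp add: outA_def)
    then have "\<delta> # w = p @ [\<alpha>]" using dpath_unique d by blast
    then have "hd (p @ [\<alpha>]) = \<delta>" by (metis list.sel(1))
    then show False using \<delta>(2) by simp
  qed
  define \<mu> where "\<mu> v = (if v \<in> I then \<one>\<^sub>i 1 else (0 :: 'k imat))" for v
  have \<mu>: "ihom Q ?V (thin I) \<mu>" unfolding \<mu>_def
  proof (rule thin_hom_in)
    show "fits 1 (rdim ?V v) (\<one>\<^sub>i 1)" if "v \<in> I" "v \<in> Q0 Q" for v using that by (simp add: rdim_thin W)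
    fix \<gamma> assume \<gamma>: "\<gamma> \<in> Q1 Q" "tgt Q \<gamma> \<in> I"
    have "src Q \<gamma> \<noteq> tgt Q \<alpha>"
    proof
      assume e: "src Q \<gamma> = tgt Q \<alpha>"
      have "dpath Q (tgt Q \<gamma>) (pth (tgt Q \<gamma>) i) i" using coreachD I_coreach \<gamma>(2) by blast
      then have "dpath Q i (\<alpha> # \<gamma> # pth (tgt Q \<gamma>) i) i" using \<gamma> e \<alpha>1 by simp
      then show False using dpath_acyclic by blast
    qed
    then show "\<one>\<^sub>i 1 * amap ?V \<gamma> = (if src Q \<gamma> \<in> I then \<one>\<^sub>i 1 else 0)"
      using \<gamma> by (simp add: amap_thin[OF \<gamma>(1)] W)
  qed
  from lift_or_factor[OF rV \<mu>] show ?thesis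
  proof (elim disjE exE conjE)
    fix s assume s: "ihom Q ?V N s" "\<forall>v\<in>Q0 Q. \<pi> v * s v = \<mu> v"
    have "fits (rdim N y) 1 (s y)" using ihom_fits[OF s(1) y(2)] y by (simp add: rdim_thin)
    moreover have "\<nu> * (R y * s y) = \<one>\<^sub>i 1"
    proof -
      have "\<pi> y * s y = \<mu> y" using s(2) y(2) by blast
      then show ?thesis using y(1) by (simp add: \<pi>_def \<mu>_def mult.assoc)
    qed
    moreover have "amap N \<delta> * s y = 0" if "\<delta> \<in> outA Q y" "\<delta> \<noteq> hd (p @ [\<alpha>])" for \<delta>
      using ihom_commute[OF s(1), of \<delta>] tne[OF that] that(1) by (auto simp: outA_def amap_thin)
    ultimately show ?thesis by blast
  next
    fix s assume s: "ihom Q N ?V s" "\<forall>v\<in>Q0 Q. \<mu> v * s v = \<pi> v"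
    have iW: "i \<in> W" "tgt Q \<alpha> \<in> W" using ends_I by (auto simp: W)
    have fs: "fits 1 (rdim N i) (s i)" using ihom_fits[OF s(1) i] iW i by (simp add: rdim_thin)
    have "\<mu> i * s i = \<pi> i" using s(2) i by blast
    then have "s i = \<nu>" using ends_I(3) fs nu(1) by (simp add: \<mu>_def \<pi>_def fits_def)
    moreover have "amap ?V \<alpha> * s i = s (tgt Q \<alpha>) * amap N \<alpha>" using ihom_commute[OF s(1) \<alpha>1(1)] \<alpha>1 by simp
    ultimately have "\<nu> = s (tgt Q \<alpha>) * amap N \<alpha>"
      using iW \<alpha>1 nu(1) by (simp add: amap_thin[OF \<alpha>1(1)] fits_def)
    then have "\<nu> * n' = 0" using n'(2) by (simp add: mult.assoc)
    then show ?thesis using n'(3) by simp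
  qed
qed

subsection \<open>Simple cokernels at branching vertices\<close>

text \<open>The arrow \<xi> is preceded by the projection of N_i onto the kernel of \<nu> along
  \<open>L i\<close>; on the image of f this changes nothing.\<close>

definition twist :: "'a \<Rightarrow> ('v, 'a, 'k) qrep" where
  "twist \<xi> = mk_rep (rdim N) (\<lambda>\<alpha>. if \<alpha> = \<xi> then amap N \<alpha> * (\<one>\<^sub>i (rdim N i) - L i * \<nu>) else amap N \<alpha>)"

lemma L_i: "fits (rdim N i) 1 (L i)" "\<nu> * L i = \<one>\<^sub>i 1"
  using L(1,3)[OF ends_I(3)] nu(1) ends_I(3) by (auto simp: \<pi>_def fits_def)

lemma fits_proj: "fits (rdim N i) (rdim N i) (\<one>\<^sub>i (rdim N i) - L i * \<nu>)"
  by (rule fits_diff[OF fits_unit fits_times[OF L_i(1) nu(1)]])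

lemma rdim_twist: "v \<in> Q0 Q \<Longrightarrow> rdim (twist \<xi>) v = rdim N v"
  by (simp add: twist_def)

lemma amap_twist:
  assumes "\<xi> \<in> outA Q i" "\<alpha> \<in> Q1 Q"
  shows "amap (twist \<xi>) \<alpha> = (if \<alpha> = \<xi> then amap N \<alpha> * (\<one>\<^sub>i (rdim N i) - L i * \<nu>) else amap N \<alpha>)"
  unfolding twist_def
proof (rule amap_mk_rep)
  show "fits (rdim N (tgt Q \<alpha>)) (rdim N (src Q \<alpha>))
      (if \<alpha> = \<xi> then amap N \<alpha> * (\<one>\<^sub>i (rdim N i) - L i * \<nu>) else amap N \<alpha>)"
    using fits_amap[OF rN assms(2)] fits_times[OF fits_amap[OF rN assms(2)], of "rdim N i"] fits_proj assms
    by (auto simp: outA_def)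
qed

text \<open>If \<open>C = S(i)\<close>, where the arrows \<open>\<alpha>\<close> and \<open>\<delta>\<close> start at \<open>i\<close>, the extension \<open>N\<close> of \<open>S(i)\<close> by
  \<open>M\<close> is the Baer sum of the extensions \<open>twist \<alpha>\<close> and \<open>twist \<delta>\<close>, in which \<open>\<alpha>\<close>, respectively
  \<open>\<delta>\<close>, kills a preimage of the generator. As \<open>End(M)\<close> is local, one of them maps to \<open>N\<close>.\<close>

context
  assumes Ii: "I = {i}"
begin

lemma nu_into_i: "\<alpha> \<in> Q1 Q \<Longrightarrow> tgt Q \<alpha> = i \<Longrightarrow> \<nu> * amap N \<alpha> = 0"
  using ihom_commute[OF pi, of \<alpha>] no_arrow_from_i[of \<alpha>] nu(1) Ii
  by (cases "src Q \<alpha> = i") (auto simp: \<pi>_def amap_thin fits_def)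

lemma pi_amap: "\<alpha> \<in> Q1 Q \<Longrightarrow> \<pi> (tgt Q \<alpha>) * amap N \<alpha> = 0"
  using nu_into_i[of \<alpha>] nu(1) Ii by (auto simp: \<pi>_def fits_def)

lemma pi_i: "\<pi> i = \<nu>"
  using nu(1) Ii by (simp add: \<pi>_def fits_def)

text \<open>All arrows of N land in the kernel of \<pi>, because the cokernel is simple, and on this
  kernel the twisted arrow equals the original one.\<close>

lemma pmap_twist_kernel:
  assumes "\<xi> \<in> outA Q i" "\<pi> v * G = 0" "dpath Q v r w"
  shows "pmap Q (twist \<xi>) v r * G = pmap Q N v r * G \<or> r = []"
  using assms(2,3)
proof (induction r arbitrary: v G)
  case (Cons \<alpha> r)
  have \<alpha>: "\<alpha> \<in> Q1 Q" "src Q \<alpha> = v" using Cons.prems by auto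
  have e: "amap (twist \<xi>) \<alpha> * G = amap N \<alpha> * G"
  proof (cases "\<alpha> = \<xi>")
    case True
    then have "\<nu> * G = 0" using assms(1) Cons.prems(1) \<alpha> pi_i by (auto simp: outA_def)
    moreover have "amap N \<alpha> * \<one>\<^sub>i (rdim N i) = amap N \<alpha>"
      using fits_amap[OF rN \<alpha>(1)] True assms(1) by (simp add: outA_def fits_def)
    moreover have "amap (twist \<xi>) \<alpha> * G = amap N \<alpha> * \<one>\<^sub>i (rdim N i) * G - amap N \<alpha> * L i * (\<nu> * G)"
      unfolding amap_twist[OF assms(1) \<alpha>(1)] using True
      by (simp add: left_diff_distrib right_diff_distrib mult.assoc)
    ultimately show ?thesis by simp
  qed (simp add: amap_twist[OF assms(1) \<alpha>(1)])
  show ?case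
  proof (cases "r = []")
    case True
    have "rdim (twist \<xi>) (tgt Q \<alpha>) = rdim N (tgt Q \<alpha>)" by (rule rdim_twist[OF arrow_ends(2)[OF \<alpha>(1)]])
    then show ?thesis using e True by (simp add: mult.assoc)
  next
    case False
    have "\<pi> (tgt Q \<alpha>) * (amap N \<alpha> * G) = 0" using pi_amap[OF \<alpha>(1)] by (simp add: mult.assoc[symmetric])
    then have "pmap Q (twist \<xi>) (tgt Q \<alpha>) r * (amap N \<alpha> * G) = pmap Q N (tgt Q \<alpha>) r * (amap N \<alpha> * G)"
      using Cons.IH[of "tgt Q \<alpha>"] Cons.prems(2) False by auto
    then show ?thesis using e by (simp add: mult.assoc)
  qed
qed simp

text \<open>A relation has length at least two, and after its first arrow the twisted and the
  original maps coincide; thus the relation in the twist is the one in N times some matrix.\<close>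

lemma twist_is_rep:
  assumes \<xi>: "\<xi> \<in> outA Q i"
  shows "is_rep Q (twist \<xi>)"
  unfolding twist_def
proof (rule mk_rep_is_rep, fold twist_def)
  fix v r w assume r: "r \<in> rels Q" "dpath Q v r w"
  have "in_I Q r" unfolding in_I_def using r(1) by (metis append_Nil append_Nil2)
  then have z: "pmap Q N v r = 0" using pmap_in_I[OF rN r(2)] by blast
  obtain \<alpha> q where q1: "r = \<alpha> # q" using rels_length[OF r(1)] by (cases r) auto
  then have q: "r = \<alpha> # q" "q \<noteq> []" using rels_length[OF r(1)] by auto
  have \<alpha>: "\<alpha> \<in> Q1 Q" "dpath Q (tgt Q \<alpha>) q w" using r(2) q by auto
  obtain G where G: "amap (twist \<xi>) \<alpha> = amap N \<alpha> * G"
  proof (cases "\<alpha> = \<xi>")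
    case True
    then show thesis using that amap_twist[OF \<xi> \<alpha>(1)] by simp
  next
    case False
    then show thesis using that[of "\<one>\<^sub>i (rdim N (src Q \<alpha>))"] amap_twist[OF \<xi> \<alpha>(1)] fits_amap[OF rN \<alpha>(1)]
      by (simp add: fits_def)
  qed
  have "\<pi> (tgt Q \<alpha>) * (amap N \<alpha> * G) = 0" using pi_amap[OF \<alpha>(1)] by (simp add: mult.assoc[symmetric])
  then have "pmap Q (twist \<xi>) v r = pmap Q N (tgt Q \<alpha>) q * (amap N \<alpha> * G)"
    using pmap_twist_kernel[OF \<xi> _ \<alpha>(2)] q G by auto
  also have "\<dots> = pmap Q N v r * G" by (simp add: q mult.assoc)
  finally show "pmap Q (twist \<xi>) v r = 0" using z by simp
qed

text \<open>\<open>L i\<close> is annihilated by \<xi> in the twist, so its image under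
  \<open>g\<close> is annihilated by \<xi> in N.\<close>

lemma twist_hom_kills:
  assumes \<xi>: "\<xi> \<in> outA Q i" and g: "ihom Q (twist \<xi>) N g" and pg: "\<pi> i * g i = \<pi> i"
  shows "\<exists>n. fits (rdim N i) 1 n \<and> \<nu> * n = \<one>\<^sub>i 1 \<and> amap N \<xi> * n = 0"
proof (intro exI conjI)
  have x: "\<xi> \<in> Q1 Q" "src Q \<xi> = i" using \<xi> by (auto simp: outA_def)
  have fg: "fits (rdim N i) (rdim N i) (g i)" using ihom_fits[OF g i] rdim_twist[OF i] by simp
  show "fits (rdim N i) 1 (g i * L i)" by (rule fits_times[OF fg L_i(1)])
  show "\<nu> * (g i * L i) = \<one>\<^sub>i 1" using pg L_i(2) pi_i by (simp add: mult.assoc[symmetric])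
  have "(\<one>\<^sub>i (rdim N i) - L i * \<nu>) * L i = 0"
    using L_i by (simp add: left_diff_distrib mult.assoc fits_def)
  then have "amap (twist \<xi>) \<xi> * L i = 0" by (simp add: amap_twist[OF \<xi> x(1)] mult.assoc)
  then have "g (tgt Q \<xi>) * amap (twist \<xi>) \<xi> * L i = 0" by (simp add: mult.assoc)
  then show "amap N \<xi> * (g i * L i) = 0" using ihom_commute[OF g x(1)] x by (simp add: mult.assoc)
qed

text \<open>By the five lemma \<open>s\<close> is invertible, being \<theta> on M and the identity
  on the cokernel; the inverse is a map from the twist to N over the cokernel.\<close>

lemma twist_iso_kills:
  assumes \<xi>: "\<xi> \<in> outA Q i" and s: "ihom Q N (twist \<xi>) s" and ps: "\<And>v. v \<in> Q0 Q \<Longrightarrow> \<pi> v * s v = \<pi> v"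
    and sF: "\<And>v. v \<in> Q0 Q \<Longrightarrow> s v * F v = F v * \<theta> v" and \<theta>: "ihom Q M M \<theta>" "iauto Q M \<theta>"
  shows "\<exists>n. fits (rdim N i) 1 n \<and> \<nu> * n = \<one>\<^sub>i 1 \<and> amap N \<xi> * n = 0"
proof -
  obtain t where t: "ihom Q M M t" "\<And>v. v \<in> Q0 Q \<Longrightarrow> \<theta> v * t v = \<one>\<^sub>i (rdim M v) \<and> t v * \<theta> v = \<one>\<^sub>i (rdim M v)"
    using \<theta>(2) unfolding iauto_def by blast
  define E where "E v = (\<one>\<^sub>i (rdim N v) :: 'k imat)" for v
  define \<tau> where "\<tau> v = \<kappa> v * (E v - L v * \<pi> v)" for v
  \<comment> \<open>The inverse made explicit: subtracting \<open>s\<close> of the linear lift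
    leaves an element of the image of f, on which \<theta> is undone by \<open>t\<close>; then the
    linear lift is added back.\<close>
  define g where "g v = F v * (t v * (\<tau> v * (E v - s v * (L v * \<pi> v)))) + L v * \<pi> v" for v
  have piL: "\<pi> v * (L v * \<pi> v) = \<pi> v" if "v \<in> Q0 Q" for v
  proof (cases "v = i")
    case True
    then show ?thesis using L_i(2) nu(1) pi_i by (simp add: mult.assoc[symmetric] fits_def)
  qed (simp add: \<pi>_def Ii)
  have fLp: "fits (rdim N v) (rdim N v) (L v * \<pi> v)" for v
    using fits_times[OF L_i(1) nu(1)] pi_i by (cases "v = i") (auto simp: \<pi>_def Ii)
  have fE: "fits (rdim N v) (rdim N v) (E v)" for v by (simp add: E_def)
  have sg: "s v * g v = E v" and gs: "g v * s v = E v" and fg: "fits (rdim N v) (rdim N v) (g v)" if v: "v \<in> Q0 Q" for v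
  proof -
    note fF = ihom_fits[OF F v] and fk = conjunct1[OF kap[OF v]] and ft = ihom_fits[OF t(1) v]
    have fs: "fits (rdim N v) (rdim N v) (s v)" using ihom_fits[OF s v] rdim_twist[OF v] by simp
    have fd: "fits (rdim N v) (rdim N v) (E v - L v * \<pi> v)" by (rule fits_diff[OF fE fLp])
    have ftau: "fits (rdim M v) (rdim N v) (\<tau> v)" unfolding \<tau>_def by (rule fits_times[OF fk fd])
    have fd': "fits (rdim N v) (rdim N v) (E v - s v * (L v * \<pi> v))" by (rule fits_diff[OF fE fits_times[OF fs fLp]])
    show fg: "fits (rdim N v) (rdim N v) (g v)"
      unfolding g_def by (rule fits_add[OF fits_times[OF fF fits_times[OF ft fits_times[OF ftau fd']]] fLp])
    have Ft: "F v * \<tau> v = E v - L v * \<pi> v" using exact[OF v] by (simp add: \<tau>_def E_def)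
    have tF: "\<tau> v * F v = \<one>\<^sub>i (rdim M v)"
    proof -
      have "\<tau> v * F v = \<kappa> v * (E v * F v) - \<kappa> v * L v * (\<pi> v * F v)"
        by (simp add: \<tau>_def left_diff_distrib right_diff_distrib mult.assoc)
      then show ?thesis using piF[OF v] kap[OF v] fF by (simp add: E_def fits_def)
    qed
    have Eu: "E v * x = x" "x * E v = x" if "fits (rdim N v) (rdim N v) x" for x
      using that by (auto simp: E_def fits_def)
    have psL: "\<pi> v * (s v * (L v * \<pi> v)) = \<pi> v" using ps[OF v] piL[OF v] by (simp add: mult.assoc[symmetric])
    have fpi: "\<pi> v * E v = \<pi> v" using ihom_fits[OF pi v] by (simp add: E_def fits_def)
    have "s v * g v = (s v * F v) * t v * \<tau> v * (E v - s v * (L v * \<pi> v)) + s v * (L v * \<pi> v)"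
      by (simp add: g_def distrib_left mult.assoc)
    also have "\<dots> = F v * (\<theta> v * t v) * \<tau> v * (E v - s v * (L v * \<pi> v)) + s v * (L v * \<pi> v)"
      unfolding sF[OF v] by (simp only: mult.assoc)
    also have "\<dots> = (E v - L v * \<pi> v) * (E v - s v * (L v * \<pi> v)) + s v * (L v * \<pi> v)"
      using t(2)[OF v] fF Ft by (simp add: fits_def)
    also have "\<dots> = E v - L v * (\<pi> v * E v) + L v * (\<pi> v * (s v * (L v * \<pi> v)))"
      using Eu[OF fE] Eu[OF fits_times[OF fs fLp]] by (simp add: left_diff_distrib right_diff_distrib mult.assoc)
    also have "\<dots> = E v" unfolding psL fpi by simp
    finally show "s v * g v = E v" .
    have "(E v - s v * (L v * \<pi> v)) * s v = s v * (E v - L v * \<pi> v)"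
      using Eu[OF fs] ps[OF v] by (simp add: left_diff_distrib right_diff_distrib mult.assoc)
    also have "\<dots> = s v * F v * \<tau> v" unfolding Ft[symmetric] by (simp only: mult.assoc)
    finally have d: "(E v - s v * (L v * \<pi> v)) * s v = F v * (\<theta> v * \<tau> v)" unfolding sF[OF v] by (simp only: mult.assoc)
    have "g v * s v = F v * (t v * (\<tau> v * ((E v - s v * (L v * \<pi> v)) * s v))) + L v * (\<pi> v * s v)"
      by (simp add: g_def distrib_right mult.assoc)
    also have "\<dots> = F v * (t v * ((\<tau> v * F v) * \<theta> v)) * \<tau> v + L v * \<pi> v" unfolding d ps[OF v] by (simp only: mult.assoc)
    also have "\<dots> = F v * \<tau> v + L v * \<pi> v"
      using tF t(2)[OF v] fF ihom_fits[OF \<theta>(1) v] by (simp add: fits_def)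
    finally show "g v * s v = E v" unfolding Ft by simp
  qed
  have "ihom Q (twist \<xi>) N g" unfolding ihom_def
  proof (intro conjI ballI)
    show "fits (rdim N v) (rdim (twist \<xi>) v) (g v)" if "v \<in> Q0 Q" for v using fg[OF that] rdim_twist[OF that] by simp
    fix \<alpha> assume \<alpha>: "\<alpha> \<in> Q1 Q"
    let ?s = "src Q \<alpha>" and ?t = "tgt Q \<alpha>"
    note se = arrow_ends(1)[OF \<alpha>] and te = arrow_ends(2)[OF \<alpha>]
    have "amap (twist \<xi>) \<alpha> = amap (twist \<xi>) \<alpha> * (s ?s * g ?s)"
      using fits_amap[OF twist_is_rep[OF \<xi>] \<alpha>] rdim_twist[OF se] sg[OF se] by (simp add: fits_def E_def)
    then have "g ?t * amap (twist \<xi>) \<alpha> = g ?t * (amap (twist \<xi>) \<alpha> * s ?s) * g ?s" by (metis mult.assoc)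
    also have "\<dots> = (g ?t * s ?t) * amap N \<alpha> * g ?s" unfolding ihom_commute[OF s \<alpha>, symmetric] by (simp only: mult.assoc)
    also have "\<dots> = amap N \<alpha> * g ?s" using gs[OF te] fits_amap[OF rN \<alpha>] by (simp add: E_def fits_def)
    finally show "g ?t * amap (twist \<xi>) \<alpha> = amap N \<alpha> * g ?s" .
  qed
  moreover have "\<pi> i * g i = \<pi> i"
  proof -
    have "\<pi> i * g i = \<pi> i * (s i * g i)" using ps[OF i] by (simp add: mult.assoc[symmetric])
    then show ?thesis using sg[OF i] ihom_fits[OF pi i] by (simp add: E_def fits_def)
  qed
  ultimately show ?thesis by (rule twist_hom_kills[OF \<xi>])
qed

lemma killed_by_an_arrow:
  assumes out: "outA Q i = {\<alpha>, \<delta>}" "\<alpha> \<noteq> \<delta>"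
  shows "\<exists>n. fits (rdim N i) 1 n \<and> \<nu> * n = \<one>\<^sub>i 1 \<and> (amap N \<alpha> * n = 0 \<or> amap N \<delta> * n = 0)"
proof -
  have a: "\<alpha> \<in> outA Q i" "\<delta> \<in> outA Q i" using out by auto
  have a1: "\<alpha> \<in> Q1 Q" "src Q \<alpha> = i" "\<delta> \<in> Q1 Q" "src Q \<delta> = i" using a by (auto simp: outA_def)
  have pt: "ihom Q (twist \<alpha>) (thin I) \<pi>" unfolding ihom_def
  proof (intro conjI ballI)
    show "fits (rdim (thin I :: ('v, 'a, 'k) qrep) v) (rdim (twist \<alpha>) v) (\<pi> v)" if "v \<in> Q0 Q" for v
      using ihom_fits[OF pi that] rdim_twist[OF that] by simp
    fix \<gamma> assume \<gamma>: "\<gamma> \<in> Q1 Q"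
    have "\<pi> (tgt Q \<gamma>) * amap (twist \<alpha>) \<gamma> = 0"
      unfolding amap_twist[OF a(1) \<gamma>] using pi_amap[OF \<gamma>]
      by (cases "\<gamma> = \<alpha>") (auto simp: mult.assoc[symmetric])
    then show "\<pi> (tgt Q \<gamma>) * amap (twist \<alpha>) \<gamma> = amap (thin I) \<gamma> * \<pi> (src Q \<gamma>)"
      using ihom_commute[OF pi \<gamma>] pi_amap[OF \<gamma>] by simp
  qed
  from lift_or_factor[OF twist_is_rep[OF a(1)] pt] show ?thesis
  proof (elim disjE exE conjE)
    fix s assume "ihom Q (twist \<alpha>) N s" "\<forall>v\<in>Q0 Q. \<pi> v * s v = \<pi> v"
    then show ?thesis using twist_hom_kills[OF a(1)] i by blast
  next
    fix s assume s: "ihom Q N (twist \<alpha>) s" and ps: "\<forall>v\<in>Q0 Q. \<pi> v * s v = \<pi> v"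
    \<comment> \<open>As \<open>s\<close> preserves \<pi>, it maps the image of f into itself;
      \<theta> is the endomorphism of M it induces.\<close>
    define \<theta> where "\<theta> v = \<kappa> v * (s v * F v)" for v
    have fs: "fits (rdim N v) (rdim N v) (s v)" if "v \<in> Q0 Q" for v using ihom_fits[OF s that] rdim_twist[OF that] by simp
    have sF: "s v * F v = F v * \<theta> v" if v: "v \<in> Q0 Q" for v
    proof -
      have fsF: "fits (rdim N v) (rdim M v) (s v * F v)" by (rule fits_times[OF fs[OF v] ihom_fits[OF F v]])
      have "\<pi> v * (s v * F v) = (\<pi> v * s v) * F v" by (simp only: mult.assoc)
      then have "\<pi> v * (s v * F v) = 0" using ps v piF[OF v] by simp
      then have e: "(\<one>\<^sub>i (rdim N v) - L v * \<pi> v) * (s v * F v) = s v * F v"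
        using fsF by (simp add: left_diff_distrib mult.assoc fits_def)
      have "F v * \<kappa> v * ((\<one>\<^sub>i (rdim N v) - L v * \<pi> v) * (s v * F v)) = (\<one>\<^sub>i (rdim N v) - L v * \<pi> v) * (s v * F v)"
        using exact[OF v] by (simp add: mult.assoc[symmetric])
      then show ?thesis unfolding e \<theta>_def by (simp add: mult.assoc)
    qed
    have \<theta>: "ihom Q M M \<theta>" unfolding ihom_def
    proof (intro conjI ballI)
      show "fits (rdim M v) (rdim M v) (\<theta> v)" if v: "v \<in> Q0 Q" for v
        unfolding \<theta>_def by (rule fits_times[OF conjunct1[OF kap[OF v]] fits_times[OF fs[OF v] ihom_fits[OF F v]]])
      fix \<gamma> assume \<gamma>: "\<gamma> \<in> Q1 Q"
      let ?s = "src Q \<gamma>" and ?t = "tgt Q \<gamma>"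
      note se = arrow_ends(1)[OF \<gamma>] and te = arrow_ends(2)[OF \<gamma>]
      have tw: "amap (twist \<alpha>) \<gamma> * F ?s = amap N \<gamma> * F ?s"
      proof (cases "\<gamma> = \<alpha>")
        case True
        have "(\<one>\<^sub>i (rdim N i) - L i * \<nu>) * F i = F i"
          using nu(2) ihom_fits[OF F i] by (simp add: left_diff_distrib mult.assoc fits_def)
        then show ?thesis unfolding amap_twist[OF a(1) \<gamma>] using True a1 by (simp add: mult.assoc)
      qed (simp add: amap_twist[OF a(1) \<gamma>])
      have "F ?t * (\<theta> ?t * amap M \<gamma>) = s ?t * (F ?t * amap M \<gamma>)" using sF[OF te] by (simp add: mult.assoc[symmetric])
      also have "\<dots> = (amap (twist \<alpha>) \<gamma> * s ?s) * F ?s"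
        unfolding ihom_commute[OF F \<gamma>] ihom_commute[OF s \<gamma>, symmetric] by (simp only: mult.assoc)
      also have "\<dots> = (amap (twist \<alpha>) \<gamma> * F ?s) * \<theta> ?s" using sF[OF se] by (simp add: mult.assoc)
      also have "\<dots> = F ?t * (amap M \<gamma> * \<theta> ?s)" unfolding tw ihom_commute[OF F \<gamma>, symmetric] by (simp only: mult.assoc)
      finally have "(\<kappa> ?t * F ?t) * (\<theta> ?t * amap M \<gamma>) = (\<kappa> ?t * F ?t) * (amap M \<gamma> * \<theta> ?s)" by (simp add: mult.assoc)
      moreover have "fits (rdim M ?t) (rdim M ?t) (\<theta> ?t)"
        unfolding \<theta>_def by (rule fits_times[OF conjunct1[OF kap[OF te]] fits_times[OF fs[OF te] ihom_fits[OF F te]]])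
      ultimately show "\<theta> ?t * amap M \<gamma> = amap M \<gamma> * \<theta> ?s"
        using kap[OF te] fits_amap[OF rM \<gamma>] by (simp add: fits_def mult.assoc[symmetric])
    qed
    from local_endomorphisms[OF indM \<theta>] show ?thesis
    proof
      assume "iauto Q M \<theta>"
      then show ?thesis using twist_iso_kills[OF a(1) s _ sF \<theta>] ps by blast
    next
      define \<theta>' where "\<theta>' v = \<one>\<^sub>i (rdim M v) - \<theta> v" for v
      assume "iauto Q M (\<lambda>v. \<one>\<^sub>i (rdim M v) - \<theta> v)"
      moreover have "\<theta>' = (\<lambda>v. \<one>\<^sub>i (rdim M v) - \<theta> v)" by (rule ext) (simp add: \<theta>'_def)
      ultimately have au: "iauto Q M \<theta>'" by simp
      have h': "ihom Q M M \<theta>'" unfolding \<theta>'_def by (rule ihom_diff[OF ihom_id[OF rM] \<theta>])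
      \<comment> \<open>The complement of \<open>s\<close> in the Baer sum: it is 1 - \<theta> on M
        and still the identity on the cokernel. The summand L \<pi> shifts the projection from
        \<alpha> to \<delta>, so the target becomes the other twist.\<close>
      define t where "t v = \<one>\<^sub>i (rdim N v) - s v + L v * \<pi> v" for v
      have fLp: "fits (rdim N v) (rdim N v) (L v * \<pi> v)" for v
        using fits_times[OF L_i(1) nu(1)] pi_i by (cases "v = i") (auto simp: \<pi>_def Ii)
      have ft: "fits (rdim N v) (rdim N v) (t v)" if "v \<in> Q0 Q" for v
        unfolding t_def by (rule fits_add[OF fits_diff[OF fits_unit fs[OF that]] fLp])
      have pL: "\<pi> v * (L v * \<pi> v) = \<pi> v" if "v \<in> Q0 Q" for v
      proof (cases "v = i")
        case True
        then show ?thesis using L_i(2) nu(1) pi_i by (simp add: mult.assoc[symmetric] fits_def)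
      qed (simp add: \<pi>_def Ii)
      have pt: "\<pi> v * t v = \<pi> v" if v: "v \<in> Q0 Q" for v
        using ps v pL[OF v] ihom_fits[OF pi v] by (simp add: t_def distrib_left right_diff_distrib fits_def)
      have tF: "t v * F v = F v * \<theta>' v" if v: "v \<in> Q0 Q" for v
        using sF[OF v] piF[OF v] ihom_fits[OF F v]
        by (simp add: t_def \<theta>'_def distrib_right left_diff_distrib right_diff_distrib mult.assoc fits_def)
      have L0: "L v = 0" if "v \<noteq> i" for v using L(2) that Ii by blast
      have ht: "ihom Q N (twist \<delta>) t" unfolding ihom_def
      proof (intro conjI ballI)
        show "fits (rdim (twist \<delta>) v) (rdim N v) (t v)" if "v \<in> Q0 Q" for v using ft[OF that] rdim_twist[OF that] by simp
        fix \<gamma> assume \<gamma>: "\<gamma> \<in> Q1 Q"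
        let ?s = "src Q \<gamma>" and ?t = "tgt Q \<gamma>"
        note se = arrow_ends(1)[OF \<gamma>] and te = arrow_ends(2)[OF \<gamma>]
        have u: "\<one>\<^sub>i (rdim N ?t) * amap N \<gamma> = amap N \<gamma>" "amap N \<gamma> * \<one>\<^sub>i (rdim N ?s) = amap N \<gamma>"
          using fits_amap[OF rN \<gamma>] by (auto simp: fits_def)
        have "L ?t * \<pi> ?t * amap N \<gamma> = 0" using pi_amap[OF \<gamma>] by (simp add: mult.assoc)
        then have l: "t ?t * amap N \<gamma> = amap N \<gamma> - amap (twist \<alpha>) \<gamma> * s ?s"
          using ihom_commute[OF s \<gamma>] u by (simp add: t_def distrib_right left_diff_distrib)
        show "t ?t * amap N \<gamma> = amap (twist \<delta>) \<gamma> * t ?s"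
        proof (cases "?s = i")
          case False
          then have "\<gamma> \<noteq> \<alpha>" "\<gamma> \<noteq> \<delta>" using a1 by auto
          then show ?thesis unfolding l using u L0[OF False]
            by (simp add: amap_twist[OF a(1) \<gamma>] amap_twist[OF a(2) \<gamma>] t_def right_diff_distrib)
        next
          case True
          then have "\<gamma> = \<alpha> \<or> \<gamma> = \<delta>" using out \<gamma> by (auto simp: outA_def)
          have ns: "\<nu> * s i = \<nu>" using ps i pi_i by auto
          have nt: "\<nu> * t i = \<nu>" using pt[OF i] pi_i by simp
          have fsi: "\<one>\<^sub>i (rdim N i) * s i = s i" "\<one>\<^sub>i (rdim N i) * t i = t i" using fs[OF i] ft[OF i] by (auto simp: fits_def)
          have P: "(\<one>\<^sub>i (rdim N i) - L i * \<nu>) * s i = s i - L i * \<nu>" "(\<one>\<^sub>i (rdim N i) - L i * \<nu>) * t i = \<one>\<^sub>i (rdim N i) - s i"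
            using ns nt fsi by (simp_all add: left_diff_distrib mult.assoc) (simp add: t_def pi_i)
          have tsi: "t i = \<one>\<^sub>i (rdim N i) - s i + L i * \<nu>" by (simp add: t_def pi_i)
          from \<open>\<gamma> = \<alpha> \<or> \<gamma> = \<delta>\<close> show ?thesis
          proof
            assume g: "\<gamma> = \<alpha>"
            have "amap (twist \<alpha>) \<gamma> * s ?s = amap N \<gamma> * (s i - L i * \<nu>)"
              unfolding amap_twist[OF a(1) \<gamma>] using g True P by (simp add: mult.assoc)
            moreover have "amap (twist \<delta>) \<gamma> * t ?s = amap N \<gamma> * (\<one>\<^sub>i (rdim N i) - s i + L i * \<nu>)"
              unfolding amap_twist[OF a(2) \<gamma>] using g out(2) True tsi by simp
            ultimately show ?thesis unfolding l using u True by (simp add: right_diff_distrib distrib_left)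
          next
            assume g: "\<gamma> = \<delta>"
            have "amap (twist \<alpha>) \<gamma> * s ?s = amap N \<gamma> * s i"
              unfolding amap_twist[OF a(1) \<gamma>] using g out(2) True by simp
            moreover have "amap (twist \<delta>) \<gamma> * t ?s = amap N \<gamma> * (\<one>\<^sub>i (rdim N i) - s i)"
              unfolding amap_twist[OF a(2) \<gamma>] using g True P by (simp add: mult.assoc)
            ultimately show ?thesis unfolding l using u True by (simp add: right_diff_distrib)
          qed
        qed
      qed
      show ?thesis using twist_iso_kills[OF a(2) ht pt tF h' au] by blast
    qed
  qed
qed

end

end

section \<open>Arrows at the border of an arm\<close>

context string_tree
begin

lemma other_arrows_subset:
  assumes "i \<in> Q0 Q" "dpath Q a q i" "q \<noteq> []"
  shows "\<exists>\<delta>. outA Q a - {hd q} \<subseteq> {\<delta>}"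
proof (cases "\<exists>\<delta>\<in>outA Q a. \<delta> \<noteq> hd q")
  case True
  then obtain \<delta> where "\<delta> \<in> outA Q a" "\<delta> \<noteq> hd q" by blast
  then have "outA Q a = {\<delta>, hd q}"
    using outA_other(1)[OF dpath_start[OF assms(1,2)] _ hd_in_outA[OF assms(2,3)]] by blast
  then show ?thesis by blast
qed blast

lemma other_arrow_leaves:
  assumes "dpath Q a q i" "\<delta> \<in> outA Q a" "\<delta> \<noteq> hd q"
  shows "tgt Q \<delta> \<notin> set (verts Q a q)"
proof
  assume t: "tgt Q \<delta> \<in> set (verts Q a q)"
  have "pth a (tgt Q \<delta>) = [\<delta>]" using assms(2) by (intro pth_eq) (simp add: outA_def)
  then have "q = \<delta> # pth (tgt Q \<delta>) i" using verts_decomp(3)[OF assms(1) t] by simp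
  then show False using assms(3) by (metis list.sel(1))
qed

lemma src_last_on_path:
  assumes "dpath Q a q i" "q \<noteq> []"
  shows "src Q (last q) \<in> set (verts Q a q)" "last q \<in> Q1 Q" "tgt Q (last q) = i"
proof -
  have q: "q = butlast q @ [last q]" using assms(2) by simp
  then have "dpath Q a (butlast q @ [last q]) i" using assms(1) by simp
  then have d: "last q \<in> Q1 Q" "dpath Q a (butlast q) (src Q (last q))" "i = tgt Q (last q)" by (auto simp: dpath_snoc)
  then show "last q \<in> Q1 Q" "tgt Q (last q) = i" by auto
  have "dpath Q (src Q (last q)) [last q] i" using d by simp
  then show "src Q (last q) \<in> set (verts Q a q)" unfolding verts_split[OF assms(1)] using d(2) q by blast
qed

lemma in_I_last:
  assumes "in_I Q [last q, \<alpha>]" "q \<noteq> []"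
  shows "in_I Q (q @ [\<alpha>])"
proof -
  have "q @ [\<alpha>] = butlast q @ [last q, \<alpha>]" using assms(2) by simp
  then show ?thesis using in_I_append2[OF assms(1)] by metis
qed

lemma end_zero:
  assumes N: "is_rep Q N" and q: "dpath Q a q i" and \<alpha>: "\<alpha> \<in> outA Q i" "in_I Q (q @ [\<alpha>])"
  shows "amap N \<alpha> * pmap Q N a (pth a i) = 0"
proof -
  have a: "\<alpha> \<in> Q1 Q" "dpath Q i [\<alpha>] (tgt Q \<alpha>)" using \<alpha>(1) by (auto simp: outA_def)
  have "dpath Q a (q @ [\<alpha>]) (tgt Q \<alpha>)" using q a by (auto simp: dpath_append)
  then have "pmap Q N a (q @ [\<alpha>]) = 0" using pmap_in_I[OF N] \<alpha>(2) by blast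
  then show ?thesis using pmap_append[OF N q a(2)] pmap_single[OF N a(1)] pth_eq[OF q] by simp
qed

lemma two_step_zero:
  assumes N: "is_rep Q N" and "\<alpha> \<in> Q1 Q" "\<delta> \<in> Q1 Q" "src Q \<delta> = tgt Q \<alpha>" "in_I Q [\<alpha>, \<delta>]"
  shows "amap N \<delta> * amap N \<alpha> = 0"
proof -
  have "dpath Q (src Q \<alpha>) [\<alpha>, \<delta>] (tgt Q \<delta>)" using assms by simp
  then have "pmap Q N (src Q \<alpha>) [\<alpha>, \<delta>] = 0" using pmap_in_I[OF N] assms(5) by blast
  then show ?thesis using fits_amap[OF N assms(3)] by (simp add: fits_def)
qed

text \<open>The arrow \<eta> of \<open>q\<close> arriving at the inner vertex has the nonzero
  continuation \<gamma>, so \<open>string_in\<close> makes \<gamma> compose to zero with any other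
  arriving arrow.\<close>

lemma border_interior:
  assumes q: "dpath Q a q i" "\<not> in_I Q q" and \<alpha>: "\<alpha> \<in> Q1 Q" and
    t: "tgt Q \<alpha> \<in> set (verts Q a q)" "tgt Q \<alpha> \<noteq> a" "tgt Q \<alpha> \<noteq> i" and s: "src Q \<alpha> \<notin> set (verts Q a q)"
  shows "in_I Q (\<alpha> # pth (tgt Q \<alpha>) i)"
proof -
  let ?v = "tgt Q \<alpha>"
  note d = verts_decomp[OF q(1) t(1)]
  have "pth ?v i \<noteq> []" using d(2) t(3) by auto
  then obtain \<gamma> w where w: "pth ?v i = \<gamma> # w" by (meson neq_Nil_conv)
  have \<gamma>: "\<gamma> \<in> Q1 Q" "src Q \<gamma> = ?v" using d(2) w by auto
  have "pth a ?v \<noteq> []" using d(1) t(2) by auto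
  then obtain u \<eta> where u: "pth a ?v = u @ [\<eta>]" by (metis rev_exhaust)
  have \<eta>: "\<eta> \<in> Q1 Q" "tgt Q \<eta> = ?v" "dpath Q a u (src Q \<eta>)" using d(1) u by (auto simp: dpath_snoc)
  have e: "q = u @ (\<eta> # pth ?v i)" using d(3) u by simp
  have "dpath Q (src Q \<eta>) (\<eta> # pth ?v i) i" using \<eta> d(2) by simp
  then have "src Q \<eta> \<in> set (verts Q a q)" unfolding verts_split[OF q(1)] using e \<eta>(3) by blast
  then have "\<eta> \<noteq> \<alpha>" using s by blast
  have "q = u @ [\<eta>, \<gamma>] @ w" using e w by simp
  then have "\<not> in_I Q [\<eta>, \<gamma>]" using q(2) in_I_extend by metis
  then have "in_I Q [\<alpha>, \<gamma>]" using string_in[OF \<eta>(1) \<alpha> \<gamma>(1) \<open>\<eta> \<noteq> \<alpha>\<close>] \<eta>(2) \<gamma>(2) by metis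
  then show ?thesis using in_I_append1[where p = "[\<alpha>, \<gamma>]" and w = w] w by simp
qed

text \<open>An entering arrow can have nonzero composite with the rest of \<open>q\<close> only at
  the start \<open>a\<close>; then \<open>string_out\<close> lets every other arrow at
  \<open>a\<close> annihilate it, and \<beta> is its own map. In all other cases the composite
  vanishes and \<beta> is 0.\<close>

lemma border_arm:
  assumes N: "is_rep Q N" and q: "dpath Q a q i" "\<not> in_I Q q" and \<alpha>: "\<alpha> \<in> Q1 Q" and
    t: "tgt Q \<alpha> \<in> set (verts Q a q)" "tgt Q \<alpha> \<noteq> i" and s: "src Q \<alpha> \<notin> set (verts Q a q)"
  shows "\<exists>\<beta>. pmap Q N (tgt Q \<alpha>) (pth (tgt Q \<alpha>) i) * amap N \<alpha> = pmap Q N a (pth a i) * \<beta> \<and>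
    (\<forall>\<delta>\<in>outA Q a - {hd q}. amap N \<delta> * \<beta> = 0)"
proof (cases "in_I Q (\<alpha> # pth (tgt Q \<alpha>) i)")
  case True
  have "dpath Q (src Q \<alpha>) (\<alpha> # pth (tgt Q \<alpha>) i) i" using \<alpha> verts_decomp(2)[OF q(1) t(1)] by simp
  then have "pmap Q N (src Q \<alpha>) (\<alpha> # pth (tgt Q \<alpha>) i) = 0" using pmap_in_I[OF N] True by blast
  then show ?thesis by (intro exI[of _ 0]) simp
next
  case False
  then have a: "tgt Q \<alpha> = a" using border_interior[OF q \<alpha> t(1) _ t(2) s] by blast
  then have e: "pth (tgt Q \<alpha>) i = q" using pth_eq[OF q(1)] by simp
  have "q \<noteq> []" using q(1) a t(2) by auto
  then obtain \<gamma> w where w: "q = \<gamma> # w" by (meson neq_Nil_conv)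
  have nI: "\<not> in_I Q [\<alpha>, \<gamma>]" using False in_I_append1[where p = "[\<alpha>, \<gamma>]" and w = w] e w by auto
  have "amap N \<delta> * amap N \<alpha> = 0" if \<delta>: "\<delta> \<in> outA Q a - {hd q}" for \<delta>
  proof -
    have \<delta>1: "\<delta> \<in> Q1 Q" "src Q \<delta> = tgt Q \<alpha>" "\<delta> \<noteq> \<gamma>" using \<delta> a w by (auto simp: outA_def)
    have \<gamma>: "\<gamma> \<in> Q1 Q" "src Q \<gamma> = tgt Q \<alpha>" using q(1) a w by auto
    have "in_I Q [\<alpha>, \<delta>]" using string_out[OF \<delta>1(1) \<gamma>(1) \<alpha> \<delta>1(3,2) \<gamma>(2)] nI by blast
    then show ?thesis using two_step_zero[OF N \<alpha> \<delta>1(1,2)] by blast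
  qed
  then show ?thesis using a by (intro exI[of _ "amap N \<alpha>"]) simp
qed

end

section \<open>Eliminating the remaining shapes of the cokernel\<close>

context thin_cokernel
begin

lemma kills_through_end:
  assumes q: "dpath Q a q i" "q \<noteq> []" and \<alpha>: "\<alpha> \<in> outA Q i" and I: "in_I Q [last q, \<alpha>]"
  shows "amap N \<alpha> * (R a * x) = 0"
  using end_zero[OF rN q(1) \<alpha> in_I_last[OF I q(2)]] by (simp add: mult.assoc[symmetric])

lemma y_neq_i: "p \<noteq> [] \<Longrightarrow> y \<noteq> i" and y'_neq_i: "p' \<noteq> [] \<Longrightarrow> y' \<noteq> i"
  using arm1(1) arm2(1) dpath_acyclic by blast+

lemma k_first: "\<alpha> \<in> outA Q y \<Longrightarrow> tgt Q \<alpha> \<notin> I \<Longrightarrow> p \<noteq> [] \<Longrightarrow> \<alpha> \<noteq> hd p"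
  and k_first': "\<alpha> \<in> outA Q y' \<Longrightarrow> tgt Q \<alpha> \<notin> I \<Longrightarrow> p' \<noteq> [] \<Longrightarrow> \<alpha> \<noteq> hd p'"
  unfolding I_def by (cases p; auto simp: verts_def) (cases p'; auto simp: verts_def)

text \<open>The two ends are the two peaks. Each arm alone is a proper submodule, which supplies
  \<open>n\<close> and \<open>n'\<close>. Both arrows into \<open>i\<close> belong to the arms, so
  nothing enters at \<open>i\<close>; and an arrow out of \<open>i\<close> annihilates the last
  arrow of one arm, hence the common element.\<close>

lemma arms_both_nontrivial: "p' = []"
proof (rule ccontr)
  assume p': "p' \<noteq> []"
  then have p: "p \<noteq> []" "last p \<noteq> last p'" using arms by auto
  note y = y_neq_i[OF p(1)] y'_neq_i[OF p']
  have sub: "\<exists>n. fits (rdim N a) 1 n \<and> \<nu> * (R a * n) = \<one>\<^sub>i 1 \<and> (\<forall>\<delta>\<in>outA Q a - {hd q}. amap N \<delta> * n = 0)"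
    if q: "dpath Q a q i" "set (verts Q a q) \<subset> I" for a q
  proof -
    have "\<exists>n. fits (rdim N a) 1 n \<and> \<nu> * (R a * n) = \<one>\<^sub>i 1 \<and> (\<forall>\<delta>\<in>outA Q a. tgt Q \<delta> \<notin> set (verts Q a q) \<longrightarrow> amap N \<delta> * n = 0)"
      by (rule element_of_subinterval[OF q(2) verts_start]) (use verts_next(1)[OF q(1)] I_coreach in blast)
    then show ?thesis using other_arrow_leaves[OF q(1)] by blast
  qed
  have "y' \<notin> set (verts Q y p)" using arms_meet[OF _ verts_start] y(2) by blast
  then have "set (verts Q y p) \<subset> I" using ends_I(2) unfolding I_def by blast
  from sub[OF arm1(1) this] obtain n where n: "fits (rdim N y) 1 n" "\<nu> * (R y * n) = \<one>\<^sub>i 1"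
    "\<forall>\<delta>\<in>outA Q y - {hd p}. amap N \<delta> * n = 0" by blast
  have "y \<notin> set (verts Q y' p')" using arms_meet[OF verts_start] y(1) by blast
  then have "set (verts Q y' p') \<subset> I" using ends_I(1) unfolding I_def by blast
  from sub[OF arm2(1) this] obtain n' where n': "fits (rdim N y') 1 n'" "\<nu> * (R y' * n') = \<one>\<^sub>i 1"
    "\<forall>\<delta>\<in>outA Q y' - {hd p'}. amap N \<delta> * n' = 0" by blast
  obtain \<delta> where \<delta>: "outA Q y - {hd p} \<subseteq> {\<delta>}" using other_arrows_subset[OF i arm1(1) p(1)] by blast
  obtain \<delta>' where \<delta>': "outA Q y' - {hd p'} \<subseteq> {\<delta>'}" using other_arrows_subset[OF i arm2(1) p'] by blast
  note l1 = src_last_on_path[OF arm1(1) p(1)] and l2 = src_last_on_path[OF arm2(1) p']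
  show False
  proof (rule two_ends_contradiction[where n = n and n' = n', OF \<delta> _ \<delta>'])
    fix \<alpha> assume \<alpha>: "\<alpha> \<in> Q1 Q" "tgt Q \<alpha> \<in> I" "src Q \<alpha> \<notin> I"
    have ne: "tgt Q \<alpha> \<noteq> i"
    proof
      assume "tgt Q \<alpha> = i"
      then have "\<alpha> \<in> inA Q i" using \<alpha> by (simp add: inA_def)
      moreover have "inA Q i = {last p, last p'}"
        by (rule inA_other[OF i last_in_inA[OF arm1(1) p(1)] last_in_inA[OF arm2(1) p'] p(2)])
      ultimately show False using \<alpha>(3) l1(1) l2(1) unfolding I_def by auto
    qed
    from \<alpha>(2) show "(\<exists>\<beta>. R (tgt Q \<alpha>) * amap N \<alpha> = R y * \<beta> \<and> (\<forall>\<delta>\<in>outA Q y - {hd p}. amap N \<delta> * \<beta> = 0)) \<or>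
      (\<exists>\<beta>. R (tgt Q \<alpha>) * amap N \<alpha> = R y' * \<beta> \<and> (\<forall>\<delta>\<in>outA Q y' - {hd p'}. amap N \<delta> * \<beta> = 0))"
      using border_arm[OF rN arm1 \<alpha>(1) _ ne] border_arm[OF rN arm2 \<alpha>(1) _ ne] \<alpha>(3) unfolding I_def by blast
  next
    fix x x' assume x: "fits (rdim N y) 1 x" "fits (rdim N y') 1 x'"
      and k: "\<And>\<delta>. \<delta> \<in> outA Q y - {hd p} \<Longrightarrow> amap N \<delta> * x = 0" "\<And>\<delta>. \<delta> \<in> outA Q y' - {hd p'} \<Longrightarrow> amap N \<delta> * x' = 0"
      and e: "R y * x = R y' * x'" "\<nu> * (R y * x) = \<one>\<^sub>i 1"
    show False
    proof (rule no_common_element[OF x e])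
      show "amap N \<alpha> * x = 0" if "\<alpha> \<in> outA Q y" "tgt Q \<alpha> \<notin> I" for \<alpha> using k(1) k_first[OF that p(1)] that by blast
      show "amap N \<alpha> * x' = 0" if "\<alpha> \<in> outA Q y'" "tgt Q \<alpha> \<notin> I" for \<alpha> using k(2) k_first'[OF that p'] that by blast
      fix \<alpha> assume \<alpha>: "\<alpha> \<in> outA Q i"
      then have a: "\<alpha> \<in> Q1 Q" "src Q \<alpha> = i" by (auto simp: outA_def)
      have "in_I Q [last p, \<alpha>] \<or> in_I Q [last p', \<alpha>]"
        using string_in[OF l1(2) l2(2) a(1) p(2)] l1(3) l2(3) a(2) by metis
      then show "amap N \<alpha> * (R y * x) = 0"
        using kills_through_end[OF arm1(1) p(1) \<alpha>] kills_through_end[OF arm2(1) p' \<alpha>] e(1) by metis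
    qed
  qed (use n n' in auto)
qed

lemma y'_eq: "y' = i"
  using arm2(1) arms_both_nontrivial by simp

lemma I_eq: "I = set (verts Q y p)"
  using y'_eq arms_both_nontrivial verts_end[OF arm1(1)] by (auto simp: I_def)

text \<open>The second end is now \<open>i\<close>, tested by \<alpha>. Deleting the peak from the
  cokernel supplies \<open>n'\<close>, prolonging it by \<alpha> supplies \<open>n\<close>. An arrow
  entering at \<open>i\<close> is not the last arrow of \<open>p\<close>, so
  \<open>string_in\<close> makes \<alpha> annihilate it.\<close>

lemma unkilled_extension:
  assumes p: "p \<noteq> []" and \<alpha>: "\<alpha> \<in> outA Q i" "\<not> in_I Q (p @ [\<alpha>])"
  shows False
proof -
  have a: "\<alpha> \<in> Q1 Q" "src Q \<alpha> = i" using \<alpha> by (auto simp: outA_def)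
  note l = src_last_on_path[OF arm1(1) p]
  have lI: "\<not> in_I Q [last p, \<alpha>]" using in_I_last[OF _ p] \<alpha>(2) by blast
  have S: "I - {y} \<subset> I" "i \<in> I - {y}" using ends_I y_neq_i[OF p] by auto
  have "\<exists>n. fits (rdim N i) 1 n \<and> \<nu> * (R i * n) = \<one>\<^sub>i 1 \<and> (\<forall>\<delta>\<in>outA Q i. tgt Q \<delta> \<notin> I - {y} \<longrightarrow> amap N \<delta> * n = 0)"
  proof (rule element_of_subinterval[OF S])
    fix \<gamma> assume \<gamma>: "\<gamma> \<in> Q1 Q" "src Q \<gamma> \<in> I - {y}" "tgt Q \<gamma> \<in> I"
    have "tgt Q \<gamma> \<noteq> y"
    proof
      assume t: "tgt Q \<gamma> = y"
      have "dpath Q y (pth y (src Q \<gamma>)) (src Q \<gamma>)" using verts_decomp(1)[OF arm1(1)] \<gamma>(2) unfolding I_eq by blast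
      then have "dpath Q y (pth y (src Q \<gamma>) @ [\<gamma>]) y" using \<gamma>(1) t by (simp add: dpath_snoc)
      then show False using dpath_acyclic by blast
    qed
    then show "tgt Q \<gamma> \<in> I - {y}" using \<gamma>(3) by blast
  qed
  then obtain n' where n': "fits (rdim N i) 1 n'" "\<nu> * (R i * n') = \<one>\<^sub>i 1" "amap N \<alpha> * n' = 0"
    using \<alpha>(1) no_arrow_from_i[OF a] by blast
  then have n'1: "\<nu> * n' = \<one>\<^sub>i 1" by (simp add: fits_def)
  obtain n where n: "fits (rdim N y) 1 n" "\<nu> * (R y * n) = \<one>\<^sub>i 1" "\<forall>\<delta>\<in>outA Q y. \<delta> \<noteq> hd (p @ [\<alpha>]) \<longrightarrow> amap N \<delta> * n = 0"
    using element_from_extension[OF arms_both_nontrivial \<alpha> n'(1,3) n'1] by blast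
  obtain \<delta> where \<delta>: "outA Q y - {hd p} \<subseteq> {\<delta>}" using other_arrows_subset[OF i arm1(1) p] by blast
  show False
  proof (rule two_ends_contradiction[where n = n and n' = n', OF \<delta> _ subset_refl[of "{\<alpha>}"]])
    show "{\<alpha>} \<subseteq> outA Q y'" "fits (rdim N y') 1 n'" "\<nu> * (R y' * n') = \<one>\<^sub>i 1" using \<alpha>(1) n' y'_eq by auto
    show "amap N \<delta>' * n' = 0" if "\<delta>' \<in> {\<alpha>}" for \<delta>' using that n'(3) by simp
    show "amap N \<delta>' * n = 0" if "\<delta>' \<in> outA Q y - {hd p}" for \<delta>' using that n(3) p by simp
    fix \<gamma> assume \<gamma>: "\<gamma> \<in> Q1 Q" "tgt Q \<gamma> \<in> I" "src Q \<gamma> \<notin> I"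
    show "(\<exists>\<beta>. R (tgt Q \<gamma>) * amap N \<gamma> = R y * \<beta> \<and> (\<forall>\<delta>\<in>outA Q y - {hd p}. amap N \<delta> * \<beta> = 0)) \<or>
      (\<exists>\<beta>. R (tgt Q \<gamma>) * amap N \<gamma> = R y' * \<beta> \<and> (\<forall>\<delta>\<in>{\<alpha>}. amap N \<delta> * \<beta> = 0))"
    proof (cases "tgt Q \<gamma> = i")
      case False
      then show ?thesis using border_arm[OF rN arm1 \<gamma>(1) _ False] \<gamma>(2,3) unfolding I_eq by blast
    next
      case True
      have "\<gamma> \<noteq> last p" using l(1) \<gamma>(3) unfolding I_eq by blast
      then have "in_I Q [\<gamma>, \<alpha>]" using string_in[OF \<gamma>(1) l(2) a(1)] lI True l(3) a(2) by metis
      then have "amap N \<alpha> * amap N \<gamma> = 0" using two_step_zero[OF rN \<gamma>(1) a(1)] True a(2) by simp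
      then show ?thesis using True y'_eq by (intro disjI2 exI[of _ "amap N \<gamma>"]) simp
    qed
  next
    fix x x' assume x: "fits (rdim N y) 1 x" "fits (rdim N y') 1 x'"
      and k: "\<And>\<delta>. \<delta> \<in> outA Q y - {hd p} \<Longrightarrow> amap N \<delta> * x = 0" "\<And>\<delta>. \<delta> \<in> {\<alpha>} \<Longrightarrow> amap N \<delta> * x' = 0"
      and e: "R y * x = R y' * x'" "\<nu> * (R y * x) = \<one>\<^sub>i 1"
    show False
    proof (rule no_common_element[OF x e])
      show "amap N \<gamma> * x = 0" if "\<gamma> \<in> outA Q y" "tgt Q \<gamma> \<notin> I" for \<gamma> using k(1) k_first[OF that p] that by blast
      show "amap N \<gamma> * x' = 0" if "y' \<noteq> i" for \<gamma> using that y'_eq by blast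
      fix \<gamma> assume \<gamma>: "\<gamma> \<in> outA Q i"
      show "amap N \<gamma> * (R y * x) = 0"
      proof (cases "\<gamma> = \<alpha>")
        case True
        then show ?thesis using k(2)[of \<alpha>] e(1) x(2) y'_eq by (simp add: fits_def)
      next
        case False
        then have "in_I Q [last p, \<gamma>]"
          using string_out[of \<gamma> \<alpha> "last p"] \<gamma> a l lI by (auto simp: outA_def)
        then show ?thesis by (rule kills_through_end[OF arm1(1) p \<gamma>])
      qed
    qed
  qed (use n in auto)
qed

text \<open>Both ends are \<open>i\<close>, the first tested by \<delta> and the second by \<alpha>.
  By \<open>string_out\<close> one of the two annihilates each arrow into \<open>i\<close>, and an
  element annihilated by both would split off S(i).\<close>

lemma trivial_cokernel_two_arrows:
  assumes p: "p = []" and out: "outA Q i = {\<alpha>, \<delta>}" "\<alpha> \<noteq> \<delta>"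
    and n': "fits (rdim N i) 1 n'" "\<nu> * n' = \<one>\<^sub>i 1" "amap N \<alpha> * n' = 0"
  shows False
proof -
  have y: "y = i" using arm1(1) p by simp
  have Ii: "I = {i}" using I_eq y p by simp
  have a: "\<alpha> \<in> outA Q i" "\<delta> \<in> outA Q i" using out by auto
  then have a1: "\<alpha> \<in> Q1 Q" "src Q \<alpha> = i" "\<delta> \<in> Q1 Q" "src Q \<delta> = i" by (auto simp: outA_def)
  obtain n where n: "fits (rdim N y) 1 n" "\<nu> * (R y * n) = \<one>\<^sub>i 1" "\<forall>\<delta>\<in>outA Q y. \<delta> \<noteq> hd (p @ [\<alpha>]) \<longrightarrow> amap N \<delta> * n = 0"
    using element_from_extension[OF arms_both_nontrivial a(1) _ n'(1,3,2)] p by auto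
  show False
  proof (rule two_ends_contradiction[where n = n and n' = n', OF subset_refl[of "{\<delta>}"] _ subset_refl[of "{\<alpha>}"]])
    show "{\<delta>} \<subseteq> outA Q y" "{\<alpha>} \<subseteq> outA Q y'" "fits (rdim N y') 1 n'" "\<nu> * (R y' * n') = \<one>\<^sub>i 1"
      using a n' y'_eq y by (auto simp: fits_def)
    show "amap N \<delta>' * n' = 0" if "\<delta>' \<in> {\<alpha>}" for \<delta>' using that n'(3) by simp
    show "amap N \<delta>' * n = 0" if "\<delta>' \<in> {\<delta>}" for \<delta>' using that n(3) p a(2) out(2) y by simp
    fix \<gamma> assume \<gamma>: "\<gamma> \<in> Q1 Q" "tgt Q \<gamma> \<in> I"
    then have t: "tgt Q \<gamma> = i" using Ii by simp
    have "in_I Q [\<gamma>, \<alpha>] \<or> in_I Q [\<gamma>, \<delta>]" using string_out[OF a1(1,3) \<gamma>(1) out(2)] a1 t by metis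
    then have "amap N \<alpha> * amap N \<gamma> = 0 \<or> amap N \<delta> * amap N \<gamma> = 0"
      using two_step_zero[OF rN \<gamma>(1) a1(1)] two_step_zero[OF rN \<gamma>(1) a1(3)] a1 t by metis
    then show "(\<exists>\<beta>. R (tgt Q \<gamma>) * amap N \<gamma> = R y * \<beta> \<and> (\<forall>\<delta>\<in>{\<delta>}. amap N \<delta> * \<beta> = 0)) \<or>
      (\<exists>\<beta>. R (tgt Q \<gamma>) * amap N \<gamma> = R y' * \<beta> \<and> (\<forall>\<delta>\<in>{\<alpha>}. amap N \<delta> * \<beta> = 0))"
      using t y y'_eq by (auto intro: exI[of _ "amap N \<gamma>"])
  next
    fix x x' assume x: "fits (rdim N y) 1 x" "fits (rdim N y') 1 x'"
      and k: "\<And>\<delta>'. \<delta>' \<in> {\<delta>} \<Longrightarrow> amap N \<delta>' * x = 0" "\<And>\<delta>. \<delta> \<in> {\<alpha>} \<Longrightarrow> amap N \<delta> * x' = 0"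
      and e: "R y * x = R y' * x'" "\<nu> * (R y * x) = \<one>\<^sub>i 1"
    have xx: "R y * x = x" "R y' * x' = x'" using x y y'_eq by (auto simp: fits_def)
    show False
    proof (rule no_common_element[OF x e])
      show "amap N \<gamma> * (R y * x) = 0" if "\<gamma> \<in> outA Q i" for \<gamma>
        using that k[of \<delta>] k(2)[of \<alpha>] e(1) xx out(1) by auto
    qed (use y y'_eq in auto)
  qed (use n in auto)
qed

theorem hook_end: "hook_end Q i"
proof (rule ccontr)
  assume nh: "\<not> hook_end Q i"
  have Ly: "fits (rdim N y) 1 (L y)" "\<nu> * (R y * L y) = \<one>\<^sub>i 1"
    using L(1,3)[OF ends_I(1)] ends_I(1) by (auto simp: \<pi>_def mult.assoc)
  have sec: False if k1: "\<And>\<alpha>. \<alpha> \<in> outA Q y \<Longrightarrow> y \<noteq> i \<Longrightarrow> tgt Q \<alpha> \<in> I"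
    and k3: "\<And>\<alpha>. \<alpha> \<in> outA Q i \<Longrightarrow> amap N \<alpha> * (R y * L y) = 0"
  proof (rule no_common_element[OF Ly(1) _ _ Ly(2)])
    show f: "fits (rdim N y') 1 (R y * L y)" using fits_times[OF fits_R[OF ends_I(1)] Ly(1)] y'_eq by simp
    show "R y * L y = R y' * (R y * L y)" using f y'_eq by (simp add: fits_def)
  qed (use k1 k3 y'_eq in blast)+
  show False
  proof (cases "p = []")
    case False
    have all: "in_I Q (p @ [\<alpha>])" if "\<alpha> \<in> outA Q i" for \<alpha> using unkilled_extension[OF False that] by blast
    show False
    proof (rule sec)
      fix \<alpha> assume \<alpha>: "\<alpha> \<in> outA Q y"
      \<comment> \<open>Another arrow at \<open>y\<close> could serve as \<beta> in
        \<open>hook_end\<close>, since \<open>p\<close> cannot be prolonged. Hence no arrow leaves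
        \<open>I\<close> at \<open>y\<close>, and \<open>L y\<close> generates a section.\<close>
      then have "\<alpha> = hd p" using nh all False arm1 unfolding hook_end_def by blast
      then show "tgt Q \<alpha> \<in> I" using k_first[OF \<alpha> _ False] by blast
    next
      fix \<alpha> assume \<alpha>: "\<alpha> \<in> outA Q i"
      show "amap N \<alpha> * (R y * L y) = 0" using end_zero[OF rN arm1(1) \<alpha> all[OF \<alpha>]] by (simp add: mult.assoc[symmetric])
    qed
  next
    case True
    then have y: "y = i" using arm1(1) by simp
    have "card (outA Q i) \<noteq> 1" using nh by (simp add: hook_end_def)
    then consider "outA Q i = {}" | "card (outA Q i) = 2"
      using card_outA[OF i] by (metis One_nat_def Suc_1 card_eq_0_iff finite_outA le_Suc_eq le_zero_eq)
    then show False
    proof cases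
      case 1
      then show False using sec y by auto
    next
      case 2
      then obtain \<alpha> \<delta> where out: "outA Q i = {\<alpha>, \<delta>}" "\<alpha> \<noteq> \<delta>" by (auto simp: card_2_iff)
      have "I = {i}" using I_eq y True by simp
      from killed_by_an_arrow[OF this out] obtain n where n: "fits (rdim N i) 1 n" "\<nu> * n = \<one>\<^sub>i 1"
        "amap N \<alpha> * n = 0 \<or> amap N \<delta> * n = 0" by blast
      have out': "outA Q i = {\<delta>, \<alpha>}" "\<delta> \<noteq> \<alpha>" using out by auto
      show False using trivial_cokernel_two_arrows[OF True out n(1,2)] trivial_cokernel_two_arrows[OF True out' n(1,2)] n(3) by blast
    qed
  qed
qed

end

section \<open>The cokernel of an irreducible monomorphism in Det is thin\<close>

text \<open>As \<open>\<zeta> v * n = 0\<close> says that \<open>n\<close> lies in the image of \<open>f\<close>, the assumptions place the socle of the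
  cokernel at \<open>i\<close>.\<close>
locale socle_cokernel = irreducible_mono Q M N f \<kappa> F
  for Q :: "('v, 'a) quiver" and M N :: "('v, 'a, 'k::field) qrep" and f \<kappa> F +
  fixes i \<zeta>
  defines "\<zeta> \<equiv> \<lambda>v. \<one>\<^sub>i (rdim N v) - F v * \<kappa> v"
  assumes i: "i \<in> Q0 Q"
    and socle: "\<And>v n. \<lbrakk>v \<in> Q0 Q; fits (rdim N v) 1 n; \<zeta> v * n \<noteq> 0;
      \<And>\<alpha>. \<alpha> \<in> outA Q v \<Longrightarrow> \<zeta> (tgt Q \<alpha>) * (amap N \<alpha> * n) = 0\<rbrakk> \<Longrightarrow> v = i"
    and top: "\<exists>n. fits (rdim N i) 1 n \<and> \<zeta> i * n \<noteq> 0"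
begin

abbreviation "R v \<equiv> pmap Q N v (pth v i)"

lemma zeta_F: "v \<in> Q0 Q \<Longrightarrow> \<zeta> v * F v = 0"
  using kap[of v] ihom_fits[OF F, of v] by (simp add: \<zeta>_def left_diff_distrib mult.assoc fits_def)

lemma zeta_kernel: "fits (rdim N v) m n \<Longrightarrow> \<zeta> v * n = 0 \<Longrightarrow> n = F v * (\<kappa> v * n)"
  by (simp add: \<zeta>_def left_diff_distrib mult.assoc fits_def)

text \<open>A nonzero class away from \<open>i\<close> is not in the socle, so some arrow keeps it
  nonzero. This continues until \<open>i\<close>, and the route taken is the only path, so its
  effect is \<open>R v\<close>.\<close>

lemma socle_descent:
  "\<lbrakk>v \<in> Q0 Q; fits (rdim N v) 1 n; \<zeta> v * n \<noteq> 0\<rbrakk> \<Longrightarrow> v \<in> coreach i \<and> \<zeta> i * (R v * n) \<noteq> 0"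
proof (induction v arbitrary: n rule: wf_induct_rule[OF wf_arrows])
  case (1 v)
  show ?case
  proof (cases "v = i")
    case True
    have "dpath Q i [] i" using i by simp
    then have "i \<in> coreach i" by (auto simp: coreach_def intro: exI[of _ "[]"])
    then show ?thesis using 1 True by (simp add: fits_def)
  next
    case False
    then obtain \<alpha> where a: "\<alpha> \<in> outA Q v" "\<zeta> (tgt Q \<alpha>) * (amap N \<alpha> * n) \<noteq> 0" using socle[OF 1(2-4)] by blast
    then have \<alpha>: "\<alpha> \<in> Q1 Q" "src Q \<alpha> = v" by (auto simp: outA_def)
    have "fits (rdim N (tgt Q \<alpha>)) 1 (amap N \<alpha> * n)" using fits_times[OF fits_amap[OF rN \<alpha>(1)]] \<alpha>(2) 1(3) by simp
    then have t: "tgt Q \<alpha> \<in> coreach i" "\<zeta> i * (R (tgt Q \<alpha>) * (amap N \<alpha> * n)) \<noteq> 0"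
      using 1(1)[of "tgt Q \<alpha>"] a(2) \<alpha> arrow_ends(2)[OF \<alpha>(1)] by blast+
    have e: "pth v i = \<alpha> # pth (tgt Q \<alpha>) i" using pth_Cons[OF \<alpha>(1) t(1)] \<alpha>(2) by simp
    have d: "dpath Q v (pth v i) i" using coreachD[OF t(1)] \<alpha> unfolding e by simp
    have Rv: "R v = R (tgt Q \<alpha>) * amap N \<alpha>" unfolding e using \<alpha>(2) by simp
    have "R v \<noteq> 0"
    proof
      assume "R v = 0"
      then have "R (tgt Q \<alpha>) * (amap N \<alpha> * n) = 0" using Rv by (simp add: mult.assoc[symmetric])
      then show False using t(2) by simp
    qed
    then have "\<not> in_I Q (pth v i)" using pmap_in_I[OF rN d] by blast
    then show ?thesis using d t(2) Rv unfolding coreach_def by (auto simp: mult.assoc)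
  qed
qed

text \<open>The support of the cokernel: \<open>socle_descent\<close> gives one inclusion, and the
  other holds because \<open>R\<close> carries the image of f into itself.\<close>

definition Y :: "'v set" where
  "Y = {v \<in> Q0 Q \<inter> coreach i. \<exists>x. fits (rdim N v) 1 x \<and> \<zeta> i * (R v * x) \<noteq> 0}"

lemma i_in_Y: "i \<in> Y"
proof -
  obtain n where n: "fits (rdim N i) 1 n" "\<zeta> i * n \<noteq> 0" using top by blast
  then show ?thesis using socle_descent[OF i n] i unfolding Y_def by blast
qed

lemma R_src: "\<alpha> \<in> Q1 Q \<Longrightarrow> tgt Q \<alpha> \<in> coreach i \<Longrightarrow> R (src Q \<alpha>) = R (tgt Q \<alpha>) * amap N \<alpha>"
  using pth_Cons[of \<alpha> i] by simp

lemma fits_R: "v \<in> coreach i \<Longrightarrow> fits (rdim N i) (rdim N v) (R v)"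
  using fits_pmap[OF rN] coreachD by blast

lemma border_in_Y:
  assumes \<alpha>: "\<alpha> \<in> Q1 Q" and t: "tgt Q \<alpha> \<in> coreach i" and nz: "\<zeta> i * (R (tgt Q \<alpha>) * amap N \<alpha>) \<noteq> 0"
  shows "src Q \<alpha> \<in> Y"
proof -
  let ?s = "src Q \<alpha>"
  have d: "dpath Q ?s (pth ?s i) i" using coreachD[OF t] \<alpha> pth_Cons[OF \<alpha> t] by simp
  have z: "fits (rdim N i) (rdim N i) (\<zeta> i)" unfolding \<zeta>_def
    using kap[OF i] by (intro fits_diff[OF fits_unit fits_times[OF ihom_fits[OF F i]]]) auto
  have "R ?s \<noteq> 0" using nz unfolding R_src[OF \<alpha> t] by auto
  then have c: "?s \<in> coreach i" unfolding coreach_def using pmap_in_I[OF rN d] d by blast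
  obtain x where "fits (rdim N ?s) 1 x" "(\<zeta> i * R ?s) * x \<noteq> 0"
    using zero_if_cols_zero[OF fits_times[OF z fits_R[OF c]]] nz unfolding R_src[OF \<alpha> t] by blast
  then show ?thesis unfolding Y_def using c arrow_ends(1)[OF \<alpha>] by (auto simp: mult.assoc)
qed

lemma longest:
  assumes "S \<subseteq> Y" "i \<in> S"
  obtains v where "v \<in> S" "\<And>u. u \<in> S \<Longrightarrow> length (pth u i) \<le> length (pth v i)"
proof -
  have S: "finite S" using assms(1) finite_Q0 finite_subset[of S "Q0 Q"] unfolding Y_def by blast
  let ?l = "(\<lambda>v. length (pth v i)) ` S"
  have "Max ?l \<in> ?l" using S assms(2) by (intro Max_in) auto
  then obtain v where v: "v \<in> S" "length (pth v i) = Max ?l" by auto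
  then show thesis using that[OF v(1)] Max_ge[of ?l] S by simp
qed

text \<open>The peaks \<open>y\<close> and \<open>y'\<close> of the thin quotient are chosen with longest paths to \<open>i\<close>, so that
  beyond the quotient at most one arrow matters, which enters at \<open>y'\<close>. Its image is \<open>b\<close>, and a row
  separating \<open>R y * x\<close> from it and from the image of \<open>f\<close> induces the projection.\<close>
theorem hook_end: "hook_end Q i"
proof -
  obtain y where y: "y \<in> Y" and ymax: "\<And>u. u \<in> Y \<Longrightarrow> length (pth u i) \<le> length (pth y i)"
    using longest[OF subset_refl i_in_Y] by blast
  define p where "p = pth y i"
  \<comment> \<open>Candidates for the second peak: vertices reaching \<open>i\<close> over a
    different last arrow, with an element that meets one from \<open>y\<close> in the socle of the
    cokernel. The vertex \<open>i\<close> itself qualifies, which covers the uniserial case.\<close>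
  define Y' where "Y' = {v \<in> Y. (v = i \<or> p \<noteq> [] \<and> pth v i \<noteq> [] \<and> last (pth v i) \<noteq> last p) \<and>
    (\<exists>x x'. fits (rdim N y) 1 x \<and> fits (rdim N v) 1 x' \<and> \<zeta> i * (R y * x) = \<zeta> i * (R v * x') \<and> \<zeta> i * (R y * x) \<noteq> 0)}"
  have yc: "y \<in> Q0 Q" "y \<in> coreach i" using y by (auto simp: Y_def)
  have ic: "i \<in> coreach i" using i_in_Y by (auto simp: Y_def)
  obtain x1 where x1: "fits (rdim N y) 1 x1" "\<zeta> i * (R y * x1) \<noteq> 0" using y by (auto simp: Y_def)
  have "fits (rdim N i) 1 (R y * x1)" by (rule fits_times[OF fits_R[OF yc(2)] x1(1)])
  moreover from this have "\<zeta> i * (R y * x1) = \<zeta> i * (R i * (R y * x1))" by (simp add: fits_def)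
  ultimately have iY': "i \<in> Y'" unfolding Y'_def using i_in_Y x1 by blast
  obtain y' where y': "y' \<in> Y'" and y'max: "\<And>u. u \<in> Y' \<Longrightarrow> length (pth u i) \<le> length (pth y' i)"
    using longest[of Y'] iY' unfolding Y'_def by blast
  define p' where "p' = pth y' i"
  have y'c: "y' \<in> Q0 Q" "y' \<in> coreach i" using y' by (auto simp: Y_def Y'_def)
  obtain x x' where x: "fits (rdim N y) 1 x" "fits (rdim N y') 1 x'"
    "\<zeta> i * (R y * x) = \<zeta> i * (R y' * x')" "\<zeta> i * (R y * x) \<noteq> 0" using y' by (auto simp: Y'_def)
  have arm1: "dpath Q y p i" "\<not> in_I Q p" using coreachD[OF yc(2)] by (auto simp: p_def)
  have arm2: "dpath Q y' p' i" "\<not> in_I Q p'" using coreachD[OF y'c(2)] by (auto simp: p'_def)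
  have arms: "p' = [] \<or> p \<noteq> [] \<and> last p \<noteq> last p'"
  proof (cases "y' = i")
    case True
    then show ?thesis using arm2(1) dpath_acyclic by blast
  next
    case False
    then show ?thesis using y' unfolding Y'_def p'_def by auto
  qed
  define I where "I = set (verts Q y p) \<union> set (verts Q y' p')"
  have Ic: "I \<subseteq> coreach i" unfolding I_def using verts_coreach[OF arm1] verts_coreach[OF arm2] by blast
  \<comment> \<open>The entering arrows with nonzero effect on the socle. They enter at
    \<open>y'\<close> only: at \<open>y\<close> the maximal length forbids it, at inner vertices the
    composite is zero, and at \<open>i\<close>, if the second arm is nontrivial, both incoming
    arrows are already used.\<close>
  define B where "B = {\<alpha> \<in> Q1 Q. tgt Q \<alpha> \<in> I \<and> src Q \<alpha> \<notin> I \<and> \<zeta> i * (R (tgt Q \<alpha>) * amap N \<alpha>) \<noteq> 0}"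
  have B: "tgt Q \<alpha> = y' \<and> src Q \<alpha> \<in> Y \<and> p \<noteq> [] \<and> pth (src Q \<alpha>) i = \<alpha> # p' \<and> last (\<alpha> # p') \<noteq> last p" if "\<alpha> \<in> B" for \<alpha>
  proof -
    have \<alpha>: "\<alpha> \<in> Q1 Q" "tgt Q \<alpha> \<in> I" "src Q \<alpha> \<notin> I" using that by (auto simp: B_def)
    have s: "src Q \<alpha> \<in> Y" using border_in_Y[OF \<alpha>(1)] that Ic by (auto simp: B_def)
    then have sc: "src Q \<alpha> \<in> coreach i" by (simp add: Y_def)
    have e: "pth (src Q \<alpha>) i = \<alpha> # pth (tgt Q \<alpha>) i" using pth_Cons[OF \<alpha>(1)] \<alpha>(2) Ic by blast
    have ty: "tgt Q \<alpha> \<noteq> y" using ymax[OF s] e by auto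
    have sub: "tgt Q \<alpha> = a \<or> tgt Q \<alpha> = i" if "dpath Q a q i" "\<not> in_I Q q" "set (verts Q a q) \<subseteq> I" "tgt Q \<alpha> \<in> set (verts Q a q)" for a q
      using border_interior[OF that(1,2) \<alpha>(1) that(4)] that(3) \<alpha>(3) coreachD[OF sc] unfolding e by blast
    have "tgt Q \<alpha> = y' \<or> tgt Q \<alpha> = i"
      using sub[OF arm1] sub[OF arm2] \<alpha>(2) ty unfolding I_def by blast
    have p: "p \<noteq> []"
    proof
      assume p0: "p = []"
      then have "p' = []" using arms by blast
      then show False using ty \<alpha>(2) p0 arm1 arm2 by (auto simp: I_def verts_def)
    qed
    show ?thesis
    proof (cases "p' = []")
      case True
      then have "tgt Q \<alpha> = i" "y' = i" using \<open>tgt Q \<alpha> = y' \<or> tgt Q \<alpha> = i\<close> arm2(1) by auto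
      moreover have "\<alpha> \<noteq> last p" using src_last_on_path(1)[OF arm1(1) p] \<alpha>(3) unfolding I_def by blast
      ultimately show ?thesis using True e s p p'_def by simp
    next
      case False
      have "tgt Q \<alpha> \<noteq> i"
      proof
        assume "tgt Q \<alpha> = i"
        then have "\<alpha> \<in> inA Q i" using \<alpha> by (simp add: inA_def)
        moreover have "inA Q i = {last p, last p'}" using arms False
          by (intro inA_other[OF i last_in_inA[OF arm1(1) p] last_in_inA[OF arm2(1) False]]) auto
        ultimately show False
          using \<alpha>(3) src_last_on_path(1)[OF arm1(1) p] src_last_on_path(1)[OF arm2(1) False] unfolding I_def by auto
      qed
      then have "tgt Q \<alpha> = y'" using \<open>tgt Q \<alpha> = y' \<or> tgt Q \<alpha> = i\<close> by blast
      then show ?thesis using e s p arms False p'_def by auto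
    qed
  qed
  \<comment> \<open>Two such arrows cannot both have nonzero composite with the first arrow of
    \<open>p'\<close> by \<open>string_in\<close>; if \<open>p'\<close> is trivial, the last arrow
    of \<open>p\<close> leaves room for one more arrow into \<open>i\<close>.\<close>
  have Buniq: "\<alpha> = \<beta>" if ab: "\<alpha> \<in> B" "\<beta> \<in> B" for \<alpha> \<beta>
  proof (rule ccontr)
    assume ne: "\<alpha> \<noteq> \<beta>"
    note a = B[OF ab(1)] and b = B[OF ab(2)]
    have q: "\<alpha> \<in> Q1 Q" "\<beta> \<in> Q1 Q" using ab by (auto simp: B_def)
    have c: "\<not> in_I Q (\<alpha> # p')" "\<not> in_I Q (\<beta> # p')"
      using a b coreachD unfolding Y_def by (metis (no_types, lifting) IntD2 mem_Collect_eq)+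
    show False
    proof (cases p')
      case Nil
      then have t: "y' = i" using arm2(1) by simp
      have "\<alpha> \<in> inA Q i" "\<beta> \<in> inA Q i" using a b q t by (auto simp: inA_def)
      from inA_other[OF i this ne] last_in_inA[OF arm1(1)] show False using a b Nil by auto
    next
      case (Cons \<gamma> w)
      then have g: "\<gamma> \<in> Q1 Q" "src Q \<gamma> = y'" using arm2(1) by auto
      have "in_I Q [\<alpha>, \<gamma>] \<or> in_I Q [\<beta>, \<gamma>]" using string_in[OF q g(1) ne] a b g(2) by metis
      then show False using c in_I_append1[where p = "[\<alpha>, \<gamma>]" and w = w] in_I_append1[where p = "[\<beta>, \<gamma>]" and w = w] Cons by auto
    qed
  qed
  obtain m b where b: "fits (rdim N i) m b" "\<And>\<alpha>. \<alpha> \<in> B \<Longrightarrow> R (tgt Q \<alpha>) * amap N \<alpha> = b"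
    "b = 0 \<or> (\<exists>\<alpha>\<in>B. b = R (src Q \<alpha>) \<and> m = rdim N (src Q \<alpha>))"
  proof (cases "B = {}")
    case True
    then show thesis using that[of 0 0] by simp
  next
    case False
    then obtain \<alpha> where \<alpha>: "\<alpha> \<in> B" by blast
    have R: "R (tgt Q \<alpha>) * amap N \<alpha> = R (src Q \<alpha>)" using \<alpha> Ic by (intro R_src[symmetric]) (auto simp: B_def)
    have s: "src Q \<alpha> \<in> coreach i" using B[OF \<alpha>] by (simp add: Y_def)
    show thesis
    proof (rule that[OF fits_R[OF s]])
      show "R (tgt Q \<beta>) * amap N \<beta> = R (src Q \<alpha>)" if "\<beta> \<in> B" for \<beta>
        using R Buniq[OF \<alpha> that] by (simp only:)
    qed (use \<alpha> in blast)
  qed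
  \<comment> \<open>Otherwise the start of the arrow in \<open>B\<close> would qualify for
    \<open>Y'\<close>, with a path longer than that of \<open>y'\<close>.\<close>
  have sep: "R y * x \<noteq> F i * c + b * z" if c: "fits (rdim M i) 1 c" and z: "fits m 1 z" for c z
  proof
    assume e: "R y * x = F i * c + b * z"
    have "\<zeta> i * (F i * c) = 0" using zeta_F[OF i] by (simp add: mult.assoc[symmetric])
    then have ze: "\<zeta> i * (R y * x) = \<zeta> i * (b * z)" unfolding e by (simp add: distrib_left)
    then have "b \<noteq> 0" using x(4) by auto
    then obtain \<alpha> where \<alpha>: "\<alpha> \<in> B" "b = R (src Q \<alpha>)" "m = rdim N (src Q \<alpha>)" using b(3) by blast
    have "fits (rdim N (src Q \<alpha>)) 1 z" "\<zeta> i * (R y * x) = \<zeta> i * (R (src Q \<alpha>) * z)" using z ze \<alpha>(2,3) by simp_all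
    moreover have "pth (src Q \<alpha>) i \<noteq> []" "last (pth (src Q \<alpha>) i) \<noteq> last p" using B[OF \<alpha>(1)] by (auto split: if_splits)
    ultimately have "src Q \<alpha> \<in> Y'" unfolding Y'_def using B[OF \<alpha>(1)] x(1,4) by blast
    then show False using y'max B[OF \<alpha>(1)] p'_def by fastforce
  qed
  obtain \<nu> where nu: "fits 1 (rdim N i) \<nu>" "\<nu> * F i = 0" "\<nu> * b = 0" "\<nu> * (R y * x) = \<one>\<^sub>i 1"
    using separating_row[OF ihom_fits[OF F i] b(1) fits_times[OF fits_R[OF yc(2)] x(1)] sep] by blast
  have nz: "\<nu> * a = \<nu> * (\<zeta> i * a)" if "fits (rdim N i) k a" for a k
  proof -
    have "\<nu> * (\<zeta> i * a) = \<nu> * a - (\<nu> * F i) * (\<kappa> i * a)"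
      using that by (simp add: \<zeta>_def left_diff_distrib right_diff_distrib mult.assoc fits_def)
    then show ?thesis using nu(2) by simp
  qed
  define \<pi> where "\<pi> = (\<lambda>v. if v \<in> I then \<nu> * R v else 0)"
  have pi: "ihom Q N (thin I) \<pi>" unfolding \<pi>_def
  proof (rule row_hom[OF rN i Ic nu(1)])
    fix \<alpha> assume \<alpha>: "\<alpha> \<in> Q1 Q" "tgt Q \<alpha> \<in> I" "src Q \<alpha> \<notin> I"
    have t: "tgt Q \<alpha> \<in> coreach i" using \<alpha> Ic by blast
    show "\<nu> * (R (tgt Q \<alpha>) * amap N \<alpha>) = 0"
    proof (cases "\<alpha> \<in> B")
      case True
      then show ?thesis using b(2) nu(3) by simp
    next
      case False
      then have "\<zeta> i * (R (tgt Q \<alpha>) * amap N \<alpha>) = 0" using \<alpha> by (simp add: B_def)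
      then show ?thesis using nz[OF fits_times[OF fits_R[OF t] fits_amap[OF rN \<alpha>(1)]]] by simp
    qed
  qed
  interpret D: thin_quotient Q M N f \<kappa> F i y y' p p' \<nu> I \<pi>
    by unfold_locales (use i arm1 arm2 arms nu pi in \<open>auto simp: I_def \<pi>_def F_def\<close>)
  \<comment> \<open>\<open>x\<close> and \<open>x'\<close> agree at \<open>i\<close> only modulo the
    image of f, so \<open>L\<close> is a linear section and not yet a homomorphism.\<close>
  define L where "L v = (if v \<in> set (verts Q y p) then pmap Q N y (pth y v) * x
    else if v \<in> set (verts Q y' p') then pmap Q N y' (pth y' v) * x' else 0)" for v
  have L: "fits (rdim N v) 1 (L v) \<and> \<zeta> i * (R v * L v) = \<zeta> i * (R y * x)" if v: "v \<in> I" for v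
  proof (cases "v \<in> set (verts Q y p)")
    case True
    show ?thesis
      using fits_times[OF fits_pmap[OF rN verts_decomp(1)[OF arm1(1) True]] x(1)] pmap_via[OF rN arm1(1) True] True
      by (simp add: L_def mult.assoc[symmetric] p_def)
  next
    case False
    then have v': "v \<in> set (verts Q y' p')" using v by (simp add: I_def)
    have "R v * L v = R y' * x'"
      using pmap_via[OF rN arm2(1) v'] False v' by (simp add: L_def mult.assoc[symmetric] p'_def)
    then show ?thesis using fits_times[OF fits_pmap[OF rN verts_decomp(1)[OF arm2(1) v']] x(2)] False v' x(3)
      by (simp add: L_def)
  qed
  have L0: "L v = 0" if "v \<notin> I" for v using that by (simp add: L_def I_def)
  have piL: "\<pi> v * L v = \<one>\<^sub>i 1" if v: "v \<in> I" for v
  proof -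
    have vc: "v \<in> coreach i" using v Ic by blast
    have "\<pi> v * L v = \<nu> * (R v * L v)" using v by (simp add: \<pi>_def mult.assoc)
    also have "\<dots> = \<nu> * (\<zeta> i * (R v * L v))" by (rule nz) (rule fits_times[OF fits_R[OF vc] conjunct1[OF L[OF v]]])
    also have "\<dots> = \<nu> * (R y * x)" using L[OF v] nz[OF fits_times[OF fits_R[OF yc(2)] x(1)]] by simp
    finally show ?thesis using nu(4) by simp
  qed
  have fL: "fits (rdim N v) (rdim (thin I :: ('v, 'a, 'k) qrep) v) (L v)" if "v \<in> Q0 Q" for v
    using L[of v] L0[of v] that by (cases "v \<in> I") (auto simp: rdim_thin)
  have chi: "imat_of (f (tgt Q \<alpha>)) * \<kappa> (tgt Q \<alpha>) * (amap N \<alpha> * L (src Q \<alpha>) - L (tgt Q \<alpha>) * amap (thin I) \<alpha>) =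
      amap N \<alpha> * L (src Q \<alpha>) - L (tgt Q \<alpha>) * amap (thin I) \<alpha>" if \<alpha>: "\<alpha> \<in> Q1 Q" for \<alpha>
  proof (cases "src Q \<alpha> \<in> I")
    case False
    then show ?thesis using L0 by (simp add: amap_thin[OF \<alpha>])
  next
    case s: True
    let ?s = "src Q \<alpha>" and ?t = "tgt Q \<alpha>"
    define \<Delta> where "\<Delta> = amap N \<alpha> * L ?s - L ?t"
    have fLt: "fits (rdim N ?t) 1 (L ?t)" using L[of ?t] L0[of ?t] by (cases "?t \<in> I") auto
    have e: "amap N \<alpha> * L ?s - L ?t * amap (thin I) \<alpha> = \<Delta>"
      using s L0 fLt by (cases "?t \<in> I") (auto simp: amap_thin[OF \<alpha>] \<Delta>_def fits_def)
    have fD: "fits (rdim N ?t) 1 \<Delta>" unfolding \<Delta>_def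
      by (rule fits_diff[OF fits_times[OF fits_amap[OF rN \<alpha>] conjunct1[OF L[OF s]]] fLt])
    \<comment> \<open>If the class of the defect were nonzero, it would survive down to
      \<open>i\<close> by \<open>socle_descent\<close>; but there both terms have the class of
      \<open>R y * x\<close>.\<close>
    have "\<zeta> ?t * \<Delta> = 0"
    proof (rule ccontr)
      assume "\<zeta> ?t * \<Delta> \<noteq> 0"
      from socle_descent[OF arrow_ends(2)[OF \<alpha>] fD this]
      have t: "?t \<in> coreach i" "\<zeta> i * (R ?t * \<Delta>) \<noteq> 0" by auto
      have tI: "?t \<in> I" by (rule D.next_I[OF \<alpha> s t(1)])
      have "R ?t * \<Delta> = R ?s * L ?s - R ?t * L ?t"
        unfolding \<Delta>_def R_src[OF \<alpha> t(1)] by (simp only: right_diff_distrib mult.assoc)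
      then show False using t(2) L[OF s] L[OF tI] by (simp add: right_diff_distrib)
    qed
    then have "\<Delta> = F ?t * (\<kappa> ?t * \<Delta>)" by (rule zeta_kernel[OF fD])
    then show ?thesis unfolding e by (simp add: F_def mult.assoc)
  qed
  have kap': "fits (rdim M v) (rdim N v) (\<kappa> v) \<and> \<kappa> v * imat_of (f v) = \<one>\<^sub>i (rdim M v)" if "v \<in> Q0 Q" for v
    using kap[OF that] by (simp only: F_def)
  \<comment> \<open>Applied to the thin quotient itself: a lift would be a section of \<pi>, and the
    other alternative says that the kernel of \<pi> is the image of f, so the quotient is the whole
    cokernel.\<close>
  have "(\<exists>\<rho>. ihom Q (thin I) N (\<lambda>v. L v - imat_of (f v) * \<rho> v)) \<or>
    (\<exists>s \<sigma>. ihom Q N (thin I) s \<and> (\<forall>v\<in>Q0 Q. imat_of (f v) * \<sigma> v + L v * s v = \<one>\<^sub>i (rdim N v)))"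
    by (rule irreducible_lift_or_factor[OF irr kap' D.rD fL chi])
  then show ?thesis
  proof (elim disjE exE conjE)
    fix \<rho> assume r: "ihom Q (thin I) N (\<lambda>v. L v - imat_of (f v) * \<rho> v)"
    have "\<pi> v * (L v - imat_of (f v) * \<rho> v) = \<one>\<^sub>i 1" if v: "v \<in> I" for v
    proof -
      have "\<pi> v * (imat_of (f v) * \<rho> v) = (\<pi> v * F v) * \<rho> v" by (simp only: F_def mult.assoc)
      then show ?thesis using piL[OF v] D.piF[OF D.I_Q0[OF v]] by (simp add: right_diff_distrib)
    qed
    then show ?thesis using D.no_section[OF r] by blast
  next
    fix s \<sigma> assume s: "ihom Q N (thin I) s" "\<forall>v\<in>Q0 Q. imat_of (f v) * \<sigma> v + L v * s v = \<one>\<^sub>i (rdim N v)"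
    have sp: "L v * s v = L v * \<pi> v" if v: "v \<in> Q0 Q" for v
    proof (cases "v \<in> I")
      case True
      have "\<pi> v = \<pi> v * (imat_of (f v) * \<sigma> v + L v * s v)" using s(2) v ihom_fits[OF pi v] by (simp add: fits_def)
      also have "\<dots> = (\<pi> v * F v) * \<sigma> v + (\<pi> v * L v) * s v" by (simp only: F_def distrib_left mult.assoc)
      also have "\<dots> = s v" using D.piF[OF v] piL[OF True] ihom_fits[OF s(1) v] v True by (simp add: rdim_thin fits_def)
      finally show ?thesis by simp
    qed (simp add: L0)
    have exact: "F v * (\<kappa> v * (\<one>\<^sub>i (rdim N v) - L v * \<pi> v)) = \<one>\<^sub>i (rdim N v) - L v * \<pi> v" if v: "v \<in> Q0 Q" for v
    proof -
      have e: "\<one>\<^sub>i (rdim N v) - L v * \<pi> v = F v * \<sigma> v"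
        using s(2)[rule_format, OF v, symmetric] unfolding sp[OF v] F_def by simp
      have "F v * (\<kappa> v * (F v * \<sigma> v)) = F v * (\<kappa> v * F v) * \<sigma> v" by (simp only: mult.assoc)
      also have "\<dots> = F v * \<sigma> v" using kap[OF v] ihom_fits[OF F v] by (simp add: fits_def)
      finally show ?thesis unfolding e .
    qed
    interpret C: thin_cokernel Q M N f \<kappa> F i y y' p p' \<nu> I \<pi> L
      by unfold_locales (use L[unfolded I_def] L0[unfolded I_def] piL[unfolded I_def \<pi>_def] exact[unfolded I_def \<pi>_def F_def] in blast)+
    show ?thesis by (rule C.hook_end)
  qed
qed

end

theorem (in string_tree) P_in_Det_iff_hook_end:
  assumes i: "i \<in> Q0 Q"
  shows "P_in_Det TYPE('k::field) Q i \<longleftrightarrow> hook_end Q i"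
proof
  assume "P_in_Det TYPE('k) Q i"
  then show "hook_end Q i"
  proof (rule P_in_DetE[OF _ i])
    fix M N :: "('v, 'a, 'k) qrep" and f \<kappa>
    assume ind: "indecomposable Q M" "indecomposable Q N" and irr: "irreducible Q M N f"
      and kap: "\<And>v. v \<in> Q0 Q \<Longrightarrow> fits (rdim M v) (rdim N v) (\<kappa> v) \<and> \<kappa> v * imat_of (f v) = \<one>\<^sub>i (rdim M v)"
      and soc: "\<And>v n. \<lbrakk>v \<in> Q0 Q; fits (rdim N v) 1 n; \<And>m. fits (rdim M v) 1 m \<Longrightarrow> n \<noteq> imat_of (f v) * m;
        \<And>\<alpha>. \<alpha> \<in> outA Q v \<Longrightarrow> \<exists>m. amap N \<alpha> * n = imat_of (f (tgt Q \<alpha>)) * m\<rbrakk> \<Longrightarrow> v = i"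
      and top: "\<exists>n. fits (rdim N i) 1 n \<and> (\<forall>m. fits (rdim M i) 1 m \<longrightarrow> n \<noteq> imat_of (f i) * m)"
    interpret D: irreducible_mono Q M N f \<kappa> "\<lambda>v. imat_of (f v)"
      by unfold_locales (use ind irr kap in auto)
    define \<zeta> where "\<zeta> v = \<one>\<^sub>i (rdim N v) - imat_of (f v) * \<kappa> v" for v
    have img: "\<zeta> v * n = 0" if v: "v \<in> Q0 Q" and "n = imat_of (f v) * m" for v n m
    proof -
      have "\<zeta> v * imat_of (f v) = 0"
        using kap[OF v] ihom_fits[OF D.F v] by (simp add: \<zeta>_def left_diff_distrib mult.assoc fits_def)
      then show ?thesis unfolding that(2) by (simp add: mult.assoc[symmetric])
    qed
    have ker: "n = imat_of (f v) * (\<kappa> v * n)" if "fits (rdim N v) 1 n" "\<zeta> v * n = 0" for v n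
      using that by (simp add: \<zeta>_def left_diff_distrib mult.assoc fits_def)
    interpret S: socle_cokernel Q M N f \<kappa> "\<lambda>v. imat_of (f v)" i "\<lambda>v. \<one>\<^sub>i (rdim N v) - imat_of (f v) * \<kappa> v"
    proof (unfold_locales, fold \<zeta>_def)
      show "i \<in> Q0 Q" by (rule i)
      show "\<exists>n. fits (rdim N i) 1 n \<and> \<zeta> i * n \<noteq> 0"
        using top ker fits_times[OF conjunct1[OF kap[OF i]]] by meson
      fix v n assume v: "v \<in> Q0 Q" "fits (rdim N v) 1 n" "\<zeta> v * n \<noteq> 0"
        and z: "\<And>\<alpha>. \<alpha> \<in> outA Q v \<Longrightarrow> \<zeta> (tgt Q \<alpha>) * (amap N \<alpha> * n) = 0"
      show "v = i"
      proof (rule soc[OF v(1,2)])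
        show "n \<noteq> imat_of (f v) * m" for m using img[OF v(1)] v(3) by blast
        fix \<alpha> assume \<alpha>: "\<alpha> \<in> outA Q v"
        then have "fits (rdim N (tgt Q \<alpha>)) 1 (amap N \<alpha> * n)"
          using fits_times[OF fits_amap[OF D.rN, of \<alpha>]] v(2) by (auto simp: outA_def)
        then show "\<exists>m. amap N \<alpha> * n = imat_of (f (tgt Q \<alpha>)) * m" using ker z[OF \<alpha>] by blast
      qed
    qed
    show ?thesis by (rule S.hook_end)
  qed
qed (rule hook_end_imp_P_in_Det[OF i])

theorem theorem3p9:
  fixes Q :: "('v, 'a) quiver" and i :: 'v
  assumes "string_tree_algebra Q" and "i \<in> Q0 Q"
  shows "P_in_Det TYPE('k::field) Q i \<longleftrightarrow>
           type_v11 Q i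
         \<or> (type_v12 Q i \<and> J_zero Q i)
         \<or> (type_v22 Q i \<and> J_zero Q i)
         \<or> type_v23 Q i
         \<or> type_v31 Q i
         \<or> (type_v32 Q i \<and> J_zero Q i)
         \<or> (type_v4 Q i \<and> J_zero Q i)"
proof -
  interpret string_tree Q by unfold_locales (rule assms(1))
  show ?thesis using P_in_Det_iff_hook_end[OF assms(2)] vertex_kinds_iff_hook_end[OF assms(2)] by simp
qed

end
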